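(* Let $M$ be a connected smooth manifold and suppose that a transitive Lie algebroid $(\mathcal{A},[\cdot,\cdot]_{\mathcal{A}},\rho)$ over $M$, with adjoint bundle $L=\mathrm{Ker}(\rho)$, has a representation $\mathfrak{L}:\mathcal{A}\to \mathcal{CDO}(F)$ on a vector bundle $F\to M$. Let $p:\widetilde M\to M$ be a universal covering map, and let $\widetilde{\mathfrak{L}}$ be the induced representation of the pull-back Lie algebroid $\widetilde{\mathcal{A}}=p^!\mathcal{A}$ on $\widetilde F=p^!F$. Write $$F_0=\{\nu\in F_y \mid y\in M,\ \mathfrak{L}_u\nu=0\ \ \forall u\in L_y\},$$ with the induced representation of $\mathcal{A}$ on $F_0$ (also denoted $\mathfrak{L}$), and let $\bar{\mathfrak{L}}:TM\to\mathcal{CDO}(F_0)$ be the reduced flat connection of $F_0$ coming from $\mathfrak{L}$. Then for each 1-cocycle $\Omega\in D^1(\mathcal{A},F)$ and each $x\in M$, the following six statements are equivalent. 1) $\delta_x:=\Omega|_{L_x}$ is a coboundary, i.e. there exists $\tau\in F_x$ such that $\delta_x(u)=\underline{\mathfrak{L}}_u\tau$ for all $u\in L_x$. 2) $\delta_y:=\Omega|_{L_y}$ is a coboundary for every $y\in M$. 3) The pull-back cochain $p^{1*}\Omega\in D^1(\widetilde{\mathcal{A}},\widetilde F)$ is a coboundary, i.e. there exists $\widetilde\mu\in\Gamma(\widetilde F)$ such that $\Omega(A)=\widetilde{\mathfrak{L}}_{(\widetilde y,A)}\widetilde\mu$ for all $A\in\mathcal{A}_y$, $y \in M$, and $\widetilde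 y\in\widetilde M$ with $p(\widetilde y)=y$. 4) There exists $\Omega_0\in D^1(\mathcal{A},F_0)$ with $\Omega_0|_{L_x}=0$ such that $\Omega$ and $\Omega_0$ are homologic. 5) There exists $\Omega_0\in D^1(\mathcal{A},F_0)$ with $\Omega_0|_{L}=0$ such that $\Omega$ and $\Omega_0$ are homologic. 6) There exist $\theta\in D^1(TM,F_0)$ and $\mu\in\Gamma(F)$ such that $\Omega=\rho^*\theta+\mathfrak{D}\mu$.
   Context: A Lie algebroid $(\mathcal{A},[\cdot,\cdot]_{\mathcal{A}},\rho)$ over $M$ is a real vector bundle $\mathcal{A}\to M$ with a bundle map $\rho:\mathcal{A}\to TM$ (the anchor) and a real Lie bracket $[\cdot,\cdot]_{\mathcal{A}}$ on $\Gamma(\mathcal{A})$ such that $\rho:\Gamma(\mathcal{A})\to\mathcal{X}(M)$ is a Lie algebra morphism and $[A,fB]_{\mathcal{A}}=f[A,B]_{\mathcal{A}}+(\rho(A)f)B$ for $f\in C^\infty(M)$. It is transitive if $\rho$ is surjective; then $L=\mathrm{Ker}(\rho)$ is a bundle of Lie algebras, called the adjoint bundle. $\mathcal{CDO}(F)$ is the bundle of covariant differential operators of the vector bundle $F$: an element of $\mathcal{CDO}(F)_x$ is a linear operator $D_x:\Gamma(F)\to F_x$ for which there is a (unique) $X=\sigma(D_x)\in T_xM$ with $D_x(f\mu)=X(f)\mu(x)+f(x)D_x\mu$. It is a transitive Lie algebroid with anchor $\sigma$ and the commutator bracket. A representation of $\mathcal{A}$ on $F$ is a bundle map $\mathfrak{L}:\mathcal{A}\to\mathcal{CDO}(F)$,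 $A\mapsto \mathfrak{L}_A$, with $\sigma\circ\mathfrak{L}=\rho$ and $\mathfrak{L}_{[A,B]_{\mathcal{A}}}=\mathfrak{L}_A\circ\mathfrak{L}_B-\mathfrak{L}_B\circ\mathfrak{L}_A$ for $A,B\in\Gamma(\mathcal{A})$. $C^k(\mathcal{A},F)$ is the space of bundle maps $\wedge^k\mathcal{A}\to F$ ($C^0=\Gamma(F)$), with the usual Chevalley (Chevalley–Eilenberg) coboundary operator $\mathfrak{D}$ defined by $\mathfrak{L}$. $D^1(\mathcal{A},F)$ is the set of 1-cocycles, i.e. bundle maps $\Omega:\mathcal{A}\to F$ with $\Omega([A,B]_{\mathcal{A}})=\mathfrak{L}_A(\Omega(B))-\mathfrak{L}_B(\Omega(A))$; such an $\Omega$ is a coboundary if $\Omega=\mathfrak{D}\mu$, i.e. $\Omega(A)=\mathfrak{L}_A\mu$, for some $\mu\in\Gamma(F)$. Two 1-cocycles are homologic if their difference is a coboundary (here $\Omega_0\in D^1(\mathcal{A},F_0)$ is regarded as a cocycle with values in $F\supset F_0$). For $x\in M$ the Lie algebra $L_x$ acts on $F_x$ by $\underline{\mathfrak{L}}_u(\mu)=\mathfrak{L}_u(\overline{\mu})$, where $\overline\mu$ is any local smooth extension of $\mu\in F_x$. For transitive $\mathcal{A}$, $F_0$ is a vector subbundle of $F$ preserved by $\mathfrak{L}$. The reduced flat connection is $\bar{\mathfrak{L}}_X\nu=\mathfrak{L}_A\nu$ for any $A\in\mathcal{A}_x$ with $\rho(A)=X\in T_xM$ and $\nu\in\Gamma(F_0)$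 (independent of the choice of $A$). $D^1(TM,F_0)$ is the set of closed $F_0$-valued 1-forms on $M$ with respect to this flat connection, i.e. $\bar{\mathfrak{L}}_X\theta(Y)-\bar{\mathfrak{L}}_Y\theta(X)-\theta([X,Y])=0$ for all vector fields $X,Y$. For such $\theta$, $(\rho^*\theta)(A)=\theta(\rho(A))$. For a covering map $p:\widetilde M\to M$, the pull-back bundle $\widetilde{\mathcal{A}}=p^!\mathcal{A}$ is a Lie algebroid over $\widetilde M$: its anchor sends $(z,A)$, with $A\in\mathcal{A}_{p(z)}$, to the unique $Z\in T_z\widetilde M$ with $p_*Z=\rho(A)$, and the bracket of pull-back sections is the pull-back of the bracket, extended by the Leibniz rule. The induced representation $\widetilde{\mathfrak{L}}$ on $\widetilde F=p^!F$ is determined by $\widetilde{\mathfrak{L}}_{(z,A)}(p^!\mu)=(z,\mathfrak{L}_A\mu)$ for $\mu\in\Gamma(F)$; one identifies $\widetilde F_z$ with $F_{p(z)}$. The pull-back cochain is $(p^{1*}\Omega)(z,A)=(z,\Omega(A))$. *)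

theory Defs
  imports "HOL-Analysis.Analysis" "HOL-Library.Function_Algebras"
begin

section \<open>Pointwise vector space structure on functions\<close>

instantiation "fun" :: (type, scaleR) scaleR
begin
definition scaleR_fun :: "real \<Rightarrow> ('a \<Rightarrow> 'b) \<Rightarrow> 'a \<Rightarrow> 'b"
  where "scaleR_fun c f = (\<lambda>x. c *\<^sub>R f x)"
instance ..
end

instance "fun" :: (type, real_vector) real_vector
  by standard (auto simp: scaleR_fun_def plus_fun_def fun_eq_iff algebra_simps)

definition linear_between :: "'a::real_vector set \<Rightarrow> 'b::real_vector set \<Rightarrow> ('a \<Rightarrow> 'b) \<Rightarrow> bool" where
  "linear_between S T f \<longleftrightarrow>
     f ` S \<subseteq> T \<and> (\<forall>a\<in>S. \<forall>b\<in>S. f (a + b) = f a + f b) \<and> (\<forall>c. \<forall>a\<in>S. f (c *\<^sub>R a) = c *\<^sub>R f a)"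


section \<open>Smooth manifolds\<close>

text \<open>\<open>Ck_on k S f\<close> is meaningful for open \<open>S\<close> in a finite-dimensional space, where existence and
  continuity of all iterated directional derivatives is the usual notion.\<close>

primrec Ck_on :: "nat \<Rightarrow> 'a::real_normed_vector set \<Rightarrow> ('a \<Rightarrow> 'b::real_normed_vector) \<Rightarrow> bool" where
  "Ck_on 0 S f \<longleftrightarrow> continuous_on S f"
| "Ck_on (Suc k) S f \<longleftrightarrow>
     (\<forall>x\<in>S. f differentiable (at x)) \<and> (\<forall>v. Ck_on k S (\<lambda>x. frechet_derivative f (at x) v))"

definition smooth_on :: "'a::real_normed_vector set \<Rightarrow> ('a \<Rightarrow> 'b::real_normed_vector) \<Rightarrow> bool" where
  "smooth_on S f \<longleftrightarrow> (\<forall>k. Ck_on k S f)"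

type_synonym ('m, 'h) atlas = "('m set \<times> ('m \<Rightarrow> 'h)) set"

text \<open>A manifold is a whole Hausdorff second countable type \<open>'m\<close> together with a smooth atlas.  The
  model space \<open>'h\<close> is a finite-dimensional inner product space; the class \<open>euclidean_space\<close> is
  not used because it excludes dimension \<open>0\<close>.  The atlas need not be maximal.\<close>

definition smooth_manifold ::
    "('m::{t2_space,second_countable_topology}, 'h::real_inner) atlas \<Rightarrow> bool" where
  "smooth_manifold M \<longleftrightarrow>
     (\<exists>B::'h set. finite B \<and> span B = UNIV) \<and>
     (\<forall>(U, \<phi>)\<in>M. open U \<and> open (\<phi> ` U) \<and> homeomorphism U (\<phi> ` U) \<phi> (inv_into U \<phi>)) \<and>
     (\<Union>(U, \<phi>)\<in>M. U) = UNIV \<and>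
     (\<forall>(U, \<phi>)\<in>M. \<forall>(V, \<psi>)\<in>M. smooth_on (\<phi> ` (U \<inter> V)) (\<psi> \<circ> inv_into U \<phi>))"

definition smooth_fun_on ::
    "('m::topological_space, 'h::real_inner) atlas \<Rightarrow> 'm set \<Rightarrow> ('m \<Rightarrow> real) \<Rightarrow> bool" where
  "smooth_fun_on M W f \<longleftrightarrow> (\<forall>(U, \<phi>)\<in>M. smooth_on (\<phi> ` (U \<inter> W)) (f \<circ> inv_into U \<phi>))"

definition Cinf :: "('m::topological_space, 'h::real_inner) atlas \<Rightarrow> ('m \<Rightarrow> real) set" where
  "Cinf M = {f. smooth_fun_on M UNIV f}"

definition smooth_map_on ::
    "('m::topological_space, 'h::real_inner) atlas \<Rightarrow> ('n::topological_space, 'k::real_inner) atlas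
      \<Rightarrow> 'm set \<Rightarrow> ('m \<Rightarrow> 'n) \<Rightarrow> bool" where
  "smooth_map_on M N W g \<longleftrightarrow>
     continuous_on W g \<and>
     (\<forall>(U, \<phi>)\<in>M. \<forall>(V, \<psi>)\<in>N. smooth_on (\<phi> ` (U \<inter> W \<inter> g -` V)) (\<psi> \<circ> g \<circ> inv_into U \<phi>))"

definition local_diffeo ::
    "('m::topological_space, 'h::real_inner) atlas \<Rightarrow> ('n::topological_space, 'k::real_inner) atlas
      \<Rightarrow> ('m \<Rightarrow> 'n) \<Rightarrow> bool" where
  "local_diffeo M N g \<longleftrightarrow>
     (\<forall>x. \<exists>W. open W \<and> x \<in> W \<and> open (g ` W) \<and> inj_on g W \<and>
              smooth_map_on M N W g \<and> smooth_map_on N M (g ` W) (inv_into W g))"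

text \<open>The library's \<open>simply_connected\<close> entails path-connectedness.\<close>

definition universal_covering ::
    "('z::topological_space, 'h::real_inner) atlas \<Rightarrow> ('m::topological_space, 'h) atlas
      \<Rightarrow> ('z \<Rightarrow> 'm) \<Rightarrow> bool" where
  "universal_covering M' M p \<longleftrightarrow>
     covering_space UNIV p UNIV \<and> simply_connected (UNIV :: 'z set) \<and> local_diffeo M' M p"


section \<open>Vector bundles\<close>

text \<open>The fibres of a vector bundle are subspaces of one ambient vector space \<open>'v\<close>, which serves only
  to carry the fibrewise operations: fibres over different points are unrelated (they may overlap,
  so an element of the bundle is a point together with a vector), and \<open>'v\<close> has no topology.
  Every vector bundle has this form up to isomorphism.  The smooth structure is an
  atlas of local trivialisations, each given as an open set \<open>U\<close> with the list of sections that form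
  the corresponding local frame; the list is empty for rank \<open>0\<close>.\<close>

record ('m, 'v) vbundle =
  fibre :: "'m \<Rightarrow> 'v set"
  frames :: "('m set \<times> ('m \<Rightarrow> 'v) list) set"

definition basis_at :: "('m \<Rightarrow> 'v::real_vector) list \<Rightarrow> 'm \<Rightarrow> 'v set \<Rightarrow> bool" where
  "basis_at es x S \<longleftrightarrow>
     (let vs = map (\<lambda>e. e x) es in distinct vs \<and> independent (set vs) \<and> span (set vs) = S)"

definition smooth_in_frame ::
    "('m::topological_space, 'h::real_inner) atlas \<Rightarrow> ('m \<Rightarrow> 'v::real_vector) list
      \<Rightarrow> 'm set \<Rightarrow> ('m \<Rightarrow> 'v) \<Rightarrow> bool" where
  "smooth_in_frame M es W \<mu> \<longleftrightarrow>
     (\<exists>c. (\<forall>i<length es. smooth_fun_on M W (c i)) \<and>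
          (\<forall>x\<in>W. \<mu> x = (\<Sum>i<length es. c i x *\<^sub>R (es ! i) x)))"

definition vector_bundle ::
    "('m::topological_space, 'h::real_inner) atlas \<Rightarrow> ('m, 'v::real_vector, 'q) vbundle_scheme \<Rightarrow> bool"
  where
  "vector_bundle M E \<longleftrightarrow>
     (\<forall>(U, es)\<in>frames E. open U \<and> (\<forall>x\<in>U. basis_at es x (fibre E x))) \<and>
     (\<Union>(U, es)\<in>frames E. U) = UNIV \<and>
     (\<forall>(U, es)\<in>frames E. \<forall>(V, es')\<in>frames E. \<forall>e\<in>set es'. smooth_in_frame M es (U \<inter> V) e)"

definition smooth_section_on ::
    "('m::topological_space, 'h::real_inner) atlas \<Rightarrow> ('m, 'v::real_vector, 'q) vbundle_scheme
      \<Rightarrow> 'm set \<Rightarrow> ('m \<Rightarrow> 'v) \<Rightarrow> bool" where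
  "smooth_section_on M E W \<mu> \<longleftrightarrow>
     (\<forall>x\<in>W. \<mu> x \<in> fibre E x) \<and> (\<forall>(U, es)\<in>frames E. smooth_in_frame M es (U \<inter> W) \<mu>)"

definition sections ::
    "('m::topological_space, 'h::real_inner) atlas \<Rightarrow> ('m, 'v::real_vector, 'q) vbundle_scheme
      \<Rightarrow> ('m \<Rightarrow> 'v) set" where
  "sections M E = {\<mu>. smooth_section_on M E UNIV \<mu>}"

definition bundle_map ::
    "('m::topological_space, 'h::real_inner) atlas \<Rightarrow> ('m, 'a::real_vector, 'q) vbundle_scheme
      \<Rightarrow> ('m, 'v::real_vector, 'r) vbundle_scheme \<Rightarrow> ('m \<Rightarrow> 'a \<Rightarrow> 'v) \<Rightarrow> bool" where
  "bundle_map M E F \<Phi> \<longleftrightarrow>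
     (\<forall>x. linear_between (fibre E x) (fibre F x) (\<Phi> x)) \<and>
     (\<forall>(U, es)\<in>frames E. \<forall>e\<in>set es. smooth_section_on M F U (\<lambda>x. \<Phi> x (e x)))"

text \<open>The subbundle of \<open>F\<close> with fibres \<open>S x\<close>: its trivialisations are all local frames of \<open>S\<close> that
  consist of smooth sections of \<open>F\<close>.\<close>

definition subbundle ::
    "('m::topological_space, 'h::real_inner) atlas \<Rightarrow> ('m, 'v::real_vector) vbundle
      \<Rightarrow> ('m \<Rightarrow> 'v set) \<Rightarrow> ('m, 'v) vbundle" where
  "subbundle M F S =
     \<lparr> fibre = S,
       frames = {(U, es). open U \<and> (\<forall>e\<in>set es. smooth_section_on M F U e) \<and>
                          (\<forall>x\<in>U. basis_at es x (S x))} \<rparr>"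

text \<open>The fibre of \<open>p\<^sup>!E\<close> at \<open>z\<close> is identified with the fibre of \<open>E\<close> at \<open>p z\<close>; the pull-back of a
  section \<open>\<mu>\<close> is \<open>\<mu> \<circ> p\<close>.\<close>

definition pullback_bundle ::
    "('z \<Rightarrow> 'm) \<Rightarrow> ('m, 'v, 'q) vbundle_scheme \<Rightarrow> ('z, 'v) vbundle" where
  "pullback_bundle p E =
     \<lparr> fibre = (\<lambda>z. fibre E (p z)),
       frames = (\<lambda>(U, es). (p -` U, map (\<lambda>e. e \<circ> p) es)) ` frames E \<rparr>"


section \<open>Tangent bundle\<close>

text \<open>Tangent vectors are derivations of \<open>C\<^sup>\<infinity>(M)\<close> at a point.  In order that they form a set of
  total functions of the right dimension, they are extended by \<open>0\<close> to functions that are not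
  smooth.\<close>

type_synonym 'm tangent = "('m \<Rightarrow> real) \<Rightarrow> real"

definition tangent_space ::
    "('m::topological_space, 'h::real_inner) atlas \<Rightarrow> 'm \<Rightarrow> 'm tangent set" where
  "tangent_space M x =
     {v. linear_between (Cinf M) UNIV v \<and>
         (\<forall>f\<in>Cinf M. \<forall>g\<in>Cinf M. v (\<lambda>y. f y * g y) = v f * g x + f x * v g) \<and>
         (\<forall>f. f \<notin> Cinf M \<longrightarrow> v f = 0)}"

definition coord_field ::
    "('m::topological_space, 'h::real_inner) atlas \<Rightarrow> 'm set \<times> ('m \<Rightarrow> 'h) \<Rightarrow> 'h \<Rightarrow> 'm \<Rightarrow> 'm tangent"
  where
  "coord_field M = (\<lambda>(U, \<phi>) b x f.
     if f \<in> Cinf M then frechet_derivative (f \<circ> inv_into U \<phi>) (at (\<phi> x)) b else 0)"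

definition tangent_bundle ::
    "('m::topological_space, 'h::real_inner) atlas \<Rightarrow> ('m, 'm tangent) vbundle" where
  "tangent_bundle M =
     \<lparr> fibre = tangent_space M,
       frames = {(U, map (coord_field M (U, \<phi>)) bs) | U \<phi> bs.
                   (U, \<phi>) \<in> M \<and> distinct bs \<and> independent (set bs) \<and> span (set bs) = UNIV} \<rparr>"

definition lie_bracket :: "('m \<Rightarrow> 'm tangent) \<Rightarrow> ('m \<Rightarrow> 'm tangent) \<Rightarrow> 'm \<Rightarrow> 'm tangent" where
  "lie_bracket X Y = (\<lambda>x f. X x (\<lambda>y. Y y f) - Y x (\<lambda>y. X y f))"

definition push_tangent ::
    "('m::topological_space, 'h::real_inner) atlas \<Rightarrow> ('z \<Rightarrow> 'm) \<Rightarrow> 'z tangent \<Rightarrow> 'm tangent" where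
  "push_tangent M p Z = (\<lambda>f. if f \<in> Cinf M then Z (f \<circ> p) else 0)"


section \<open>Lie algebroids\<close>

record ('m, 'a) algebroid = "('m, 'a) vbundle" +
  bracket :: "('m \<Rightarrow> 'a) \<Rightarrow> ('m \<Rightarrow> 'a) \<Rightarrow> 'm \<Rightarrow> 'a"
  anchor :: "'m \<Rightarrow> 'a \<Rightarrow> 'm tangent"

definition lie_algebroid ::
    "('m::topological_space, 'h::real_inner) atlas \<Rightarrow> ('m, 'a::real_vector) algebroid \<Rightarrow> bool" where
  "lie_algebroid M \<A> \<longleftrightarrow>
     vector_bundle M \<A> \<and>
     bundle_map M \<A> (tangent_bundle M) (anchor \<A>) \<and>
     (\<forall>A\<in>sections M \<A>. linear_between (sections M \<A>) (sections M \<A>) (bracket \<A> A)) \<and>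
     (\<forall>A\<in>sections M \<A>. \<forall>B\<in>sections M \<A>. bracket \<A> A B = - bracket \<A> B A) \<and>
     (\<forall>A\<in>sections M \<A>. \<forall>B\<in>sections M \<A>. \<forall>C\<in>sections M \<A>.
        bracket \<A> A (bracket \<A> B C) + bracket \<A> B (bracket \<A> C A) + bracket \<A> C (bracket \<A> A B) = 0) \<and>
     (\<forall>A\<in>sections M \<A>. \<forall>B\<in>sections M \<A>.
        (\<lambda>x. anchor \<A> x (bracket \<A> A B x)) =
        lie_bracket (\<lambda>x. anchor \<A> x (A x)) (\<lambda>x. anchor \<A> x (B x))) \<and>
     (\<forall>A\<in>sections M \<A>. \<forall>B\<in>sections M \<A>. \<forall>f\<in>Cinf M.
        bracket \<A> A (\<lambda>x. f x *\<^sub>R B x) =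
        (\<lambda>x. f x *\<^sub>R bracket \<A> A B x + anchor \<A> x (A x) f *\<^sub>R B x))"

definition transitive_algebroid ::
    "('m::topological_space, 'h::real_inner) atlas \<Rightarrow> ('m, 'a::real_vector) algebroid \<Rightarrow> bool" where
  "transitive_algebroid M \<A> \<longleftrightarrow>
     lie_algebroid M \<A> \<and> (\<forall>x. anchor \<A> x ` fibre \<A> x = tangent_space M x)"

definition adjoint_fibre :: "('m, 'a) algebroid \<Rightarrow> 'm \<Rightarrow> 'a set" where
  "adjoint_fibre \<A> x = {u \<in> fibre \<A> x. anchor \<A> x u = 0}"

definition tangent_algebroid ::
    "('m::topological_space, 'h::real_inner) atlas \<Rightarrow> ('m, 'm tangent) algebroid" where
  "tangent_algebroid M =
     \<lparr> fibre = fibre (tangent_bundle M), frames = frames (tangent_bundle M),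
       bracket = lie_bracket, anchor = (\<lambda>x v. v) \<rparr>"


section \<open>Representations\<close>

text \<open>\<open>is_symbol M F x D X\<close> says \<open>X = \<sigma>(D)\<close>.  It is a relation because \<open>X\<close> is not determined
  by \<open>D\<close> if \<open>F\<close> has rank \<open>0\<close>.\<close>

definition is_symbol ::
    "('m::topological_space, 'h::real_inner) atlas \<Rightarrow> ('m, 'v::real_vector) vbundle \<Rightarrow> 'm
      \<Rightarrow> (('m \<Rightarrow> 'v) \<Rightarrow> 'v) \<Rightarrow> 'm tangent \<Rightarrow> bool" where
  "is_symbol M F x D X \<longleftrightarrow>
     X \<in> tangent_space M x \<and>
     (\<forall>f\<in>Cinf M. \<forall>\<mu>\<in>sections M F. D (\<lambda>y. f y *\<^sub>R \<mu> y) = X f *\<^sub>R \<mu> x + f x *\<^sub>R D \<mu>)"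

text \<open>The fibre of \<open>CDO(F)\<close> at \<open>x\<close>.  Like tangent vectors, the operators are extended by \<open>0\<close>
  outside \<open>\<Gamma>(F)\<close>.\<close>

definition CDO ::
    "('m::topological_space, 'h::real_inner) atlas \<Rightarrow> ('m, 'v::real_vector) vbundle \<Rightarrow> 'm
      \<Rightarrow> (('m \<Rightarrow> 'v) \<Rightarrow> 'v) set" where
  "CDO M F x =
     {D. linear_between (sections M F) (fibre F x) D \<and>
         (\<forall>\<mu>. \<mu> \<notin> sections M F \<longrightarrow> D \<mu> = 0) \<and> (\<exists>X. is_symbol M F x D X)}"

text \<open>The third conjunct is smoothness of \<open>\<LL> : \<A> \<rightarrow> CDO(F)\<close>: the smooth sections of \<open>CDO(F)\<close> are
  those that map \<open>\<Gamma>(F)\<close> into \<open>\<Gamma>(F)\<close>.\<close>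

definition algebroid_rep ::
    "('m::topological_space, 'h::real_inner) atlas \<Rightarrow> ('m, 'a::real_vector) algebroid
      \<Rightarrow> ('m, 'v::real_vector) vbundle \<Rightarrow> ('m \<Rightarrow> 'a \<Rightarrow> ('m \<Rightarrow> 'v) \<Rightarrow> 'v) \<Rightarrow> bool" where
  "algebroid_rep M \<A> F \<LL> \<longleftrightarrow>
     (\<forall>x. linear_between (fibre \<A> x) (CDO M F x) (\<LL> x)) \<and>
     (\<forall>x. \<forall>a\<in>fibre \<A> x. is_symbol M F x (\<LL> x a) (anchor \<A> x a)) \<and>
     (\<forall>A\<in>sections M \<A>. \<forall>\<mu>\<in>sections M F. (\<lambda>x. \<LL> x (A x) \<mu>) \<in> sections M F) \<and>
     (\<forall>A\<in>sections M \<A>. \<forall>B\<in>sections M \<A>. \<forall>\<mu>\<in>sections M F. \<forall>x.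
        \<LL> x (bracket \<A> A B x) \<mu> =
        \<LL> x (A x) (\<lambda>y. \<LL> y (B y) \<mu>) - \<LL> x (B x) (\<lambda>y. \<LL> y (A y) \<mu>))"

definition cocycles1 ::
    "('m::topological_space, 'h::real_inner) atlas \<Rightarrow> ('m, 'a::real_vector) algebroid
      \<Rightarrow> ('m, 'v::real_vector) vbundle \<Rightarrow> ('m \<Rightarrow> 'a \<Rightarrow> ('m \<Rightarrow> 'v) \<Rightarrow> 'v) \<Rightarrow> ('m \<Rightarrow> 'a \<Rightarrow> 'v) set" where
  "cocycles1 M \<A> F \<LL> =
     {\<Omega>. bundle_map M \<A> F \<Omega> \<and>
         (\<forall>A\<in>sections M \<A>. \<forall>B\<in>sections M \<A>. \<forall>x.
            \<Omega> x (bracket \<A> A B x) = \<LL> x (A x) (\<lambda>y. \<Omega> y (B y)) - \<LL> x (B x) (\<lambda>y. \<Omega> y (A y)))}"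

definition coboundary_op :: "('m \<Rightarrow> 'a \<Rightarrow> ('m \<Rightarrow> 'v) \<Rightarrow> 'v) \<Rightarrow> ('m \<Rightarrow> 'v) \<Rightarrow> 'm \<Rightarrow> 'a \<Rightarrow> 'v" where
  "coboundary_op \<LL> \<mu> = (\<lambda>x a. \<LL> x a \<mu>)"

text \<open>Values of cochains off the fibres are irrelevant.\<close>

definition is_coboundary ::
    "('m::topological_space, 'h::real_inner) atlas \<Rightarrow> ('m, 'a::real_vector) algebroid
      \<Rightarrow> ('m, 'v::real_vector) vbundle \<Rightarrow> ('m \<Rightarrow> 'a \<Rightarrow> ('m \<Rightarrow> 'v) \<Rightarrow> 'v) \<Rightarrow> ('m \<Rightarrow> 'a \<Rightarrow> 'v) \<Rightarrow> bool" where
  "is_coboundary M \<A> F \<LL> \<Omega> \<longleftrightarrow>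
     (\<exists>\<mu>\<in>sections M F. \<forall>x. \<forall>a\<in>fibre \<A> x. \<Omega> x a = coboundary_op \<LL> \<mu> x a)"

definition homologic ::
    "('m::topological_space, 'h::real_inner) atlas \<Rightarrow> ('m, 'a::real_vector) algebroid
      \<Rightarrow> ('m, 'v::real_vector) vbundle \<Rightarrow> ('m \<Rightarrow> 'a \<Rightarrow> ('m \<Rightarrow> 'v) \<Rightarrow> 'v)
      \<Rightarrow> ('m \<Rightarrow> 'a \<Rightarrow> 'v) \<Rightarrow> ('m \<Rightarrow> 'a \<Rightarrow> 'v) \<Rightarrow> bool" where
  "homologic M \<A> F \<LL> \<Omega> \<Omega>' \<longleftrightarrow> is_coboundary M \<A> F \<LL> (\<Omega> - \<Omega>')"


section \<open>The isotropy action, its invariants and the reduced connection\<close>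

text \<open>The common value of \<open>\<LL> x u\<close> on all smooth extensions of \<open>\<tau>\<close>, for \<open>u\<close> in the adjoint fibre.\<close>

definition isotropy_action ::
    "('m::topological_space, 'h::real_inner) atlas \<Rightarrow> ('m, 'v::real_vector) vbundle
      \<Rightarrow> ('m \<Rightarrow> 'a \<Rightarrow> ('m \<Rightarrow> 'v) \<Rightarrow> 'v) \<Rightarrow> 'm \<Rightarrow> 'a \<Rightarrow> 'v \<Rightarrow> 'v" where
  "isotropy_action M F \<LL> x u \<tau> = (THE w. \<forall>\<mu>\<in>sections M F. \<mu> x = \<tau> \<longrightarrow> \<LL> x u \<mu> = w)"

definition isotropy_coboundary ::
    "('m::topological_space, 'h::real_inner) atlas \<Rightarrow> ('m, 'a::real_vector) algebroid
      \<Rightarrow> ('m, 'v::real_vector) vbundle \<Rightarrow> ('m \<Rightarrow> 'a \<Rightarrow> ('m \<Rightarrow> 'v) \<Rightarrow> 'v) \<Rightarrow> 'm \<Rightarrow> ('a \<Rightarrow> 'v) \<Rightarrow> bool" where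
  "isotropy_coboundary M \<A> F \<LL> x \<delta> \<longleftrightarrow>
     (\<exists>\<tau>\<in>fibre F x. \<forall>u\<in>adjoint_fibre \<A> x. \<delta> u = isotropy_action M F \<LL> x u \<tau>)"

definition invariant_bundle ::
    "('m::topological_space, 'h::real_inner) atlas \<Rightarrow> ('m, 'a::real_vector) algebroid
      \<Rightarrow> ('m, 'v::real_vector) vbundle \<Rightarrow> ('m \<Rightarrow> 'a \<Rightarrow> ('m \<Rightarrow> 'v) \<Rightarrow> 'v) \<Rightarrow> ('m, 'v) vbundle" where
  "invariant_bundle M \<A> F \<LL> =
     subbundle M F (\<lambda>y. {\<nu> \<in> fibre F y. \<forall>u\<in>adjoint_fibre \<A> y. isotropy_action M F \<LL> y u \<nu> = 0})"

definition restrict_rep ::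
    "('m::topological_space, 'h::real_inner) atlas \<Rightarrow> ('m, 'v::real_vector) vbundle
      \<Rightarrow> ('m \<Rightarrow> 'a \<Rightarrow> ('m \<Rightarrow> 'v) \<Rightarrow> 'v) \<Rightarrow> 'm \<Rightarrow> 'a \<Rightarrow> ('m \<Rightarrow> 'v) \<Rightarrow> 'v" where
  "restrict_rep M F0 \<LL> = (\<lambda>x a \<nu>. if \<nu> \<in> sections M F0 then \<LL> x a \<nu> else 0)"

text \<open>The common value of \<open>\<LL> x a \<nu>\<close> over all \<open>a\<close> with anchor \<open>X\<close>.\<close>

definition reduced_connection ::
    "('m::topological_space, 'h::real_inner) atlas \<Rightarrow> ('m, 'a::real_vector) algebroid
      \<Rightarrow> ('m, 'v::real_vector) vbundle \<Rightarrow> ('m \<Rightarrow> 'a \<Rightarrow> ('m \<Rightarrow> 'v) \<Rightarrow> 'v)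
      \<Rightarrow> 'm \<Rightarrow> 'm tangent \<Rightarrow> ('m \<Rightarrow> 'v) \<Rightarrow> 'v" where
  "reduced_connection M \<A> F0 \<LL> = (\<lambda>x X \<nu>.
     if \<nu> \<in> sections M F0 then (THE w. \<forall>a\<in>fibre \<A> x. anchor \<A> x a = X \<longrightarrow> \<LL> x a \<nu> = w) else 0)"


section \<open>Pull-back along a covering\<close>

definition pullback_anchor ::
    "('z::topological_space, 'h::real_inner) atlas \<Rightarrow> ('m::topological_space, 'h) atlas
      \<Rightarrow> ('z \<Rightarrow> 'm) \<Rightarrow> ('m, 'a::real_vector) algebroid \<Rightarrow> 'z \<Rightarrow> 'a \<Rightarrow> 'z tangent" where
  "pullback_anchor M' M p \<A> z a =
     (THE Z. Z \<in> tangent_space M' z \<and> push_tangent M p Z = anchor \<A> (p z) a)"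

definition algebroid_of ::
    "('m, 'a) vbundle \<Rightarrow> (('m \<Rightarrow> 'a) \<Rightarrow> ('m \<Rightarrow> 'a) \<Rightarrow> 'm \<Rightarrow> 'a) \<Rightarrow> ('m \<Rightarrow> 'a \<Rightarrow> 'm tangent)
      \<Rightarrow> ('m, 'a) algebroid" where
  "algebroid_of E br \<rho> = \<lparr> fibre = fibre E, frames = frames E, bracket = br, anchor = \<rho> \<rparr>"

text \<open>The unique Lie algebroid bracket that extends the pull-back of the bracket; the last
  condition fixes its irrelevant values off smooth sections.\<close>

definition pullback_bracket ::
    "('z::topological_space, 'h::real_inner) atlas \<Rightarrow> ('m::topological_space, 'h) atlas
      \<Rightarrow> ('z \<Rightarrow> 'm) \<Rightarrow> ('m, 'a::real_vector) algebroid \<Rightarrow> ('z \<Rightarrow> 'a) \<Rightarrow> ('z \<Rightarrow> 'a) \<Rightarrow> 'z \<Rightarrow> 'a" where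
  "pullback_bracket M' M p \<A> =
     (THE br. lie_algebroid M' (algebroid_of (pullback_bundle p \<A>) br (pullback_anchor M' M p \<A>)) \<and>
        (\<forall>A\<in>sections M \<A>. \<forall>B\<in>sections M \<A>. br (A \<circ> p) (B \<circ> p) = bracket \<A> A B \<circ> p) \<and>
        (\<forall>A B. A \<notin> sections M' (pullback_bundle p \<A>) \<or> B \<notin> sections M' (pullback_bundle p \<A>)
           \<longrightarrow> br A B = 0))"

definition pullback_algebroid ::
    "('z::topological_space, 'h::real_inner) atlas \<Rightarrow> ('m::topological_space, 'h) atlas
      \<Rightarrow> ('z \<Rightarrow> 'm) \<Rightarrow> ('m, 'a::real_vector) algebroid \<Rightarrow> ('z, 'a) algebroid" where
  "pullback_algebroid M' M p \<A> =
     algebroid_of (pullback_bundle p \<A>) (pullback_bracket M' M p \<A>) (pullback_anchor M' M p \<A>)"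

definition pullback_rep ::
    "('z::topological_space, 'h::real_inner) atlas \<Rightarrow> ('m::topological_space, 'h) atlas
      \<Rightarrow> ('z \<Rightarrow> 'm) \<Rightarrow> ('m, 'a::real_vector) algebroid \<Rightarrow> ('m, 'v::real_vector) vbundle
      \<Rightarrow> ('m \<Rightarrow> 'a \<Rightarrow> ('m \<Rightarrow> 'v) \<Rightarrow> 'v) \<Rightarrow> 'z \<Rightarrow> 'a \<Rightarrow> ('z \<Rightarrow> 'v) \<Rightarrow> 'v" where
  "pullback_rep M' M p \<A> F \<LL> z a =
     (THE D. D \<in> CDO M' (pullback_bundle p F) z \<and>
             is_symbol M' (pullback_bundle p F) z D (pullback_anchor M' M p \<A> z a) \<and>
             (\<forall>\<mu>\<in>sections M F. D (\<mu> \<circ> p) = \<LL> (p z) a \<mu>))"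

definition pullback_cochain :: "('z \<Rightarrow> 'm) \<Rightarrow> ('m \<Rightarrow> 'a \<Rightarrow> 'v) \<Rightarrow> 'z \<Rightarrow> 'a \<Rightarrow> 'v" where
  "pullback_cochain p \<Omega> = (\<lambda>z a. \<Omega> (p z) a)"

end

theory Submission
  imports Defs
begin

text \<open>Call \<open>\<tau> \<in> F\<^sub>y\<close> a primitive of \<open>\<Omega>\<close> at \<open>y\<close> if \<open>\<delta>\<^sub>y(u) = \<LL>\<^sub>u \<tau>\<close> for all \<open>u \<in> L\<^sub>y\<close>. A local
  section \<open>m\<close> solves \<open>\<LL>\<^sub>A m = \<Omega>(A)\<close> for all \<open>A\<close> iff its values are primitives and it solves the
  equations for lifts \<open>B\<^sub>b\<close> of the coordinate fields, which define an (affine) connection. Both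
  the curvature of this connection and the derivatives of the equations for \<open>L\<close> are linear
  combinations of the equations for \<open>L\<close>, because brackets of the \<open>B\<^sub>b\<close> among themselves and with
  sections of \<open>L\<close> are sections of \<open>L\<close>. Hence every primitive at \<open>y\<close> extends, by transport along
  rays, to a unique solution near \<open>y\<close>: the primitives form a local system. Over a connected
  manifold its fibres are therefore all empty or all nonempty, and over a simply connected
  covering a nonempty fibre yields a global solution. If primitives exist everywhere, a partition
  of unity glues local solutions to a section \<open>\<mu>\<close> with \<open>\<Omega> = \<DD>\<mu>\<close> on \<open>L\<close>; then \<open>\<Omega> - \<DD>\<mu>\<close> vanishes on
  \<open>L\<close>, by the cocycle identity it takes values in \<open>F\<^sub>0\<close>, and it descends to \<open>TM\<close>.\<close>

section \<open>Functions of class \<open>C\<^sup>k\<close>\<close>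

text \<open>The curvature vanishes only where the equations for \<open>L\<close> hold, and these are
  propagated from \<open>y\<close> only by exact solutions. So the form that a Picard iterate asks
  to integrate is not closed, and the Poincare lemma does not apply to it as it stands. The way out
  is quantitative. The iterates are formed with the homotopy operator, whose error is the exterior
  derivative of the form; a Gronwall estimate along rays bounds the violation of the equations for
  \<open>L\<close> by the defect of the iterate. Both errors then decay together, and the limit
  solves everything at once. The 1/8 in the smallness condition leaves room for three such error
  terms in one step that halves the error.

  The equation is affine. One more coefficient, kept equal to 1, makes it linear, so that the
  cocycle identity becomes one more column of the curvature identity. Brackets of the
  \<open>B_b\<close> lie in \<open>L\<close> because coordinate fields commute. On the covering
  every germ of a function or section is a pull-back, which makes the operators defined there by
  unique description computable.\<close>

lemma Ck_on_subset: "Ck_on k S f \<Longrightarrow> T \<subseteq> S \<Longrightarrow> Ck_on k T f"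
  by (induction k arbitrary: f) (auto intro: continuous_on_subset)

lemma Ck_on_cong:
  assumes "open S" "\<And>x. x \<in> S \<Longrightarrow> f x = g x"
  shows "Ck_on k S f \<longleftrightarrow> Ck_on k S g"
  using assms(2)
proof (induction k arbitrary: f g)
  case 0
  then show ?case by (auto cong: continuous_on_cong)
next
  case (Suc k)
  have d: "f differentiable (at x) \<longleftrightarrow> g differentiable (at x)" if "x \<in> S" for x
    unfolding differentiable_def
    using has_derivative_transform_within_open[OF _ \<open>open S\<close> that] Suc.prems by metis
  have "Ck_on k S (\<lambda>x. frechet_derivative f (at x) v) = Ck_on k S (\<lambda>x. frechet_derivative g (at x) v)"
    if "\<And>x. x \<in> S \<Longrightarrow> f differentiable (at x)" for v
  proof (rule Suc.IH)
    fix x assume "x \<in> S"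
    then show "frechet_derivative f (at x) v = frechet_derivative g (at x) v"
      using frechet_derivative_transform_within_open[OF that \<open>open S\<close>] Suc.prems by metis
  qed
  then show ?case using d by auto
qed

lemma Ck_on_local:
  assumes "\<And>x. x \<in> S \<Longrightarrow> \<exists>T. open T \<and> x \<in> T \<and> Ck_on k T f"
  shows "Ck_on k S f"
  using assms
proof (induction k arbitrary: f)
  case 0
  then show ?case
    unfolding Ck_on.simps
    by (intro continuous_at_imp_continuous_on ballI) (metis continuous_on_eq_continuous_at)
next
  case (Suc k)
  have "f differentiable (at x)" if "x \<in> S" for x using Suc.prems[OF that] by auto
  moreover have "Ck_on k S (\<lambda>x. frechet_derivative f (at x) v)" for v
    by (rule Suc.IH) (use Suc.prems in fastforce)
  ultimately show ?case by simp
qed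

lemma Ck_on_Suc_D: "Ck_on (Suc k) S f \<Longrightarrow> Ck_on k S f"
proof (induction k arbitrary: f)
  case 0
  then show ?case
    by (auto intro!: continuous_at_imp_continuous_on differentiable_imp_continuous_within)
next
  case (Suc k)
  then show ?case by (metis Ck_on.simps(2))
qed

lemma Ck_on_const: "Ck_on k S (\<lambda>x. c)"
  by (induction k arbitrary: c) (auto simp: frechet_derivative_const)

text \<open>Any explicit formula for the derivative may be supplied, so later proofs can stay away
  from \<open>frechet_derivative\<close>.\<close>

lemma Ck_on_Suc_I:
  assumes "open S" "\<And>x. x \<in> S \<Longrightarrow> (f has_derivative f' x) (at x)" "\<And>v. Ck_on k S (\<lambda>x. f' x v)"
  shows "Ck_on (Suc k) S f"
proof -
  have "Ck_on k S (\<lambda>x. frechet_derivative f (at x) v)" for v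
    by (subst Ck_on_cong[OF assms(1), of _ "\<lambda>x. f' x v"])
      (use assms frechet_derivative_at in \<open>metis, blast\<close>)
  then show ?thesis using assms(2) by (auto simp: differentiable_def)
qed

lemma Ck_on_Suc_E:
  assumes "Ck_on (Suc k) S f" "x \<in> S"
  shows "(f has_derivative frechet_derivative f (at x)) (at x)"
  using assms frechet_derivative_works by auto

lemma Ck_on_bounded_linear:
  assumes "open S" "bounded_linear L"
  shows "Ck_on k S f \<Longrightarrow> Ck_on k S (\<lambda>x. L (f x))"
proof (induction k arbitrary: f)
  case 0
  then show ?case using bounded_linear.continuous_on[OF assms(2)] by auto
next
  case (Suc k)
  show ?case
    by (rule Ck_on_Suc_I[OF assms(1), where f' = "\<lambda>x v. L (frechet_derivative f (at x) v)"])
      (use Suc bounded_linear.has_derivative[OF assms(2) Ck_on_Suc_E[OF Suc.prems]] in auto)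
qed

lemma Ck_on_add:
  assumes "open S"
  shows "Ck_on k S f \<Longrightarrow> Ck_on k S g \<Longrightarrow> Ck_on k S (\<lambda>x. f x + g x)"
proof (induction k arbitrary: f g)
  case 0
  then show ?case by (auto intro: continuous_intros)
next
  case (Suc k)
  show ?case
    by (rule Ck_on_Suc_I[OF assms(1), where f'
      = "\<lambda>x v. frechet_derivative f (at x) v + frechet_derivative g (at x) v"])
      (use Suc Ck_on_Suc_E[OF Suc.prems(1)] Ck_on_Suc_E[OF Suc.prems(2)] in \<open>auto intro: has_derivative_add\<close>)
qed

lemma Ck_on_bilinear:
  assumes "open S" "bounded_bilinear B"
  shows "Ck_on k S f \<Longrightarrow> Ck_on k S g \<Longrightarrow> Ck_on k S (\<lambda>x. B (f x) (g x))"
proof (induction k arbitrary: f g)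
  case 0
  then show ?case using bounded_bilinear.continuous_on[OF assms(2)] by auto
next
  case (Suc k)
  show ?case
  proof (rule Ck_on_Suc_I[OF assms(1), where f'
    = "\<lambda>x v. B (f x) (frechet_derivative g (at x) v) + B (frechet_derivative f (at x) v) (g x)"])
    fix x assume "x \<in> S"
    show "((\<lambda>x. B (f x) (g x)) has_derivative (\<lambda>v. B (f x) (frechet_derivative g (at x) v) + B (frechet_derivative f (at x) v) (g x))) (at x)"
      using bounded_bilinear.FDERIV[OF assms(2) Ck_on_Suc_E[OF Suc.prems(1) \<open>x \<in> S\<close>] Ck_on_Suc_E[OF
        Suc.prems(2) \<open>x \<in> S\<close>]] .
  next
    fix v show "Ck_on k S (\<lambda>x. B (f x) (frechet_derivative g (at x) v) + B (frechet_derivative f (at x) v) (g x))"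
      using Suc.prems Suc.IH Ck_on_Suc_D[OF Suc.prems(1)] Ck_on_Suc_D[OF Suc.prems(2)]
      by (auto intro!: Ck_on_add[OF assms(1)])
  qed
qed

lemma Ck_on_sum:
  assumes "open S" "\<And>i. i \<in> I \<Longrightarrow> Ck_on k S (f i)"
  shows "Ck_on k S (\<lambda>x. \<Sum>i\<in>I. f i x)"
  using assms(2) by (induction I rule: infinite_finite_induct) (auto simp: Ck_on_const intro: Ck_on_add[OF
    assms(1)])

lemma Ck_on_inverse:
  fixes f :: "'a::real_normed_vector \<Rightarrow> real"
  assumes "open S" "\<And>x. x \<in> S \<Longrightarrow> f x \<noteq> 0"
  shows "Ck_on k S f \<Longrightarrow> Ck_on k S (\<lambda>x. inverse (f x))"
proof (induction k)
  case 0
  then show ?case using assms by (auto intro: continuous_intros)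
next
  case (Suc k)
  have c: "Ck_on k S f" "Ck_on k S (\<lambda>x. inverse (f x))" using Suc Ck_on_Suc_D by blast+
  show ?case
  proof (rule Ck_on_Suc_I[OF assms(1), where f'
    = "\<lambda>x v. - (inverse (f x) * frechet_derivative f (at x) v * inverse (f x))"])
    fix x assume "x \<in> S"
    then show "((\<lambda>x. inverse (f x)) has_derivative (\<lambda>v. - (inverse (f x) * frechet_derivative f (at x) v * inverse (f x)))) (at x)"
      using Deriv.has_derivative_inverse[OF assms(2) Ck_on_Suc_E[OF Suc.prems]] by auto
  next
    fix v
    have "Ck_on k S (\<lambda>x. inverse (f x) * frechet_derivative f (at x) v * inverse (f x))"
      using Suc.prems c by (intro Ck_on_bilinear[OF assms(1) bounded_bilinear_mult]) auto
    then show "Ck_on k S (\<lambda>x. - (inverse (f x) * frechet_derivative f (at x) v * inverse (f x)))"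
      using Ck_on_bounded_linear[OF assms(1) bounded_linear_minus[OF bounded_linear_ident]] by blast
  qed
qed

section \<open>Orthonormal bases of the model space\<close>

definition onb :: "'a::real_inner set \<Rightarrow> bool" where
  "onb B \<longleftrightarrow> finite B \<and> (\<forall>b\<in>B. norm b = 1) \<and> pairwise orthogonal B \<and> span B = UNIV"

text \<open>The model space is only known to be an inner product space of finite dimension, so its
  basis is made by Gram-Schmidt; in dimension 0 it is empty.\<close>

lemma onb_exists:
  fixes B0 :: "'a::real_inner set"
  assumes "finite B0" "span B0 = UNIV"
  shows "\<exists>B::'a set. onb B"
proof -
  obtain C :: "'a set" where C: "finite C" "span C = UNIV" "pairwise orthogonal C"
    using basis_orthogonal[OF assms(1)] assms(2) by auto
  \<comment> \<open>The orthogonal set may contain the zero vector, which cannot be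
    normalised.\<close>
  define B where "B = (\<lambda>c. (1 / norm c) *\<^sub>R c) ` (C - {0})"
  have "pairwise orthogonal B"
    using C(3) unfolding B_def pairwise_def orthogonal_def by auto
  moreover have "span B = UNIV"
  proof -
    have "c \<in> span B" if "c \<in> C" for c
    proof (cases "c = 0")
      case False
      then have "c = norm c *\<^sub>R ((1 / norm c) *\<^sub>R c)" by simp
      moreover have "(1 / norm c) *\<^sub>R c \<in> B" using that False by (auto simp: B_def)
      ultimately show ?thesis by (metis span_base span_scale)
    qed (auto simp: span_zero)
    then have "span C \<subseteq> span B" by (simp add: span_minimal subsetI)
    then show ?thesis using C(2) by auto
  qed
  ultimately have "onb B" using C(1) by (auto simp: onb_def B_def)
  then show ?thesis ..
qed

lemma onb_expand:
  assumes "onb B" shows "(\<Sum>b\<in>B. (x \<bullet> b) *\<^sub>R b) = x"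
proof -
  have B: "finite B" "\<And>b. b \<in> B \<Longrightarrow> b \<bullet> b = 1" "\<And>b c. b \<in> B \<Longrightarrow> c \<in> B \<Longrightarrow> b \<noteq> c \<Longrightarrow> b \<bullet> c = 0"
    using assms by (auto simp: onb_def pairwise_def orthogonal_def norm_eq_1)
  have "x \<in> span B" using assms by (auto simp: onb_def)
  then show ?thesis
  proof (induction rule: span_induct_alt)
    case base
    then show ?case by simp
  next
    case (step c a y)
    have "(\<Sum>b\<in>B. (a \<bullet> b) *\<^sub>R b) = (\<Sum>b\<in>B. if b = a then a else 0)"
      using B step by (intro sum.cong) auto
    then have "(\<Sum>b\<in>B. (a \<bullet> b) *\<^sub>R b) = a" using B step by auto
    then show ?case
      using step by (simp add: inner_add_left scaleR_add_left sum.distrib flip: scaleR_scaleR scaleR_right.sum)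
  qed
qed

lemma onb_linear:
  assumes "onb B" "linear L" shows "L x = (\<Sum>b\<in>B. (x \<bullet> b) *\<^sub>R L b)"
proof -
  have "L x = L (\<Sum>b\<in>B. (x \<bullet> b) *\<^sub>R b)" by (simp add: onb_expand[OF assms(1)])
  then show ?thesis by (simp add: linear_sum[OF assms(2)] linear_scale[OF assms(2)])
qed

lemma onb_inner:
  assumes "onb B" "b \<in> B" "c \<in> B" shows "b \<bullet> c = (if b = c then 1 else 0)"
  using assms by (auto simp: onb_def pairwise_def orthogonal_def norm_eq_1)

lemma onb_independent: assumes "onb B" shows "independent B"
proof (rule pairwise_orthogonal_independent)
  show "pairwise orthogonal B" "0 \<notin> B" using assms by (auto simp: onb_def)
qed

text \<open>\<open>Ck_on\<close> controls derivatives in fixed directions, but the direction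
  \<open>?g' x v\<close> in the chain rule moves with \<open>x\<close>. Expanding it in the
  orthonormal basis \<open>B\<close> leaves sums of products in which all directions are fixed, and
  the induction hypothesis applies.\<close>

lemma Ck_on_compose:
  fixes f :: "'h::real_inner \<Rightarrow> 'c::real_normed_vector" and g :: "'a::real_normed_vector \<Rightarrow> 'h"
  assumes "onb (B :: 'h set)" "open S" "open T"
  shows "g ` S \<subseteq> T \<Longrightarrow> Ck_on k T f \<Longrightarrow> Ck_on k S g \<Longrightarrow> Ck_on k S (\<lambda>x. f (g x))"
proof (induction k arbitrary: f)
  case 0
  then show ?case by (auto intro: continuous_on_compose2)
next
  case (Suc k)
  let ?f' = "\<lambda>x. frechet_derivative f (at x)" and ?g' = "\<lambda>x. frechet_derivative g (at x)"
  have d: "(f has_derivative ?f' (g x)) (at (g x))" if "x \<in> S" for x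
    using Suc.prems(1,2) that Ck_on_Suc_E by blast
  show ?case
  proof (rule Ck_on_Suc_I[OF assms(2), where f' = "\<lambda>x v. ?f' (g x) (?g' x v)"])
    fix x assume x: "x \<in> S"
    show "((\<lambda>x. f (g x)) has_derivative (\<lambda>v. ?f' (g x) (?g' x v))) (at x)"
      using has_derivative_compose[OF Ck_on_Suc_E[OF Suc.prems(3) x] d[OF x]] .
  next
    fix v
    have "Ck_on k S (\<lambda>x. \<Sum>b\<in>B. (?g' x v \<bullet> b) *\<^sub>R ?f' (g x) b)"
    proof (intro Ck_on_sum[OF assms(2)] Ck_on_bilinear[OF assms(2) bounded_bilinear_scaleR])
      fix b
      show "Ck_on k S (\<lambda>x. ?g' x v \<bullet> b)"
        using Suc.prems(3) by (intro Ck_on_bounded_linear[OF assms(2) bounded_linear_inner_left]) auto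
      show "Ck_on k S (\<lambda>x. ?f' (g x) b)"
        using Suc.prems(1,2) Ck_on_Suc_D[OF Suc.prems(3)] by (intro Suc.IH) auto
    qed
    also have "?this \<longleftrightarrow> Ck_on k S (\<lambda>x. ?f' (g x) (?g' x v))"
      by (intro Ck_on_cong[OF assms(2)] onb_linear[OF assms(1) has_derivative_linear[OF d], symmetric])
    finally show "Ck_on k S (\<lambda>x. ?f' (g x) (?g' x v))" .
  qed
qed

section \<open>A smooth cutoff function on the real line\<close>

lemma onb_real: "onb {1::real}"
proof -
  have "x \<in> span {1}" for x :: real
    using span_scale[OF span_base[of "1::real" "{1}"], of x] by simp
  then show ?thesis by (auto simp: onb_def pairwise_def)
qed

text \<open>The powers of \<open>1 / t\<close> are included because differentiation then stays
  inside the span of the family: it raises \<open>k\<close> by 2 and by 1. The cutoff is built from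
  \<open>k = 0\<close>.\<close>

definition bump_aux :: "nat \<Rightarrow> real \<Rightarrow> real" where
  "bump_aux k t = (if t > 0 then (1 / t) ^ k * exp (- (1 / t)) else 0)"

text \<open>This is the difference quotient at 0. From the right it becomes
  \<open>x ^ Suc k * exp (- x)\<close> at infinity under \<open>x = 1 / t\<close>; from the left it
  is constantly 0.\<close>

lemma bump_aux_lim: "((\<lambda>t. bump_aux k t / t) \<longlongrightarrow> 0) (at 0)"
proof -
  have "((\<lambda>x::real. x ^ Suc k * exp (- x)) \<longlongrightarrow> 0) at_top"
    using tendsto_power_div_exp_0[of "Suc k"] by (simp add: exp_minus divide_inverse)
  then have "((\<lambda>t::real. (inverse t) ^ Suc k * exp (- (inverse t))) \<longlongrightarrow> 0) (at_right 0)"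
    using filterlim_compose[OF _ filterlim_inverse_at_top_right] by fast
  then have r: "((\<lambda>t. bump_aux k t / t) \<longlongrightarrow> 0) (at_right 0)"
    by (rule Lim_transform_eventually)
      (auto simp: eventually_at_right_field bump_aux_def field_simps intro!: exI[of _ 1])
  have l: "((\<lambda>t. bump_aux k t / t) \<longlongrightarrow> 0) (at_left 0)"
    by (rule Lim_transform_eventually[where f="\<lambda>_. 0"])
      (auto simp: eventually_at_left_field bump_aux_def intro!: exI[of _ "-1"])
  show ?thesis using r l by (simp add: filterlim_split_at)
qed

lemma bump_aux_deriv:
  "(bump_aux k has_real_derivative (bump_aux (Suc (Suc k)) t - real k * bump_aux (Suc k) t)) (at t)"
proof (cases t "0::real" rule: linorder_cases)
  case equal
  have "(\<lambda>h. (bump_aux k (0 + h) - bump_aux k 0) / h) = (\<lambda>h. bump_aux k h / h)"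
    by (auto simp: bump_aux_def)
  then show ?thesis using bump_aux_lim[of k] equal by (simp add: DERIV_def bump_aux_def)
next
  case less
  have "((\<lambda>_. 0) has_real_derivative 0) (at t)" by simp
  then have "(bump_aux k has_real_derivative 0) (at t)"
    by (rule has_field_derivative_transform_within_open[of _ _ _ "{..<0}"]) (use less in
      \<open>auto simp: bump_aux_def\<close>)
  then show ?thesis using less by (simp add: bump_aux_def)
next
  case greater
  have "((\<lambda>t. (1 / t) ^ k * exp (- (1 / t))) has_real_derivative
      (bump_aux (Suc (Suc k)) t - real k * bump_aux (Suc k) t)) (at t)"
  proof -
    have u: "((\<lambda>t. 1 / t) has_real_derivative - ((1 / t) * (1 / t))) (at t)"
      using greater by (auto intro!: derivative_eq_intros simp: field_simps power2_eq_square)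
    have "((\<lambda>u. u ^ k * exp (- u)) has_real_derivative
        (real k * u ^ (k - 1) * exp (- u) - u ^ k * exp (- u))) (at u)" for u :: real
      by (auto intro!: derivative_eq_intros)
    from DERIV_chain2[OF this u] show ?thesis
      by (rule DERIV_cong) (cases k; use greater in \<open>simp add: bump_aux_def algebra_simps add_divide_distrib\<close>)
  qed
  then show ?thesis
    by (rule has_field_derivative_transform_within_open[of _ _ _ "{0<..}"]) (use greater in
      \<open>auto simp: bump_aux_def\<close>)
qed

lemma Ck_on_bump_aux: "Ck_on n UNIV (bump_aux k)"
proof (induction n arbitrary: k)
  case 0
  show ?case using DERIV_isCont[OF bump_aux_deriv] by (auto intro!: continuous_at_imp_continuous_on)
next
  case (Suc n)
  show ?case
  proof (rule Ck_on_Suc_I[where f' = "\<lambda>t v. (bump_aux (Suc (Suc k)) t - real k * bump_aux (Suc k) t) * v"])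
    fix t :: real
    show "(bump_aux k has_derivative (*) (bump_aux (Suc (Suc k)) t - real k * bump_aux (Suc k) t)) (at t)"
      using bump_aux_deriv[of k t] by (simp add: has_field_derivative_def)
  next
    fix v :: real
    have "Ck_on n UNIV (\<lambda>t. bump_aux (Suc (Suc k)) t * v + bump_aux (Suc k) t * (- real k * v))"
      using Suc by (intro Ck_on_add Ck_on_bilinear[OF _ bounded_bilinear_mult] Ck_on_const) auto
    then show "Ck_on n UNIV (\<lambda>t. (bump_aux (Suc (Suc k)) t - real k * bump_aux (Suc k) t) * v)"
      by (simp add: algebra_simps)
  qed auto
qed

text \<open>A normalised quotient: one summand of the denominator is positive for
  \<open>t < 2\<close>, the other for \<open>t > 1\<close>, so the denominator never
  vanishes.\<close>

definition cutoff :: "real \<Rightarrow> real" where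
  "cutoff t = bump_aux 0 (2 - t) * inverse (bump_aux 0 (2 - t) + bump_aux 0 (t - 1))"

lemma cutoff_eq_1: "t \<le> 1 \<Longrightarrow> cutoff t = 1" and cutoff_eq_0: "t \<ge> 2 \<Longrightarrow> cutoff t = 0"
  by (auto simp: cutoff_def bump_aux_def)

lemma Ck_on_ident: "open S \<Longrightarrow> Ck_on k S (\<lambda>x. x)"
  by (cases k) (auto simp: Ck_on_const intro!: Ck_on_Suc_I[where f'="\<lambda>x v. v"])

lemma Ck_on_affine_real: "Ck_on k UNIV (\<lambda>t::real. a * t + b)"
  by (intro Ck_on_add Ck_on_bilinear[OF _ bounded_bilinear_mult] Ck_on_const Ck_on_ident) auto

lemma Ck_on_cutoff: "Ck_on k UNIV cutoff"
proof -
  have a: "Ck_on k UNIV (\<lambda>t. bump_aux 0 (a * t + b))" for a b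
    by (rule Ck_on_compose[OF onb_real _ _ _ Ck_on_bump_aux Ck_on_affine_real]) auto
  have "bump_aux 0 (2 - t) + bump_aux 0 (t - 1) \<noteq> 0" for t
    by (auto simp: bump_aux_def add_pos_pos order_less_imp_not_eq2)
  then have "Ck_on k UNIV (\<lambda>t. bump_aux 0 (2 - t) * inverse (bump_aux 0 (2 - t) + bump_aux 0 (t - 1)))"
    using a[of "-1" 2] a[of 1 "-1"]
    by (intro Ck_on_bilinear[OF _ bounded_bilinear_mult] Ck_on_inverse Ck_on_add) auto
  then show ?thesis by (simp add: cutoff_def[abs_def])
qed

section \<open>Rules for smooth functions\<close>

lemma smooth_on_subset: "smooth_on S f \<Longrightarrow> T \<subseteq> S \<Longrightarrow> smooth_on T f"
  unfolding smooth_on_def using Ck_on_subset by blast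

lemma smooth_on_cong: "open S \<Longrightarrow> (\<And>x. x \<in> S \<Longrightarrow> f x = g x) \<Longrightarrow> smooth_on S f \<longleftrightarrow> smooth_on S g"
  unfolding smooth_on_def using Ck_on_cong by blast

lemma smooth_on_local:
  assumes "\<And>x. x \<in> S \<Longrightarrow> \<exists>T. open T \<and> x \<in> T \<and> smooth_on T f"
  shows "smooth_on S f"
  unfolding smooth_on_def by (intro allI Ck_on_local) (use assms in \<open>auto simp: smooth_on_def\<close>)

lemma smooth_on_const: "smooth_on S (\<lambda>x. c)"
  by (simp add: smooth_on_def Ck_on_const)

lemma smooth_on_add: "open S \<Longrightarrow> smooth_on S f \<Longrightarrow> smooth_on S g \<Longrightarrow> smooth_on S (\<lambda>x. f x + g x)"
  by (simp add: smooth_on_def Ck_on_add)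

lemma smooth_on_bilinear:
  "open S \<Longrightarrow> bounded_bilinear B \<Longrightarrow> smooth_on S f \<Longrightarrow> smooth_on S g \<Longrightarrow> smooth_on S (\<lambda>x. B (f x) (g x))"
  by (simp add: smooth_on_def Ck_on_bilinear)

lemma smooth_on_inverse:
  fixes f :: "'a::real_normed_vector \<Rightarrow> real"
  shows "open S \<Longrightarrow> (\<And>x. x \<in> S \<Longrightarrow> f x \<noteq> 0) \<Longrightarrow> smooth_on S f \<Longrightarrow> smooth_on S (\<lambda>x. inverse (f x))"
  by (simp add: smooth_on_def Ck_on_inverse)

lemma smooth_on_compose:
  fixes f :: "'h::real_inner \<Rightarrow> 'c::real_normed_vector" and g :: "'a::real_normed_vector \<Rightarrow> 'h"
  assumes "onb (B :: 'h set)" "open S" "open T" "g ` S \<subseteq> T" "smooth_on T f" "smooth_on S g"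
  shows "smooth_on S (\<lambda>x. f (g x))"
  using Ck_on_compose[OF assms(1-4)] assms(5,6) unfolding smooth_on_def by blast

lemma smooth_on_differentiable:
  "smooth_on S f \<Longrightarrow> x \<in> S \<Longrightarrow> (f has_derivative frechet_derivative f (at x)) (at x)"
  unfolding smooth_on_def using Ck_on_Suc_E by blast

lemma smooth_on_derivative:
  "smooth_on S f \<Longrightarrow> smooth_on S (\<lambda>x. frechet_derivative f (at x) v)"
  unfolding smooth_on_def by (metis Ck_on.simps(2))

lemma smooth_on_continuous: "smooth_on S f \<Longrightarrow> continuous_on S f"
  unfolding smooth_on_def by (metis Ck_on.simps(1))

section \<open>Partial derivatives and the homotopy operator\<close>

text \<open>Partial derivatives are carried as data, so that a differential equation is expressed by
  the shape of \<open>gd\<close> and all estimates concern finitely many real functions.\<close>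

definition pd :: "'h::real_inner set \<Rightarrow> 'h set \<Rightarrow> ('h \<Rightarrow> real) \<Rightarrow> ('h \<Rightarrow> 'h \<Rightarrow> real) \<Rightarrow> bool" where
  "pd B W g gd \<longleftrightarrow>
     (\<forall>x\<in>W. (g has_derivative (\<lambda>v. \<Sum>b\<in>B. (v \<bullet> b) * gd b x)) (at x)) \<and> (\<forall>b\<in>B. continuous_on W (gd b))"

lemma pd_deriv: "pd B W g gd \<Longrightarrow> x \<in> W \<Longrightarrow> (g has_derivative (\<lambda>v. \<Sum>b\<in>B. (v \<bullet> b) * gd b x)) (at x)"
  by (simp add: pd_def)

lemma pd_cont: "pd B W g gd \<Longrightarrow> continuous_on W g"
  by (meson continuous_at_imp_continuous_on has_derivative_continuous pd_deriv)

lemma pd_cong: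
  "pd B W g gd \<Longrightarrow> (\<And>b x. b \<in> B \<Longrightarrow> x \<in> W \<Longrightarrow> gd b x = gd' b x) \<Longrightarrow> pd B W g gd'"
  unfolding pd_def by (auto cong: continuous_on_cong)

lemma pd_const: "pd B W (\<lambda>x. c) (\<lambda>b x. 0)"
  by (simp add: pd_def)

lemma pd_add:
  assumes "pd B W f fd" "pd B W g gd" shows "pd B W (\<lambda>x. f x + g x) (\<lambda>b x. fd b x + gd b x)"
  using assms unfolding pd_def
  by (auto intro!: continuous_intros has_derivative_eq_rhs[OF has_derivative_add] simp: distrib_left
    sum.distrib)

lemma pd_mult:
  assumes "pd B W f fd" "pd B W g gd" shows "pd B W (\<lambda>x. f x * g x) (\<lambda>b x. fd b x * g x + f x * gd b x)"
  using assms pd_cont[OF assms(1)] pd_cont[OF assms(2)] unfolding pd_def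
  by (auto intro!: continuous_intros has_derivative_eq_rhs[OF has_derivative_mult]
      simp: algebra_simps sum.distrib sum_distrib_left)

lemma pd_sum:
  assumes "\<And>i. i \<in> I \<Longrightarrow> pd B W (f i) (fd i)"
  shows "pd B W (\<lambda>x. \<Sum>i\<in>I. f i x) (\<lambda>b x. \<Sum>i\<in>I. fd i b x)"
  using assms by (induction I rule: infinite_finite_induct) (auto simp: pd_const pd_add)

lemma pd_smooth:
  assumes "onb B" "smooth_on W g"
  shows "pd B W g (\<lambda>b x. frechet_derivative g (at x) b)"
  unfolding pd_def
proof (intro conjI ballI)
  fix x assume x: "x \<in> W"
  have d: "(g has_derivative frechet_derivative g (at x)) (at x)"
    using smooth_on_differentiable[OF assms(2) x] .
  have "frechet_derivative g (at x) v = (\<Sum>b\<in>B. (v \<bullet> b) * frechet_derivative g (at x) b)" for v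
    using onb_linear[OF assms(1) has_derivative_linear[OF d], of v] unfolding real_scaleR_def .
  then show "(g has_derivative (\<lambda>v. \<Sum>b\<in>B. (v \<bullet> b) * frechet_derivative g (at x) b)) (at x)"
    by (intro has_derivative_eq_rhs[OF d] ext)
next
  fix b show "continuous_on W (\<lambda>x. frechet_derivative g (at x) b)"
    using smooth_on_derivative[OF assms(2)] smooth_on_continuous by blast
qed

lemma pd_unique:
  assumes "onb B" "pd B W g gd" "x \<in> W" "b \<in> B"
  shows "gd b x = frechet_derivative g (at x) b"
proof -
  have "frechet_derivative g (at x) = (\<lambda>v. \<Sum>c\<in>B. (v \<bullet> c) * gd c x)"
    using frechet_derivative_at[OF pd_deriv[OF assms(2,3)]] by simp
  moreover have "(\<Sum>c\<in>B. (b \<bullet> c) * gd c x) = (\<Sum>c\<in>B. if c = b then gd c x else 0)"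
    using onb_inner[OF assms(1)] assms(4) by (intro sum.cong) auto
  ultimately show ?thesis using assms(1,4) by (simp add: onb_def)
qed

section \<open>Estimates and integrals along rays\<close>

lemma pd_translate_mvt:
  assumes "pd B W g gd" "\<And>t. 0 \<le> t \<Longrightarrow> t \<le> 1 \<Longrightarrow> x + t *\<^sub>R v \<in> W"
  shows "\<exists>t. 0 < t \<and> t < 1 \<and> g (x + v) - g x = (\<Sum>b\<in>B. (v \<bullet> b) * gd b (x + t *\<^sub>R v))"
proof -
  have "((\<lambda>t. g (x + t *\<^sub>R v)) has_real_derivative (\<Sum>b\<in>B. (v \<bullet> b) * gd b (x + t *\<^sub>R v))) (at t)"
    if "0 \<le> t" "t \<le> 1" for t
  proof -
    have "((\<lambda>t. x + t *\<^sub>R v) has_derivative (\<lambda>s. s *\<^sub>R v)) (at t)"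
      by (auto intro!: derivative_eq_intros)
    from has_derivative_compose[OF this pd_deriv[OF assms(1) assms(2)[OF that]]]
    show ?thesis
      unfolding has_field_derivative_def
      by (rule has_derivative_eq_rhs) (simp add: fun_eq_iff sum_distrib_left mult_ac)
  qed
  from MVT2[OF _ this, of 0 1] show ?thesis by (auto simp: algebra_simps)
qed

lemma onb_inner_le: "onb B \<Longrightarrow> b \<in> B \<Longrightarrow> \<bar>x \<bullet> b\<bar> \<le> norm x"
  using Cauchy_Schwarz_ineq2[of x b] by (auto simp: onb_def)

lemma onb_sum_le:
  assumes "onb B" "\<And>b. b \<in> B \<Longrightarrow> \<bar>d b\<bar> \<le> e"
  shows "\<bar>\<Sum>b\<in>B. (v \<bullet> b) * d b\<bar> \<le> real (card B) * (norm v * e)"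
proof -
  have "\<bar>\<Sum>b\<in>B. (v \<bullet> b) * d b\<bar> \<le> (\<Sum>b\<in>B. norm v * e)"
    using assms(2) onb_inner_le[OF assms(1)]
    by (intro order_trans[OF sum_abs] sum_mono) (auto simp: abs_mult intro!: mult_mono)
  then show ?thesis by simp
qed

lemma convex_ray: "convex W \<Longrightarrow> y \<in> W \<Longrightarrow> x \<in> W \<Longrightarrow> 0 \<le> t \<Longrightarrow> t \<le> 1 \<Longrightarrow> y + t *\<^sub>R (x - y) \<in> W"
  using convexD[of W y x "1 - t" t] by (simp add: algebra_simps)

lemma ray_continuous:
  fixes g :: "'h::real_normed_vector \<Rightarrow> real"
  assumes "convex W" "y \<in> W" "continuous_on W g"
  shows "continuous_on (W \<times> {0..1::real}) (\<lambda>(x, t). g (y + t *\<^sub>R (x - y)))"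
  unfolding split_beta
  by (rule continuous_on_compose2[OF assms(3)])
    (use convex_ray[OF assms(1,2)] in \<open>auto intro!: continuous_intros\<close>)

lemma ray_continuous_t:
  fixes g :: "'h::real_normed_vector \<Rightarrow> real"
  assumes "convex W" "y \<in> W" "x \<in> W" "continuous_on W g"
  shows "continuous_on {0..1::real} (\<lambda>t. g (y + t *\<^sub>R (x - y)))"
  by (rule continuous_on_compose2[OF assms(4)])
    (use convex_ray[OF assms(1-3)] in \<open>auto intro!: continuous_intros\<close>)

lemma ray_integral_continuous:
  fixes g :: "'h::real_normed_vector \<Rightarrow> real"
  assumes "convex W" "y \<in> W" "continuous_on W g" "continuous_on {0..1} f"
  shows "continuous_on W (\<lambda>x. integral {0..1} (\<lambda>t. f t * g (y + t *\<^sub>R (x - y))))"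
proof -
  have f: "continuous_on (W \<times> {0..1::real}) (\<lambda>p. f (snd p))"
    by (rule continuous_on_compose2[OF assms(4) continuous_on_snd[OF continuous_on_id]]) auto
  have "continuous_on (W \<times> {0..1::real}) (\<lambda>p. f (snd p) * g (y + snd p *\<^sub>R (fst p - y)))"
    using ray_continuous[OF assms(1-3)] by (intro continuous_on_mult f) (auto simp: split_beta)
  then show ?thesis
    using integral_continuous_on_param[of W 0 1 "\<lambda>x t. f t * g (y + t *\<^sub>R (x - y))"]
    by (simp add: split_beta)
qed

text \<open>Differentiation under the integral sign; the factor \<open>t\<close> is the derivative
  of the ray point in \<open>x\<close>. For each \<open>t\<close> the remainder is estimated by the
  mean value theorem, uniformly because \<open>{0..1}\<close> is compact.\<close>

lemma ray_integral_deriv: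
  assumes B: "onb B" and W: "open W" "convex W" "y \<in> W" and g: "pd B W g gd"
  shows "pd B W (\<lambda>x. integral {0..1} (\<lambda>t. g (y + t *\<^sub>R (x - y))))
           (\<lambda>b x. integral {0..1} (\<lambda>t. t * gd b (y + t *\<^sub>R (x - y))))"
  unfolding pd_def
proof (intro conjI ballI)
  fix b assume "b \<in> B"
  then show "continuous_on W (\<lambda>x. integral {0..1} (\<lambda>t. t * gd b (y + t *\<^sub>R (x - y))))"
    using g by (intro ray_integral_continuous W) (auto simp: pd_def continuous_intros)
next
  fix x assume x: "x \<in> W"
  let ?z = "\<lambda>x t. y + t *\<^sub>R (x - y)"
  have gdc: "continuous_on W (gd b)" if "b \<in> B" for b using g that by (auto simp: pd_def)
  have int_g: "(\<lambda>t. g (?z u t)) integrable_on {0..1}" if "u \<in> W" for u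
    using ray_continuous_t[OF W(2,3) that pd_cont[OF g]] by (rule integrable_continuous_real)
  have int_gd: "(\<lambda>t. t * gd b (?z x t)) integrable_on {0..1}" if "b \<in> B" for b
    by (intro integrable_continuous_real continuous_intros ray_continuous_t[OF W(2,3) x gdc[OF that]])
  show "((\<lambda>x. integral {0..1} (\<lambda>t. g (?z x t))) has_derivative
         (\<lambda>v. \<Sum>b\<in>B. (v \<bullet> b) * integral {0..1} (\<lambda>t. t * gd b (?z x t)))) (at x)"
    unfolding has_derivative_at_alt
  proof (intro conjI allI impI)
    show "bounded_linear (\<lambda>v. \<Sum>b\<in>B. (v \<bullet> b) * integral {0..1} (\<lambda>t. t * gd b (?z x t)))"
      by (intro bounded_linear_sum bounded_linear_mult_const bounded_linear_inner_left)
  next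
    fix e :: real assume e: "e > 0"
    \<comment> \<open>One error per basis vector adds up to at most \<open>e\<close>; the
      \<open>+ 1\<close> avoids division by 0 when \<open>B\<close> is empty.\<close>
    define e' where "e' = e / (real (card B) + 1)"
    have e': "e' > 0" using e by (auto simp: e'_def)
    \<comment> \<open>Compactness of the interval gives one neighbourhood of \<open>x\<close> that
      serves all \<open>t\<close>.\<close>
    have "\<exists>X. x \<in> X \<and> open X \<and> (\<forall>u\<in>X \<inter> W. \<forall>t\<in>{0..1}. \<bar>gd b (?z u t) - gd b (?z x t)\<bar> \<le> e')" if "b \<in> B" for b
      using continuous_on_prod_compactE[OF ray_continuous[OF W(2,3) gdc[OF that]] compact_Icc x e']
      by (simp add: dist_real_def) metis
    then obtain X where X: "\<And>b. b \<in> B \<Longrightarrow> x \<in> X b \<and> open (X b) \<and>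
        (\<forall>u\<in>X b \<inter> W. \<forall>t\<in>{0..1}. \<bar>gd b (?z u t) - gd b (?z x t)\<bar> \<le> e')" by metis
    have "open (W \<inter> (\<Inter>b\<in>B. X b))" "x \<in> W \<inter> (\<Inter>b\<in>B. X b)"
      using X x W(1) B by (auto simp: onb_def intro!: open_Int open_INT)
    then obtain d where d: "d > 0" "ball x d \<subseteq> W \<inter> (\<Inter>b\<in>B. X b)"
      by (meson open_contains_ball)
    show "\<exists>d>0. \<forall>u. norm (u - x) < d \<longrightarrow>
            norm (integral {0..1} (\<lambda>t. g (?z u t)) - integral {0..1} (\<lambda>t. g (?z x t)) -
              (\<Sum>b\<in>B. ((u - x) \<bullet> b) * integral {0..1} (\<lambda>t. t * gd b (?z x t)))) \<le> e * norm (u - x)"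
    proof (intro exI conjI allI impI)
      fix u assume u: "norm (u - x) < d"
      have inb: "x + s *\<^sub>R (u - x) \<in> ball x d" if "0 \<le> s" "s \<le> 1" for s
        using u that mult_left_le_one_le[of "norm (u - x)" s] by (auto simp: dist_norm)
      have uW: "u \<in> W" using inb[of 1] d by auto
      have pt: "\<bar>g (?z u t) - g (?z x t) - (\<Sum>b\<in>B. ((u - x) \<bullet> b) * (t * gd b (?z x t)))\<bar> \<le> e * norm (u - x)"
        if t: "t \<in> {0..1}" for t
      proof -
        have *: "?z x t + s *\<^sub>R (t *\<^sub>R (u - x)) = ?z (x + s *\<^sub>R (u - x)) t" for s
          by (simp add: algebra_simps)
        have "?z x t + s *\<^sub>R (t *\<^sub>R (u - x)) \<in> W" if "0 \<le> s" "s \<le> 1" for s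
          using inb[OF that] d(2) t convex_ray[OF W(2,3), of "x + s *\<^sub>R (u - x)" t] unfolding * by auto
        from pd_translate_mvt[OF g this] obtain s where s: "0 < s" "s < 1"
          and eq: "g (?z x t + t *\<^sub>R (u - x)) - g (?z x t) =
            (\<Sum>b\<in>B. (t *\<^sub>R (u - x) \<bullet> b) * gd b (?z x t + s *\<^sub>R (t *\<^sub>R (u - x))))" by auto
        have "?z x t + t *\<^sub>R (u - x) = ?z u t" by (simp add: algebra_simps)
        then have "g (?z u t) - g (?z x t) - (\<Sum>b\<in>B. ((u - x) \<bullet> b) * (t * gd b (?z x t))) =
           (\<Sum>b\<in>B. ((u - x) \<bullet> b) * (t * (gd b (?z (x + s *\<^sub>R (u - x)) t) - gd b (?z x t))))"
          using eq unfolding * by (simp add: right_diff_distrib sum_subtractf mult_ac add.assoc del: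
            inner_diff_left)
        also have "\<bar>\<dots>\<bar> \<le> real (card B) * (norm (u - x) * e')"
        proof (rule onb_sum_le[OF B])
          fix b assume b: "b \<in> B"
          have "\<bar>gd b (?z (x + s *\<^sub>R (u - x)) t) - gd b (?z x t)\<bar> \<le> e'"
          proof -
            have "x + s *\<^sub>R (u - x) \<in> ball x d" using inb s by simp
            then have "x + s *\<^sub>R (u - x) \<in> X b \<inter> W" using d(2) b by blast
            then show ?thesis using X[OF b] t by blast
          qed
          then show "\<bar>t * (gd b (?z (x + s *\<^sub>R (u - x)) t) - gd b (?z x t))\<bar> \<le> e'"
            using t mult_mono[of "\<bar>t\<bar>" 1 "\<bar>gd b (?z (x + s *\<^sub>R (u - x)) t) - gd b (?z x t)\<bar>" e']
            by (auto simp: abs_mult)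
        qed
        also have "real (card B) * (norm (u - x) * e') \<le> e * norm (u - x)"
        proof -
          have "real (card B) * e' \<le> e" using e by (auto simp: e'_def field_simps)
          then show ?thesis using mult_right_mono[of "real (card B) * e'" e "norm (u - x)"]
            by (simp add: mult_ac)
        qed
        finally show ?thesis .
      qed
      have "integral {0..1} (\<lambda>t. g (?z u t)) - integral {0..1} (\<lambda>t. g (?z x t)) -
              (\<Sum>b\<in>B. ((u - x) \<bullet> b) * integral {0..1} (\<lambda>t. t * gd b (?z x t))) =
            integral {0..1} (\<lambda>t. g (?z u t) - g (?z x t) - (\<Sum>b\<in>B. ((u - x) \<bullet> b) * (t * gd b (?z x t))))"
        using int_g[OF uW] int_g[OF x] int_gd B
        by (simp add: Henstock_Kurzweil_Integration.integral_diff integrable_diff integrable_sum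
            integrable_on_mult_right Henstock_Kurzweil_Integration.integral_sum onb_def)
      also have "norm \<dots> \<le> e * norm (u - x) * (1 - 0)"
        by (rule integral_bound)
          (use pt uW x in \<open>auto intro!: continuous_intros ray_continuous_t[OF W(2,3)] pd_cont[OF g] gdc\<close>)
      finally show "norm (integral {0..1} (\<lambda>t. g (?z u t)) - integral {0..1} (\<lambda>t. g (?z x t)) -
              (\<Sum>b\<in>B. ((u - x) \<bullet> b) * integral {0..1} (\<lambda>t. t * gd b (?z x t)))) \<le> e * norm (u - x)"
        by simp
    qed (use d in auto)
  qed
qed

text \<open>The homotopy operator of the Poincare lemma on 1-forms.\<close>

definition hop :: "'h::real_inner set \<Rightarrow> 'h \<Rightarrow> ('h \<Rightarrow> 'h \<Rightarrow> real) \<Rightarrow> 'h \<Rightarrow> real" where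
  "hop B y \<omega> x = (\<Sum>b\<in>B. ((x - y) \<bullet> b) * integral {0..1} (\<lambda>t. \<omega> b (y + t *\<^sub>R (x - y))))"

lemma hop_self [simp]: "hop B y \<omega> y = 0"
  by (simp add: hop_def)

text \<open>\<open>hop\<close> is linear, and integration along rays of length at most
  \<open>r\<close> costs a factor proportional to \<open>r\<close> in the sup norm. On a small ball
  this factor makes the Picard iteration contract.\<close>

lemma hop_diff_bound:
  assumes B: "onb B" and W: "convex W" "y \<in> W" "x \<in> W" and r: "norm (x - y) \<le> r"
    and c: "\<And>b. b \<in> B \<Longrightarrow> continuous_on W (\<omega> b)" "\<And>b. b \<in> B \<Longrightarrow> continuous_on W (\<omega>' b)"
    and e: "\<And>b z. b \<in> B \<Longrightarrow> z \<in> W \<Longrightarrow> \<bar>\<omega> b z - \<omega>' b z\<bar> \<le> e"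
  shows "\<bar>hop B y \<omega> x - hop B y \<omega>' x\<bar> \<le> real (card B) * (r * e)"
proof (cases "B = {}")
  case False
  let ?z = "\<lambda>t. y + t *\<^sub>R (x - y)"
  have "e \<ge> 0" using e[OF _ W(2)] False by (metis abs_ge_zero equals0I order_trans)
  have c': "continuous_on {0..1} (\<lambda>t. \<omega> b (?z t))" "continuous_on {0..1} (\<lambda>t. \<omega>' b (?z t))" if "b \<in> B" for b
    using ray_continuous_t[OF W] c that by blast+
  have "hop B y \<omega> x - hop B y \<omega>' x = (\<Sum>b\<in>B. ((x - y) \<bullet> b) * integral {0..1} (\<lambda>t. \<omega> b (?z t) - \<omega>' b (?z t)))"
    unfolding hop_def sum_subtractf[symmetric]
    by (intro sum.cong)
      (auto simp: Henstock_Kurzweil_Integration.integral_diff integrable_continuous_real c' right_diff_distrib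
        simp del: inner_diff_left)
  also have "\<bar>\<dots>\<bar> \<le> real (card B) * (norm (x - y) * e)"
  proof (rule onb_sum_le[OF B])
    fix b assume b: "b \<in> B"
    have "norm (integral {0..1} (\<lambda>t. \<omega> b (?z t) - \<omega>' b (?z t))) \<le> e * (1 - 0)"
      by (rule integral_bound) (use e[OF b convex_ray[OF W]] c'[OF b] in \<open>auto intro!: continuous_intros\<close>)
    then show "\<bar>integral {0..1} (\<lambda>t. \<omega> b (?z t) - \<omega>' b (?z t))\<bar> \<le> e" by simp
  qed
  also have "\<dots> \<le> real (card B) * (r * e)"
    using r \<open>e \<ge> 0\<close> by (intro mult_left_mono mult_right_mono) auto
  finally show ?thesis .
qed (auto simp: hop_def)

lemma pd_inner:
  assumes "onb B" "b \<in> B" shows "pd B W (\<lambda>x. (x - y) \<bullet> b) (\<lambda>c x. if c = b then 1 else 0)"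
  using assms unfolding pd_def by (auto intro!: derivative_eq_intros simp: onb_def if_distrib cong: if_cong)

text \<open>The homotopy formula: the differential of \<open>hop B y \<omega>\<close> misses
  \<open>\<omega>\<close> by an integral of the exterior derivative of \<open>\<omega>\<close>.
  Closedness is not assumed because the forms to be integrated are closed only
  approximately.\<close>

lemma hop_deriv:
  assumes B: "onb B" and W: "open W" "convex W" "y \<in> W"
    and \<omega>: "\<And>b. b \<in> B \<Longrightarrow> pd B W (\<omega> b) (\<omega>d b)"
  obtains hd where "pd B W (hop B y \<omega>) hd"
    "\<And>c x. c \<in> B \<Longrightarrow> x \<in> W \<Longrightarrow> hd c x - \<omega> c x =
       (\<Sum>b\<in>B. ((x - y) \<bullet> b) * integral {0..1} (\<lambda>t. t * (\<omega>d b c (y + t *\<^sub>R (x - y)) - \<omega>d c b (y + t *\<^sub>R (x -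
         y)))))"
proof -
  let ?z = "\<lambda>x t. y + t *\<^sub>R (x - y)"
  let ?I = "\<lambda>b x. integral {0..1} (\<lambda>t. \<omega> b (?z x t))"
  let ?J = "\<lambda>b c x. integral {0..1} (\<lambda>t. t * \<omega>d b c (?z x t))"
  define hd where "hd = (\<lambda>c x. \<Sum>b\<in>B. (if c = b then 1 else 0) * ?I b x + ((x - y) \<bullet> b) * ?J b c x)"
  have "pd B W (hop B y \<omega>) hd"
    unfolding hop_def[abs_def] hd_def
    by (intro pd_sum pd_mult pd_inner ray_integral_deriv \<omega> B W) auto
  moreover have "hd c x - \<omega> c x = (\<Sum>b\<in>B. ((x - y) \<bullet> b) * integral {0..1} (\<lambda>t. t * (\<omega>d b c (?z x t) - \<omega>d c b (?z x t))))"
    if c: "c \<in> B" and x: "x \<in> W" for c x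
  proof -
    have cd: "continuous_on W (\<omega>d b b')" if "b \<in> B" "b' \<in> B" for b b'
      using \<omega>[OF that(1)] that(2) by (auto simp: pd_def)
    have cont: "continuous_on {0..1} (\<lambda>t. t * \<omega>d b b' (?z x t))" if "b \<in> B" "b' \<in> B" for b b'
      by (intro continuous_intros ray_continuous_t[OF W(2,3) x cd[OF that]])
    have cont': "continuous_on {0..1} (\<lambda>t. \<omega> c (?z x t))"
      by (rule ray_continuous_t[OF W(2,3) x pd_cont[OF \<omega>[OF c]]])
    \<comment> \<open>The integrand is the derivative of \<open>t * \<omega> c\<close> along the
      ray, so its integral is the value at the end point \<open>x\<close>. Comparison with the
      product rule for \<open>hop\<close> leaves the antisymmetric part only.\<close>
    have "((\<lambda>t. \<omega> c (?z x t) + (\<Sum>b\<in>B. ((x - y) \<bullet> b) * (t * \<omega>d c b (?z x t)))) has_integral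
        (1 * \<omega> c (?z x 1) - 0 * \<omega> c (?z x 0))) {0..1}"
    proof (rule fundamental_theorem_of_calculus)
      fix t :: real assume t: "t \<in> {0..1}"
      have "((\<lambda>t. ?z x t) has_derivative (\<lambda>s. s *\<^sub>R (x - y))) (at t)"
        by (auto intro!: derivative_eq_intros)
      from has_derivative_compose[OF this pd_deriv[OF \<omega>[OF c] convex_ray[OF W(2,3) x]]] t
      have "((\<lambda>t. \<omega> c (?z x t)) has_derivative (\<lambda>s. \<Sum>b\<in>B. (s *\<^sub>R (x - y) \<bullet> b) * \<omega>d c b (?z x t))) (at t)"
        by simp
      then have "((\<lambda>t. t * \<omega> c (?z x t)) has_derivative
          (\<lambda>s. t * (\<Sum>b\<in>B. (s *\<^sub>R (x - y) \<bullet> b) * \<omega>d c b (?z x t)) + s * \<omega> c (?z x t))) (at t within {0..1})"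
        by (intro has_derivative_mult) (auto intro: has_derivative_at_withinI)
      then show "((\<lambda>t. t * \<omega> c (?z x t)) has_vector_derivative
         (\<omega> c (?z x t) + (\<Sum>b\<in>B. ((x - y) \<bullet> b) * (t * \<omega>d c b (?z x t))))) (at t within {0..1})"
        unfolding has_vector_derivative_def
        by (rule has_derivative_eq_rhs) (auto simp: fun_eq_iff algebra_simps sum_distrib_left)
    qed auto
    then have "\<omega> c x = integral {0..1} (\<lambda>t. \<omega> c (?z x t) + (\<Sum>b\<in>B. ((x - y) \<bullet> b) * (t * \<omega>d c b (?z x t))))"
      by (simp add: integral_unique)
    also have "\<dots> = ?I c x + (\<Sum>b\<in>B. ((x - y) \<bullet> b) * ?J c b x)"
      using cont cont' c B
      by (simp add: Henstock_Kurzweil_Integration.integral_add integrable_continuous_real integrable_sum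
          integrable_on_mult_right Henstock_Kurzweil_Integration.integral_sum onb_def)
    finally have "\<omega> c x = ?I c x + (\<Sum>b\<in>B. ((x - y) \<bullet> b) * ?J c b x)" .
    moreover have "hd c x = ?I c x + (\<Sum>b\<in>B. ((x - y) \<bullet> b) * ?J b c x)"
      using c B by (simp add: hd_def sum.distrib onb_def if_distrib[of "\<lambda>u. u * _"] cong: if_cong)
    moreover have "integral {0..1} (\<lambda>t. t * (\<omega>d b c (?z x t) - \<omega>d c b (?z x t))) = ?J b c x - ?J c b x"
      if "b \<in> B" for b
      using cont[OF that c] cont[OF c that]
      by (simp add: right_diff_distrib Henstock_Kurzweil_Integration.integral_diff integrable_continuous_real)
    ultimately show ?thesis by (simp add: right_diff_distrib sum_subtractf)
  qed
  ultimately show thesis by (rule that)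
qed

text \<open>A form that is closed up to \<open>e\<close> has a primitive up to a multiple of
  \<open>r * e\<close>.\<close>

lemma hop_deriv_bound:
  assumes B: "onb B" and W: "open W" "convex W" "y \<in> W" and r: "\<And>x. x \<in> W \<Longrightarrow> norm (x - y) \<le> r"
    and \<omega>: "\<And>b. b \<in> B \<Longrightarrow> pd B W (\<omega> b) (\<omega>d b)"
    and e: "\<And>b c z. b \<in> B \<Longrightarrow> c \<in> B \<Longrightarrow> z \<in> W \<Longrightarrow> \<bar>\<omega>d b c z - \<omega>d c b z\<bar> \<le> e"
  obtains hd where "pd B W (hop B y \<omega>) hd"
    "\<And>c x. c \<in> B \<Longrightarrow> x \<in> W \<Longrightarrow> \<bar>hd c x - \<omega> c x\<bar> \<le> real (card B) * (r * e)"
proof -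
  let ?z = "\<lambda>x t. y + t *\<^sub>R (x - y)"
  obtain hd where hd: "pd B W (hop B y \<omega>) hd"
    "\<And>c x. c \<in> B \<Longrightarrow> x \<in> W \<Longrightarrow> hd c x - \<omega> c x =
       (\<Sum>b\<in>B. ((x - y) \<bullet> b) * integral {0..1} (\<lambda>t. t * (\<omega>d b c (?z x t) - \<omega>d c b (?z x t))))"
    using hop_deriv[OF B W, of \<omega> \<omega>d] \<omega> by blast
  have "\<bar>hd c x - \<omega> c x\<bar> \<le> real (card B) * (r * e)" if c: "c \<in> B" and x: "x \<in> W" for c x
  proof -
    have "\<bar>hd c x - \<omega> c x\<bar> \<le> real (card B) * (norm (x - y) * e)"
      unfolding hd(2)[OF that]
    proof (rule onb_sum_le[OF B])
      fix b assume b: "b \<in> B"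
      have cont: "continuous_on {0..1} (\<lambda>t. t * (\<omega>d b c (?z x t) - \<omega>d c b (?z x t)))"
        using \<omega>[OF b] \<omega>[OF c] b c
        by (intro continuous_intros ray_continuous_t[OF W(2,3) x]) (auto simp: pd_def)
      have "norm (integral {0..1} (\<lambda>t. t * (\<omega>d b c (?z x t) - \<omega>d c b (?z x t)))) \<le> e * (1 - 0)"
      proof (rule integral_bound[OF _ cont])
        fix t :: real assume t: "t \<in> {0..1}"
        have "\<bar>t\<bar> * \<bar>\<omega>d b c (?z x t) - \<omega>d c b (?z x t)\<bar> \<le> 1 * e"
          using t by (intro mult_mono e[OF b c] convex_ray[OF W(2,3) x]) auto
        then show "norm (t * (\<omega>d b c (?z x t) - \<omega>d c b (?z x t))) \<le> e" by (simp add: abs_mult)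
      qed auto
      then show "\<bar>integral {0..1} (\<lambda>t. t * (\<omega>d b c (?z x t) - \<omega>d c b (?z x t)))\<bar> \<le> e" by simp
    qed
    also have "\<dots> \<le> real (card B) * (r * e)"
      using r[OF x] order_trans[OF abs_ge_zero e[OF c c x]] by (intro mult_left_mono mult_right_mono) auto
    finally show ?thesis .
  qed
  with hd(1) show thesis by (rule that)
qed

text \<open>At the point of the segment where the sum is maximal, the mean value theorem bounds the
  maximum by half of itself plus the error. Absorbing the half yields the factor 2.\<close>

lemma segment_gronwall:
  assumes B: "onb B" and W: "convex W" "y \<in> W" "x \<in> W" and r: "\<And>x. x \<in> W \<Longrightarrow> norm (x - y) \<le> r"
    and Q: "finite Q" and u: "\<And>q. q \<in> Q \<Longrightarrow> pd B W (u q) (ud q)" "\<And>q. q \<in> Q \<Longrightarrow> u q y = 0"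
    and c: "c \<ge> 0" "e \<ge> 0"
      "\<And>b q z. b \<in> B \<Longrightarrow> q \<in> Q \<Longrightarrow> z \<in> W \<Longrightarrow> \<bar>ud q b z\<bar> \<le> c * (\<Sum>q\<in>Q. \<bar>u q z\<bar>) + e"
    and small: "real (card Q) * (real (card B) * (r * c)) \<le> 1 / 2"
  shows "(\<Sum>q\<in>Q. \<bar>u q x\<bar>) \<le> 2 * (real (card Q) * (real (card B) * (r * e)))"
proof -
  let ?s = "\<lambda>z. \<Sum>q\<in>Q. \<bar>u q z\<bar>"
  let ?z = "\<lambda>t. y + t *\<^sub>R (x - y)"
  have "continuous_on {0..1::real} (\<lambda>t. ?s (?z t))"
    by (intro continuous_intros ray_continuous_t[OF W] pd_cont[OF u(1)])
  then obtain t where t: "t \<in> {0..1}" "\<And>t'. t' \<in> {0..1} \<Longrightarrow> ?s (?z t') \<le> ?s (?z t)"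
    using continuous_attains_sup[of "{0..1::real}" "\<lambda>t. ?s (?z t)"] by auto
  \<comment> \<open>The maximum is taken over the whole segment, so it also bounds the sum at the
    intermediate point that the mean value theorem produces.\<close>
  define m where "m = ?s (?z t)"
  have r0: "r \<ge> 0" using r[OF W(2)] by auto
  have "\<bar>u q (?z t)\<bar> \<le> real (card B) * (r * (c * m + e))" if q: "q \<in> Q" for q
  proof -
    have "y + s *\<^sub>R (t *\<^sub>R (x - y)) \<in> W" if "0 \<le> s" "s \<le> 1" for s
      using convex_ray[OF W, of "s * t"] that t(1) by (auto simp: mult_le_one)
    from pd_translate_mvt[OF u(1)[OF q] this] obtain s where s: "0 < s" "s < 1"
      "u q (?z t) = (\<Sum>b\<in>B. (t *\<^sub>R (x - y) \<bullet> b) * ud q b (y + s *\<^sub>R (t *\<^sub>R (x - y))))"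
      using u(2)[OF q] by auto
    have st: "s * t \<in> {0..1}" using s t(1) by (auto simp: mult_le_one)
    have "\<bar>u q (?z t)\<bar> \<le> real (card B) * (norm (t *\<^sub>R (x - y)) * (c * m + e))"
      unfolding s(3)
    proof (rule onb_sum_le[OF B])
      fix b assume b: "b \<in> B"
      have "\<bar>ud q b (?z (s * t))\<bar> \<le> c * ?s (?z (s * t)) + e"
        using st by (intro c(3) b q convex_ray[OF W]) auto
      also have "\<dots> \<le> c * m + e"
        using t(2)[OF st] c by (auto simp: m_def intro!: mult_left_mono)
      finally show "\<bar>ud q b (y + s *\<^sub>R (t *\<^sub>R (x - y)))\<bar> \<le> c * m + e" by simp
    qed
    also have "\<dots> \<le> real (card B) * (r * (c * m + e))"
    proof -
      have "norm (t *\<^sub>R (x - y)) \<le> r"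
        using t(1) r[OF W(3)] mult_left_le_one_le[of "norm (x - y)" t] by auto
      moreover have "c * m + e \<ge> 0" using c by (auto simp: m_def sum_nonneg)
      ultimately show ?thesis by (intro mult_left_mono mult_right_mono) auto
    qed
    finally show ?thesis .
  qed
  then have "m \<le> (\<Sum>q\<in>Q. real (card B) * (r * (c * m + e)))"
    unfolding m_def by (intro sum_mono) auto
  also have "\<dots> = (real (card Q) * (real (card B) * (r * c))) * m + real (card Q) * (real (card B) * (r * e))"
    by (simp add: algebra_simps)
  also have "\<dots> \<le> 1 / 2 * m + real (card Q) * (real (card B) * (r * e))"
    using small by (intro add_right_mono mult_right_mono) (auto simp: m_def sum_nonneg)
  finally have "m \<le> 2 * (real (card Q) * (real (card B) * (r * e)))" by simp
  then show ?thesis using t(2)[of 1] by (auto simp: m_def)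
qed

section \<open>Parallel sections\<close>

text \<open>An overdetermined linear system: \<open>\<sigma>\<close> shall have partial derivatives
  \<open>a b\<close> applied to \<open>\<sigma>\<close> and satisfy the constraints
  \<open>K q\<close>. By \<open>K_eq\<close> the derivative of a constraint along a solution is a
  combination, through \<open>m\<close>, of constraints; by \<open>curv\<close> the curvature is one
  through \<open>S\<close>. So both obstructions vanish where the constraints hold. \<open>r\<close>
  bounds the diameter of \<open>W\<close>, and \<open>small\<close> makes it small against the
  common bound \<open>C\<close> of the coefficients.\<close>

locale flat_system =
  fixes B :: "'h::real_inner set" and W :: "'h set" and J :: "nat set" and Q :: "'q set"
    and a :: "'h \<Rightarrow> nat \<Rightarrow> nat \<Rightarrow> 'h \<Rightarrow> real"
    and ad :: "'h \<Rightarrow> 'h \<Rightarrow> nat \<Rightarrow> nat \<Rightarrow> 'h \<Rightarrow> real"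
    and K :: "'q \<Rightarrow> nat \<Rightarrow> 'h \<Rightarrow> real" and Kd :: "'h \<Rightarrow> 'q \<Rightarrow> nat \<Rightarrow> 'h \<Rightarrow> real"
    and m :: "'h \<Rightarrow> 'q \<Rightarrow> 'q \<Rightarrow> 'h \<Rightarrow> real" and S :: "'h \<Rightarrow> 'h \<Rightarrow> nat \<Rightarrow> 'q \<Rightarrow> 'h \<Rightarrow> real"
    and C r :: real
  assumes onb: "onb B" and W: "open W" "convex W" and r: "\<And>x y. x \<in> W \<Longrightarrow> y \<in> W \<Longrightarrow> norm (x - y) \<le> r"
    and fin: "finite J" "finite Q"
    and a_pd: "\<And>b i j. b \<in> B \<Longrightarrow> i \<in> J \<Longrightarrow> j \<in> J \<Longrightarrow> pd B W (a b i j) (\<lambda>c. ad c b i j)"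
    and K_pd: "\<And>q j. q \<in> Q \<Longrightarrow> j \<in> J \<Longrightarrow> pd B W (K q j) (\<lambda>c. Kd c q j)"
    and K_eq: "\<And>b q j x. b \<in> B \<Longrightarrow> q \<in> Q \<Longrightarrow> j \<in> J \<Longrightarrow> x \<in> W \<Longrightarrow>
        Kd b q j x = (\<Sum>q'\<in>Q. m b q q' x * K q' j x) - (\<Sum>k\<in>J. K q k x * a b k j x)"
    and curv: "\<And>b c i j x. b \<in> B \<Longrightarrow> c \<in> B \<Longrightarrow> i \<in> J \<Longrightarrow> j \<in> J \<Longrightarrow> x \<in> W \<Longrightarrow>
        ad c b i j x - ad b c i j x + (\<Sum>k\<in>J. a b i k x * a c k j x - a c i k x * a b k j x)
          = (\<Sum>q\<in>Q. S c b i q x * K q j x)"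
    and C: "C \<ge> 0"
      "\<And>b i j x. b \<in> B \<Longrightarrow> i \<in> J \<Longrightarrow> j \<in> J \<Longrightarrow> x \<in> W \<Longrightarrow> \<bar>a b i j x\<bar> \<le> C"
      "\<And>q j x. q \<in> Q \<Longrightarrow> j \<in> J \<Longrightarrow> x \<in> W \<Longrightarrow> \<bar>K q j x\<bar> \<le> C"
      "\<And>b q q' x. b \<in> B \<Longrightarrow> q \<in> Q \<Longrightarrow> q' \<in> Q \<Longrightarrow> x \<in> W \<Longrightarrow> \<bar>m b q q' x\<bar> \<le> C"
      "\<And>b c i q x. b \<in> B \<Longrightarrow> c \<in> B \<Longrightarrow> i \<in> J \<Longrightarrow> q \<in> Q \<Longrightarrow> x \<in> W \<Longrightarrow> \<bar>S b c i q x\<bar> \<le> C"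
    and small: "(real (card J) + 1) * ((real (card Q) + 1) * (real (card B) * (r * C))) \<le> 1 / 8"
begin

definition parallel :: "(nat \<Rightarrow> 'h \<Rightarrow> real) \<Rightarrow> bool" where
  "parallel \<sigma> \<longleftrightarrow> (\<forall>i\<in>J. pd B W (\<sigma> i) (\<lambda>b x. \<Sum>j\<in>J. a b i j x * \<sigma> j x))"

lemma sum_abs_bound:
  fixes f g :: "'x \<Rightarrow> real"
  assumes "\<And>i. i \<in> I \<Longrightarrow> \<bar>f i\<bar> \<le> c" "\<And>i. i \<in> I \<Longrightarrow> \<bar>g i\<bar> \<le> d"
  shows "\<bar>\<Sum>i\<in>I. f i * g i\<bar> \<le> real (card I) * (c * d)"
proof -
  have "\<bar>\<Sum>i\<in>I. f i * g i\<bar> \<le> (\<Sum>i\<in>I. c * d)"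
    using assms by (intro order_trans[OF sum_abs] sum_mono) (auto simp: abs_mult intro!: mult_mono
      order_trans[OF abs_ge_zero assms(1)])
  then show ?thesis by simp
qed

lemma sum_abs_bound1:
  fixes f g :: "'x \<Rightarrow> real"
  assumes "\<And>i. i \<in> I \<Longrightarrow> \<bar>f i\<bar> \<le> c"
  shows "\<bar>\<Sum>i\<in>I. f i * g i\<bar> \<le> c * (\<Sum>i\<in>I. \<bar>g i\<bar>)"
  unfolding sum_distrib_left using assms
  by (intro order_trans[OF sum_abs] sum_mono) (auto simp: abs_mult intro!: mult_right_mono)

text \<open>Expanding the product in \<open>small\<close> gives nonnegative summands, each of which
  is therefore at most 1/8. These are the products that occur in the estimates.\<close>

lemma card_bounds:
  assumes "x \<in> W"
  shows "r \<ge> 0" "real (card B) * (r * C) \<ge> 0"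
    "real (card J) * (real (card B) * (r * C)) \<le> 1 / 8"
    "real (card Q) * (real (card B) * (r * C)) \<le> 1 / 8"
    "real (card Q) * (real (card J) * (real (card B) * (r * C))) \<le> 1 / 8"
    "real (card B) * (r * C) \<le> 1 / 8"
proof -
  show r0: "r \<ge> 0" using r[OF assms assms] by simp
  let ?t = "real (card B) * (r * C)"
  show t: "?t \<ge> 0" using r0 C(1) by simp
  have s: "real (card J) * (real (card Q) * ?t) + real (card J) * ?t + real (card Q) * ?t + ?t \<le> 1 / 8"
    using small by (simp add: algebra_simps)
  have "real (card J) * (real (card Q) * ?t) \<ge> 0" "real (card J) * ?t \<ge> 0" "real (card Q) * ?t \<ge> 0"
    using t by auto
  with s t show "real (card J) * ?t \<le> 1 / 8" "real (card Q) * ?t \<le> 1 / 8" "?t \<le> 1 / 8"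
    "real (card Q) * (real (card J) * ?t) \<le> 1 / 8" by (auto simp: mult.left_commute)
qed

lemma parallel_unique:
  assumes "parallel \<sigma>" "parallel \<sigma>'" "y \<in> W" "\<And>j. j \<in> J \<Longrightarrow> \<sigma> j y = \<sigma>' j y" "x \<in> W" "j \<in> J"
  shows "\<sigma> j x = \<sigma>' j x"
proof -
  \<comment> \<open>Gronwall's estimate for the difference, with error term 0. The difference is
    written with \<open>(-1) *\<close> to fit \<open>pd_add\<close> and
    \<open>pd_mult\<close>.\<close>
  have "(\<Sum>j\<in>J. \<bar>\<sigma> j x + (-1) * \<sigma>' j x\<bar>) \<le> 2 * (real (card J) * (real (card B) * (r * 0)))"
  proof (rule segment_gronwall[OF onb W(2) assms(3,5) r[OF _ assms(3)] fin(1), where c = C])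
    fix i assume i: "i \<in> J"
    have "pd B W (\<lambda>x. \<sigma> i x + (-1) * \<sigma>' i x)
        (\<lambda>b x. (\<Sum>j\<in>J. a b i j x * \<sigma> j x) + (0 * \<sigma>' i x + (-1) * (\<Sum>j\<in>J. a b i j x * \<sigma>' j x)))"
      using assms(1,2) i unfolding parallel_def by (intro pd_add pd_mult pd_const) auto
    then show "pd B W (\<lambda>x. \<sigma> i x + (-1) * \<sigma>' i x) (\<lambda>b x. (\<Sum>j\<in>J. a b i j x * (\<sigma> j x + (-1) * \<sigma>' j x)))"
      by (rule pd_cong) (simp add: algebra_simps sum_subtractf)
    show "\<sigma> i y + (-1) * \<sigma>' i y = 0" using assms(4) i by simp
  next
    fix b i z assume *: "b \<in> B" "i \<in> J" "z \<in> W"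
    show "\<bar>\<Sum>j\<in>J. a b i j z * (\<sigma> j z + (-1) * \<sigma>' j z)\<bar> \<le> C * (\<Sum>j\<in>J. \<bar>\<sigma> j z + (-1) * \<sigma>' j z\<bar>) + 0"
      using sum_abs_bound1[OF C(2)] * by simp
  qed (use C card_bounds(3)[OF assms(3)] in auto)
  then have "\<bar>\<sigma> j x + (-1) * \<sigma>' j x\<bar> \<le> 0"
    using member_le_sum[OF assms(6), of "\<lambda>j. \<bar>\<sigma> j x + (-1) * \<sigma>' j x\<bar>"] fin(1) by force
  then show ?thesis by simp
qed

text \<open>Picard iteration for the radial equation through \<open>y\<close>.\<close>

primrec picard :: "'h \<Rightarrow> (nat \<Rightarrow> real) \<Rightarrow> nat \<Rightarrow> nat \<Rightarrow> 'h \<Rightarrow> real" where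
  "picard y \<tau> 0 = (\<lambda>i x. \<tau> i)"
| "picard y \<tau> (Suc n) = (\<lambda>i x. \<tau> i + hop B y (\<lambda>b z. \<Sum>j\<in>J. a b i j z * picard y \<tau> n j z) x)"

lemma picard_at: "picard y \<tau> n i y = \<tau> i"
  by (cases n) auto

text \<open>The defect \<open>e\<close> of an approximate solution controls everything. The
  constraints obey a Gronwall inequality with an error proportional to \<open>e\<close>, hence stay
  below \<open>e\<close>. Then curvature and defect together bound the exterior derivative of the
  form \<open>a\<close> applied to \<open>\<sigma>\<close>, and the homotopy formula bounds by a
  fraction of \<open>e\<close> how far its integral is from a primitive.\<close>

lemma picard_step:
  assumes y: "y \<in> W"
    and ker: "\<And>q. q \<in> Q \<Longrightarrow> (\<Sum>j\<in>J. K q j y * \<sigma> j y) = 0"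
    and \<sigma>: "\<And>i. i \<in> J \<Longrightarrow> pd B W (\<sigma> i) (\<lambda>b. \<sigma>d b i)"
    and e: "\<And>b i x. b \<in> B \<Longrightarrow> i \<in> J \<Longrightarrow> x \<in> W \<Longrightarrow> \<bar>\<sigma>d b i x - (\<Sum>j\<in>J. a b i j x * \<sigma> j x)\<bar> \<le> e" "e \<ge> 0"
  shows "\<And>q x. q \<in> Q \<Longrightarrow> x \<in> W \<Longrightarrow> \<bar>\<Sum>j\<in>J. K q j x * \<sigma> j x\<bar> \<le> e"
    and "\<exists>hd. \<forall>i\<in>J. pd B W (hop B y (\<lambda>b z. \<Sum>j\<in>J. a b i j z * \<sigma> j z)) (\<lambda>b. hd b i) \<and>
          (\<forall>b\<in>B. \<forall>x\<in>W. \<bar>hd b i x - (\<Sum>j\<in>J. a b i j x * \<sigma> j x)\<bar> \<le> 3 / 8 * e)"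
proof -
  define \<epsilon> where "\<epsilon> b i x = \<sigma>d b i x - (\<Sum>j\<in>J. a b i j x * \<sigma> j x)" for b i x
  have \<epsilon>: "\<bar>\<epsilon> b i x\<bar> \<le> e" if "b \<in> B" "i \<in> J" "x \<in> W" for b i x using e(1) that by (simp add: \<epsilon>_def)
  have sd: "\<sigma>d b i x = \<epsilon> b i x + (\<Sum>j\<in>J. a b i j x * \<sigma> j x)" for b i x by (simp add: \<epsilon>_def)
  let ?\<kappa> = "\<lambda>q x. \<Sum>j\<in>J. K q j x * \<sigma> j x"
  define \<kappa>d where "\<kappa>d b q x = (\<Sum>j\<in>J. Kd b q j x * \<sigma> j x + K q j x * \<sigma>d b j x)" for b q x
  have \<kappa>: "pd B W (?\<kappa> q) (\<lambda>b. \<kappa>d b q)" if "q \<in> Q" for q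
    unfolding \<kappa>d_def using that \<sigma> K_pd by (intro pd_sum pd_mult) auto
  \<comment> \<open>By \<open>K_eq\<close> the terms with \<open>a\<close> cancel. For an exact
    solution the constraints would satisfy a homogeneous linear equation; the defect
    \<open>\<epsilon>\<close> is its only source.\<close>
  have \<kappa>d: "\<kappa>d b q x = (\<Sum>q'\<in>Q. m b q q' x * ?\<kappa> q' x) + (\<Sum>j\<in>J. K q j x * \<epsilon> b j x)"
    if "b \<in> B" "q \<in> Q" "x \<in> W" for b q x
  proof -
    have "(\<Sum>j\<in>J. K q j x * (\<Sum>k\<in>J. a b j k x * \<sigma> k x)) = (\<Sum>j\<in>J. (\<Sum>k\<in>J. K q k x * a b k j x) * \<sigma> j x)"
      unfolding sum_distrib_left sum_distrib_right by (subst sum.swap) (simp add: mult_ac)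
    moreover have "(\<Sum>j\<in>J. (\<Sum>q'\<in>Q. m b q q' x * K q' j x) * \<sigma> j x) = (\<Sum>q'\<in>Q. m b q q' x * ?\<kappa> q' x)"
      unfolding sum_distrib_left sum_distrib_right by (subst sum.swap) (simp add: mult_ac)
    ultimately show ?thesis
      unfolding \<kappa>d_def sd using that
      by (simp add: K_eq ring_distribs sum.distrib left_diff_distrib sum_subtractf)
  qed
  show kb: "\<bar>?\<kappa> q x\<bar> \<le> e" if q: "q \<in> Q" and x: "x \<in> W" for q x
  proof -
    have "(\<Sum>q\<in>Q. \<bar>?\<kappa> q x\<bar>) \<le> 2 * (real (card Q) * (real (card B) * (r * (real (card J) * (C * e)))))"
    proof (rule segment_gronwall[OF onb W(2) y x r[OF _ y] fin(2) \<kappa> ker, where c = C])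
      fix b q z assume *: "b \<in> B" "q \<in> Q" "z \<in> W"
      show "\<bar>\<kappa>d b q z\<bar> \<le> C * (\<Sum>q\<in>Q. \<bar>?\<kappa> q z\<bar>) + real (card J) * (C * e)"
        unfolding \<kappa>d[OF *]
        by (intro order_trans[OF abs_triangle_ineq] add_mono sum_abs_bound sum_abs_bound1) (use * C \<epsilon> in auto)
    qed (use C e card_bounds[OF y] in auto)
    also have "\<dots> = 2 * (real (card Q) * (real (card J) * (real (card B) * (r * C)))) * e" by (simp add: mult_ac)
    also have "\<dots> \<le> 1 * e" using card_bounds[OF y] e(2) by (intro mult_right_mono) auto
    finally show ?thesis
      using member_le_sum[OF q, of "\<lambda>q. \<bar>?\<kappa> q x\<bar>"] fin(2) by force
  qed
  have "\<forall>i\<in>J. \<exists>hd. pd B W (hop B y (\<lambda>b z. \<Sum>j\<in>J. a b i j z * \<sigma> j z)) hd \<and>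
          (\<forall>b\<in>B. \<forall>x\<in>W. \<bar>hd b x - (\<Sum>j\<in>J. a b i j x * \<sigma> j x)\<bar> \<le> 3 / 8 * e)" (is "\<forall>i\<in>J. ?P i")
  proof
    fix i assume i: "i \<in> J"
    define \<omega>d where "\<omega>d b c x = (\<Sum>j\<in>J. ad c b i j x * \<sigma> j x + a b i j x * \<sigma>d c j x)" for b c x
    have pdo: "pd B W (\<lambda>z. \<Sum>j\<in>J. a b i j z * \<sigma> j z) (\<omega>d b)" if "b \<in> B" for b
      unfolding \<omega>d_def using that i \<sigma> a_pd by (intro pd_sum pd_mult) auto
    \<comment> \<open>The exterior derivative is the curvature applied to \<open>\<sigma>\<close>,
      which \<open>curv\<close> turns into constraints already bounded by \<open>e\<close>, plus two
      terms with the defect.\<close>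
    have "\<bar>\<omega>d b c z - \<omega>d c b z\<bar> \<le> (real (card Q) + 2 * real (card J)) * (C * e)"
      if bc: "b \<in> B" "c \<in> B" and z: "z \<in> W" for b c z
    proof -
      have sw: "(\<Sum>j\<in>J. a b i j z * (\<Sum>k\<in>J. a c j k z * \<sigma> k z))
        = (\<Sum>j\<in>J. (\<Sum>k\<in>J. a b i k z * a c k j z) * \<sigma> j z)" for b c
        unfolding sum_distrib_left sum_distrib_right by (subst sum.swap) (simp add: mult_ac)
      have "\<omega>d b c z - \<omega>d c b z =
         (\<Sum>j\<in>J. (ad c b i j z - ad b c i j z + (\<Sum>k\<in>J. a b i k z * a c k j z - a c i k z * a b k j z)) * \<sigma> j z)
         + ((\<Sum>j\<in>J. a b i j z * \<epsilon> c j z) - (\<Sum>j\<in>J. a c i j z * \<epsilon> b j z))"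
        unfolding \<omega>d_def sd
        by (simp add: distrib_left sum.distrib sw left_diff_distrib distrib_right sum_subtractf)
      also have "(\<Sum>j\<in>J. (ad c b i j z - ad b c i j z + (\<Sum>k\<in>J. a b i k z * a c k j z - a c i k z * a b k j z)) * \<sigma> j z)
          = (\<Sum>j\<in>J. (\<Sum>q\<in>Q. S c b i q z * K q j z) * \<sigma> j z)"
        by (intro sum.cong) (auto simp only: curv[OF bc i _ z])
      also have "\<dots> = (\<Sum>q\<in>Q. S c b i q z * ?\<kappa> q z)"
        unfolding sum_distrib_left sum_distrib_right by (subst sum.swap) (simp add: mult_ac)
      finally have "\<bar>\<omega>d b c z - \<omega>d c b z\<bar> \<le> \<bar>\<Sum>q\<in>Q. S c b i q z * ?\<kappa> q z\<bar> +
          (\<bar>\<Sum>j\<in>J. a b i j z * \<epsilon> c j z\<bar> + \<bar>\<Sum>j\<in>J. a c i j z * \<epsilon> b j z\<bar>)" by linarith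
      also have "\<dots> \<le> real (card Q) * (C * e) + (real (card J) * (C * e) + real (card J) * (C * e))"
        by (intro add_mono sum_abs_bound) (use bc i z C kb \<epsilon> in auto)
      finally show ?thesis by (simp add: algebra_simps)
    qed
    with hop_deriv_bound[OF onb W y r[OF _ y], of "\<lambda>b z. \<Sum>j\<in>J. a b i j z * \<sigma> j z" \<omega>d
        "(real (card Q) + 2 * real (card J)) * (C * e)"] pdo
    obtain hd where hd: "pd B W (hop B y (\<lambda>b z. \<Sum>j\<in>J. a b i j z * \<sigma> j z)) hd"
      "\<And>c x. c \<in> B \<Longrightarrow> x \<in> W \<Longrightarrow> \<bar>hd c x - (\<Sum>j\<in>J. a c i j x * \<sigma> j x)\<bar> \<le>
         real (card B) * (r * ((real (card Q) + 2 * real (card J)) * (C * e)))" by blast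
    \<comment> \<open>Of the 3/8, one eighth comes from the constraints and two from the defect
      terms.\<close>
    have "real (card B) * (r * ((real (card Q) + 2 * real (card J)) * (C * e))) =
       (real (card Q) * (real (card B) * (r * C)) + 2 * (real (card J) * (real (card B) * (r * C)))) * e"
      by (simp add: algebra_simps)
    also have "\<dots> \<le> 3 / 8 * e" using card_bounds[OF y] e(2) by (intro mult_right_mono) auto
    finally show "?P i" using hd(1) order_trans[OF hd(2)] by blast
  qed
  from bchoice[OF this] obtain hd where "\<forall>i\<in>J. pd B W (hop B y (\<lambda>b z. \<Sum>j\<in>J. a b i j z * \<sigma> j z)) (hd i) \<and>
          (\<forall>b\<in>B. \<forall>x\<in>W. \<bar>hd i b x - (\<Sum>j\<in>J. a b i j x * \<sigma> j x)\<bar> \<le> 3 / 8 * e)" by blast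
  then show "\<exists>hd. \<forall>i\<in>J. pd B W (hop B y (\<lambda>b z. \<Sum>j\<in>J. a b i j z * \<sigma> j z)) (\<lambda>b. hd b i) \<and>
          (\<forall>b\<in>B. \<forall>x\<in>W. \<bar>hd b i x - (\<Sum>j\<in>J. a b i j x * \<sigma> j x)\<bar> \<le> 3 / 8 * e)"
    by (intro exI[of _ "\<lambda>b i. hd i b"]) simp
qed

text \<open>Along the Picard iteration started at the constant \<open>\<tau>\<close>, both the
  change from one iterate to the next and the defect in the differential equation decay like
  \<open>(1/2)^n\<close>. The first gives a limit, the second makes it parallel and, by
  \<open>picard_step\<close>, annihilated by the constraints.\<close>

lemma parallel_exists:
  assumes y: "y \<in> W" and ker: "\<And>q. q \<in> Q \<Longrightarrow> (\<Sum>j\<in>J. K q j y * \<tau> j) = 0"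
  obtains \<sigma> where "parallel \<sigma>" "\<And>j. j \<in> J \<Longrightarrow> \<sigma> j y = \<tau> j"
    "\<And>q x. q \<in> Q \<Longrightarrow> x \<in> W \<Longrightarrow> (\<Sum>j\<in>J. K q j x * \<sigma> j x) = 0"
proof -
  define T where "T = (\<Sum>j\<in>J. \<bar>\<tau> j\<bar>)"
  define l where "l = real (card J)"
  have T: "\<bar>\<tau> j\<bar> \<le> T" if "j \<in> J" for j
    unfolding T_def using member_le_sum[OF that, of "\<lambda>j. \<bar>\<tau> j\<bar>"] fin by auto
  have T0: "T \<ge> 0" by (auto simp: T_def sum_nonneg)
  \<comment> \<open>\<open>D\<close> bounds the first Picard step. \<open>E\<close> bounds the
    initial defect \<open>l * (C * T)\<close> and is large enough that the defect after one step,
    \<open>3 / 8 * E + l * (C * D)\<close>, is at most \<open>E / 2\<close>.\<close>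
  define D where "D = real (card B) * (r * (l * (C * T)))"
  define E where "E = 8 * (l * (C * D)) + l * (C * T)"
  have l0: "l \<ge> 0" by (simp add: l_def)
  have D0: "D \<ge> 0" using card_bounds[OF y] C T0 l0 by (auto simp: D_def)
  have E0: "E \<ge> 0" using D0 T0 C l0 by (auto simp: E_def)
  let ?p = "picard y \<tau>"
  have cont_a: "continuous_on W (a b i j)" if "b \<in> B" "i \<in> J" "j \<in> J" for b i j
    using pd_cont[OF a_pd] that by blast
  \<comment> \<open>The derivatives \<open>sd\<close> of the iterate belong to the induction
    statement because the defect is formulated with them.\<close>
  have I: "\<forall>n. \<exists>sd. \<forall>i\<in>J. pd B W (?p n i) (\<lambda>b. sd b i) \<and>
        (\<forall>b\<in>B. \<forall>x\<in>W. \<bar>sd b i x - (\<Sum>j\<in>J. a b i j x * ?p n j x)\<bar> \<le> E * (1/2)^n) \<and>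
        (\<forall>x\<in>W. \<bar>?p (Suc n) i x - ?p n i x\<bar> \<le> D * (1/2)^n)" (is "\<forall>n. \<exists>sd. ?P n sd")
  proof
    fix n show "\<exists>sd. ?P n sd"
  proof (induction n)
    case 0
    show ?case
    proof (intro exI[of _ "\<lambda>b i x. 0"] ballI conjI)
      fix i assume i: "i \<in> J"
      show "pd B W (?p 0 i) (\<lambda>b x. 0)" by (simp add: pd_const)
      fix x assume x: "x \<in> W"
      have "\<bar>hop B y (\<lambda>b z. \<Sum>j\<in>J. a b i j z * \<tau> j) x - hop B y (\<lambda>b z. 0) x\<bar> \<le> real (card B) * (r * (l * (C * T)))"
        unfolding l_def
        by (rule hop_diff_bound[OF onb W(2) y x r[OF x y]])
          (use i C T sum_abs_bound[of J _ C _ T] in \<open>auto intro!: continuous_intros cont_a\<close>)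
      then show "\<bar>?p (Suc 0) i x - ?p 0 i x\<bar> \<le> D * (1/2)^0"
        by (simp add: D_def hop_def)
      fix b assume b: "b \<in> B"
      have "\<bar>\<Sum>j\<in>J. a b i j x * \<tau> j\<bar> \<le> l * (C * T)"
        unfolding l_def by (rule sum_abs_bound) (use b i x C T in auto)
      then show "\<bar>0 - (\<Sum>j\<in>J. a b i j x * ?p 0 j x)\<bar> \<le> E * (1/2)^0"
        using D0 C l0 by (auto simp: E_def intro: order_trans)
    qed
  next
    case (Suc n)
    then obtain sd where sd: "\<And>i. i \<in> J \<Longrightarrow> pd B W (?p n i) (\<lambda>b. sd b i)"
      "\<And>b i x. b \<in> B \<Longrightarrow> i \<in> J \<Longrightarrow> x \<in> W \<Longrightarrow> \<bar>sd b i x - (\<Sum>j\<in>J. a b i j x * ?p n j x)\<bar> \<le> E * (1/2)^n"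
      and dn: "\<And>i x. i \<in> J \<Longrightarrow> x \<in> W \<Longrightarrow> \<bar>?p (Suc n) i x - ?p n i x\<bar> \<le> D * (1/2)^n" by blast
    have "\<exists>hd. \<forall>i\<in>J. pd B W (hop B y (\<lambda>b z. \<Sum>j\<in>J. a b i j z * ?p n j z)) (\<lambda>b. hd b i) \<and>
          (\<forall>b\<in>B. \<forall>x\<in>W. \<bar>hd b i x - (\<Sum>j\<in>J. a b i j x * ?p n j x)\<bar> \<le> 3 / 8 * (E * (1/2)^n))"
      by (rule picard_step(2)[OF y _ sd(1) sd(2)]) (use ker E0 in \<open>auto simp: picard_at\<close>)
    then obtain hd where hd: "\<And>i. i \<in> J \<Longrightarrow> pd B W (hop B y (\<lambda>b z. \<Sum>j\<in>J. a b i j z * ?p n j z)) (\<lambda>b. hd b i)"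
       "\<And>b i x. i \<in> J \<Longrightarrow> b \<in> B \<Longrightarrow> x \<in> W \<Longrightarrow> \<bar>hd b i x - (\<Sum>j\<in>J. a b i j x * ?p n j x)\<bar> \<le> 3 / 8 * (E * (1/2)^n)"
      by blast
    have pdS: "pd B W (?p (Suc n) i) (\<lambda>b. hd b i)" if "i \<in> J" for i
      using pd_add[OF pd_const hd(1)[OF that]] by simp
    have diff: "\<bar>(\<Sum>j\<in>J. a b i j z * ?p (Suc n) j z) - (\<Sum>j\<in>J. a b i j z * ?p n j z)\<bar> \<le> l * (C * (D * (1/2)^n))"
      if "b \<in> B" "i \<in> J" "z \<in> W" for b i z
      unfolding sum_subtractf[symmetric] right_diff_distrib[symmetric] l_def
      by (rule sum_abs_bound) (use that C dn in auto)
    show ?case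
    proof (intro exI[of _ hd] ballI conjI)
      fix i assume i: "i \<in> J"
      show "pd B W (?p (Suc n) i) (\<lambda>b. hd b i)" by (rule pdS[OF i])
      fix x assume x: "x \<in> W"
      have "\<bar>hop B y (\<lambda>b z. \<Sum>j\<in>J. a b i j z * ?p (Suc n) j z) x - hop B y (\<lambda>b z. \<Sum>j\<in>J. a b i j z * ?p n j z) x\<bar>
          \<le> real (card B) * (r * (l * (C * (D * (1/2)^n))))"
        by (rule hop_diff_bound[OF onb W(2) y x r[OF x y] _ _ diff])
          (use i in \<open>auto intro!: continuous_on_sum continuous_on_mult cont_a pd_cont[OF pdS] pd_cont[OF sd(1)] simp del: picard.simps\<close>)
      also have "\<dots> = (l * (real (card B) * (r * C))) * (D * (1/2)^n)" by (simp add: mult_ac)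
      also have "\<dots> \<le> 1/8 * (D * (1/2)^n)"
        using card_bounds[OF y] D0 unfolding l_def by (intro mult_right_mono) auto
      also have "\<dots> \<le> D * (1/2)^Suc n" using D0 by simp
      finally show "\<bar>?p (Suc (Suc n)) i x - ?p (Suc n) i x\<bar> \<le> D * (1/2)^Suc n"
        by (simp del: picard.simps(2) add: picard.simps(2)[of y \<tau> "Suc n"] picard.simps(2)[of y \<tau> n, THEN
          fun_cong, THEN fun_cong])
      fix b assume b: "b \<in> B"
      have "\<bar>hd b i x - (\<Sum>j\<in>J. a b i j x * ?p (Suc n) j x)\<bar> \<le> 3 / 8 * (E * (1/2)^n) + l * (C * (D * (1/2)^n))"
        using hd(2)[OF i b x] diff[OF b i x] by linarith
      also have "\<dots> = (3 / 8 * E + l * (C * D)) * (1/2)^n" by (simp add: algebra_simps)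
      also have "\<dots> \<le> (1 / 2 * E) * (1/2)^n"
        using C T0 l0 by (intro mult_right_mono) (auto simp: E_def)
      finally show "\<bar>hd b i x - (\<Sum>j\<in>J. a b i j x * ?p (Suc n) j x)\<bar> \<le> E * (1/2)^Suc n"
        by (simp add: mult_ac del: picard.simps)
    qed
  qed
  qed
  from choice[OF I] obtain sd where sd: "\<And>n i. i \<in> J \<Longrightarrow> pd B W (?p n i) (\<lambda>b. sd n b i)"
      "\<And>n b i x. b \<in> B \<Longrightarrow> i \<in> J \<Longrightarrow> x \<in> W \<Longrightarrow> \<bar>sd n b i x - (\<Sum>j\<in>J. a b i j x * ?p n j x)\<bar> \<le> E * (1/2)^n"
      and dn: "\<And>n i x. i \<in> J \<Longrightarrow> x \<in> W \<Longrightarrow> \<bar>?p (Suc n) i x - ?p n i x\<bar> \<le> D * (1/2)^n"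
    by blast
  define \<sigma> where "\<sigma> i x = lim (\<lambda>n. ?p n i x)" for i x
  have dist: "\<bar>?p (n + k) i x - ?p n i x\<bar> \<le> 2 * D * (1/2)^n * (1 - (1/2)^k)" if "i \<in> J" "x \<in> W" for n k i x
  proof (induction k)
    case (Suc k)
    have "\<bar>?p (n + Suc k) i x - ?p n i x\<bar> \<le> 2 * D * (1/2)^n * (1 - (1/2)^k) + D * (1/2)^(n+k)"
      using Suc dn[OF that, of "n + k"] by (simp del: picard.simps)
    also have "\<dots> = 2 * D * (1/2)^n * (1 - (1/2)^Suc k)" by (simp add: algebra_simps power_add)
    finally show ?case .
  qed auto
  have dist': "\<bar>?p k i x - ?p n i x\<bar> \<le> 2 * D * (1/2)^n" if "i \<in> J" "x \<in> W" "n \<le> k" for n k i x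
  proof -
    have "2 * D * (1/2)^n * (1 - (1/2)^(k-n)) \<le> 2 * D * (1/2)^n * 1"
      using D0 by (intro mult_left_mono) auto
    then show ?thesis using dist[OF that(1,2), of n "k - n"] that(3) by simp
  qed
  have half: "(\<lambda>n. c * (1/2)^n) \<longlonglongrightarrow> 0" for c :: real
    using tendsto_mult_right_zero[OF LIMSEQ_power_zero[of "1/2::real"]] by simp
  have lim: "(\<lambda>n. ?p n i x) \<longlonglongrightarrow> \<sigma> i x" if "i \<in> J" "x \<in> W" for i x
  proof -
    have "Cauchy (\<lambda>n. ?p n i x)"
    proof (rule CauchyI')
      fix e :: real assume "e > 0"
      then obtain N where N: "2 * D * (1/2)^N < e / 2"
        using eventually_happens[OF order_tendstoD(2)[OF half[of "2 * D"], of "e / 2"]] by auto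
      have "dist (?p n i x) (?p k i x) < e" if "n \<ge> N" "n < k" for n k
        using dist'[OF \<open>i \<in> J\<close> \<open>x \<in> W\<close>, of N n] dist'[OF \<open>i \<in> J\<close> \<open>x \<in> W\<close>, of N k] N that
          by (simp add: dist_real_def)
      then show "\<exists>M. \<forall>m\<ge>M. \<forall>n>m. dist (?p m i x) (?p n i x) < e" by blast
    qed
    then show ?thesis unfolding \<sigma>_def by (simp add: Cauchy_convergent_iff convergent_LIMSEQ_iff)
  qed
  have lim_dist: "\<bar>\<sigma> i x - ?p n i x\<bar> \<le> 2 * D * (1/2)^n" if "i \<in> J" "x \<in> W" for n i x
  proof (rule Lim_bounded)
    show "(\<lambda>k. \<bar>?p k i x - ?p n i x\<bar>) \<longlonglongrightarrow> \<bar>\<sigma> i x - ?p n i x\<bar>"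
      using lim[OF that] by (intro tendsto_intros)
  qed (use dist'[OF that] in auto)
  have deriv: "(\<sigma> i has_derivative (\<lambda>v. \<Sum>b\<in>B. (v \<bullet> b) * (\<Sum>j\<in>J. a b i j x * \<sigma> j x))) (at x)"
    if i: "i \<in> J" and x: "x \<in> W" for i x
  proof -
    let ?g' = "\<lambda>x v. \<Sum>b\<in>B. (v \<bullet> b) * (\<Sum>j\<in>J. a b i j x * \<sigma> j x)"
    \<comment> \<open>The derivatives of the iterates converge uniformly, as the defect and the
      distance to the limit both decay; so the limit may be differentiated termwise.\<close>
    have "\<exists>g. \<forall>x\<in>W. (\<lambda>n. ?p n i x) \<longlonglongrightarrow> g x \<and> (g has_derivative ?g' x) (at x within W)"
    proof (rule has_derivative_sequence[OF W(2), where f' = "\<lambda>n x v. \<Sum>b\<in>B. (v \<bullet> b) * sd n b i x"])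
      fix e :: real assume e: "e > 0"
      define c where "c = real (card B) * (E + l * (C * (2 * D)))"
      have "\<forall>\<^sub>F n in sequentially. c * (1/2)^n < e"
        using half[of c] e by (rule order_tendstoD(2))
      then show "\<forall>\<^sub>F n in sequentially. \<forall>x\<in>W. \<forall>h. norm ((\<Sum>b\<in>B. (h \<bullet> b) * sd n b i x) - ?g' x h) \<le> e * norm h"
      proof eventually_elim
        case (elim n)
        show ?case
        proof (intro ballI allI)
          fix z h assume z: "z \<in> W"
          have "\<bar>\<Sum>b\<in>B. (h \<bullet> b) * (sd n b i z - (\<Sum>j\<in>J. a b i j z * \<sigma> j z))\<bar> \<le>
              real (card B) * (norm h * (E * (1/2)^n + l * (C * (2 * D * (1/2)^n))))"
          proof (rule onb_sum_le[OF onb])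
            fix b assume b: "b \<in> B"
            have "\<bar>(\<Sum>j\<in>J. a b i j z * \<sigma> j z) - (\<Sum>j\<in>J. a b i j z * ?p n j z)\<bar> \<le> l * (C * (2 * D * (1/2)^n))"
              unfolding sum_subtractf[symmetric] right_diff_distrib[symmetric] l_def
              by (rule sum_abs_bound) (use b i z C lim_dist in auto)
            then show "\<bar>sd n b i z - (\<Sum>j\<in>J. a b i j z * \<sigma> j z)\<bar> \<le> E * (1/2)^n + l * (C * (2 * D * (1/2)^n))"
              using sd(2)[OF b i z, of n] by linarith
          qed
          also have "\<dots> = (c * (1/2)^n) * norm h" by (simp add: c_def algebra_simps)
          also have "\<dots> \<le> e * norm h" using elim by (intro mult_right_mono) auto
          finally show "norm ((\<Sum>b\<in>B. (h \<bullet> b) * sd n b i z) - ?g' z h) \<le> e * norm h"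
            by (simp add: right_diff_distrib sum_subtractf)
        qed
      qed
    qed (use y lim[OF i y] has_derivative_at_withinI[OF pd_deriv[OF sd(1)[OF i]]] in auto)
    then obtain g where g: "\<And>x. x \<in> W \<Longrightarrow> (\<lambda>n. ?p n i x) \<longlonglongrightarrow> g x"
      "\<And>x. x \<in> W \<Longrightarrow> (g has_derivative ?g' x) (at x within W)" by blast
    have "g z = \<sigma> i z" if "z \<in> W" for z using LIMSEQ_unique[OF g(1) lim[OF i]] that by blast
    moreover have "(g has_derivative ?g' x) (at x)"
      using g(2)[OF x] unfolding at_within_open[OF x W(1)] .
    ultimately show ?thesis
      using has_derivative_transform_within_open[OF _ W(1) x] by blast
  qed
  have "continuous_on W (\<sigma> i)" if "i \<in> J" for i
    using deriv[OF that] by (meson continuous_at_imp_continuous_on has_derivative_continuous)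
  then have "parallel \<sigma>"
    unfolding parallel_def pd_def using deriv cont_a by (auto intro!: continuous_intros)
  moreover have "\<sigma> j y = \<tau> j" if "j \<in> J" for j
    using LIMSEQ_unique[OF lim[OF that y]] by (simp add: picard_at)
  \<comment> \<open>The constraints of the n-th iterate are bounded by its defect, which tends to
    0.\<close>
  moreover have "(\<Sum>j\<in>J. K q j x * \<sigma> j x) = 0" if q: "q \<in> Q" and x: "x \<in> W" for q x
  proof (rule LIMSEQ_unique)
    show "(\<lambda>n. \<Sum>j\<in>J. K q j x * ?p n j x) \<longlonglongrightarrow> (\<Sum>j\<in>J. K q j x * \<sigma> j x)"
      using lim x by (intro tendsto_intros) auto
    have "\<bar>\<Sum>j\<in>J. K q j x * ?p n j x\<bar> \<le> E * (1/2)^n" for n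
      by (rule picard_step(1)[OF y _ sd(1,2) _ q x]) (use ker E0 in \<open>auto simp: picard_at\<close>)
    then show "(\<lambda>n. \<Sum>j\<in>J. K q j x * ?p n j x) \<longlonglongrightarrow> 0"
      by (intro Lim_null_comparison[OF _ half[of E]]) auto
  qed
  ultimately show thesis by (rule that)
qed

end

section \<open>Local systems over simply connected spaces\<close>

text \<open>A locally constant sheaf with stalks \<open>V\<close> and local sections
  \<open>Sol\<close>. By \<open>nice\<close> every point has arbitrarily small path-connected
  neighbourhoods on which each stalk element extends and a section is determined by one
  value.\<close>

locale local_system =
  fixes V :: "'z::topological_space \<Rightarrow> 'v set" and Sol :: "'z set \<Rightarrow> ('z \<Rightarrow> 'v) \<Rightarrow> bool"
  assumes Sol_subset: "\<And>N N' s. Sol N s \<Longrightarrow> N' \<subseteq> N \<Longrightarrow> open N' \<Longrightarrow> Sol N' s"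
    and Sol_val: "\<And>N s z. Sol N s \<Longrightarrow> z \<in> N \<Longrightarrow> s z \<in> V z"
    and nice: "\<And>U z. open U \<Longrightarrow> z \<in> U \<Longrightarrow> \<exists>N. open N \<and> z \<in> N \<and> N \<subseteq> U \<and> path_connected N \<and>
        (\<forall>y\<in>N. \<forall>v\<in>V y. \<exists>s. Sol N s \<and> s y = v) \<and>
        (\<forall>s s' y y'. Sol N s \<longrightarrow> Sol N s' \<longrightarrow> y \<in> N \<longrightarrow> y' \<in> N \<longrightarrow> s y = s' y \<longrightarrow> s y' = s' y')"
begin

text \<open>A section of the pull-back along \<open>H\<close>. The parameter space is arbitrary, so
  that one notion covers paths and homotopy squares.\<close>

definition flat :: "'p::topological_space set \<Rightarrow> ('p \<Rightarrow> 'z) \<Rightarrow> ('p \<Rightarrow> 'v) \<Rightarrow> bool" where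
  "flat T H l \<longleftrightarrow> (\<forall>t\<in>T. \<exists>N s U. open N \<and> Sol N s \<and> open U \<and> t \<in> U \<and>
     (\<forall>t'. t' \<in> U \<longrightarrow> t' \<in> T \<longrightarrow> H t' \<in> N \<and> l t' = s (H t')))"

definition liftable :: "'p::topological_space set \<Rightarrow> ('p \<Rightarrow> 'z) \<Rightarrow> bool" where
  "liftable T H \<longleftrightarrow> (\<forall>t\<in>T. \<forall>v\<in>V (H t). \<exists>l. flat T H l \<and> l t = v)"

lemma flatE:
  assumes "flat T H l" "t \<in> T"
  obtains N s U where "open N" "Sol N s" "open U" "t \<in> U"
    "\<forall>t'. t' \<in> U \<longrightarrow> t' \<in> T \<longrightarrow> H t' \<in> N \<and> l t' = s (H t')"
  using bspec[OF assms[unfolded flat_def]] by (elim exE conjE)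

lemma flatI:
  assumes "\<And>t. t \<in> T \<Longrightarrow> \<exists>N s U. open N \<and> Sol N s \<and> open U \<and> t \<in> U \<and>
    (\<forall>t'. t' \<in> U \<longrightarrow> t' \<in> T \<longrightarrow> H t' \<in> N \<and> l t' = s (H t'))"
  shows "flat T H l"
  unfolding flat_def by (rule ballI) (rule assms)

lemma flat_val:
  assumes "flat T H l" "t \<in> T" shows "l t \<in> V (H t)"
  using assms
proof (rule flatE)
  fix N s U assume "Sol N s" "t \<in> U" "\<forall>t'. t' \<in> U \<longrightarrow> t' \<in> T \<longrightarrow> H t' \<in> N \<and> l t' = s (H t')"
  then show ?thesis using Sol_val[of N s "H t"] assms(2) by simp
qed

lemma flat_compose:
  assumes "flat T H l" "continuous_on T' f" "f ` T' \<subseteq> T"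
  shows "flat T' (\<lambda>t. H (f t)) (\<lambda>t. l (f t))"
proof (rule flatI)
  fix t assume t: "t \<in> T'"
  then have ft: "f t \<in> T" using assms(3) by blast
  obtain N s U where *: "open N" "Sol N s" "open U" "f t \<in> U" "\<forall>t'. t' \<in> U \<longrightarrow> t' \<in> T \<longrightarrow> H t' \<in> N \<and>
    l t' = s (H t')"
    using flatE[OF assms(1) ft] .
  obtain U' where U': "open U'" "U' \<inter> T' = f -` U \<inter> T'"
    using assms(2) *(3) unfolding continuous_on_open_invariant by blast
  have "H (f t') \<in> N \<and> l (f t') = s (H (f t'))" if "t' \<in> U'" "t' \<in> T'" for t'
    using *(5)[rule_format, of "f t'"] U'(2) that assms(3) by blast
  moreover have "t \<in> U'" using U'(2) *(4) t by blast
  ultimately show "\<exists>N s U. open N \<and> Sol N s \<and> open U \<and> t \<in> U \<and>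
      (\<forall>t'. t' \<in> U \<longrightarrow> t' \<in> T' \<longrightarrow> H (f t') \<in> N \<and> l (f t') = s (H (f t')))"
    using *(1,2) U'(1) by blast
qed

lemma flat_cong:
  assumes "flat T H l" "\<And>t. t \<in> T \<Longrightarrow> H' t = H t \<and> l' t = l t" shows "flat T H' l'"
proof (rule flatI)
  fix t assume "t \<in> T"
  from flatE[OF assms(1) this]
  obtain N s U where *: "open N" "Sol N s" "open U" "t \<in> U" "\<forall>t'. t' \<in> U \<longrightarrow> t' \<in> T \<longrightarrow> H t' \<in> N \<and>
    l t' = s (H t')" .
  then show "\<exists>N s U. open N \<and> Sol N s \<and> open U \<and> t \<in> U \<and>
      (\<forall>t'. t' \<in> U \<longrightarrow> t' \<in> T \<longrightarrow> H' t' \<in> N \<and> l' t' = s (H' t'))"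
    by (intro exI[of _ N] exI[of _ s] exI[of _ U]) (simp add: assms(2))
qed

lemma flat_subset: "flat T H l \<Longrightarrow> T' \<subseteq> T \<Longrightarrow> flat T' H l"
  using flat_compose[of T H l T' "\<lambda>t. t"] by (simp add: continuous_on_id)

text \<open>On a nice neighbourhood a single point decides whether two sections agree. The
  equivalence propagates agreement as well as disagreement, so that agreement is locally constant
  along \<open>H\<close>.\<close>

lemma germ_agree:
  assumes H: "continuous_on T H" and t: "t \<in> T"
    and 1: "open N" "Sol N s" "H t \<in> N" and 2: "open N'" "Sol N' s'" "H t \<in> N'"
  obtains U where "open U" "t \<in> U"
    "\<forall>t'. t' \<in> U \<longrightarrow> t' \<in> T \<longrightarrow> (s (H t') = s' (H t')) = (s (H t) = s' (H t))"
proof -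
  obtain N0 where N0: "open N0" "H t \<in> N0" "N0 \<subseteq> N \<inter> N'"
    "\<And>s s' y y'. Sol N0 s \<Longrightarrow> Sol N0 s' \<Longrightarrow> y \<in> N0 \<Longrightarrow> y' \<in> N0 \<Longrightarrow> s y = s' y \<Longrightarrow> s y' = s' y'"
    using nice[of "N \<inter> N'" "H t"] 1 2 by (metis IntI open_Int)
  have s: "Sol N0 s" "Sol N0 s'" using Sol_subset N0(1,3) 1(2) 2(2) by blast+
  obtain U where U: "open U" "U \<inter> T = H -` N0 \<inter> T"
    using H N0(1) unfolding continuous_on_open_invariant by blast
  show thesis
  proof (rule that[OF U(1)])
    show "t \<in> U" using U(2) N0(2) t by blast
    show "\<forall>t'. t' \<in> U \<longrightarrow> t' \<in> T \<longrightarrow> (s (H t') = s' (H t')) = (s (H t) = s' (H t))"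
    proof (intro allI impI)
      fix t' assume "t' \<in> U" "t' \<in> T"
      then have "H t' \<in> N0" using U(2) by blast
      then show "(s (H t') = s' (H t')) = (s (H t) = s' (H t))"
        using N0(4)[OF s] N0(2) by blast
    qed
  qed
qed

lemma flat_unique:
  assumes "connected T" and H: "continuous_on T H" and l: "flat T H l" "flat T H l'"
    and t: "t0 \<in> T" "l t0 = l' t0" "t \<in> T"
  shows "l t = l' t"
proof -
  have "(l t0 = l' t0) = (l t = l' t)"
  proof (rule connected_local_const[OF assms(1) t(1,3)], rule ballI)
    fix a assume a: "a \<in> T"
    obtain N s U where 1: "open N" "Sol N s" "open U" "a \<in> U" "\<forall>t'. t' \<in> U \<longrightarrow> t' \<in> T \<longrightarrow> H t' \<in> N \<and>
      l t' = s (H t')"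
      using flatE[OF l(1) a] .
    obtain N' s' U' where 2: "open N'" "Sol N' s'" "open U'" "a \<in> U'" "\<forall>t'. t' \<in> U' \<longrightarrow> t' \<in> T \<longrightarrow> H t' \<in> N' \<and>
      l' t' = s' (H t')"
      using flatE[OF l(2) a] .
    have Ha: "H a \<in> N" "H a \<in> N'" using 1 2 a by auto
    from germ_agree[OF H a 1(1,2) Ha(1) 2(1,2) Ha(2)]
    obtain U0 where U0: "open U0" "a \<in> U0"
      "\<forall>t'. t' \<in> U0 \<longrightarrow> t' \<in> T \<longrightarrow> (s (H t') = s' (H t')) = (s (H a) = s' (H a))" .
    show "\<forall>\<^sub>F b in at a within T. (l a = l' a) = (l b = l' b)"
      unfolding eventually_at_topological
    proof (intro exI[of _ "U \<inter> U' \<inter> U0"] conjI ballI impI)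
      show "open (U \<inter> U' \<inter> U0)" by (intro open_Int 1 2 U0)
      show "a \<in> U \<inter> U' \<inter> U0" using 1 2 U0 by blast
      fix b assume b: "b \<in> U \<inter> U' \<inter> U0" "b \<in> T"
      have e: "l a = s (H a)" "l' a = s' (H a)" "l b = s (H b)" "l' b = s' (H b)"
        using 1(4,5) 2(4,5) a b by auto
      show "(l a = l' a) = (l b = l' b)"
        unfolding e using U0(3)[rule_format, of b] b by auto
    qed
  qed
  then show ?thesis using t(2) by simp
qed

text \<open>At a common point the two local sections have the same value and so coincide nearby; at
  any other point the closed piece that misses it is removed from the neighbourhood.\<close>

lemma flat_glue:
  assumes "closed T1" "closed T2" and H: "continuous_on (T1 \<union> T2) H"
    and l: "flat T1 H l1" "flat T2 H l2" "\<And>t. t \<in> T1 \<Longrightarrow> t \<in> T2 \<Longrightarrow> l1 t = l2 t"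
  shows "flat (T1 \<union> T2) H (\<lambda>t. if t \<in> T1 then l1 t else l2 t)"
proof (rule flatI)
  fix t assume t: "t \<in> T1 \<union> T2"
  let ?l = "\<lambda>t. if t \<in> T1 then l1 t else l2 t"
  let ?G = "\<exists>N s U. open N \<and> Sol N s \<and> open U \<and> t \<in> U \<and>
    (\<forall>t'. t' \<in> U \<longrightarrow> t' \<in> T1 \<union> T2 \<longrightarrow> H t' \<in> N \<and> ?l t' = s (H t'))"
  consider "t \<in> T1" "t \<notin> T2" | "t \<in> T2" "t \<notin> T1" | "t \<in> T1" "t \<in> T2" using t by blast
  then show ?G
  proof cases
    case 1
    obtain N s U where "open N" "Sol N s" "open U" "t \<in> U" "\<forall>t'. t' \<in> U \<longrightarrow> t' \<in> T1 \<longrightarrow> H t' \<in> N \<and> l1 t' = s (H t')"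
      using flatE[OF l(1) 1(1)] .
    then show ?G
      by (intro exI[of _ N] exI[of _ s] exI[of _ "U \<inter> - T2"]) (use 1 assms(2) in
        \<open>auto simp: open_Int open_Compl\<close>)
  next
    case 2
    obtain N s U where "open N" "Sol N s" "open U" "t \<in> U" "\<forall>t'. t' \<in> U \<longrightarrow> t' \<in> T2 \<longrightarrow> H t' \<in> N \<and> l2 t' = s (H t')"
      using flatE[OF l(2) 2(1)] .
    then show ?G
      by (intro exI[of _ N] exI[of _ s] exI[of _ "U \<inter> - T1"]) (use 2 assms(1) in
        \<open>auto simp: open_Int open_Compl\<close>)
  next
    case 3
    obtain N s U where a: "open N" "Sol N s" "open U" "t \<in> U" "\<forall>t'. t' \<in> U \<longrightarrow> t' \<in> T1 \<longrightarrow> H t' \<in> N \<and>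
      l1 t' = s (H t')"
      using flatE[OF l(1) 3(1)] .
    obtain N' s' U' where b: "open N'" "Sol N' s'" "open U'" "t \<in> U'" "\<forall>t'. t' \<in> U' \<longrightarrow> t' \<in> T2 \<longrightarrow> H t' \<in> N' \<and>
      l2 t' = s' (H t')"
      using flatE[OF l(2) 3(2)] .
    have N: "H t \<in> N" "H t \<in> N'" using a b 3 by auto
    obtain U0 where U0: "open U0" "t \<in> U0"
      "\<forall>t'. t' \<in> U0 \<longrightarrow> t' \<in> T1 \<union> T2 \<longrightarrow> (s (H t') = s' (H t')) = (s (H t) = s' (H t))"
      using germ_agree[OF H t a(1,2) N(1) b(1,2) N(2)] .
    obtain U1 where U1: "open U1" "U1 \<inter> (T1 \<union> T2) = H -` N \<inter> (T1 \<union> T2)"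
      using H a(1) unfolding continuous_on_open_invariant by blast
    have "s (H t) = s' (H t)" using a(5)[rule_format, OF a(4) 3(1)] b(5)[rule_format, OF b(4) 3(2)] l(3)[OF
      3] by simp
    then have U0': "s (H t') = s' (H t')" if "t' \<in> U0" "t' \<in> T1 \<union> T2" for t' using U0(3) that by blast
    show ?G
    proof (intro exI[of _ N] exI[of _ s] exI[of _ "U \<inter> U' \<inter> U0 \<inter> U1"] conjI allI impI)
      fix t' assume t': "t' \<in> U \<inter> U' \<inter> U0 \<inter> U1" "t' \<in> T1 \<union> T2"
      show "H t' \<in> N" using t' U1 by blast
      show "?l t' = s (H t')" using t' a(5)[rule_format, of t'] b(5)[rule_format, of t'] U0'[of t'] by auto
    next
      have "t \<in> U1" using U1(2) N(1) t by blast
      then show "t \<in> U \<inter> U' \<inter> U0 \<inter> U1" using a b U0 by blast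
    qed (use a b U0 U1 in \<open>auto simp: open_Int\<close>)
  qed
qed

text \<open>The second lift is started at a point of the overlap with the value of the first;
  connectedness of the overlap makes the lifts agree on all of it.\<close>

lemma liftable_glue:
  assumes T: "closed T1" "closed T2" and H: "continuous_on (T1 \<union> T2) H"
    and c: "connected (T1 \<inter> T2)" "T1 \<inter> T2 \<noteq> {}" and l: "liftable T1 H" "liftable T2 H"
  shows "liftable (T1 \<union> T2) H"
  unfolding liftable_def
proof (intro ballI)
  \<comment> \<open>Stated for fresh \<open>T1\<close> and \<open>T2\<close>, so that it can be used
    a second time with the roles exchanged.\<close>
  have *: "\<exists>l. flat (T1 \<union> T2) H l \<and> l t = v"
    if T: "closed T1" "closed T2" and H: "continuous_on (T1 \<union> T2) H"
      and c: "connected (T1 \<inter> T2)" "T1 \<inter> T2 \<noteq> {}" and l: "liftable T1 H" "liftable T2 H"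
      and t: "t \<in> T1" "v \<in> V (H t)" for t v and T1 T2
  proof -
    obtain l1 where l1: "flat T1 H l1" "l1 t = v" using l(1) t unfolding liftable_def by blast
    obtain a where a: "a \<in> T1" "a \<in> T2" using c(2) by blast
    obtain l2 where l2: "flat T2 H l2" "l2 a = l1 a"
      using l(2) flat_val[OF l1(1) a(1)] a unfolding liftable_def by blast
    have "l1 t = l2 t" if "t \<in> T1" "t \<in> T2" for t
      by (rule flat_unique[OF c(1), of H l1 l2 a])
        (use that a l2(2) l1(1) l2(1) in \<open>auto intro: flat_subset continuous_on_subset[OF H]\<close>)
    then show ?thesis using flat_glue[OF T H l1(1) l2(1)] l1(2) t(1) by auto
  qed
  fix t v assume "t \<in> T1 \<union> T2" "v \<in> V (H t)"
  then show "\<exists>l. flat (T1 \<union> T2) H l \<and> l t = v"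
  proof (cases "t \<in> T1")
    case True
    then show ?thesis using *[OF T H c l] \<open>v \<in> _\<close> by blast
  next
    case False
    then have "t \<in> T2" using \<open>t \<in> _\<close> by blast
    have "\<exists>l. flat (T2 \<union> T1) H l \<and> l t = v"
      by (rule *) (use T H c l \<open>v \<in> _\<close> \<open>t \<in> T2\<close> in \<open>simp_all add: Un_commute Int_commute\<close>)
    then show ?thesis by (simp only: Un_commute)
  qed
qed

lemma liftable_nice:
  assumes "open N" "\<forall>y\<in>N. \<forall>v\<in>V y. \<exists>s. Sol N s \<and> s y = v" "H ` T \<subseteq> N"
  shows "liftable T H"
  unfolding liftable_def
proof (intro ballI)
  fix t v assume t: "t \<in> T" "v \<in> V (H t)"
  then obtain s where "Sol N s" "s (H t) = v" using assms by blast
  moreover have "flat T H (\<lambda>t. s (H t))"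
    by (intro flatI exI[of _ N] exI[of _ s] exI[of _ UNIV]) (use assms calculation in auto)
  ultimately show "\<exists>l. flat T H l \<and> l t = v" by blast
qed

text \<open>Subdivision in two stages by the bisection principle \<open>Bolzano\<close>: first the
  second coordinate, which gives thin strips, then the first. Adjacent rectangles meet in a segment,
  which is connected as \<open>liftable_glue\<close> demands.\<close>

lemma liftable_square:
  assumes H: "continuous_on ({0..1} \<times> {0..1}) (H :: real \<times> real \<Rightarrow> 'z)"
  shows "liftable ({0..1} \<times> {0..1}) H"
proof -
  have loc: "\<exists>d>0. \<forall>a b a' b'. 0 \<le> a \<longrightarrow> a \<le> s \<longrightarrow> s \<le> b \<longrightarrow> b \<le> 1 \<longrightarrow> b - a < d \<longrightarrow>
      0 \<le> a' \<longrightarrow> a' \<le> t \<longrightarrow> t \<le> b' \<longrightarrow> b' \<le> 1 \<longrightarrow> b' - a' < d \<longrightarrow> liftable ({a..b} \<times> {a'..b'}) H"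
    if st: "s \<in> {0..1}" "t \<in> {0..1}" for s t
  proof -
    obtain N where N: "open N" "H (s, t) \<in> N" "\<forall>y\<in>N. \<forall>v\<in>V y. \<exists>s. Sol N s \<and> s y = v"
      using nice[of UNIV "H (s, t)"] by auto
    obtain U where U: "open U" "U \<inter> ({0..1} \<times> {0..1}) = H -` N \<inter> ({0..1} \<times> {0..1})"
      using H N(1) unfolding continuous_on_open_invariant by blast
    then have "(s, t) \<in> U" using N(2) st by blast
    then obtain A A' where A: "open A" "open A'" "(s, t) \<in> A \<times> A'" "A \<times> A' \<subseteq> U"
      using open_prod_elim[OF U(1)] by metis
    then have sA: "s \<in> A" "t \<in> A'" by auto
    obtain d where d1: "d > 0" "ball s d \<subseteq> A" using openE[OF A(1) sA(1)] .
    obtain d' where d2: "d' > 0" "ball t d' \<subseteq> A'" using openE[OF A(2) sA(2)] .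
    note d = d1 d2
    show ?thesis
    proof (intro exI[of _ "min d d'"] conjI allI impI)
      fix a b a' b' assume *: "0 \<le> a" "a \<le> s" "s \<le> b" "b \<le> 1" "b - a < min d d'"
        "0 \<le> a'" "a' \<le> t" "t \<le> b'" "b' \<le> 1" "b' - a' < min d d'"
      have "{a..b} \<subseteq> ball s d" "{a'..b'} \<subseteq> ball t d'" using * by (auto simp: dist_real_def)
      then have "{a..b} \<times> {a'..b'} \<subseteq> U" using A(4) d by blast
      moreover have "{a..b} \<times> {a'..b'} \<subseteq> {0..1} \<times> {0..1}" using * by auto
      ultimately have "H ` ({a..b} \<times> {a'..b'}) \<subseteq> N" using U(2) by blast
      then show "liftable ({a..b} \<times> {a'..b'}) H" using liftable_nice N by blast
    qed (use d in auto)
  qed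
  have strip: "\<exists>d>0. \<forall>a b. 0 \<le> a \<longrightarrow> a \<le> s \<longrightarrow> s \<le> b \<longrightarrow> b \<le> 1 \<longrightarrow> b - a < d \<longrightarrow> liftable ({a..b} \<times> {0..1}) H"
    if s: "s \<in> {0..1}" for s
  proof -
    \<comment> \<open>The admissible width of the strip is part of the property, since it may shrink
      whenever two rectangles are joined.\<close>
    define P where "P a' b' \<longleftrightarrow> (0 \<le> a' \<longrightarrow> b' \<le> 1 \<longrightarrow> a' \<le> b' \<longrightarrow>
      (\<exists>d>0. \<forall>a b. 0 \<le> a \<longrightarrow> a \<le> s \<longrightarrow> s \<le> b \<longrightarrow> b \<le> 1 \<longrightarrow> b - a < d \<longrightarrow> liftable ({a..b} \<times> {a'..b'}) H))" for a' b'
    have "P 0 1"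
    proof (rule Bolzano)
      fix a' b' c' assume trans: "P a' b'" "P b' c'" "a' \<le> b'" "b' \<le> c'"
      show "P a' c'" unfolding P_def
      proof (intro impI)
        assume *: "0 \<le> a'" "c' \<le> 1" "a' \<le> c'"
        obtain d where d: "d > 0" "\<And>a b. 0 \<le> a \<Longrightarrow> a \<le> s \<Longrightarrow> s \<le> b \<Longrightarrow> b \<le> 1 \<Longrightarrow> b - a < d \<Longrightarrow>
          liftable ({a..b} \<times> {a'..b'}) H"
          using trans * unfolding P_def by auto
        obtain d' where d': "d' > 0" "\<And>a b. 0 \<le> a \<Longrightarrow> a \<le> s \<Longrightarrow> s \<le> b \<Longrightarrow> b \<le> 1 \<Longrightarrow> b - a < d' \<Longrightarrow>
          liftable ({a..b} \<times> {b'..c'}) H"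
          using trans * unfolding P_def by auto
        show "\<exists>d>0. \<forall>a b. 0 \<le> a \<longrightarrow> a \<le> s \<longrightarrow> s \<le> b \<longrightarrow> b \<le> 1 \<longrightarrow> b - a < d \<longrightarrow> liftable ({a..b} \<times> {a'..c'}) H"
        proof (intro exI[of _ "min d d'"] conjI allI impI)
          fix a b assume ab: "0 \<le> a" "a \<le> s" "s \<le> b" "b \<le> 1" "b - a < min d d'"
          have e: "{a..b} \<times> {a'..b'} \<union> {a..b} \<times> {b'..c'} = {a..b} \<times> {a'..c'}"
            "{a..b} \<times> {a'..b'} \<inter> {a..b} \<times> {b'..c'} = {a..b} \<times> {b'}"
            using trans by auto
          have "liftable ({a..b} \<times> {a'..b'} \<union> {a..b} \<times> {b'..c'}) H"
          proof (rule liftable_glue)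
            show "continuous_on ({a..b} \<times> {a'..b'} \<union> {a..b} \<times> {b'..c'}) H"
              unfolding e using * ab by (intro continuous_on_subset[OF H]) auto
            show "connected ({a..b} \<times> {a'..b'} \<inter> {a..b} \<times> {b'..c'})"
              unfolding e by (intro connected_Times) auto
          qed (use e ab d d' in \<open>auto intro: closed_Times\<close>)
          then show "liftable ({a..b} \<times> {a'..c'}) H" unfolding e .
        qed (use d d' in auto)
      qed
    next
      fix t :: real assume "0 \<le> t" "t \<le> 1"
      then obtain d where d: "d > 0" "\<And>a b a' b'. 0 \<le> a \<Longrightarrow> a \<le> s \<Longrightarrow> s \<le> b \<Longrightarrow> b \<le> 1 \<Longrightarrow> b - a < d \<Longrightarrow>
        0 \<le> a' \<Longrightarrow> a' \<le> t \<Longrightarrow> t \<le> b' \<Longrightarrow> b' \<le> 1 \<Longrightarrow> b' - a' < d \<Longrightarrow> liftable ({a..b} \<times> {a'..b'}) H"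
        using loc[OF s, of t] by auto
      show "\<exists>d>0. \<forall>a b. a \<le> t \<and> t \<le> b \<and> b - a < d \<longrightarrow> P a b"
        by (rule exI[of _ d]) (use d in \<open>auto simp: P_def intro!: exI[of _ d]\<close>)
    qed auto
    then show ?thesis unfolding P_def by simp
  qed
  define P where "P a b \<longleftrightarrow> (0 \<le> a \<longrightarrow> b \<le> 1 \<longrightarrow> a \<le> b \<longrightarrow> liftable ({a..b} \<times> {0..1}) H)" for a b
  have "P 0 1"
  proof (rule Bolzano)
    fix a b c assume trans: "P a b" "P b c" "a \<le> b" "b \<le> c"
    show "P a c" unfolding P_def
    proof (intro impI)
      assume *: "0 \<le> a" "c \<le> 1" "a \<le> c"
      have e: "{a..b} \<times> {0..1::real} \<union> {b..c} \<times> {0..1} = {a..c} \<times> {0..1}"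
            "{a..b} \<times> {0..1::real} \<inter> {b..c} \<times> {0..1} = {b} \<times> {0..1}"
        using trans by auto
      have "liftable ({a..b} \<times> {0..1} \<union> {b..c} \<times> {0..1}) H"
      proof (rule liftable_glue)
        show "continuous_on ({a..b} \<times> {0..1} \<union> {b..c} \<times> {0..1}) H"
          unfolding e using * by (intro continuous_on_subset[OF H]) auto
        show "connected ({a..b} \<times> {0..1::real} \<inter> {b..c} \<times> {0..1})"
          unfolding e by (intro connected_Times) auto
        show "{a..b} \<times> {0..1::real} \<inter> {b..c} \<times> {0..1} \<noteq> {}" unfolding e by auto
      qed (use * trans in \<open>auto intro: closed_Times simp: P_def\<close>)
      then show "liftable ({a..c} \<times> {0..1}) H" unfolding e .
    qed
  next
    fix s :: real assume "0 \<le> s" "s \<le> 1"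
    then show "\<exists>d>0. \<forall>a b. a \<le> s \<and> s \<le> b \<and> b - a < d \<longrightarrow> P a b"
      using strip[of s] by (fastforce simp: P_def)
  qed auto
  then show ?thesis unfolding P_def by simp
qed

section \<open>Transport along paths and monodromy\<close>

definition transport :: "(real \<Rightarrow> 'z) \<Rightarrow> 'v \<Rightarrow> 'v \<Rightarrow> bool" where
  "transport g v w \<longleftrightarrow> (\<exists>l. flat {0..1} g l \<and> l 0 = v \<and> l 1 = w)"

lemma transport_exists:
  assumes "path g" "v \<in> V (pathstart g)"
  obtains w where "transport g v w"
proof -
  \<comment> \<open>The path is viewed as a square that is constant in the first coordinate.\<close>
  let ?H = "\<lambda>p::real \<times> real. g (snd p)"
  have "continuous_on ({0..1} \<times> {0..1}) ?H"
    using assms(1) unfolding path_def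
    by (rule continuous_on_compose2[OF _ continuous_on_snd[OF continuous_on_id]]) auto
  from liftable_square[OF this] obtain l where l: "flat ({0..1} \<times> {0..1}) ?H l" "l (0, 0) = v"
    using assms(2) unfolding liftable_def pathstart_def by force
  have "flat {0..1} (\<lambda>t. ?H (0, t)) (\<lambda>t. l (0, t))"
    by (rule flat_compose[OF l(1)]) (auto intro!: continuous_intros)
  then show thesis using that[of "l (0, 1)"] l(2) unfolding transport_def by auto
qed

lemma transport_val: "transport g v w \<Longrightarrow> v \<in> V (pathstart g) \<and> w \<in> V (pathfinish g)"
  unfolding transport_def pathstart_def pathfinish_def using flat_val by fastforce

lemma transport_rev:
  assumes "transport g v w" shows "transport (reversepath g) w v"
proof -
  obtain l where l: "flat {0..1} g l" "l 0 = v" "l 1 = w" using assms unfolding transport_def by blast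
  have "flat {0..1::real} (\<lambda>t. g (1 - t)) (\<lambda>t. l (1 - t))"
    by (rule flat_compose[OF l(1)]) (auto intro!: continuous_intros)
  then show ?thesis using l unfolding transport_def reversepath_def by (intro exI[of _ "\<lambda>t. l (1 - t)"]) auto
qed

lemma transport_join:
  assumes g: "path g" "path g'" "pathfinish g = pathstart g'" and t: "transport g u v" "transport g' v w"
  shows "transport (g +++ g') u w"
proof -
  obtain l where l: "flat {0..1} g l" "l 0 = u" "l 1 = v" using t(1) unfolding transport_def by blast
  obtain l' where l': "flat {0..1} g' l'" "l' 0 = v" "l' 1 = w" using t(2) unfolding transport_def by blast
  have 1: "flat {0..1/2::real} (\<lambda>t. g (2 * t)) (\<lambda>t. l (2 * t))"
    by (rule flat_compose[OF l(1)]) (auto intro!: continuous_intros)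
  have 1: "flat {0..1/2} (g +++ g') (\<lambda>t. l (2 * t))"
    by (rule flat_cong[OF 1]) (auto simp: joinpaths_def)
  have 2: "flat {1/2..1::real} (\<lambda>t. g' (2 * t - 1)) (\<lambda>t. l' (2 * t - 1))"
    by (rule flat_compose[OF l'(1)]) (auto intro!: continuous_intros)
  have 2: "flat {1/2..1} (g +++ g') (\<lambda>t. l' (2 * t - 1))"
  proof (rule flat_cong[OF 2])
    fix t :: real assume t: "t \<in> {1/2..1}"
    show "(g +++ g') t = g' (2 * t - 1) \<and> l' (2 * t - 1) = l' (2 * t - 1)"
    proof (cases "t = 1/2")
      case True
      then show ?thesis using g(3) unfolding True by (simp add: joinpaths_def pathstart_def pathfinish_def)
    qed (use t in \<open>auto simp: joinpaths_def\<close>)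
  qed
  have e: "{0..1/2} \<union> {1/2..1} = {0..1::real}" by auto
  have "path (g +++ g')" using g by simp
  then have "flat ({0..1/2} \<union> {1/2..1}) (g +++ g') (\<lambda>t. if t \<in> {0..1/2} then l (2 * t) else l' (2 * t - 1))"
    by (intro flat_glue 1 2) (use l l' in \<open>auto simp: e path_def mult.commute\<close>)
  then show ?thesis
    unfolding e transport_def using l l' by force
qed

text \<open>Monodromy: lift a free homotopy from the loop to a constant loop. Over the constant loop
  the lift is constant. The tracks of the two endpoints coincide, because every stage is a loop, so
  uniqueness run backwards along this track gives equal ends over the original loop.\<close>

lemma transport_loop:
  assumes sc: "simply_connected (UNIV :: 'z set)" and g: "path g" "pathfinish g = pathstart g"
    and t: "transport g v w"
  shows "w = v"
proof -
  obtain l where l: "flat {0..1} g l" "l 0 = v" "l 1 = w" using t unfolding transport_def by blast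
  have "homotopic_loops UNIV g (linepath' g)" if "linepath' = (\<lambda>g::real \<Rightarrow> 'z. \<lambda>t::real. pathstart g)"
    for linepath'
    using sc g unfolding simply_connected_def that
    by (auto simp: path_def pathstart_def pathfinish_def)
  then have "homotopic_loops UNIV g (\<lambda>t. pathstart g)" by blast
  then obtain H :: "real \<times> real \<Rightarrow> 'z" where H: "continuous_on ({0..1} \<times> {0..1}) H"
    "\<And>x. x \<in> {0..1} \<Longrightarrow> H (0, x) = g x" "\<And>x. x \<in> {0..1} \<Longrightarrow> H (1, x) = pathstart g"
    "\<And>t. t \<in> {0..1} \<Longrightarrow> pathfinish (H \<circ> Pair t) = pathstart (H \<circ> Pair t)"
    unfolding homotopic_loops by metis
  have "v \<in> V (H (0, 0))" using transport_val[OF t] H(2)[of 0] by (simp add: pathstart_def)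
  then obtain k where k: "flat ({0..1} \<times> {0..1}) H k" "k (0, 0) = v"
    using liftable_square[OF H(1)] unfolding liftable_def by force
  have Hc: "continuous_on {0..1} (\<lambda>t. H (f t))" if "continuous_on {0..1} f" "f ` {0..1} \<subseteq> {0..1} \<times> {0..1}"
    for f :: "real \<Rightarrow> _"
    using continuous_on_compose2[OF H(1) that] .
  have kf: "flat {0..1} (\<lambda>t. H (f t)) (\<lambda>t. k (f t))" if "continuous_on {0..1} f"
    "f ` {0..1} \<subseteq> {0..1} \<times> {0..1}" for f :: "real \<Rightarrow> _"
    using flat_compose[OF k(1) that] .
  have cn: "connected {0..1::real}" by simp
  have k0: "k (0, 1) = l 1"
  proof (rule flat_unique[OF cn, of g "\<lambda>t. k (0, t)" l 0 1])
    have "flat {0..1} (\<lambda>t. H (0, t)) (\<lambda>t. k (0, t))" by (rule kf) (auto intro!: continuous_intros)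
    then show "flat {0..1} g (\<lambda>t. k (0, t))" by (rule flat_cong) (use H in auto)
  qed (use g l k in \<open>auto simp: path_def\<close>)
  have k1: "k (1, 1) = k (1, 0)"
  proof (rule flat_unique[OF cn, of "\<lambda>t. pathstart g" "\<lambda>t. k (1, t)" "\<lambda>t. k (1, 0)" 0 1])
    have "flat {0..1} (\<lambda>t. H (1, t)) (\<lambda>t. k (1, t))" by (rule kf) (auto intro!: continuous_intros)
    then show "flat {0..1} (\<lambda>t. pathstart g) (\<lambda>t. k (1, t))" by (rule flat_cong) (use H in auto)
    have "flat {0..1} (\<lambda>t. H (1, 0)) (\<lambda>t::real. k (1, 0))" by (rule kf) auto
    then show "flat {0..1} (\<lambda>t. pathstart g) (\<lambda>t::real. k (1, 0))" by (rule flat_cong) (use H in auto)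
  qed auto
  have "k (0, 0) = k (0, 1)"
  proof (rule flat_unique[OF cn, of "\<lambda>t. H (t, 0)" "\<lambda>t. k (t, 0)" "\<lambda>t. k (t, 1)" 1 0])
    show "flat {0..1} (\<lambda>t. H (t, 0)) (\<lambda>t. k (t, 0))" by (rule kf) (auto intro!: continuous_intros)
    have "flat {0..1} (\<lambda>t. H (t, 1)) (\<lambda>t. k (t, 1))" by (rule kf) (auto intro!: continuous_intros)
    then show "flat {0..1} (\<lambda>t. H (t, 0)) (\<lambda>t. k (t, 1))"
      by (rule flat_cong) (use H(4) in \<open>auto simp: pathfinish_def pathstart_def\<close>)
    show "continuous_on {0..1} (\<lambda>t. H (t, 0))" by (rule Hc) (auto intro!: continuous_intros)
  qed (use k1 in auto)
  then show ?thesis using k0 k l by simp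
qed

text \<open>The value at \<open>z\<close> is transported from \<open>z0\<close>. Independence of the
  path is \<open>transport_loop\<close>, applied to one path back followed by another path
  forth.\<close>

theorem global_section:
  assumes sc: "simply_connected (UNIV :: 'z set)" and v0: "v0 \<in> V z0"
  obtains \<mu> where "\<mu> z0 = v0" "\<And>z. \<exists>N s. open N \<and> z \<in> N \<and> Sol N s \<and> (\<forall>y\<in>N. \<mu> y = s y)"
proof -
  define R where "R z w \<longleftrightarrow> (\<exists>g. path g \<and> pathstart g = z0 \<and> pathfinish g = z \<and> transport g v0 w)" for z w
  have uniq: "w = w'" if R1: "R z w" and R2: "R z w'" for z w w'
  proof -
    obtain g where g: "path g" "pathstart g = z0" "pathfinish g = z" "transport g v0 w"
      using R1 unfolding R_def by (elim exE conjE)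
    obtain g' where g': "path g'" "pathstart g' = z0" "pathfinish g' = z" "transport g' v0 w'"
      using R2 unfolding R_def by (elim exE conjE)
    have "transport (reversepath g' +++ g) w' w"
      by (rule transport_join[OF _ g(1) _ transport_rev[OF g'(4)] g(4)]) (use g g' in auto)
    then show ?thesis
      by (intro transport_loop[OF sc, of "reversepath g' +++ g"]) (use g g' in auto)
  qed
  have ex: "\<exists>w. R z w" for z
  proof -
    \<comment> \<open>Any two constant loops are homotopic, and the track of one parameter under
      this homotopy is a path from \<open>z0\<close> to \<open>z\<close>.\<close>
    have "homotopic_loops UNIV (\<lambda>t::real. z0) (\<lambda>t. z)"
      using sc unfolding simply_connected_def by (auto simp: path_def pathstart_def pathfinish_def)
    then obtain H :: "real \<times> real \<Rightarrow> 'z" where H: "continuous_on ({0..1} \<times> {0..1}) H"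
      "\<And>x. x \<in> {0..1} \<Longrightarrow> H (0, x) = z0" "\<And>x. x \<in> {0..1} \<Longrightarrow> H (1, x) = z"
      unfolding homotopic_loops by metis
    define g where "g t = H (t, 0)" for t
    have "path g"
      unfolding path_def g_def by (rule continuous_on_compose2[OF H(1)]) (auto intro!: continuous_intros)
    then have g: "path g" "pathstart g = z0" "pathfinish g = z"
      using H(2,3) by (auto simp: g_def pathstart_def pathfinish_def)
    then show ?thesis using transport_exists[OF g(1)] v0 unfolding R_def by metis
  qed
  define \<mu> where "\<mu> z = (SOME w. R z w)" for z
  have \<mu>: "R z (\<mu> z)" for z unfolding \<mu>_def using ex by (rule someI_ex)
  have "\<exists>N s. open N \<and> z \<in> N \<and> Sol N s \<and> (\<forall>y\<in>N. \<mu> y = s y)" for z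
  proof -
    obtain g where g: "path g" "pathstart g = z0" "pathfinish g = z" "transport g v0 (\<mu> z)"
      using \<mu>[of z] unfolding R_def by blast
    then have "\<mu> z \<in> V z" using transport_val by blast
    then obtain N s where N: "open N" "z \<in> N" "path_connected N" "Sol N s" "s z = \<mu> z"
      using nice[of UNIV z] by (metis UNIV_I open_UNIV)
    \<comment> \<open>Within \<open>N\<close> transport is evaluation of \<open>s\<close>, so
      prolonging the path to \<open>z\<close> by a path inside \<open>N\<close> produces the value
      \<open>s y\<close>.\<close>
    have "\<mu> y = s y" if y: "y \<in> N" for y
    proof -
      obtain h where h: "path h" "path_image h \<subseteq> N" "pathstart h = z" "pathfinish h = y"
        using N(2,3) y unfolding path_connected_def by blast
      have "flat {0..1} h (\<lambda>t. s (h t))"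
        by (intro flatI exI[of _ N] exI[of _ s] exI[of _ UNIV]) (use N h in \<open>auto simp: path_image_def\<close>)
      then have "transport h (\<mu> z) (s y)"
        unfolding transport_def using h N(5) by (intro exI[of _ "\<lambda>t. s (h t)"]) (auto simp: pathstart_def
          pathfinish_def)
      then have "transport (g +++ h) v0 (s y)" by (intro transport_join[OF g(1) h(1) _ g(4)]) (use g h in auto)
      then have "R y (s y)" unfolding R_def by (intro exI[of _ "g +++ h"]) (use g h in auto)
      then show ?thesis using uniq \<mu> by blast
    qed
    then show ?thesis using N by blast
  qed
  moreover have "R z0 v0"
  proof -
    let ?h = "\<lambda>t::real. z0"
    obtain N s where N: "open N" "z0 \<in> N" "Sol N s" "s z0 = v0"
      using nice[of UNIV z0] v0 by (metis UNIV_I open_UNIV)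
    then have "flat {0..1::real} ?h (\<lambda>t. v0)"
      by (intro flatI exI[of _ N] exI[of _ s] exI[of _ UNIV]) auto
    then have "transport ?h v0 v0" unfolding transport_def by blast
    then show ?thesis unfolding R_def by (intro exI[of _ ?h]) (auto simp: path_def pathstart_def pathfinish_def)
  qed
  then have "\<mu> z0 = v0" using uniq \<mu> by blast
  ultimately show thesis using that by blast
qed

end

section \<open>Functions and vector fields on manifolds\<close>

locale mfd =
  fixes M :: "('m::{t2_space,second_countable_topology}, 'h::real_inner) atlas"
  assumes mfd: "smooth_manifold M"
begin

definition bas :: "'h set" where "bas = (SOME B. onb B)"

lemma onb_bas: "onb bas"
  using mfd onb_exists unfolding smooth_manifold_def bas_def by (metis someI_ex)

lemma finite_bas: "finite bas"
  using onb_bas by (simp add: onb_def)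

lemma chart:
  assumes "(U, \<phi>) \<in> M"
  shows "open U" "open (\<phi> ` U)" "homeomorphism U (\<phi> ` U) \<phi> (inv_into U \<phi>)"
  using mfd assms unfolding smooth_manifold_def by blast+

lemma chart_inv: "(U, \<phi>) \<in> M \<Longrightarrow> x \<in> U \<Longrightarrow> inv_into U \<phi> (\<phi> x) = x"
  by (rule homeomorphism_apply1[OF chart(3)])

lemma chart_exists: obtains U \<phi> where "(U, \<phi>) \<in> M" "x \<in> U"
proof -
  have "x \<in> (\<Union>(U, \<phi>)\<in>M. U)" using mfd unfolding smooth_manifold_def by simp
  then show thesis using that by blast
qed

lemma transition:
  "(U, \<phi>) \<in> M \<Longrightarrow> (V, \<psi>) \<in> M \<Longrightarrow> smooth_on (\<phi> ` (U \<inter> V)) (\<psi> \<circ> inv_into U \<phi>)"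
  using mfd unfolding smooth_manifold_def by blast

lemma chart_cont: "(U, \<phi>) \<in> M \<Longrightarrow> continuous_on U \<phi>"
  using chart(3) homeomorphism_cont1 by blast

lemma chart_open_image:
  assumes "(U, \<phi>) \<in> M" "open W" shows "open (\<phi> ` (U \<inter> W))"
proof -
  have "openin (top_of_set (\<phi> ` U)) (\<phi> ` (U \<inter> W))"
    using homeomorphism_imp_open_map[OF chart(3)[OF assms(1)]] assms(2) by blast
  then show ?thesis using chart(2)[OF assms(1)] openin_open_trans by blast
qed

lemma chart_open_vimage:
  assumes "(U, \<phi>) \<in> M" "open T" shows "open (U \<inter> \<phi> -` T)"
  using continuous_open_preimage[OF chart_cont chart(1) assms(2)] assms(1) by blast

lemma smooth_fun_on_smooth:
  "smooth_fun_on M W f \<Longrightarrow> (U, \<phi>) \<in> M \<Longrightarrow> smooth_on (\<phi> ` (U \<inter> W)) (f \<circ> inv_into U \<phi>)"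
  unfolding smooth_fun_on_def by blast

lemma smooth_fun_onI:
  "(\<And>U \<phi>. (U, \<phi>) \<in> M \<Longrightarrow> smooth_on (\<phi> ` (U \<inter> W)) (f \<circ> inv_into U \<phi>)) \<Longrightarrow> smooth_fun_on M W f"
  unfolding smooth_fun_on_def by blast

lemma smooth_fun_on_subset: "smooth_fun_on M W f \<Longrightarrow> W' \<subseteq> W \<Longrightarrow> smooth_fun_on M W' f"
  unfolding smooth_fun_on_def by (force elim!: smooth_on_subset)

lemma smooth_fun_on_cong:
  assumes "open W" "\<And>x. x \<in> W \<Longrightarrow> f x = g x" "smooth_fun_on M W f" shows "smooth_fun_on M W g"
proof (rule smooth_fun_onI)
  fix U \<phi> assume c: "(U, \<phi>) \<in> M"
  have "smooth_on (\<phi> ` (U \<inter> W)) (f \<circ> inv_into U \<phi>) \<longleftrightarrow> smooth_on (\<phi> ` (U \<inter> W)) (g \<circ> inv_into U \<phi>)"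
    by (rule smooth_on_cong[OF chart_open_image[OF c assms(1)]]) (use assms(2) chart_inv[OF c] in auto)
  then show "smooth_on (\<phi> ` (U \<inter> W)) (g \<circ> inv_into U \<phi>)" using smooth_fun_on_smooth[OF assms(3) c] by simp
qed

lemma smooth_fun_on_local:
  assumes "\<And>x. x \<in> W \<Longrightarrow> \<exists>T. open T \<and> x \<in> T \<and> smooth_fun_on M T f"
  shows "smooth_fun_on M W f"
proof (rule smooth_fun_onI, rule smooth_on_local)
  fix U \<phi> u assume c: "(U, \<phi>) \<in> M" and "u \<in> \<phi> ` (U \<inter> W)"
  then obtain x where x: "x \<in> U" "x \<in> W" "u = \<phi> x" by blast
  obtain T where "open T" "x \<in> T" "smooth_fun_on M T f" using assms x(2) by blast
  then show "\<exists>T. open T \<and> u \<in> T \<and> smooth_on T (f \<circ> inv_into U \<phi>)"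
    using chart_open_image[OF c] smooth_fun_on_smooth c x by (intro exI[of _ "\<phi> ` (U \<inter> T)"]) auto
qed

text \<open>Smoothness is defined by all charts of the atlas; the transition maps reduce it to a
  single chart around \<open>W\<close>.\<close>

lemma smooth_fun_on_chart:
  assumes c: "(U, \<phi>) \<in> M" and W: "open W" "W \<subseteq> U" and f: "smooth_on (\<phi> ` W) (f \<circ> inv_into U \<phi>)"
  shows "smooth_fun_on M W f"
proof (rule smooth_fun_onI)
  fix V \<psi> assume d: "(V, \<psi>) \<in> M"
  have eq: "inv_into U \<phi> (\<phi> (inv_into V \<psi> u)) = inv_into V \<psi> u" if "u \<in> \<psi> ` (V \<inter> W)" for u
    using that chart_inv[OF d] chart_inv[OF c] W by auto
  have W': "\<phi> ` W = \<phi> ` (U \<inter> W)" using W by (simp add: Int_absorb1)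
  have "smooth_on (\<psi> ` (V \<inter> W)) (\<lambda>u. (f \<circ> inv_into U \<phi>) ((\<phi> \<circ> inv_into V \<psi>) u))"
  proof (rule smooth_on_compose[OF onb_bas chart_open_image[OF d W(1)] _ _ f])
    show "open (\<phi> ` W)" unfolding W' by (rule chart_open_image[OF c W(1)])
    show "(\<phi> \<circ> inv_into V \<psi>) ` \<psi> ` (V \<inter> W) \<subseteq> \<phi> ` W" using chart_inv[OF d] by auto
    show "smooth_on (\<psi> ` (V \<inter> W)) (\<phi> \<circ> inv_into V \<psi>)"
      by (rule smooth_on_subset[OF transition[OF d c]]) (use W in auto)
  qed
  then show "smooth_on (\<psi> ` (V \<inter> W)) (f \<circ> inv_into V \<psi>)"
    using smooth_on_cong[OF chart_open_image[OF d W(1)], of "\<lambda>u. (f \<circ> inv_into U \<phi>) ((\<phi> \<circ> inv_into V \<psi>) u)"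
        "f \<circ> inv_into V \<psi>"] eq by simp
qed

lemma smooth_fun_on_const: "smooth_fun_on M W (\<lambda>x. c)"
  by (rule smooth_fun_onI) (simp add: smooth_on_const comp_def)

lemma smooth_fun_on_add:
  assumes "open W" "smooth_fun_on M W f" "smooth_fun_on M W g" shows "smooth_fun_on M W (\<lambda>x. f x + g x)"
proof (rule smooth_fun_onI)
  fix U \<phi> assume c: "(U, \<phi>) \<in> M"
  show "smooth_on (\<phi> ` (U \<inter> W)) ((\<lambda>x. f x + g x) \<circ> inv_into U \<phi>)"
    using smooth_on_add[OF chart_open_image[OF c assms(1)] smooth_fun_on_smooth[OF assms(2) c]
      smooth_fun_on_smooth[OF assms(3) c]]
    by (simp add: comp_def)
qed

lemma smooth_fun_on_mult:
  assumes "open W" "smooth_fun_on M W f" "smooth_fun_on M W g" shows "smooth_fun_on M W (\<lambda>x. f x * g x)"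
proof (rule smooth_fun_onI)
  fix U \<phi> assume c: "(U, \<phi>) \<in> M"
  show "smooth_on (\<phi> ` (U \<inter> W)) ((\<lambda>x. f x * g x) \<circ> inv_into U \<phi>)"
    using smooth_on_bilinear[OF chart_open_image[OF c assms(1)] bounded_bilinear_mult
      smooth_fun_on_smooth[OF assms(2) c] smooth_fun_on_smooth[OF assms(3) c]]
    by (simp add: comp_def)
qed

lemma smooth_fun_on_sum:
  "open W \<Longrightarrow> (\<And>i. i \<in> I \<Longrightarrow> smooth_fun_on M W (f i)) \<Longrightarrow> smooth_fun_on M W (\<lambda>x. \<Sum>i\<in>I. f i x)"
  by (induction I rule: infinite_finite_induct) (auto simp: smooth_fun_on_const smooth_fun_on_add)

lemma smooth_fun_on_prod:
  "open W \<Longrightarrow> (\<And>i. i \<in> I \<Longrightarrow> smooth_fun_on M W (f i)) \<Longrightarrow> smooth_fun_on M W (\<lambda>x. \<Prod>i\<in>I. f i x)"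
  by (induction I rule: infinite_finite_induct) (auto simp: smooth_fun_on_const smooth_fun_on_mult)

lemma smooth_fun_on_inverse:
  assumes "open W" "smooth_fun_on M W f" "\<And>x. x \<in> W \<Longrightarrow> f x \<noteq> 0" shows "smooth_fun_on M W (\<lambda>x. inverse (f x))"
proof (rule smooth_fun_onI)
  fix U \<phi> assume c: "(U, \<phi>) \<in> M"
  have "smooth_on (\<phi> ` (U \<inter> W)) (\<lambda>x. inverse ((f \<circ> inv_into U \<phi>) x))"
    by (rule smooth_on_inverse[OF chart_open_image[OF c assms(1)] _ smooth_fun_on_smooth[OF assms(2) c]])
      (use assms(3) chart_inv[OF c] in auto)
  then show "smooth_on (\<phi> ` (U \<inter> W)) ((\<lambda>x. inverse (f x)) \<circ> inv_into U \<phi>)" by (simp add: comp_def)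
qed

lemma smooth_fun_on_diff:
  assumes "open W" "smooth_fun_on M W f" "smooth_fun_on M W g" shows "smooth_fun_on M W (\<lambda>x. f x - g x)"
  using smooth_fun_on_add[OF assms(1,2) smooth_fun_on_mult[OF assms(1) smooth_fun_on_const[of W "-1"]
    assms(3)]] by simp

lemma smooth_fun_on_cont:
  assumes "open W" "smooth_fun_on M W f" shows "continuous_on W f"
proof (rule continuous_at_imp_continuous_on, rule ballI)
  fix x assume x: "x \<in> W"
  obtain U \<phi> where c: "(U, \<phi>) \<in> M" "x \<in> U" by (rule chart_exists)
  have "continuous_on (U \<inter> W) (\<lambda>y. (f \<circ> inv_into U \<phi>) (\<phi> y))"
    by (rule continuous_on_compose2[OF smooth_on_continuous[OF smooth_fun_on_smooth[OF assms(2) c(1)]]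
          continuous_on_subset[OF chart_cont[OF c(1)]]]) auto
  then have "continuous_on (U \<inter> W) f"
    by (rule continuous_on_eq) (use chart_inv[OF c(1)] in auto)
  then show "isCont f x"
    using x c chart(1)[OF c(1)] assms(1) by (auto simp: continuous_on_eq_continuous_at open_Int)
qed

section \<open>Bump functions and partitions of unity\<close>

lemma Cinf_on: "f \<in> Cinf M \<Longrightarrow> smooth_fun_on M W f"
  unfolding Cinf_def using smooth_fun_on_subset by blast

lemma CinfI: "smooth_fun_on M UNIV f \<Longrightarrow> f \<in> Cinf M"
  by (simp add: Cinf_def)

lemma Cinf_const: "(\<lambda>x. c) \<in> Cinf M"
  by (intro CinfI smooth_fun_on_const)

lemma Cinf_add: "f \<in> Cinf M \<Longrightarrow> g \<in> Cinf M \<Longrightarrow> (\<lambda>x. f x + g x) \<in> Cinf M"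
  by (rule CinfI, intro smooth_fun_on_add Cinf_on) auto

lemma Cinf_mult: "f \<in> Cinf M \<Longrightarrow> g \<in> Cinf M \<Longrightarrow> (\<lambda>x. f x * g x) \<in> Cinf M"
  by (rule CinfI, intro smooth_fun_on_mult Cinf_on) auto

text \<open>A coordinate box is a Minkowski sum of segments. It serves as a compact neighbourhood in
  the model space, in place of a closed ball.\<close>

lemma compact_box:
  fixes B :: "'a::real_normed_vector set"
  shows "finite B \<Longrightarrow> compact {\<Sum>b\<in>B. c b *\<^sub>R b |c. \<forall>b\<in>B. \<bar>c b\<bar> \<le> (r::real)}"
proof (induction B rule: finite_induct)
  case (insert a B)
  have "{\<Sum>b\<in>insert a B. c b *\<^sub>R b |c. \<forall>b\<in>insert a B. \<bar>c b\<bar> \<le> r} =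
    {x + y |x y. x \<in> (\<lambda>t. t *\<^sub>R a) ` {-r..r} \<and> y \<in> {\<Sum>b\<in>B. c b *\<^sub>R b |c. \<forall>b\<in>B. \<bar>c b\<bar> \<le> r}}" (is "?L = ?R")
  proof
    show "?L \<subseteq> ?R"
    proof clarify
      fix c assume *: "\<forall>b\<in>insert a B. \<bar>c b\<bar> \<le> r"
      show "\<exists>x y. (\<Sum>b\<in>insert a B. c b *\<^sub>R b) = x + y \<and> x \<in> (\<lambda>t. t *\<^sub>R a) ` {-r..r} \<and>
          y \<in> {\<Sum>b\<in>B. c b *\<^sub>R b |c. \<forall>b\<in>B. \<bar>c b\<bar> \<le> r}"
        by (rule exI[of _ "c a *\<^sub>R a"], rule exI[of _ "\<Sum>b\<in>B. c b *\<^sub>R b"]) (use insert * in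
          \<open>auto simp: abs_le_iff\<close>)
    qed
    show "?R \<subseteq> ?L"
    proof clarify
      fix t c assume *: "t \<in> {-r..r}" "\<forall>b\<in>B. \<bar>c b\<bar> \<le> r"
      have "t *\<^sub>R a + (\<Sum>b\<in>B. c b *\<^sub>R b) = (\<Sum>b\<in>insert a B. (c(a := t)) b *\<^sub>R b)"
        using insert by (simp cong: sum.cong) (intro sum.cong, auto)
      then show "\<exists>c'. t *\<^sub>R a + (\<Sum>b\<in>B. c b *\<^sub>R b) = (\<Sum>b\<in>insert a B. c' b *\<^sub>R b) \<and> (\<forall>b\<in>insert a B. \<bar>c' b\<bar> \<le> r)"
        using * by (intro exI[of _ "c(a := t)"]) (auto simp: abs_le_iff)
    qed
  qed
  moreover have "compact ((\<lambda>t. t *\<^sub>R a) ` {-r..r})"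
    by (intro compact_continuous_image continuous_intros) auto
  note compact_sums[OF this insert.IH]
  ultimately show ?case by (simp only:)
qed auto

text \<open>\<open>C\<close> is closed in the whole manifold and contained in \<open>N\<close>, so a
  function or section on \<open>N\<close> extends by 0 after multiplication with
  \<open>\<beta>\<close>; on \<open>N'\<close> the multiplication changes nothing.\<close>

lemma bump:
  assumes "open N" "y \<in> N"
  obtains \<beta> N' C where "\<beta> \<in> Cinf M" "open N'" "y \<in> N'" "N' \<subseteq> N" "\<And>x. x \<in> N' \<Longrightarrow> \<beta> x = 1"
    "closed C" "C \<subseteq> N" "\<And>x. x \<notin> C \<Longrightarrow> \<beta> x = 0"
proof -
  obtain U \<phi> where c: "(U, \<phi>) \<in> M" "y \<in> U" by (rule chart_exists)
  have "open (\<phi> ` (U \<inter> N))" "\<phi> y \<in> \<phi> ` (U \<inter> N)" using chart_open_image[OF c(1) assms(1)] c assms by auto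
  then obtain e where e: "e > 0" "ball (\<phi> y) e \<subseteq> \<phi> ` (U \<inter> N)" by (meson openE)
  \<comment> \<open>The norm is at most the sum of the absolute coordinates, so a box of this
    half-width lies in the ball of radius \<open>e\<close>.\<close>
  define d where "d = e / (2 * (real (card bas) + 1))"
  have d: "d > 0" using e by (auto simp: d_def intro!: divide_pos_pos)
  define K where "K = {u. \<forall>b\<in>bas. \<bar>(u - \<phi> y) \<bullet> b\<bar> \<le> d}"
  have Kball: "K \<subseteq> \<phi> ` (U \<inter> N)"
  proof
    fix u assume u: "u \<in> K"
    have "norm (u - \<phi> y) = norm (\<Sum>b\<in>bas. ((u - \<phi> y) \<bullet> b) *\<^sub>R b)" by (simp add: onb_expand[OF onb_bas])
    also have "\<dots> \<le> (\<Sum>b\<in>bas. d)"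
      using u onb_bas by (intro sum_norm_le) (auto simp: K_def onb_def)
    also have "\<dots> < e"
    proof -
      have "real (card bas) * e < 2 * (real (card bas) + 1) * e" using e(1)
        by (intro mult_strict_right_mono) auto
      then show ?thesis by (simp add: d_def field_simps)
    qed
    finally show "u \<in> \<phi> ` (U \<inter> N)" using e(2) by (auto simp: dist_norm norm_minus_commute)
  qed
  have "compact K"
  proof -
    have "K = (\<lambda>v. \<phi> y + v) ` {\<Sum>b\<in>bas. c b *\<^sub>R b |c. \<forall>b\<in>bas. \<bar>c b\<bar> \<le> d}" (is "_ = _ ` ?A")
    proof
      show "K \<subseteq> (\<lambda>v. \<phi> y + v) ` ?A"
      proof
        fix u assume "u \<in> K"
        then have "(\<Sum>b\<in>bas. ((u - \<phi> y) \<bullet> b) *\<^sub>R b) \<in> ?A" by (auto simp: K_def)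
        then show "u \<in> (\<lambda>v. \<phi> y + v) ` ?A"
          unfolding onb_expand[OF onb_bas] by (rule rev_image_eqI) simp
      qed
      show "(\<lambda>v. \<phi> y + v) ` ?A \<subseteq> K"
      proof clarify
        fix c :: "'h \<Rightarrow> real" assume c: "\<forall>b\<in>bas. \<bar>c b\<bar> \<le> d"
        have "(\<Sum>b\<in>bas. c b *\<^sub>R b) \<bullet> a = c a" if "a \<in> bas" for a
        proof -
          have "(\<Sum>b\<in>bas. c b *\<^sub>R b) \<bullet> a = (\<Sum>b\<in>bas. if b = a then c b else 0)"
            unfolding inner_sum_left by (intro sum.cong) (auto simp: onb_inner[OF onb_bas] that)
          then show ?thesis using that finite_bas by simp
        qed
        then show "\<phi> y + (\<Sum>b\<in>bas. c b *\<^sub>R b) \<in> K" using c by (auto simp: K_def)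
      qed
    qed
    moreover have "compact ((\<lambda>v. \<phi> y + v) ` ?A)" by (intro compact_continuous_image continuous_intros
      compact_box finite_bas)
    ultimately show ?thesis by simp
  qed
  have inv: "continuous_on (\<phi> ` U) (inv_into U \<phi>)"
    using chart(3)[OF c(1)] homeomorphism_cont2 by blast
  define C where "C = inv_into U \<phi> ` K"
  have "compact C" unfolding C_def
    by (rule compact_continuous_image[OF continuous_on_subset[OF inv] \<open>compact K\<close>]) (use Kball in auto)
  \<comment> \<open>The Hausdorff property enters here: \<open>C\<close> must be closed in the whole
    manifold and not only in the chart domain.\<close>
  then have C: "closed C" by (rule compact_imp_closed)
  have C_sub: "C \<subseteq> U \<inter> N" using Kball chart_inv[OF c(1)] by (fastforce simp: C_def)
  have C_iff: "x \<in> C \<longleftrightarrow> \<phi> x \<in> K" if x: "x \<in> U" for x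
  proof
    show "\<phi> x \<in> K \<Longrightarrow> x \<in> C" using chart_inv[OF c(1) x] by (auto simp: C_def rev_image_eqI)
    assume "x \<in> C"
    then obtain u where u: "u \<in> K" "x = inv_into U \<phi> u" by (auto simp: C_def)
    then obtain x' where "x' \<in> U" "u = \<phi> x'" using Kball by blast
    then show "\<phi> x \<in> K" using u chart_inv[OF c(1)] by simp
  qed
  \<comment> \<open>One factor for each coordinate and sign: by the scaling \<open>2 / d\<close> it
    is 1 up to \<open>d / 2\<close> and 0 from \<open>d\<close> on.\<close>
  define h where "h u = (\<Prod>b\<in>bas. cutoff (2 / d * ((u - \<phi> y) \<bullet> b)) * cutoff (- (2 / d) * ((u - \<phi> y) \<bullet> b)))" for u
  define \<beta> where "\<beta> x = (if x \<in> U then h (\<phi> x) else 0)" for x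
  have h0: "h u = 0" if u: "u \<notin> K" for u
  proof -
    obtain b where b: "b \<in> bas" "\<bar>(u - \<phi> y) \<bullet> b\<bar> > d" using u by (auto simp: K_def not_le)
    have "2 / d * t \<ge> 2 \<or> - (2 / d) * t \<ge> 2" if "\<bar>t\<bar> > d" for t
      using that d by (simp add: field_simps) linarith
    note this[OF b(2)]
    then have "cutoff (2 / d * ((u - \<phi> y) \<bullet> b)) * cutoff (- (2 / d) * ((u - \<phi> y) \<bullet> b)) = 0"
      using cutoff_eq_0 by auto
    then show ?thesis unfolding h_def using b(1) finite_bas by (intro prod_zero) auto
  qed
  have \<beta>0: "\<beta> x = 0" if "x \<notin> C" for x using that C_iff h0 by (auto simp: \<beta>_def)
  have sm_h: "smooth_on UNIV h"
  proof -
    have s: "smooth_on UNIV (\<lambda>u. cutoff (a * ((u - \<phi> y) \<bullet> b)))" for a b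
    proof (rule smooth_on_compose[OF onb_real open_UNIV open_UNIV, where f = cutoff])
      show "smooth_on UNIV cutoff" by (simp add: smooth_on_def Ck_on_cutoff)
      have "smooth_on UNIV (\<lambda>u::'h. u \<bullet> b)"
        unfolding smooth_on_def
        by (intro allI Ck_on_bounded_linear[OF open_UNIV bounded_linear_inner_left] Ck_on_ident) auto
      then have "smooth_on UNIV (\<lambda>u. a * (u \<bullet> b + - (\<phi> y \<bullet> b)))"
        by (intro smooth_on_bilinear[OF _ bounded_bilinear_mult] smooth_on_add smooth_on_const) auto
      then show "smooth_on UNIV (\<lambda>u. a * ((u - \<phi> y) \<bullet> b))" by (simp add: inner_diff_left)
    qed auto
    have "smooth_on UNIV (\<lambda>u. \<Prod>b\<in>I. cutoff (2 / d * ((u - \<phi> y) \<bullet> b)) * cutoff (- (2 / d) * ((u - \<phi> y) \<bullet> b)))"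
      for I :: "'h set"
    proof (induction I rule: infinite_finite_induct)
      case (insert b I)
      have "smooth_on UNIV (\<lambda>u. (cutoff (2 / d * ((u - \<phi> y) \<bullet> b)) * cutoff (- (2 / d) * ((u - \<phi> y) \<bullet> b))) *
          (\<Prod>b\<in>I. cutoff (2 / d * ((u - \<phi> y) \<bullet> b)) * cutoff (- (2 / d) * ((u - \<phi> y) \<bullet> b))))"
        by (intro smooth_on_bilinear[OF _ bounded_bilinear_mult] insert s) auto
      then show ?case using insert by simp
    qed (auto simp: smooth_on_const)
    then show ?thesis by (simp add: h_def[abs_def])
  qed
  \<comment> \<open>The open sets \<open>U\<close> and \<open>- C\<close> cover the manifold; on the
    first \<open>\<beta>\<close> is \<open>h\<close> in the chart, on the second it is 0.\<close>
  have "\<beta> \<in> Cinf M"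
  proof (rule CinfI, rule smooth_fun_on_local)
    fix x
    show "\<exists>T. open T \<and> x \<in> T \<and> smooth_fun_on M T \<beta>"
    proof (cases "x \<in> U")
      case True
      have "smooth_on (\<phi> ` U) (\<beta> \<circ> inv_into U \<phi>)"
        using smooth_on_subset[OF sm_h, of "\<phi> ` U"]
        by (subst smooth_on_cong[OF chart(2)[OF c(1)], of _ h]) (auto simp: \<beta>_def chart_inv[OF c(1)])
      then show ?thesis using True smooth_fun_on_chart[OF c(1) chart(1)[OF c(1)]] chart(1)[OF c(1)] by blast
    next
      case False
      have "smooth_fun_on M (- C) \<beta>"
        by (rule smooth_fun_on_cong[OF _ _ smooth_fun_on_const[of _ 0]]) (use C \<beta>0 in auto)
      then show ?thesis using C False C_sub by (intro exI[of _ "- C"]) auto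
    qed
  qed
  moreover
  define N' where "N' = U \<inter> \<phi> -` {u. \<forall>b\<in>bas. \<bar>(u - \<phi> y) \<bullet> b\<bar> < d / 2}"
  have "open {u. \<forall>b\<in>bas. \<bar>(u - \<phi> y) \<bullet> b\<bar> < d / 2}"
  proof -
    have "{u. \<forall>b\<in>bas. \<bar>(u - \<phi> y) \<bullet> b\<bar> < d / 2} = (\<Inter>b\<in>bas. {u. \<bar>(u - \<phi> y) \<bullet> b\<bar> < d / 2})" by auto
    also have "open \<dots>" by (intro open_INT ballI open_Collect_less continuous_intros finite_bas)
    finally show ?thesis .
  qed
  then have "open N'" unfolding N'_def by (rule chart_open_vimage[OF c(1)])
  moreover have "y \<in> N'" using c d by (auto simp: N'_def)
  moreover have "N' \<subseteq> N"
  proof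
    fix x assume x: "x \<in> N'"
    then have "\<phi> x \<in> K" using d by (force simp: N'_def K_def)
    then show "x \<in> N" using C_iff C_sub x by (auto simp: N'_def)
  qed
  moreover have "\<beta> x = 1" if x: "x \<in> N'" for x
  proof -
    have t: "2 / d * t \<le> 1 \<and> - (2 / d) * t \<le> 1" if "\<bar>t\<bar> < d / 2" for t
      using that d by (auto simp: field_simps)
    have "2 / d * ((\<phi> x - \<phi> y) \<bullet> b) \<le> 1 \<and> - (2 / d) * ((\<phi> x - \<phi> y) \<bullet> b) \<le> 1" if "b \<in> bas" for b
      by (rule t) (use x that in \<open>auto simp: N'_def\<close>)
    then have "h (\<phi> x) = 1" unfolding h_def by (intro prod.neutral) (simp add: cutoff_eq_1)
    then show ?thesis using x by (simp add: \<beta>_def N'_def)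
  qed
  ultimately show thesis using that C C_sub \<beta>0 by blast
qed

lemma cutoff_smooth:
  assumes "open N" "\<beta> \<in> Cinf M" "closed C" "C \<subseteq> N" "\<And>x. x \<notin> C \<Longrightarrow> \<beta> x = 0" "smooth_fun_on M N g"
  shows "(\<lambda>x. \<beta> x * g x) \<in> Cinf M"
proof (rule CinfI, rule smooth_fun_on_local)
  fix x
  have "smooth_fun_on M N (\<lambda>x. \<beta> x * g x)" by (intro smooth_fun_on_mult assms Cinf_on)
  moreover have "smooth_fun_on M (- C) (\<lambda>x. \<beta> x * g x)"
    by (rule smooth_fun_on_cong[OF _ _ smooth_fun_on_const[of _ 0]]) (use assms in auto)
  ultimately show "\<exists>T. open T \<and> x \<in> T \<and> smooth_fun_on M T (\<lambda>x. \<beta> x * g x)"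
    using assms by (cases "x \<in> C") (auto intro: exI[of _ N] exI[of _ "- C"])
qed

lemma Cinf_extend:
  assumes "open N" "y \<in> N" "smooth_fun_on M N g"
  obtains g' N' where "g' \<in> Cinf M" "open N'" "y \<in> N'" "N' \<subseteq> N" "\<And>x. x \<in> N' \<Longrightarrow> g' x = g x"
proof (rule bump[OF assms(1,2)])
  fix \<beta> N' C assume *: "\<beta> \<in> Cinf M" "open N'" "y \<in> N'" "N' \<subseteq> N" "\<And>x. x \<in> N' \<Longrightarrow> \<beta> x = 1"
    "closed C" "C \<subseteq> N" "\<And>x. x \<notin> C \<Longrightarrow> \<beta> x = 0"
  show thesis
    by (rule that[OF cutoff_smooth[OF assms(1) *(1,6,7,8) assms(3)] *(2-4)]) (simp_all add: *(5))
qed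

text \<open>On \<open>N' n\<close> the bump function \<open>\<phi> n\<close> is \<open>1\<close>, so \<open>\<phi> m * (\<Prod>k<m. 1 - \<phi> k)\<close> vanishes there for
  \<open>m > n\<close>: local finiteness comes for free.\<close>

lemma partition_of_unity:
  fixes N :: "'m \<Rightarrow> 'm set"
  assumes "\<And>y. open (N y)" "\<And>y. y \<in> N y"
  obtains ys :: "nat \<Rightarrow> 'm" and \<psi> C where "\<And>n. \<psi> n \<in> Cinf M" "\<And>n. closed (C n)" "\<And>n. C n \<subseteq> N (ys n)"
    "\<And>n x. x \<notin> C n \<Longrightarrow> \<psi> n x = 0"
    "\<And>x. \<exists>T m. open T \<and> x \<in> T \<and> (\<forall>z\<in>T. (\<forall>n\<ge>m. \<psi> n z = 0) \<and> (\<Sum>n<m. \<psi> n z) = 1)"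
proof -
  have "\<exists>\<beta> N' C. \<beta> \<in> Cinf M \<and> open N' \<and> y \<in> N' \<and> (\<forall>x\<in>N'. \<beta> x = 1) \<and>
    closed C \<and> C \<subseteq> N y \<and> (\<forall>x. x \<notin> C \<longrightarrow> \<beta> x = 0)" for y
    using bump[OF assms, of y] by metis
  then obtain \<beta> N' C where *: "\<And>y. \<beta> y \<in> Cinf M" "\<And>y. open (N' y)" "\<And>y. y \<in> N' y"
    "\<And>y x. x \<in> N' y \<Longrightarrow> \<beta> y x = 1" "\<And>y. closed (C y)" "\<And>y. C y \<subseteq> N y" "\<And>y x. x \<notin> C y \<Longrightarrow> \<beta> y x = (0::real)"
    by metis
  \<comment> \<open>Second countability provides a countable subcover, which is then enumerated by
    \<open>ys\<close>.\<close>
  obtain F where F: "F \<subseteq> range N'" "countable F" "\<Union>F = \<Union>(range N')"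
    using Lindelof[of "range N'"] *(2) by blast
  obtain Y where Y: "countable Y" "F = N' ` Y" using countable_image_eq_inj F by (metis countable_subset_image)
  have cov: "(\<Union>y\<in>Y. N' y) = UNIV" using F(3) Y *(3) by auto
  then have "Y \<noteq> {}" by auto
  define ys where "ys = from_nat_into Y"
  have ys: "\<exists>n. x \<in> N' (ys n)" for x
    using cov range_from_nat_into[OF \<open>Y \<noteq> {}\<close> Y(1)] unfolding ys_def by (metis UNIV_I UN_E rangeE)
  define \<psi> where "\<psi> n x = \<beta> (ys n) x * (\<Prod>k<n. 1 - \<beta> (ys k) x)" for n x
  show thesis
  proof (rule that[of \<psi> "\<lambda>n. C (ys n)" ys])
    fix n
    show "\<psi> n \<in> Cinf M" unfolding \<psi>_def[abs_def]
      by (rule CinfI, intro smooth_fun_on_mult smooth_fun_on_prod smooth_fun_on_diff smooth_fun_on_const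
        Cinf_on *) auto
    show "\<psi> n x = 0" if "x \<notin> C (ys n)" for x using *(7)[OF that] by (simp add: \<psi>_def)
  next
    fix x
    obtain k where k: "x \<in> N' (ys k)" using ys by blast
    have "(\<forall>n\<ge>Suc k. \<psi> n z = 0) \<and> (\<Sum>n<Suc k. \<psi> n z) = 1" if z: "z \<in> N' (ys k)" for z
    proof -
      \<comment> \<open>The sum telescopes, and the product on the right is 0 once it contains a
        factor for which the bump function is 1.\<close>
      have "(\<Sum>n<m. \<psi> n z) = 1 - (\<Prod>k<m. 1 - \<beta> (ys k) z)" for m
        by (induction m) (auto simp: \<psi>_def algebra_simps)
      then show ?thesis using *(4)[OF z] by (auto simp: \<psi>_def less_Suc_eq_le[symmetric])
    qed
    then show "\<exists>T m. open T \<and> x \<in> T \<and> (\<forall>z\<in>T. (\<forall>n\<ge>m. \<psi> n z = 0) \<and> (\<Sum>n<m. \<psi> n z) = 1)"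
      using k *(2) by blast
  qed (use * in auto)
qed

section \<open>Tangent vectors and coordinate fields\<close>

lemma tangent_linear:
  assumes "X \<in> tangent_space M x" "f \<in> Cinf M" "g \<in> Cinf M"
  shows "X (\<lambda>y. f y + g y) = X f + X g" "X (\<lambda>y. c * f y) = c * X f" "X (\<lambda>y. f y * g y) = X f * g x + f x * X g"
  using assms unfolding tangent_space_def linear_between_def plus_fun_def scaleR_fun_def by auto

lemma tangent_const:
  assumes "X \<in> tangent_space M x" shows "X (\<lambda>y. c) = 0"
proof -
  have "X (\<lambda>y. 1 * 1) = X (\<lambda>y. 1) * 1 + 1 * X (\<lambda>y. 1)"
    using tangent_linear(3)[OF assms Cinf_const Cinf_const] by blast
  then have "X (\<lambda>y. 1) = 0" by simp
  then show ?thesis using tangent_linear(2)[OF assms Cinf_const Cinf_const, of c 1] by simp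
qed

text \<open>The products of \<open>f\<close> and of \<open>g\<close> with a bump function are the
  same function, and the product rule at \<open>x\<close> turns this into
  \<open>X f = X g\<close>.\<close>

lemma tangent_local:
  assumes X: "X \<in> tangent_space M x" and f: "f \<in> Cinf M" "g \<in> Cinf M" and N: "open N" "x \<in> N" "\<And>y. y \<in> N \<Longrightarrow>
    f y = g y"
  shows "X f = X g"
proof (rule bump[OF N(1,2)])
  fix \<beta> N' C assume *: "\<beta> \<in> Cinf M" "open N'" "x \<in> N'" "N' \<subseteq> N" "\<And>x. x \<in> N' \<Longrightarrow> \<beta> x = 1"
    "closed C" "C \<subseteq> N" "\<And>x. x \<notin> C \<Longrightarrow> \<beta> x = 0"
  have "(\<lambda>y. \<beta> y * f y) = (\<lambda>y. \<beta> y * g y)" using * N(3) by (metis mult_eq_0_iff subsetD)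
  then have "X \<beta> * f x + \<beta> x * X f = X \<beta> * g x + \<beta> x * X g"
    using tangent_linear(3)[OF X *(1) f(1)] tangent_linear(3)[OF X *(1) f(2)] by simp
  then show ?thesis using *(3,5) N by simp
qed

lemma coord_field_eq:
  assumes "(U, \<phi>) \<in> M" "x \<in> U" "f \<in> Cinf M"
  shows "coord_field M (U, \<phi>) b x f = frechet_derivative (f \<circ> inv_into U \<phi>) (at (\<phi> x)) b"
  using assms by (simp add: coord_field_def)

lemma chart_differentiable:
  assumes c: "(U, \<phi>) \<in> M" and x: "x \<in> U" "x \<in> W" and f: "smooth_fun_on M W f"
  shows "(f \<circ> inv_into U \<phi> has_derivative frechet_derivative (f \<circ> inv_into U \<phi>) (at (\<phi> x))) (at (\<phi> x))"
  by (rule smooth_on_differentiable[OF smooth_fun_on_smooth[OF f c]]) (use x in auto)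

lemma coord_field_tangent:
  assumes c: "(U, \<phi>) \<in> M" and x: "x \<in> U"
  shows "coord_field M (U, \<phi>) b x \<in> tangent_space M x"
proof -
  let ?D = "\<lambda>f. frechet_derivative (f \<circ> inv_into U \<phi>) (at (\<phi> x))"
  have d: "(f \<circ> inv_into U \<phi> has_derivative ?D f) (at (\<phi> x))" if "f \<in> Cinf M" for f
    using chart_differentiable[OF c x UNIV_I] that by (simp add: Cinf_def)
  have add: "?D (\<lambda>y. f y + g y) b = ?D f b + ?D g b" if "f \<in> Cinf M" "g \<in> Cinf M" for f g
    using frechet_derivative_at[OF has_derivative_add[OF d[OF that(1)] d[OF that(2)]], THEN fun_cong, of b]
    by (simp add: comp_def)
  have mul: "?D (\<lambda>y. f y * g y) b = ?D f b * g x + f x * ?D g b" if "f \<in> Cinf M" "g \<in> Cinf M" for f g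
    using frechet_derivative_at[OF has_derivative_mult[OF d[OF that(1)] d[OF that(2)]], THEN fun_cong, of b]
    by (simp add: comp_def chart_inv[OF c x])
  have const: "?D (\<lambda>y. k) b = 0" for k by (simp add: comp_def)
  have "?D (\<lambda>y. k * f y) b = k * ?D f b" if "f \<in> Cinf M" for f k
    using mul[OF Cinf_const that, of k] const by simp
  then show ?thesis
    unfolding tangent_space_def linear_between_def
    using add mul coord_field_eq[OF c x] Cinf_add Cinf_mult Cinf_const
    by (auto simp: plus_fun_def scaleR_fun_def coord_field_def)
qed

lemma coord_field_smooth:
  assumes c: "(U, \<phi>) \<in> M" and f: "f \<in> Cinf M" shows "smooth_fun_on M U (\<lambda>x. coord_field M (U, \<phi>) b x f)"
proof (rule smooth_fun_on_chart[OF c chart(1)[OF c] order_refl])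
  have "smooth_on (\<phi> ` U) (\<lambda>u. frechet_derivative (f \<circ> inv_into U \<phi>) (at u) b)"
    using smooth_on_derivative[OF smooth_fun_on_smooth[OF Cinf_on[OF f] c, of UNIV]] by simp
  then show "smooth_on (\<phi> ` U) ((\<lambda>x. coord_field M (U, \<phi>) b x f) \<circ> inv_into U \<phi>)"
    by (subst smooth_on_cong[OF chart(2)[OF c], of _ "\<lambda>u. frechet_derivative (f \<circ> inv_into U \<phi>) (at u) b"])
      (auto simp: coord_field_def chart_inv[OF c] f)
qed

text \<open>The coordinate functions, cut off to global functions near a point, are dual to the coordinate fields.\<close>

lemma coord_dual:
  assumes c: "(U, \<phi>) \<in> M" and x: "x \<in> U" and b: "b \<in> bas"
  obtains f where "f \<in> Cinf M" "\<And>a. a \<in> bas \<Longrightarrow> coord_field M (U, \<phi>) a x f = (if a = b then 1 else 0)"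
proof -
  have "smooth_on (\<phi> ` U) (\<lambda>u. u \<bullet> b)"
    unfolding smooth_on_def using chart(2)[OF c]
    by (intro allI Ck_on_bounded_linear[OF _ bounded_linear_inner_left] Ck_on_ident)
  then have "smooth_fun_on M U (\<lambda>y. \<phi> y \<bullet> b)"
    by (intro smooth_fun_on_chart[OF c chart(1)[OF c] order_refl])
      (subst smooth_on_cong[OF chart(2)[OF c], of _ "\<lambda>u. u \<bullet> b"], auto simp: chart_inv[OF c])
  from Cinf_extend[OF chart(1)[OF c] x this] obtain f N where
    f: "f \<in> Cinf M" "open N" "x \<in> N" "N \<subseteq> U" "\<And>y. y \<in> N \<Longrightarrow> f y = \<phi> y \<bullet> b" by blast
  have "((\<lambda>u. u \<bullet> b) has_derivative (\<lambda>v. v \<bullet> b)) (at (\<phi> x))" by (auto intro!: derivative_eq_intros)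
  then have "(f \<circ> inv_into U \<phi> has_derivative (\<lambda>v. v \<bullet> b)) (at (\<phi> x))"
    by (rule has_derivative_transform_within_open[OF _ chart_open_image[OF c f(2)]])
      (use x f chart_inv[OF c] in auto)
  then have "coord_field M (U, \<phi>) a x f = a \<bullet> b" for a
    using coord_field_eq[OF c x f(1)] frechet_derivative_at by metis
  then show thesis using that[OF f(1)] onb_inner[OF onb_bas] b by simp
qed

end

section \<open>Vector bundles\<close>

definition comb :: "('m \<Rightarrow> 'v::real_vector) list \<Rightarrow> (nat \<Rightarrow> real) \<Rightarrow> 'm \<Rightarrow> 'v" where
  "comb es a x = (\<Sum>i<length es. a i *\<^sub>R (es ! i) x)"

lemma comb_cong: "(\<And>i. i < length es \<Longrightarrow> a i = b i) \<Longrightarrow> comb es a x = comb es b x"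
  by (simp add: comb_def)

lemma comb_add: "comb es (\<lambda>i. a i + b i) x = comb es a x + comb es b x"
  by (simp add: comb_def scaleR_add_left sum.distrib)

lemma comb_diff: "comb es (\<lambda>i. a i - b i) x = comb es a x - comb es b x"
  by (simp add: comb_def scaleR_diff_left sum_subtractf)

lemma comb_scale: "comb es (\<lambda>i. c * a i) x = c *\<^sub>R comb es a x"
  by (simp add: comb_def scaleR_sum_right)

lemma comb_sum: "comb es (\<lambda>i. \<Sum>k\<in>K. a k i) x = (\<Sum>k\<in>K. comb es (a k) x)"
  by (induction K rule: infinite_finite_induct) (auto simp: comb_add, simp_all add: comb_def)

lemma comb_unit: "k < length es \<Longrightarrow> comb es (\<lambda>i. if i = k then 1 else 0) x = (es ! k) x"
  by (simp add: comb_def if_distrib[of "\<lambda>t. t *\<^sub>R _"] cong: if_cong)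

text \<open>For a list, distinctness together with independence of its set is independence as a
  family. Smooth coefficient functions are indexed by positions in the list, so later arguments use
  this form.\<close>

lemma basis_at_iff:
  "basis_at es x S \<longleftrightarrow>
     (\<forall>a. comb es a x = 0 \<longrightarrow> (\<forall>i<length es. a i = 0)) \<and> S = range (\<lambda>a. comb es a x)"
proof -
  define vs where "vs = map (\<lambda>e. e x) es"
  have len: "length vs = length es" and nth: "\<And>i. i < length es \<Longrightarrow> vs ! i = (es ! i) x" by (auto simp: vs_def)
  have comb: "comb es a x = (\<Sum>i<length vs. a i *\<^sub>R vs ! i)" for a by (simp add: comb_def len nth)
  have bij: "bij_betw ((!) vs) {..<length vs} (set vs)" if "distinct vs" using that by (simp add: bij_betw_nth)
  have sum1: "(\<Sum>v\<in>set vs. u v *\<^sub>R v) = (\<Sum>i<length vs. u (vs ! i) *\<^sub>R vs ! i)" if "distinct vs" for u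
    using sum.reindex_bij_betw[OF bij[OF that], of "\<lambda>v. u v *\<^sub>R v"] by simp
  have sum2: "(\<Sum>i<length vs. a i *\<^sub>R vs ! i) = (\<Sum>v\<in>set vs. a (inv_into {..<length vs} ((!) vs) v) *\<^sub>R v)"
    if "distinct vs" for a
    unfolding sum1[OF that] using bij[OF that]
    by (intro sum.cong) (auto simp: bij_betw_def inv_into_f_f)
  have span: "span (set vs) = range (\<lambda>a. comb es a x)" if "distinct vs"
    unfolding span_finite[OF finite_set] comb
  proof (intro equalityI subsetI)
    fix w assume "w \<in> range (\<lambda>u. \<Sum>v\<in>set vs. u v *\<^sub>R v)"
    then show "w \<in> range (\<lambda>a. \<Sum>i<length vs. a i *\<^sub>R vs ! i)" by (auto simp: sum1[OF that])
  next
    fix w assume "w \<in> range (\<lambda>a. \<Sum>i<length vs. a i *\<^sub>R vs ! i)"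
    then show "w \<in> range (\<lambda>u. \<Sum>v\<in>set vs. u v *\<^sub>R v)" by (auto simp: sum2[OF that])
  qed
  have ind: "distinct vs \<and> independent (set vs) \<longleftrightarrow> (\<forall>a. comb es a x = 0 \<longrightarrow> (\<forall>i<length es. a i = 0))"
  proof
    assume d: "distinct vs \<and> independent (set vs)"
    show "\<forall>a. comb es a x = 0 \<longrightarrow> (\<forall>i<length es. a i = 0)"
    proof (intro allI impI)
      fix a i assume *: "comb es a x = 0" "i < length es"
      have "a (inv_into {..<length vs} ((!) vs) (vs ! i)) = 0"
        by (rule independentD[of "set vs" "set vs" "\<lambda>v. a (inv_into {..<length vs} ((!) vs) v)"])
          (use d * len sum2[of a] in \<open>auto simp: comb\<close>)
      then show "a i = 0" using bij d * len by (auto simp: bij_betw_def inv_into_f_f)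
    qed
  next
    assume *: "\<forall>a. comb es a x = 0 \<longrightarrow> (\<forall>i<length es. a i = 0)"
    have d: "distinct vs"
      unfolding distinct_conv_nth
    proof (intro allI impI)
      fix i j assume ij: "i < length vs" "j < length vs" "i \<noteq> j"
      show "vs ! i \<noteq> vs ! j"
      proof
        assume eq: "vs ! i = vs ! j"
        have "comb es (\<lambda>k. (if k = i then 1 else 0) - (if k = j then 1 else 0)) x = 0"
          using ij len eq nth by (simp add: comb_diff comb_unit)
        from *[rule_format, OF this, of i] show False using ij len by simp
      qed
    qed
    have "independent (set vs)"
    proof (rule independent_if_scalars_zero[OF finite_set])
      fix f v assume f: "(\<Sum>v\<in>set vs. f v *\<^sub>R v) = 0" "v \<in> set vs"
      then have "comb es (\<lambda>i. f (vs ! i)) x = 0" by (simp add: comb sum1[OF d])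
      moreover obtain i where "i < length vs" "v = vs ! i" using f(2) by (auto simp: in_set_conv_nth)
      ultimately show "f v = 0" using *[rule_format, of "\<lambda>i. f (vs ! i)" i] len by simp
    qed
    with d show "distinct vs \<and> independent (set vs)" by simp
  qed
  show ?thesis
    unfolding basis_at_def Let_def vs_def[symmetric] using ind span by auto
qed

lemma basis_at_unique:
  assumes "basis_at es x S" "comb es a x = comb es b x" "i < length es" shows "a i = b i"
proof -
  have "comb es (\<lambda>i. a i - b i) x = 0" using assms(2) by (simp add: comb_diff)
  then show ?thesis using assms(1,3) unfolding basis_at_iff by fastforce
qed

lemma basis_at_comb: "basis_at es x S \<Longrightarrow> comb es a x \<in> S"
  unfolding basis_at_iff by blast

lemma basis_at_expand: assumes "basis_at es x S" "v \<in> S" obtains a where "v = comb es a x"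
  using assms unfolding basis_at_iff by blast

lemma basis_at_subspace: "basis_at es x S \<Longrightarrow> subspace S"
  unfolding basis_at_def Let_def using subspace_span by blast

lemma smooth_in_frame_iff:
  "smooth_in_frame M es W \<mu> \<longleftrightarrow>
     (\<exists>c. (\<forall>i<length es. smooth_fun_on M W (c i)) \<and> (\<forall>x\<in>W. \<mu> x = comb es (\<lambda>i. c i x) x))"
  unfolding smooth_in_frame_def comb_def ..

section \<open>Smooth matrices and smooth coefficients\<close>

context mfd
begin

text \<open>Gaussian elimination by induction on the index set. The pivot \<open>g a a\<close> is 1
  at \<open>y\<close>, hence nonzero nearby, and the Schur complement \<open>g'\<close> is again the
  identity at \<open>y\<close>. All formulas are rational, so the entries stay smooth.\<close>

lemma smooth_matrix_inverse:
  fixes g :: "'i \<Rightarrow> 'i \<Rightarrow> 'm \<Rightarrow> real"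
  assumes "finite I"
  shows "open N \<Longrightarrow> y \<in> N \<Longrightarrow> (\<And>i j. i \<in> I \<Longrightarrow> j \<in> I \<Longrightarrow> smooth_fun_on M N (g i j)) \<Longrightarrow>
    (\<And>i j. i \<in> I \<Longrightarrow> j \<in> I \<Longrightarrow> g i j y = (if i = j then 1 else 0)) \<Longrightarrow>
    \<exists>N' h. open N' \<and> y \<in> N' \<and> N' \<subseteq> N \<and> (\<forall>i\<in>I. \<forall>j\<in>I. smooth_fun_on M N' (h i j)) \<and>
      (\<forall>x\<in>N'. \<forall>i\<in>I. \<forall>j\<in>I. (\<Sum>k\<in>I. h i k x * g k j x) = (if i = j then 1 else 0))"
  using assms
proof (induction I arbitrary: N g rule: finite_induct)
  case empty
  then show ?case by blast
next
  case (insert a J)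
  define N1 where "N1 = N \<inter> g a a -` (- {0})"
  have sm: "smooth_fun_on M N (g i j)" if "i \<in> insert a J" "j \<in> insert a J" for i j
    using insert.prems(3) that by blast
  have "open N1" unfolding N1_def
    by (rule continuous_open_preimage[OF smooth_fun_on_cont[OF insert.prems(1) sm]]) (use insert.prems in auto)
  have yN1: "y \<in> N1" using insert.prems by (auto simp: N1_def)
  have sm1: "smooth_fun_on M N1 (g i j)" if "i \<in> insert a J" "j \<in> insert a J" for i j
    by (rule smooth_fun_on_subset[OF sm[OF that]]) (auto simp: N1_def)
  have smi: "smooth_fun_on M N1 (\<lambda>x. inverse (g a a x))"
    by (rule smooth_fun_on_inverse[OF \<open>open N1\<close> sm1]) (auto simp: N1_def)
  define g' where "g' i j x = g i j x - g i a x * inverse (g a a x) * g a j x" for i j x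
  have smg': "smooth_fun_on M N1 (g' i j)" if "i \<in> J" "j \<in> J" for i j
    unfolding g'_def[abs_def] by (intro smooth_fun_on_diff smooth_fun_on_mult smi sm1 \<open>open N1\<close>) (use that
      in auto)
  have g'y: "g' i j y = (if i = j then 1 else 0)" if "i \<in> J" "j \<in> J" for i j
    using that insert by (auto simp: g'_def)
  have "\<exists>N' h'. open N' \<and> y \<in> N' \<and> N' \<subseteq> N1 \<and> (\<forall>i\<in>J. \<forall>j\<in>J. smooth_fun_on M N' (h' i j)) \<and>
      (\<forall>x\<in>N'. \<forall>i\<in>J. \<forall>j\<in>J. (\<Sum>k\<in>J. h' i k x * g' k j x) = (if i = j then 1 else 0))"
    by (rule insert.IH[OF \<open>open N1\<close> yN1 smg' g'y])
  then obtain N' h' where h': "open N'" "y \<in> N'" "N' \<subseteq> N1" "\<And>i j. i \<in> J \<Longrightarrow> j \<in> J \<Longrightarrow> smooth_fun_on M N' (h' i j)"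
    "\<And>x i j. x \<in> N' \<Longrightarrow> i \<in> J \<Longrightarrow> j \<in> J \<Longrightarrow> (\<Sum>k\<in>J. h' i k x * g' k j x) = (if i = j then 1 else 0)"
    by blast
  \<comment> \<open>In the rows of \<open>J\<close>, the entry in column \<open>a\<close> is chosen
    to supply the correction by which \<open>g'\<close> differs from \<open>g\<close>.\<close>
  define hJ where "hJ i k x = (if k = a then - (\<Sum>c\<in>J. h' i c x * (g c a x * inverse (g a a x))) else h' i k x)" for i k x
  have hJ: "(\<Sum>k\<in>insert a J. hJ i k x * g k j x) = (if i = j then 1 else 0)" if x: "x \<in> N'" and i: "i \<in> J"
    and j: "j \<in> insert a J" for i j x
  proof -
    have nz: "g a a x \<noteq> 0" using x h'(3) by (auto simp: N1_def)
    have "(\<Sum>k\<in>insert a J. hJ i k x * g k j x) =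
        (\<Sum>k\<in>J. h' i k x * g k j x) - (\<Sum>c\<in>J. h' i c x * (g c a x * inverse (g a a x))) * g a j x"
      using insert.hyps by (auto simp: hJ_def intro!: sum.cong)
    also have "\<dots> = (\<Sum>k\<in>J. h' i k x * g' k j x)"
      by (simp add: g'_def sum_distrib_right right_diff_distrib sum_subtractf mult.assoc)
    also have "\<dots> = (if i = j then 1 else 0)"
    proof (cases "j = a")
      case True
      then have "g' k j x = 0" for k using nz by (simp add: g'_def)
      then show ?thesis using True i insert.hyps by auto
    qed (use h'(5) x i j in auto)
    finally show ?thesis .
  qed
  \<comment> \<open>The row \<open>a\<close> follows by back substitution from the rows of
    \<open>J\<close>.\<close>
  define h where "h i k x = (if i = a then inverse (g a a x) * ((if k
    = a then 1 else 0) - (\<Sum>d\<in>J. g a d x * hJ d k x)) else hJ i k x)" for i k x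
  have ha: "(\<Sum>k\<in>insert a J. h a k x * g k j x) = (if a = j then 1 else 0)" if x: "x \<in> N'"
    and j: "j \<in> insert a J" for j x
  proof -
    have nz: "g a a x \<noteq> 0" using x h'(3) by (auto simp: N1_def)
    have "(\<Sum>k\<in>insert a J. h a k x * g k j x) = inverse (g a a x) *
       ((\<Sum>k\<in>insert a J. (if k = a then 1 else 0) * g k j x) - (\<Sum>k\<in>insert a J. (\<Sum>d\<in>J. g a d x * hJ d k x) * g
         k j x))"
      unfolding h_def by (simp add: sum_distrib_left sum_subtractf[symmetric] algebra_simps del: sum.insert)
    also have "(\<Sum>k\<in>insert a J. (if k = a then 1 else 0) * g k j x) = g a j x"
      using insert.hyps by (simp add: if_distrib[of "\<lambda>t. t * _"] cong: if_cong)
    also have "(\<Sum>k\<in>insert a J. (\<Sum>d\<in>J. g a d x * hJ d k x) * g k j x)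
      = (\<Sum>d\<in>J. g a d x * (\<Sum>k\<in>insert a J. hJ d k x * g k j x))"
      unfolding sum_distrib_left sum_distrib_right by (subst sum.swap) (simp add: mult.assoc)
    also have "\<dots> = (\<Sum>d\<in>J. if d = j then g a d x else 0)"
      by (intro sum.cong refl) (use hJ[OF x _ j] in auto)
    also have "\<dots> = (if j \<in> J then g a j x else 0)" using insert.hyps by simp
    finally show ?thesis using nz j insert.hyps by auto
  qed
  have smJ: "smooth_fun_on M N' (hJ i k)" if "i \<in> J" "k \<in> insert a J" for i k
  proof (cases "k = a")
    case True
    have "smooth_fun_on M N' (\<lambda>x. 0 - (\<Sum>c\<in>J. h' i c x * (g c a x * inverse (g a a x))))"
      by (intro smooth_fun_on_diff smooth_fun_on_const smooth_fun_on_sum smooth_fun_on_mult h'(1) h'(4)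
          smooth_fun_on_subset[OF sm1 h'(3)] smooth_fun_on_subset[OF smi h'(3)]) (use that in auto)
    then show ?thesis using True by (simp add: hJ_def[abs_def])
  next
    case False
    then show ?thesis using that h'(4) by (auto simp: hJ_def[abs_def])
  qed
  have "smooth_fun_on M N' (h i k)" if "i \<in> insert a J" "k \<in> insert a J" for i k
  proof (cases "i = a")
    case True
    have "smooth_fun_on M N' (\<lambda>x. inverse (g a a x) * ((if k = a then 1 else 0) - (\<Sum>d\<in>J. g a d x * hJ d k x)))"
      by (intro smooth_fun_on_diff smooth_fun_on_const smooth_fun_on_sum smooth_fun_on_mult h'(1) smJ
          smooth_fun_on_subset[OF sm1 h'(3)] smooth_fun_on_subset[OF smi h'(3)]) (use that in auto)
    then show ?thesis using True by (simp add: h_def[abs_def])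
  next
    case False
    then show ?thesis using that smJ by (auto simp: h_def[abs_def])
  qed
  moreover have "(\<Sum>k\<in>insert a J. h i k x * g k j x) = (if i = j then 1 else 0)"
    if "x \<in> N'" "i \<in> insert a J" "j \<in> insert a J" for x i j
  proof (cases "i = a")
    case False
    then have "h i k x = hJ i k x" for k by (simp add: h_def)
    then show ?thesis using hJ[of x i j] that False by simp
  qed (use ha that in auto)
  ultimately show ?case using h'(1-3) by (intro exI[of _ N'] exI[of _ h]) (auto simp: N1_def)
qed

lemma smooth_in_frame_subset: "smooth_in_frame M es W \<mu> \<Longrightarrow> W' \<subseteq> W \<Longrightarrow> smooth_in_frame M es W' \<mu>"
  unfolding smooth_in_frame_def using smooth_fun_on_subset by (meson subsetD)

lemma smooth_in_frame_cong:
  "smooth_in_frame M es W \<mu> \<Longrightarrow> (\<And>x. x \<in> W \<Longrightarrow> \<mu> x = \<nu> x) \<Longrightarrow> smooth_in_frame M es W \<nu>"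
  unfolding smooth_in_frame_def by (elim exE conjE, rule exI, rule conjI, assumption) simp

text \<open>Coefficients in a basis are unique, so the local smooth ones fit together.\<close>

lemma smooth_in_frame_local:
  assumes b: "\<And>x. x \<in> W \<Longrightarrow> basis_at es x (S x)"
    and l: "\<And>x. x \<in> W \<Longrightarrow> \<exists>T. open T \<and> x \<in> T \<and> smooth_in_frame M es (T \<inter> W) \<mu>" and W: "open W"
  shows "smooth_in_frame M es W \<mu>"
proof -
  have "\<forall>x\<in>W. \<exists>a. \<mu> x = comb es a x"
    using l unfolding smooth_in_frame_iff by blast
  from bchoice[OF this] obtain c where c: "\<And>x. x \<in> W \<Longrightarrow> \<mu> x = comb es (c x) x" by blast
  have "smooth_fun_on M W (\<lambda>x. c x i)" if i: "i < length es" for i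
  proof (rule smooth_fun_on_local)
    fix x assume x: "x \<in> W"
    obtain T where T: "open T" "x \<in> T" "smooth_in_frame M es (T \<inter> W) \<mu>" using l[OF x] by blast
    then obtain d where d: "smooth_fun_on M (T \<inter> W) (d i)" "\<And>y. y \<in> T \<inter> W \<Longrightarrow> \<mu> y = comb es (\<lambda>i. d i y) y"
      using i unfolding smooth_in_frame_iff by blast
    have "d i y = c y i" if "y \<in> T \<inter> W" for y
      by (rule basis_at_unique[OF b, of y]) (use that d(2) c i in auto)
    then have "smooth_fun_on M (T \<inter> W) (\<lambda>x. c x i)"
      by (intro smooth_fun_on_cong[OF open_Int[OF T(1) W] _ d(1)])
    then show "\<exists>T. open T \<and> x \<in> T \<and> smooth_fun_on M T (\<lambda>x. c x i)" using T W x by blast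
  qed
  then show ?thesis unfolding smooth_in_frame_iff using c by (intro exI[of _ "\<lambda>i x. c x i"]) auto
qed

lemma smooth_in_frame_add:
  assumes "open W" "smooth_in_frame M es W \<mu>" "smooth_in_frame M es W \<nu>"
  shows "smooth_in_frame M es W (\<lambda>x. \<mu> x + \<nu> x)"
proof -
  obtain c d where "\<And>i. i < length es \<Longrightarrow> smooth_fun_on M W (c i)" "\<And>x. x \<in> W \<Longrightarrow> \<mu> x = comb es (\<lambda>i. c i x) x"
    "\<And>i. i < length es \<Longrightarrow> smooth_fun_on M W (d i)" "\<And>x. x \<in> W \<Longrightarrow> \<nu> x = comb es (\<lambda>i. d i x) x"
    using assms unfolding smooth_in_frame_iff by blast
  then show ?thesis
    unfolding smooth_in_frame_iff
    by (intro exI[of _ "\<lambda>i x. c i x + d i x"]) (auto simp: comb_add intro: smooth_fun_on_add[OF assms(1)])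
qed

lemma smooth_in_frame_mult:
  assumes "open W" "smooth_fun_on M W f" "smooth_in_frame M es W \<mu>"
  shows "smooth_in_frame M es W (\<lambda>x. f x *\<^sub>R \<mu> x)"
proof -
  obtain c where "\<And>i. i < length es \<Longrightarrow> smooth_fun_on M W (c i)" "\<And>x. x \<in> W \<Longrightarrow> \<mu> x = comb es (\<lambda>i. c i x) x"
    using assms unfolding smooth_in_frame_iff by blast
  then show ?thesis
    unfolding smooth_in_frame_iff
    by (intro exI[of _ "\<lambda>i x. f x * c i x"]) (auto simp: comb_scale intro: smooth_fun_on_mult[OF assms(1,2)])
qed

lemma smooth_in_frame_zero: "smooth_in_frame M es W (\<lambda>x. 0)"
  unfolding smooth_in_frame_iff by (intro exI[of _ "\<lambda>i x. 0"]) (auto simp: comb_def smooth_fun_on_const)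

end

section \<open>Sections of a vector bundle\<close>

locale vb = mfd M for M :: "('m::{t2_space,second_countable_topology}, 'h::real_inner) atlas" +
  fixes E :: "('m, 'v::real_vector, 'q) vbundle_scheme"
  assumes vb: "vector_bundle M E"
begin

lemma frame:
  assumes "(U, es) \<in> frames E"
  shows "open U" "x \<in> U \<Longrightarrow> basis_at es x (fibre E x)"
  using vb assms unfolding vector_bundle_def by blast+

lemma frame_smooth:
  assumes "(U, es) \<in> frames E" "(V, es') \<in> frames E" "e \<in> set es'"
  shows "smooth_in_frame M es (U \<inter> V) e"
  using vb assms unfolding vector_bundle_def by blast

lemma frame_exists: obtains U es where "(U, es) \<in> frames E" "x \<in> U"
proof -
  have "x \<in> (\<Union>(U, es)\<in>frames E. U)" using vb unfolding vector_bundle_def by simp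
  then show thesis using that by blast
qed

lemma fibre_subspace: "subspace (fibre E x)"
proof -
  obtain U es where "(U, es) \<in> frames E" "x \<in> U" by (rule frame_exists)
  then show ?thesis by (rule basis_at_subspace[OF frame(2)])
qed

lemma fibre_ops:
  "0 \<in> fibre E x" "u \<in> fibre E x \<Longrightarrow> v \<in> fibre E x \<Longrightarrow> u + v \<in> fibre E x" "u \<in> fibre E x \<Longrightarrow> c *\<^sub>R u \<in> fibre E x"
  "u \<in> fibre E x \<Longrightarrow> v \<in> fibre E x \<Longrightarrow> u - v \<in> fibre E x"
  "(\<And>i. i \<in> I \<Longrightarrow> s i \<in> fibre E x) \<Longrightarrow> sum s I \<in> fibre E x"
  using fibre_subspace[of x] by (auto intro: subspace_0 subspace_add subspace_scale subspace_diff subspace_sum)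

lemma smooth_section_onD:
  "smooth_section_on M E W \<mu> \<Longrightarrow> x \<in> W \<Longrightarrow> \<mu> x \<in> fibre E x"
  "smooth_section_on M E W \<mu> \<Longrightarrow> (U, es) \<in> frames E \<Longrightarrow> smooth_in_frame M es (U \<inter> W) \<mu>"
  unfolding smooth_section_on_def by blast+

lemma smooth_section_onI:
  assumes "\<And>x. x \<in> W \<Longrightarrow> \<mu> x \<in> fibre E x" "\<And>U es. (U, es) \<in> frames E \<Longrightarrow> smooth_in_frame M es (U \<inter> W) \<mu>"
  shows "smooth_section_on M E W \<mu>"
  using assms unfolding smooth_section_on_def by blast

lemma smooth_section_on_subset: "smooth_section_on M E W \<mu> \<Longrightarrow> W' \<subseteq> W \<Longrightarrow> smooth_section_on M E W' \<mu>"
  by (intro smooth_section_onI) (auto dest: smooth_section_onD intro: smooth_in_frame_subset)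

lemma smooth_section_on_local:
  assumes "open W" "\<And>x. x \<in> W \<Longrightarrow> \<exists>T. open T \<and> x \<in> T \<and> smooth_section_on M E T \<mu>"
  shows "smooth_section_on M E W \<mu>"
proof (rule smooth_section_onI)
  show "\<mu> x \<in> fibre E x" if "x \<in> W" for x using assms(2)[OF that] smooth_section_onD(1) by blast
  fix U es assume f: "(U, es) \<in> frames E"
  show "smooth_in_frame M es (U \<inter> W) \<mu>"
  proof (rule smooth_in_frame_local[OF frame(2)[OF f]])
    fix x assume "x \<in> U \<inter> W"
    then obtain T where "open T" "x \<in> T" "smooth_section_on M E T \<mu>" using assms(2) by blast
    then have "smooth_in_frame M es (U \<inter> T) \<mu>" using smooth_section_onD(2) f by blast
    then show "\<exists>T. open T \<and> x \<in> T \<and> smooth_in_frame M es (T \<inter> (U \<inter> W)) \<mu>"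
      using \<open>open T\<close> \<open>x \<in> T\<close> by (intro exI[of _ T]) (auto intro: smooth_in_frame_subset)
  qed (use frame(1)[OF f] assms(1) in auto)
qed

lemma smooth_section_on_cong:
  assumes "smooth_section_on M E W \<mu>" "\<And>x. x \<in> W \<Longrightarrow> \<mu> x = \<nu> x" shows "smooth_section_on M E W \<nu>"
  by (rule smooth_section_onI)
    (use assms smooth_section_onD[OF assms(1)] in \<open>force intro: smooth_in_frame_cong\<close>)+

lemma smooth_section_on_frame:
  assumes f: "(U, es) \<in> frames E" and W: "open W" "W \<subseteq> U" and c: "\<And>i. i < length es \<Longrightarrow> smooth_fun_on M W (c i)"
  shows "smooth_section_on M E W (\<lambda>x. comb es (\<lambda>i. c i x) x)"
proof (rule smooth_section_onI)
  show "comb es (\<lambda>i. c i x) x \<in> fibre E x" if "x \<in> W" for x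
    by (rule basis_at_comb[OF frame(2)[OF f]]) (use W that in blast)
  fix V es' assume g: "(V, es') \<in> frames E"
  have *: "smooth_in_frame M es' (V \<inter> W) (es ! i)" if "i < length es" for i
    by (rule smooth_in_frame_subset[OF frame_smooth[OF g f]]) (use that W in auto)
  have "smooth_in_frame M es' (V \<inter> W) (\<lambda>x. \<Sum>i<n. c i x *\<^sub>R (es ! i) x)" if "n \<le> length es" for n
    using that
    by (induction n) (auto intro!: smooth_in_frame_zero smooth_in_frame_add smooth_in_frame_mult *
        smooth_fun_on_subset[OF c] open_Int W frame(1)[OF g])
  then show "smooth_in_frame M es' (V \<inter> W) (\<lambda>x. comb es (\<lambda>i. c i x) x)" unfolding comb_def by blast
qed

lemma smooth_section_on_add:
  assumes "open W" "smooth_section_on M E W \<mu>" "smooth_section_on M E W \<nu>"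
  shows "smooth_section_on M E W (\<lambda>x. \<mu> x + \<nu> x)"
  using assms by (intro smooth_section_onI)
    (auto dest: smooth_section_onD frame(1) intro!: smooth_in_frame_add fibre_ops open_Int)

lemma smooth_section_on_mult:
  assumes "open W" "smooth_fun_on M W f" "smooth_section_on M E W \<mu>"
  shows "smooth_section_on M E W (\<lambda>x. f x *\<^sub>R \<mu> x)"
  using assms by (intro smooth_section_onI)
    (auto dest: smooth_section_onD frame(1) intro!: smooth_in_frame_mult fibre_ops open_Int intro:
      smooth_fun_on_subset)

lemma smooth_section_on_zero: "smooth_section_on M E W (\<lambda>x. 0)"
  by (intro smooth_section_onI smooth_in_frame_zero fibre_ops)

lemma smooth_section_on_sum:
  "open W \<Longrightarrow> (\<And>i. i \<in> I \<Longrightarrow> smooth_section_on M E W (s i)) \<Longrightarrow> smooth_section_on M E W (\<lambda>x. \<Sum>i\<in>I. s i x)"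
  by (induction I rule: infinite_finite_induct) (auto simp: smooth_section_on_zero smooth_section_on_add)

lemma sec_on: "\<mu> \<in> sections M E \<Longrightarrow> smooth_section_on M E W \<mu>"
  unfolding sections_def using smooth_section_on_subset by blast

lemma secI: "smooth_section_on M E UNIV \<mu> \<Longrightarrow> \<mu> \<in> sections M E"
  by (simp add: sections_def)

lemma sec_fibre: "\<mu> \<in> sections M E \<Longrightarrow> \<mu> x \<in> fibre E x"
  using smooth_section_onD(1)[OF sec_on] by blast

lemma sec_add: "\<mu> \<in> sections M E \<Longrightarrow> \<nu> \<in> sections M E \<Longrightarrow> (\<lambda>x. \<mu> x + \<nu> x) \<in> sections M E"
  by (rule secI, intro smooth_section_on_add sec_on) auto

lemma sec_mult: "f \<in> Cinf M \<Longrightarrow> \<mu> \<in> sections M E \<Longrightarrow> (\<lambda>x. f x *\<^sub>R \<mu> x) \<in> sections M E"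
  by (rule secI, intro smooth_section_on_mult sec_on Cinf_on) auto

lemma sec_zero: "(\<lambda>x. 0) \<in> sections M E"
  by (rule secI, rule smooth_section_on_zero)

lemma sec_sum: "(\<And>i. i \<in> I \<Longrightarrow> s i \<in> sections M E) \<Longrightarrow> (\<lambda>x. \<Sum>i\<in>I. s i x) \<in> sections M E"
  by (rule secI, intro smooth_section_on_sum sec_on) auto

lemma sec_diff: "\<mu> \<in> sections M E \<Longrightarrow> \<nu> \<in> sections M E \<Longrightarrow> (\<lambda>x. \<mu> x - \<nu> x) \<in> sections M E"
  using sec_add[of \<mu> "\<lambda>x. (-1) *\<^sub>R \<nu> x"] sec_mult[OF Cinf_const, of \<nu> "-1"] by simp

lemma sec_local:
  assumes "\<And>x. \<exists>T \<nu>. open T \<and> x \<in> T \<and> \<nu> \<in> sections M E \<and> (\<forall>y\<in>T. \<mu> y = \<nu> y)"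
  shows "\<mu> \<in> sections M E"
proof (rule secI, rule smooth_section_on_local)
  fix x
  obtain T \<nu> where T: "open T" "x \<in> T" "\<nu> \<in> sections M E" "\<forall>y\<in>T. \<mu> y = \<nu> y" using assms by blast
  then have "smooth_section_on M E T \<mu>" using smooth_section_on_cong[OF sec_on] by metis
  then show "\<exists>T. open T \<and> x \<in> T \<and> smooth_section_on M E T \<mu>" using T by blast
qed auto

lemma sec_cutoff:
  assumes "open N" "\<beta> \<in> Cinf M" "closed C" "C \<subseteq> N" "\<And>x. x \<notin> C \<Longrightarrow> \<beta> x = 0" "smooth_section_on M E N \<mu>"
  shows "(\<lambda>x. \<beta> x *\<^sub>R \<mu> x) \<in> sections M E"
proof (rule secI, rule smooth_section_on_local)
  fix x
  have "smooth_section_on M E N (\<lambda>x. \<beta> x *\<^sub>R \<mu> x)" by (intro smooth_section_on_mult assms Cinf_on)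
  moreover have "smooth_section_on M E (- C) (\<lambda>x. \<beta> x *\<^sub>R \<mu> x)"
    by (rule smooth_section_on_cong[OF smooth_section_on_zero]) (use assms in auto)
  ultimately show "\<exists>T. open T \<and> x \<in> T \<and> smooth_section_on M E T (\<lambda>x. \<beta> x *\<^sub>R \<mu> x)"
    using assms by (cases "x \<in> C") (auto intro: exI[of _ N] exI[of _ "- C"])
qed auto

lemma sec_extend:
  assumes "open N" "y \<in> N" "smooth_section_on M E N \<mu>"
  obtains \<mu>' N' where "\<mu>' \<in> sections M E" "open N'" "y \<in> N'" "N' \<subseteq> N" "\<And>x. x \<in> N' \<Longrightarrow> \<mu>' x = \<mu> x"
proof (rule bump[OF assms(1,2)])
  fix \<beta> N' C assume *: "\<beta> \<in> Cinf M" "open N'" "y \<in> N'" "N' \<subseteq> N" "\<And>x. x \<in> N' \<Longrightarrow> \<beta> x = 1"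
    "closed C" "C \<subseteq> N" "\<And>x. x \<notin> C \<Longrightarrow> \<beta> x = 0"
  show thesis
    by (rule that[OF sec_cutoff[OF assms(1) *(1,6,7,8) assms(3)] *(2-4)]) (simp_all add: *(5))
qed

text \<open>The frame consists of global sections, since the bracket and the representation are
  given on global sections only; the frames of the bundle atlas are controlled on their domain
  alone.\<close>

definition framed :: "'m set \<Rightarrow> ('m \<Rightarrow> 'v) list \<Rightarrow> bool" where
  "framed W es \<longleftrightarrow> open W \<and> set es \<subseteq> sections M E \<and> (\<forall>x\<in>W. basis_at es x (fibre E x)) \<and>
     (\<forall>W' \<mu>. open W' \<longrightarrow> W' \<subseteq> W \<longrightarrow> smooth_section_on M E W' \<mu> \<longrightarrow> smooth_in_frame M es W' \<mu>)"

lemma framed_sec: "framed W es \<Longrightarrow> i < length es \<Longrightarrow> es ! i \<in> sections M E"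
  unfolding framed_def using nth_mem by blast

lemma framed_basis: "framed W es \<Longrightarrow> x \<in> W \<Longrightarrow> basis_at es x (fibre E x)"
  unfolding framed_def by blast

lemma framed_subset: "framed W es \<Longrightarrow> open W' \<Longrightarrow> W' \<subseteq> W \<Longrightarrow> framed W' es"
  unfolding framed_def by (meson order_trans subsetD)

lemma framed_exists:
  assumes "open N" "y \<in> N"
  obtains W es where "framed W es" "y \<in> W" "W \<subseteq> N"
proof -
  obtain U es where f: "(U, es) \<in> frames E" "y \<in> U" by (rule frame_exists)
  have U: "open (U \<inter> N)" "y \<in> U \<inter> N" using f frame(1) assms by auto
  show thesis
  proof (rule bump[OF U])
    fix \<beta> N' C assume *: "\<beta> \<in> Cinf M" "open N'" "y \<in> N'" "N' \<subseteq> U \<inter> N" "\<And>x. x \<in> N' \<Longrightarrow> \<beta> x = 1"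
      "closed C" "C \<subseteq> U \<inter> N" "\<And>x. x \<notin> C \<Longrightarrow> \<beta> x = 0"
    define fs where "fs = map (\<lambda>e x. \<beta> x *\<^sub>R e x) es"
    have comb: "comb fs a x = comb es a x" if "x \<in> N'" for a x
      using *(5)[OF that] by (auto simp: comb_def fs_def intro!: sum.cong)
    have len: "length fs = length es" by (simp add: fs_def)
    have "framed N' fs"
      unfolding framed_def
    proof (intro conjI ballI allI impI)
      show "set fs \<subseteq> sections M E"
      proof
        fix e assume "e \<in> set fs"
        then obtain e' where e': "e' \<in> set es" "e = (\<lambda>x. \<beta> x *\<^sub>R e' x)" by (auto simp: fs_def)
        then obtain i where i: "i < length es" "e' = es ! i" by (metis in_set_conv_nth)
        have "smooth_section_on M E (U \<inter> N) (\<lambda>x. comb es (\<lambda>k. if k = i then 1 else 0) x)"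
          by (rule smooth_section_on_frame[OF f(1) U(1)]) (auto intro: smooth_fun_on_const)
        then have "smooth_section_on M E (U \<inter> N) e'" using i by (simp add: comb_unit)
        then show "e \<in> sections M E" unfolding e' using sec_cutoff[OF U(1) *(1,6,7,8)] by blast
      qed
      fix x assume "x \<in> N'"
      then show "basis_at fs x (fibre E x)"
        using frame(2)[OF f(1), of x] *(4) by (auto simp: basis_at_iff comb len)
    next
      fix W' \<mu> assume W': "open W'" "W' \<subseteq> N'" "smooth_section_on M E W' \<mu>"
      have "smooth_in_frame M es (U \<inter> W') \<mu>" by (rule smooth_section_onD(2)[OF W'(3) f(1)])
      moreover have "U \<inter> W' = W'" using W' * by blast
      ultimately show "smooth_in_frame M fs W' \<mu>"
        using W'(2) by (auto simp: smooth_in_frame_iff len comb subset_iff)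
    qed (use * in auto)
    then show thesis using that *(3,4) by blast
  qed
qed

lemma fibre_extend:
  assumes "v \<in> fibre E y" obtains \<mu> where "\<mu> \<in> sections M E" "\<mu> y = v"
proof -
  obtain W es where f: "framed W es" "y \<in> W" by (rule framed_exists[OF open_UNIV UNIV_I])
  obtain a where a: "v = comb es a y" using basis_at_expand[OF framed_basis[OF f] assms] .
  have "(\<lambda>x. comb es a x) \<in> sections M E"
    unfolding comb_def by (intro sec_sum sec_mult Cinf_const framed_sec[OF f(1)]) auto
  then show thesis using that a by blast
qed

lemma frame_expand:
  assumes f: "framed W es" and s: "open W'" "W' \<subseteq> W" "smooth_section_on M E W' \<mu>"
  obtains c where "\<And>i. i < length es \<Longrightarrow> smooth_fun_on M W' (c i)" "\<And>x. x \<in> W' \<Longrightarrow> \<mu> x = comb es (\<lambda>i. c i x) x"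
proof -
  have "smooth_in_frame M es W' \<mu>" using assms unfolding framed_def by blast
  then show thesis using that unfolding smooth_in_frame_iff by blast
qed

lemma Cinf_extend_family:
  assumes "finite I" "open N" "y \<in> N" "\<And>i. i \<in> I \<Longrightarrow> smooth_fun_on M N (g i)"
  obtains g' N' where "\<And>i. i \<in> I \<Longrightarrow> g' i \<in> Cinf M" "open N'" "y \<in> N'" "N' \<subseteq> N" "\<And>i x. i \<in> I \<Longrightarrow> x \<in> N' \<Longrightarrow>
    g' i x = g i x"
proof (rule bump[OF assms(2,3)])
  fix \<beta> N' C assume *: "\<beta> \<in> Cinf M" "open N'" "y \<in> N'" "N' \<subseteq> N" "\<And>x. x \<in> N' \<Longrightarrow> \<beta> x = 1"
    "closed C" "C \<subseteq> N" "\<And>x. x \<notin> C \<Longrightarrow> \<beta> x = 0"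
  show thesis
    by (rule that[of "\<lambda>i x. \<beta> x * g i x", OF cutoff_smooth[OF assms(2) *(1,6,7,8) assms(4)] *(2-4)])
      (simp_all add: *(5))
qed

lemma frame_expand_Cinf:
  assumes f: "framed W es" and s: "open W'" "W' \<subseteq> W" "smooth_section_on M E W' \<mu>" "y \<in> W'"
  obtains c T where "\<And>i. i < length es \<Longrightarrow> c i \<in> Cinf M" "open T" "y \<in> T" "T \<subseteq> W'" "\<And>x. x \<in> T \<Longrightarrow>
    \<mu> x = comb es (\<lambda>i. c i x) x"
proof -
  obtain c where c: "\<And>i. i < length es \<Longrightarrow> smooth_fun_on M W' (c i)" "\<And>x. x \<in> W' \<Longrightarrow> \<mu> x = comb es (\<lambda>i. c i x) x"
    using frame_expand[OF f s(1-3)] by blast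
  obtain c' T where c': "\<And>i. i \<in> {..<length es} \<Longrightarrow> c' i \<in> Cinf M" "open T" "y \<in> T" "T \<subseteq> W'"
    "\<And>i x. i \<in> {..<length es} \<Longrightarrow> x \<in> T \<Longrightarrow> c' i x = c i x"
    using Cinf_extend_family[of "{..<length es}" W' y c] c s by auto
  have "\<mu> x = comb es (\<lambda>i. c' i x) x" if "x \<in> T" for x
  proof -
    have "comb es (\<lambda>i. c' i x) x = comb es (\<lambda>i. c i x) x" by (rule comb_cong) (use c'(5) that in auto)
    then show ?thesis using c(2) c'(4) that by auto
  qed
  then show thesis using that[of c', OF _ c'(2-4)] c'(1) by simp
qed

text \<open>What is recorded are the weights at each point. Conditions that are affine in the value
  of a section at the point survive the gluing.\<close>

lemma sections_glue:
  fixes N :: "'m \<Rightarrow> 'm set"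
  assumes "\<And>y. open (N y)" "\<And>y. y \<in> N y" "\<And>y. s y \<in> sections M E"
  obtains \<mu> where "\<mu> \<in> sections M E"
    "\<And>x. \<exists>(m::nat) ys w. (\<forall>i<m. w i \<noteq> 0 \<longrightarrow> x \<in> N (ys i)) \<and> (\<Sum>i<m. w i) = 1 \<and> \<mu> x = (\<Sum>i<m. w i *\<^sub>R s (ys i) x)"
proof (rule partition_of_unity[of N, OF assms(1,2)])
  fix ys :: "nat \<Rightarrow> 'm" and \<psi> C assume p: "\<And>n. \<psi> n \<in> Cinf M" "\<And>n. closed (C n)" "\<And>n. C n \<subseteq> N (ys n)"
    "\<And>n x. x \<notin> C n \<Longrightarrow> \<psi> n x = 0"
    "\<And>x. \<exists>T m. open T \<and> x \<in> T \<and> (\<forall>z\<in>T. (\<forall>n\<ge>m. \<psi> n z = 0) \<and> (\<Sum>n<m. \<psi> n z) = 1)"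
  define \<mu> where "\<mu> x = (\<Sum>n | \<psi> n x \<noteq> 0. \<psi> n x *\<^sub>R s (ys n) x)" for x
  have \<mu>: "\<mu> z = (\<Sum>n<m. \<psi> n z *\<^sub>R s (ys n) z)" if "\<forall>n\<ge>m. \<psi> n z = 0" for z m
    unfolding \<mu>_def using that by (intro sum.mono_neutral_left) (auto simp: not_le[symmetric])
  show thesis
  proof (rule that)
    show "\<mu> \<in> sections M E"
    proof (rule sec_local)
      fix x
      obtain T m where T: "open T" "x \<in> T" "\<forall>z\<in>T. (\<forall>n\<ge>m. \<psi> n z = 0)" using p(5)[of x] by blast
      have "(\<lambda>z. \<Sum>n<m. \<psi> n z *\<^sub>R s (ys n) z) \<in> sections M E" by (intro sec_sum sec_mult p assms)
      then show "\<exists>T \<nu>. open T \<and> x \<in> T \<and> \<nu> \<in> sections M E \<and> (\<forall>y\<in>T. \<mu> y = \<nu> y)"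
        using T \<mu> by (intro exI[of _ T] exI[of _ "\<lambda>z. \<Sum>n<m. \<psi> n z *\<^sub>R s (ys n) z"]) auto
    qed
    fix x
    obtain T m where T: "x \<in> T" "\<forall>z\<in>T. (\<forall>n\<ge>m. \<psi> n z = 0) \<and> (\<Sum>n<m. \<psi> n z) = 1" using p(5)[of x] by blast
    then show "\<exists>(m::nat) ys w. (\<forall>i<m. w i \<noteq> 0 \<longrightarrow> x \<in> N (ys i)) \<and> (\<Sum>i<m. w i) = 1 \<and>
      \<mu> x = (\<Sum>i<m. w i *\<^sub>R s (ys i) x)"
      by (intro exI[of _ m] exI[of _ ys] exI[of _ "\<lambda>n. \<psi> n x"]) (use p(3,4) \<mu> in blast)
  qed
qed

text \<open>With constants \<open>D\<close> dual to \<open>es\<close> at \<open>y\<close>, the matrix of \<open>es\<close> times \<open>D\<close> is near the identity and hence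
  smoothly invertible, which solves for the coefficients.\<close>

lemma smooth_in_subframe:
  assumes U: "open U" and es: "\<And>e. e \<in> set es \<Longrightarrow> smooth_section_on M E U e"
    and b: "\<And>x. x \<in> U \<Longrightarrow> basis_at es x (S x)"
    and \<mu>: "smooth_section_on M E U \<mu>" "\<And>x. x \<in> U \<Longrightarrow> \<mu> x \<in> S x"
  shows "smooth_in_frame M es U \<mu>"
proof (rule smooth_in_frame_local[OF b _ U])
  fix y assume y: "y \<in> U"
  obtain W fs where f: "framed W fs" "y \<in> W" "W \<subseteq> U" by (rule framed_exists[OF U y])
  have W: "open W" using f(1) by (simp add: framed_def)
  have ex: "\<exists>c. (\<forall>k<length fs. smooth_fun_on M W (c k)) \<and> (\<forall>x\<in>W. \<nu> x = comb fs (\<lambda>k. c k x) x)"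
    if "smooth_section_on M E U \<nu>" for \<nu>
    using frame_expand[OF f(1) W order_refl smooth_section_on_subset[OF that f(3)]] by metis
  have "\<forall>i. \<exists>c. i < length es \<longrightarrow> (\<forall>k<length fs. smooth_fun_on M W (c k)) \<and>
    (\<forall>x\<in>W. (es ! i) x = comb fs (\<lambda>k. c k x) x)"
    using ex es by (metis nth_mem)
  then obtain G where G: "\<And>i k. i < length es \<Longrightarrow> k < length fs \<Longrightarrow> smooth_fun_on M W (G i k)"
    "\<And>i x. i < length es \<Longrightarrow> x \<in> W \<Longrightarrow> (es ! i) x = comb fs (\<lambda>k. G i k x) x"
    by (metis (mono_tags))
  obtain m where m: "\<And>k. k < length fs \<Longrightarrow> smooth_fun_on M W (m k)" "\<And>x. x \<in> W \<Longrightarrow> \<mu> x = comb fs (\<lambda>k. m k x) x"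
    using ex[OF \<mu>(1)] by blast
  have by': "distinct (map (\<lambda>e. e y) es)" "independent (set (map (\<lambda>e. e y) es))"
    using b[OF y] by (auto simp: basis_at_def Let_def)
  have "\<forall>j. \<exists>l. linear l \<and> (\<forall>i<length es. j < length es \<longrightarrow> l ((es ! i) y) = (if i = j then 1 else 0::real))"
  proof
    fix j
    obtain l :: "'v \<Rightarrow> real" where l: "linear l"
      "\<forall>v\<in>set (map (\<lambda>e. e y) es). l v = (if v = (es ! j) y then 1 else 0)"
      using linear_independent_extend[OF by'(2), of "\<lambda>v. if v = (es ! j) y then 1 else 0"] by blast
    have "l ((es ! i) y) = (if i = j then 1 else 0)" if "i < length es" "j < length es" for i
      using l(2) that by'(1) nth_eq_iff_index_eq[OF by'(1), of i j] by (auto split: if_splits)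
    then show "\<exists>l. linear l \<and> (\<forall>i<length es. j < length es \<longrightarrow> l ((es ! i) y) = (if i = j then 1 else 0::real))"
      using l(1) by blast
  qed
  then obtain l where l: "\<And>j. linear (l j)" "\<And>i j. i < length es \<Longrightarrow> j < length es \<Longrightarrow> l j ((es ! i) y) = (if i
    = j then 1 else 0::real)"
    by metis
  define D where "D k j = l j ((fs ! k) y)" for k j
  define g where "g j i x = (\<Sum>k<length fs. G i k x * D k j)" for j i x
  have gy: "g j i y = (if j = i then 1 else 0)" if "i < length es" "j < length es" for i j
  proof -
    have "l j ((es ! i) y) = g j i y"
      unfolding G(2)[OF that(1) f(2)] comb_def g_def D_def
      by (simp add: linear_sum[OF l(1)] linear_scale[OF l(1)])
    then show ?thesis using l(2) that by auto
  qed
  have sg: "smooth_fun_on M W (g j i)" if "i < length es" for i j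
    unfolding g_def[abs_def] by (intro smooth_fun_on_sum smooth_fun_on_mult smooth_fun_on_const W G) (use
      that in auto)
  have "\<exists>N' h. open N' \<and> y \<in> N' \<and> N' \<subseteq> W \<and> (\<forall>i\<in>{..<length es}. \<forall>j\<in>{..<length es}. smooth_fun_on M N' (h i j)) \<and>
      (\<forall>x\<in>N'. \<forall>i\<in>{..<length es}. \<forall>j\<in>{..<length es}. (\<Sum>k\<in>{..<length es}. h i k x * g k j x) = (if i = j then
        1 else 0))"
    by (rule smooth_matrix_inverse[OF _ W f(2)]) (use sg gy in auto)
  then obtain N' h where N': "open N'" "y \<in> N'" "N' \<subseteq> W"
    and h0: "\<forall>i\<in>{..<length es}. \<forall>j\<in>{..<length es}. smooth_fun_on M N' (h i j)"
      "\<forall>x\<in>N'. \<forall>i\<in>{..<length es}. \<forall>j\<in>{..<length es}. (\<Sum>k\<in>{..<length es}. h i k x * g k j x) = (if i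
        = j then 1 else 0)"
    by blast
  have h: "i < length es \<Longrightarrow> j < length es \<Longrightarrow> smooth_fun_on M N' (h i j)"
    "x \<in> N' \<Longrightarrow> i < length es \<Longrightarrow> j < length es \<Longrightarrow> (\<Sum>k<length es. h i k x * g k j x) = (if i = j then 1 else 0)"
      for i j x
    using h0 by simp_all
  define c where "c i x = (\<Sum>j<length es. h i j x * (\<Sum>k<length fs. m k x * D k j))" for i x
  have "\<mu> x = comb es (\<lambda>i. c i x) x" if x: "x \<in> N'" for x
  proof -
    have xW: "x \<in> W" "x \<in> U" using x N' f by auto
    \<comment> \<open>The pointwise coefficients \<open>a\<close> solve a linear system with matrix
      \<open>g\<close>, so applying the smooth left inverse \<open>h\<close> identifies them with
      the smooth functions \<open>c\<close>.\<close>
    obtain a where a: "\<mu> x = comb es a x" using basis_at_expand[OF b \<mu>(2)] xW by blast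
    have "comb fs (\<lambda>k. m k x) x = comb fs (\<lambda>k. \<Sum>i<length es. a i * G i k x) x"
      using a m(2)[OF xW(1)] G(2)[OF _ xW(1)] by (simp add: comb_sum comb_scale) (simp add: comb_def[of es])
    then have mk: "m k x = (\<Sum>i<length es. a i * G i k x)" if "k < length fs" for k
      using basis_at_unique[OF framed_basis[OF f(1) xW(1)]] that by blast
    have "c i x = a i" if i: "i < length es" for i
    proof -
      have "(\<Sum>k<length fs. m k x * D k j) = (\<Sum>n<length es. a n * g j n x)" for j
      proof -
        have "(\<Sum>k<length fs. m k x * D k j) = (\<Sum>k<length fs. \<Sum>n<length es. a n * G n k x * D k j)"
          by (simp add: mk sum_distrib_right)
        also have "\<dots> = (\<Sum>n<length es. \<Sum>k<length fs. a n * G n k x * D k j)" by (rule sum.swap)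
        finally show ?thesis by (simp add: g_def sum_distrib_left mult.assoc)
      qed
      then have "c i x = (\<Sum>j<length es. \<Sum>n<length es. a n * (h i j x * g j n x))"
        by (simp add: c_def sum_distrib_left mult_ac)
      also have "\<dots> = (\<Sum>n<length es. a n * (\<Sum>j<length es. h i j x * g j n x))"
        by (subst sum.swap) (simp add: sum_distrib_left)
      also have "\<dots> = (\<Sum>n<length es. if n = i then a n else 0)"
        by (intro sum.cong refl) (use h(2)[OF x i] in auto)
      finally show ?thesis using i by simp
    qed
    then show ?thesis unfolding a by (intro comb_cong) simp
  qed
  moreover have "smooth_fun_on M N' (c i)" if "i < length es" for i
    unfolding c_def[abs_def]
    by (intro smooth_fun_on_sum smooth_fun_on_mult smooth_fun_on_const smooth_fun_on_subset[OF m(1) N'(3)] h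
      N') (use that in auto)
  ultimately have "smooth_in_frame M es N' \<mu>" unfolding smooth_in_frame_iff by (intro exI[of _ c]) auto
  then show "\<exists>T. open T \<and> y \<in> T \<and> smooth_in_frame M es (T \<inter> U) \<mu>"
    using N' by (intro exI[of _ N']) (auto intro: smooth_in_frame_subset)
qed

end

section \<open>Representations of transitive Lie algebroids\<close>

lemma sum_fun_apply: "(\<Sum>i\<in>I. g i) y = (\<Sum>i\<in>I. g i y :: 'b::comm_monoid_add)"
  by (induction I rule: infinite_finite_induct) auto

section \<open>Symmetry of second derivatives\<close>

lemma smooth_on_line_deriv:
  fixes g :: "'h::real_normed_vector \<Rightarrow> real"
  assumes "smooth_on S g" "p + r *\<^sub>R u \<in> S"
  shows "((\<lambda>r. g (p + r *\<^sub>R u)) has_real_derivative frechet_derivative g (at (p + r *\<^sub>R u)) u) (at r)"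
proof -
  have d: "(g has_derivative frechet_derivative g (at (p + r *\<^sub>R u))) (at (p + r *\<^sub>R u))"
    by (rule smooth_on_differentiable[OF assms])
  have "((\<lambda>r. p + r *\<^sub>R u) has_derivative (\<lambda>s. s *\<^sub>R u)) (at r)"
    by (auto intro!: derivative_eq_intros)
  from has_derivative_compose[OF this d] show ?thesis
    unfolding has_field_derivative_def
    by (rule has_derivative_eq_rhs) (simp add: fun_eq_iff linear_scale[OF has_derivative_linear[OF d]]
      mult.commute)
qed

text \<open>The mean value theorem is used twice: in direction \<open>u\<close> for the difference
  of two translates, then in direction \<open>v\<close>.\<close>

lemma second_difference:
  fixes g :: "'h::real_normed_vector \<Rightarrow> real"
  assumes g: "smooth_on S g" and t: "t > 0"
    and S: "\<And>r s. 0 \<le> r \<Longrightarrow> r \<le> t \<Longrightarrow> 0 \<le> s \<Longrightarrow> s \<le> t \<Longrightarrow> x + r *\<^sub>R u + s *\<^sub>R v \<in> S"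
  shows "\<exists>r s. 0 < r \<and> r < t \<and> 0 < s \<and> s < t \<and>
    g (x + t *\<^sub>R u + t *\<^sub>R v) - g (x + t *\<^sub>R u) - g (x + t *\<^sub>R v) + g x =
    t * (t * frechet_derivative (\<lambda>y. frechet_derivative g (at y) u) (at (x + r *\<^sub>R u + s *\<^sub>R v)) v)"
proof -
  let ?u = "\<lambda>y. frechet_derivative g (at y) u"
  have u: "smooth_on S ?u" by (rule smooth_on_derivative[OF g])
  have "((\<lambda>r. g ((x + t *\<^sub>R v) + r *\<^sub>R u) - g (x + r *\<^sub>R u)) has_real_derivative
      ?u ((x + t *\<^sub>R v) + r *\<^sub>R u) - ?u (x + r *\<^sub>R u)) (at r)" if "0 \<le> r" "r \<le> t" for r
    using S[of r t] S[of r 0] that t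
    by (intro DERIV_diff smooth_on_line_deriv[OF g]) (auto simp: algebra_simps)
  from MVT2[OF t this] obtain r where r: "0 < r" "r < t" and
    1: "g ((x + t *\<^sub>R v) + t *\<^sub>R u) - g (x + t *\<^sub>R u) - (g (x + t *\<^sub>R v) - g x) =
      t * (?u ((x + t *\<^sub>R v) + r *\<^sub>R u) - ?u (x + r *\<^sub>R u))" by auto
  have "((\<lambda>s. ?u ((x + r *\<^sub>R u) + s *\<^sub>R v)) has_real_derivative
      frechet_derivative ?u (at ((x + r *\<^sub>R u) + s *\<^sub>R v)) v) (at s)" if "0 \<le> s" "s \<le> t" for s
    using S[of r s] that r by (intro smooth_on_line_deriv[OF u]) auto
  from MVT2[OF t this] obtain s where s: "0 < s" "s < t" and
    2: "?u ((x + r *\<^sub>R u) + t *\<^sub>R v) - ?u (x + r *\<^sub>R u)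
      = t * frechet_derivative ?u (at ((x + r *\<^sub>R u) + s *\<^sub>R v)) v"
    by auto
  show ?thesis
    by (rule exI[of _ r], rule exI[of _ s]) (use r s 1 2 in \<open>auto simp: algebra_simps\<close>)
qed

lemma divide_double_times: "(c::real) \<noteq> 0 \<Longrightarrow> d / (2 * c) * c = d / 2"
  by simp

text \<open>The second difference is symmetric in \<open>u\<close> and \<open>v\<close>, and after
  division by the square of \<open>t\<close> it approaches either mixed derivative. This is what
  makes coordinate fields commute.\<close>

lemma smooth_on_symmetric:
  fixes g :: "'h::real_normed_vector \<Rightarrow> real"
  assumes g: "smooth_on S g" and S: "open S" "x \<in> S"
  shows "frechet_derivative (\<lambda>y. frechet_derivative g (at y) u) (at x) v =
    frechet_derivative (\<lambda>y. frechet_derivative g (at y) v) (at x) u"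
proof -
  let ?D = "\<lambda>u v y. frechet_derivative (\<lambda>y. frechet_derivative g (at y) u) (at y) v"
  have c: "isCont (?D u v) x" for u v
    using smooth_on_continuous[OF smooth_on_derivative[OF smooth_on_derivative[OF g]]] S
    by (simp add: continuous_on_eq_continuous_at)
  have "\<bar>?D u v x - ?D v u x\<bar> \<le> e" if e: "e > 0" for e
  proof -
    obtain d1 where d1: "d1 > 0" "\<And>y. dist y x < d1 \<Longrightarrow> \<bar>?D u v y - ?D u v x\<bar> < e / 2"
      using c[of u v] e unfolding continuous_at_eps_delta dist_real_def by (metis half_gt_zero)
    obtain d2 where d2: "d2 > 0" "\<And>y. dist y x < d2 \<Longrightarrow> \<bar>?D v u y - ?D v u x\<bar> < e / 2"
      using c[of v u] e unfolding continuous_at_eps_delta dist_real_def by (metis half_gt_zero)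
    obtain d3 where d3: "d3 > 0" "ball x d3 \<subseteq> S" using S by (meson openE)
    define d where "d = min d1 (min d2 d3)"
    have d: "d > 0" using d1 d2 d3 by (simp add: d_def)
    \<comment> \<open>With this \<open>t\<close> all points of the parallelogram spanned by the
      multiples of \<open>u\<close> and \<open>v\<close> stay within \<open>d / 2\<close> of
      \<open>x\<close>.\<close>
    define t where "t = d / (2 * (norm u + norm v + 1))"
    have nz: "norm u + norm v + 1 > 0" by (simp add: add_nonneg_pos)
    have t: "t > 0" using d nz by (simp add: t_def)
    have near: "dist (x + r *\<^sub>R a + s *\<^sub>R b) x < d"
      if "0 \<le> r" "r \<le> t" "0 \<le> s" "s \<le> t" "norm a + norm b \<le> norm u + norm v" for r s a b
    proof -
      have "dist (x + r *\<^sub>R a + s *\<^sub>R b) x \<le> norm (r *\<^sub>R a) + norm (s *\<^sub>R b)"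
        by (simp add: dist_norm add.assoc norm_triangle_ineq del: norm_scaleR)
      also have "\<dots> \<le> t * norm a + t * norm b" using that by (auto intro!: add_mono mult_right_mono)
      also have "\<dots> = t * (norm a + norm b)" by (simp add: algebra_simps)
      also have "\<dots> \<le> t * (norm u + norm v + 1)" using that t by (intro mult_left_mono) auto
      also have "\<dots> = d / 2"
        unfolding t_def by (rule divide_double_times) (use nz in auto)
      finally show ?thesis using d by simp
    qed
    have 1: "x + r *\<^sub>R u + s *\<^sub>R v \<in> S" "x + r *\<^sub>R v + s *\<^sub>R u \<in> S" if "0 \<le> r" "r \<le> t" "0 \<le> s" "s \<le> t" for r s
      using near[OF that, of u v] near[OF that, of v u] d3(2) by (auto simp: d_def dist_commute subset_iff)
    obtain r s where rs: "0 < r" "r < t" "0 < s" "s < t"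
      "g (x + t *\<^sub>R u + t *\<^sub>R v) - g (x + t *\<^sub>R u) - g (x + t *\<^sub>R v) + g x
        = t * (t * ?D u v (x + r *\<^sub>R u + s *\<^sub>R v))"
      using second_difference[OF g t 1(1)] by blast
    obtain r' s' where rs': "0 < r'" "r' < t" "0 < s'" "s' < t"
      "g (x + t *\<^sub>R v + t *\<^sub>R u) - g (x + t *\<^sub>R v) - g (x + t *\<^sub>R u) + g x
        = t * (t * ?D v u (x + r' *\<^sub>R v + s' *\<^sub>R u))"
      using second_difference[OF g t 1(2)] by blast
    have comm: "x + t *\<^sub>R v + t *\<^sub>R u = x + t *\<^sub>R u + t *\<^sub>R v" by (simp add: ac_simps)
    have "t * (t * ?D u v (x + r *\<^sub>R u + s *\<^sub>R v)) = t * (t * ?D v u (x + r' *\<^sub>R v + s' *\<^sub>R u))"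
      using rs(5) rs'(5) unfolding comm by linarith
    then have "?D u v (x + r *\<^sub>R u + s *\<^sub>R v) = ?D v u (x + r' *\<^sub>R v + s' *\<^sub>R u)"
      using t by simp
    moreover have "\<bar>?D u v (x + r *\<^sub>R u + s *\<^sub>R v) - ?D u v x\<bar> < e / 2"
      using near[of r s u v] rs(1-4) by (intro d1(2)) (simp add: d_def)
    moreover have "\<bar>?D v u (x + r' *\<^sub>R v + s' *\<^sub>R u) - ?D v u x\<bar> < e / 2"
      using near[of r' s' v u] rs'(1-4) by (intro d2(2)) (simp add: d_def)
    ultimately show ?thesis by linarith
  qed
  from this[of "\<bar>?D u v x - ?D v u x\<bar> / 2"] show ?thesis
    by (cases "?D u v x = ?D v u x") simp_all
qed

section \<open>Rules for the anchor and the representation\<close>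

locale trans_rep = mfd M for M :: "('m::{t2_space,second_countable_topology}, 'h::real_inner) atlas" +
  fixes \<A> :: "('m, 'a::real_vector) algebroid" and F :: "('m, 'v::real_vector) vbundle"
    and \<LL> :: "'m \<Rightarrow> 'a \<Rightarrow> ('m \<Rightarrow> 'v) \<Rightarrow> 'v"
  assumes trans: "transitive_algebroid M \<A>" and vbF: "vector_bundle M F" and rep: "algebroid_rep M \<A> F \<LL>"
begin

lemma lie: "lie_algebroid M \<A>" using trans by (simp add: transitive_algebroid_def)

sublocale A: vb M \<A> using lie by unfold_locales (simp add: lie_algebroid_def)
sublocale F: vb M F using vbF by unfold_locales

abbreviation rho :: "'m \<Rightarrow> 'a \<Rightarrow> 'm tangent" where "rho \<equiv> anchor \<A>"

lemma rho_tangent: "a \<in> fibre \<A> x \<Longrightarrow> rho x a \<in> tangent_space M x"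
  using trans unfolding transitive_algebroid_def by blast

lemma rho_surj: assumes "X \<in> tangent_space M x" obtains a where "a \<in> fibre \<A> x" "rho x a = X"
proof -
  have "X \<in> rho x ` fibre \<A> x" using trans assms unfolding transitive_algebroid_def by simp
  then show thesis using that by blast
qed

lemma rho_linear:
  "a \<in> fibre \<A> x \<Longrightarrow> b \<in> fibre \<A> x \<Longrightarrow> rho x (a + b) = rho x a + rho x b"
  "a \<in> fibre \<A> x \<Longrightarrow> rho x (c *\<^sub>R a) = c *\<^sub>R rho x a"
proof -
  have "bundle_map M \<A> (tangent_bundle M) rho" using lie unfolding lie_algebroid_def by (elim conjE)
  then have "linear_between (fibre \<A> x) (fibre (tangent_bundle M) x) (rho x)" unfolding bundle_map_def by simp
  then show "a \<in> fibre \<A> x \<Longrightarrow> b \<in> fibre \<A> x \<Longrightarrow> rho x (a + b) = rho x a + rho x b"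
    "a \<in> fibre \<A> x \<Longrightarrow> rho x (c *\<^sub>R a) = c *\<^sub>R rho x a"
    unfolding linear_between_def by simp_all
qed

lemma rho_zero: "rho x 0 = 0"
  using rho_linear(2)[OF A.fibre_ops(1), of x 0] by simp

lemma rho_sum: "(\<And>i. i \<in> I \<Longrightarrow> s i \<in> fibre \<A> x) \<Longrightarrow> rho x (sum s I) = (\<Sum>i\<in>I. rho x (s i))"
  by (induction I rule: infinite_finite_induct) (auto simp: rho_zero rho_linear A.fibre_ops(5))

lemma rho_diff: "a \<in> fibre \<A> x \<Longrightarrow> b \<in> fibre \<A> x \<Longrightarrow> rho x (a - b) = rho x a - rho x b"
  using rho_linear(1)[of a x "(-1) *\<^sub>R b"] rho_linear(2)[of b x "-1"] A.fibre_ops(3)[of b x "-1"] by simp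

lemma sec_bracket: "A \<in> sections M \<A> \<Longrightarrow> B \<in> sections M \<A> \<Longrightarrow> bracket \<A> A B \<in> sections M \<A>"
  using lie unfolding lie_algebroid_def linear_between_def by blast

lemma rho_bracket:
  assumes "A \<in> sections M \<A>" "B \<in> sections M \<A>"
  shows "rho x (bracket \<A> A B x) = lie_bracket (\<lambda>x. rho x (A x)) (\<lambda>x. rho x (B x)) x"
proof -
  have "(\<lambda>x. rho x (bracket \<A> A B x)) = lie_bracket (\<lambda>x. rho x (A x)) (\<lambda>x. rho x (B x))"
    using lie assms unfolding lie_algebroid_def by blast
  then show ?thesis by (rule fun_cong)
qed

lemma L_linear_between: "linear_between (fibre \<A> x) (CDO M F x) (\<LL> x)"
  using rep unfolding algebroid_rep_def by blast

lemma L_a_add: "a \<in> fibre \<A> x \<Longrightarrow> b \<in> fibre \<A> x \<Longrightarrow> \<LL> x (a + b) \<mu> = \<LL> x a \<mu> + \<LL> x b \<mu>"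
  and L_a_scale: "a \<in> fibre \<A> x \<Longrightarrow> \<LL> x (c *\<^sub>R a) \<mu> = c *\<^sub>R \<LL> x a \<mu>"
  using L_linear_between[of x] unfolding linear_between_def by (auto simp: scaleR_fun_def)

lemma L_a_zero: "\<LL> x 0 \<mu> = 0"
  using L_a_scale[OF A.fibre_ops(1), of x 0] by simp

lemma L_a_sum: "(\<And>i. i \<in> I \<Longrightarrow> s i \<in> fibre \<A> x) \<Longrightarrow> \<LL> x (sum s I) \<mu> = (\<Sum>i\<in>I. \<LL> x (s i) \<mu>)"
  by (induction I rule: infinite_finite_induct) (auto simp: L_a_zero L_a_add A.fibre_ops(5))

lemma L_CDO: "a \<in> fibre \<A> x \<Longrightarrow> \<LL> x a \<in> CDO M F x"
  using L_linear_between[of x] unfolding linear_between_def by blast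

lemma L_fibre: "a \<in> fibre \<A> x \<Longrightarrow> \<mu> \<in> sections M F \<Longrightarrow> \<LL> x a \<mu> \<in> fibre F x"
  using L_CDO[of a x] unfolding CDO_def linear_between_def by blast

lemma L_add: "a \<in> fibre \<A> x \<Longrightarrow> \<mu> \<in> sections M F \<Longrightarrow> \<nu> \<in> sections M F \<Longrightarrow>
    \<LL> x a (\<lambda>y. \<mu> y + \<nu> y) = \<LL> x a \<mu> + \<LL> x a \<nu>"
  using L_CDO[of a x] unfolding CDO_def linear_between_def plus_fun_def by blast

lemma L_scale: "a \<in> fibre \<A> x \<Longrightarrow> \<mu> \<in> sections M F \<Longrightarrow> \<LL> x a (\<lambda>y. c *\<^sub>R \<mu> y) = c *\<^sub>R \<LL> x a \<mu>"
  using L_CDO[of a x] unfolding CDO_def linear_between_def scaleR_fun_def by blast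

lemma L_leibniz: "a \<in> fibre \<A> x \<Longrightarrow> f \<in> Cinf M \<Longrightarrow> \<mu> \<in> sections M F \<Longrightarrow>
    \<LL> x a (\<lambda>y. f y *\<^sub>R \<mu> y) = rho x a f *\<^sub>R \<mu> x + f x *\<^sub>R \<LL> x a \<mu>"
  using rep unfolding algebroid_rep_def is_symbol_def by blast

lemma L_sec: "A \<in> sections M \<A> \<Longrightarrow> \<mu> \<in> sections M F \<Longrightarrow> (\<lambda>x. \<LL> x (A x) \<mu>) \<in> sections M F"
  using rep unfolding algebroid_rep_def by blast

lemma L_bracket: "A \<in> sections M \<A> \<Longrightarrow> B \<in> sections M \<A> \<Longrightarrow> \<mu> \<in> sections M F \<Longrightarrow>
    \<LL> x (bracket \<A> A B x) \<mu> = \<LL> x (A x) (\<lambda>y. \<LL> y (B y) \<mu>) - \<LL> x (B x) (\<lambda>y. \<LL> y (A y) \<mu>)"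
  using rep unfolding algebroid_rep_def by blast

lemma L_zero: "a \<in> fibre \<A> x \<Longrightarrow> \<LL> x a (\<lambda>y. 0) = 0"
  using L_scale[OF _ F.sec_zero, of a x 0] by simp

lemma L_diff: "a \<in> fibre \<A> x \<Longrightarrow> \<mu> \<in> sections M F \<Longrightarrow> \<nu> \<in> sections M F \<Longrightarrow>
    \<LL> x a (\<lambda>y. \<mu> y - \<nu> y) = \<LL> x a \<mu> - \<LL> x a \<nu>"
  using L_add[of a x \<mu> "\<lambda>y. (-1) *\<^sub>R \<nu> y"] L_scale[of a x \<nu> "-1"] F.sec_mult[OF Cinf_const, of \<nu> "-1"] by simp

lemma L_sum: "a \<in> fibre \<A> x \<Longrightarrow> (\<And>i. i \<in> I \<Longrightarrow> s i \<in> sections M F) \<Longrightarrow>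
    \<LL> x a (\<lambda>y. \<Sum>i\<in>I. s i y) = (\<Sum>i\<in>I. \<LL> x a (s i))"
  by (induction I rule: infinite_finite_induct) (auto simp: L_zero L_add F.sec_sum)

lemma L_comb:
  assumes "a \<in> fibre \<A> x" "\<And>i. i < length es \<Longrightarrow> es ! i \<in> sections M F" "\<And>i. i < length es \<Longrightarrow> c i \<in> Cinf M"
  shows "\<LL> x a (\<lambda>y. comb es (\<lambda>i. c i y) y) =
    comb es (\<lambda>i. rho x a (c i)) x + (\<Sum>i<length es. c i x *\<^sub>R \<LL> x a (es ! i))"
proof -
  have "\<LL> x a (\<lambda>y. \<Sum>i<length es. c i y *\<^sub>R (es ! i) y) = (\<Sum>i<length es. \<LL> x a (\<lambda>y. c i y *\<^sub>R (es ! i) y))"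
    using assms by (intro L_sum F.sec_mult) auto
  then show ?thesis unfolding comb_def using assms by (simp add: L_leibniz sum.distrib)
qed

lemma L_local:
  assumes a: "a \<in> fibre \<A> x" and s: "\<mu> \<in> sections M F" "\<nu> \<in> sections M F"
    and N: "open N" "x \<in> N" "\<And>y. y \<in> N \<Longrightarrow> \<mu> y = \<nu> y"
  shows "\<LL> x a \<mu> = \<LL> x a \<nu>"
proof (rule bump[OF N(1,2)])
  fix \<beta> N' C assume *: "\<beta> \<in> Cinf M" "open N'" "x \<in> N'" "N' \<subseteq> N" "\<And>x. x \<in> N' \<Longrightarrow> \<beta> x = 1"
    "closed C" "C \<subseteq> N" "\<And>x. x \<notin> C \<Longrightarrow> \<beta> x = 0"
  have "(\<lambda>y. \<beta> y *\<^sub>R \<mu> y) = (\<lambda>y. \<beta> y *\<^sub>R \<nu> y)" using * N(3) by (metis scale_eq_0_iff subsetD)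
  then have "rho x a \<beta> *\<^sub>R \<mu> x + \<beta> x *\<^sub>R \<LL> x a \<mu> = rho x a \<beta> *\<^sub>R \<nu> x + \<beta> x *\<^sub>R \<LL> x a \<nu>"
    using L_leibniz[OF a *(1) s(1)] L_leibniz[OF a *(1) s(2)] by simp
  then show ?thesis using *(3,5) N by simp
qed

lemma adjoint_iff: "u \<in> adjoint_fibre \<A> x \<longleftrightarrow> u \<in> fibre \<A> x \<and> rho x u = 0"
  by (simp add: adjoint_fibre_def)

text \<open>For zero anchor the Leibniz rule has no derivative term, so \<open>\<LL> x u\<close> is
  linear over functions; expanded in a frame, \<open>\<mu>\<close> has coefficients that vanish at
  \<open>x\<close>. This makes the isotropy action well defined.\<close>

lemma L_adjoint_zero:
  assumes u: "u \<in> adjoint_fibre \<A> x" and \<mu>: "\<mu> \<in> sections M F" "\<mu> x = 0"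
  shows "\<LL> x u \<mu> = 0"
proof -
  have u': "u \<in> fibre \<A> x" "rho x u = 0" using u by (auto simp: adjoint_iff)
  obtain W es where f: "F.framed W es" "x \<in> W" by (rule F.framed_exists[OF open_UNIV UNIV_I])
  have W: "open W" using f(1) by (simp add: F.framed_def)
  obtain c T where c: "\<And>i. i < length es \<Longrightarrow> c i \<in> Cinf M" "open T" "x \<in> T" "T \<subseteq> W"
    "\<And>y. y \<in> T \<Longrightarrow> \<mu> y = comb es (\<lambda>i. c i y) y"
    using F.frame_expand_Cinf[OF f(1) W order_refl F.sec_on[OF \<mu>(1)] f(2)] by blast
  have es: "\<And>i. i < length es \<Longrightarrow> es ! i \<in> sections M F" using F.framed_sec[OF f(1)] .
  have c0: "c i x = 0" if "i < length es" for i
    using basis_at_unique[OF F.framed_basis[OF f], of "\<lambda>i. c i x" "\<lambda>i. 0"] c(5)[OF c(3)] \<mu>(2) that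
    by (simp add: comb_def)
  have "(\<lambda>y. comb es (\<lambda>i. c i y) y) \<in> sections M F"
    unfolding comb_def by (intro F.sec_sum F.sec_mult) (use es c in auto)
  then have "\<LL> x u \<mu> = \<LL> x u (\<lambda>y. comb es (\<lambda>i. c i y) y)"
    by (rule L_local[OF u'(1) \<mu>(1) _ c(2,3,5)])
  also have "\<dots> = 0"
    using L_comb[OF u'(1) es c(1)] c0 by (simp add: u'(2) comb_def)
  finally show ?thesis .
qed

lemma L_adjoint_pointwise:
  assumes u: "u \<in> adjoint_fibre \<A> x" and s: "\<mu> \<in> sections M F" "\<nu> \<in> sections M F" "\<mu> x = \<nu> x"
  shows "\<LL> x u \<mu> = \<LL> x u \<nu>"
proof -
  have "\<LL> x u (\<lambda>y. \<mu> y - \<nu> y) = 0" using L_adjoint_zero[OF u F.sec_diff[OF s(1,2)]] s(3) by simp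
  then show ?thesis using L_diff[of u x] u s by (simp add: adjoint_iff)
qed

abbreviation iso :: "'m \<Rightarrow> 'a \<Rightarrow> 'v \<Rightarrow> 'v" where "iso \<equiv> isotropy_action M F \<LL>"

lemma iso_eq:
  assumes u: "u \<in> adjoint_fibre \<A> x" and s: "\<mu> \<in> sections M F"
  shows "iso x u (\<mu> x) = \<LL> x u \<mu>"
  unfolding isotropy_action_def
proof (rule the_equality)
  show "\<forall>\<nu>\<in>sections M F. \<nu> x = \<mu> x \<longrightarrow> \<LL> x u \<nu> = \<LL> x u \<mu>"
    using L_adjoint_pointwise[OF u _ s] by blast
qed (use s in blast)

lemma iso_sum:
  assumes u: "u \<in> adjoint_fibre \<A> x" and v: "\<And>i. i \<in> I \<Longrightarrow> v i \<in> fibre F x"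
  shows "iso x u (\<Sum>i\<in>I. w i *\<^sub>R v i) = (\<Sum>i\<in>I. w i *\<^sub>R iso x u (v i))"
proof -
  have "\<forall>i\<in>I. \<exists>s. s \<in> sections M F \<and> s x = v i" using v F.fibre_extend by metis
  from bchoice[OF this] obtain s where s: "\<And>i. i \<in> I \<Longrightarrow> s i \<in> sections M F" "\<And>i. i \<in> I \<Longrightarrow> s i x = v i" by blast
  have u': "u \<in> fibre \<A> x" using u by (simp add: adjoint_iff)
  have sc: "\<And>i. i \<in> I \<Longrightarrow> (\<lambda>y. w i *\<^sub>R s i y) \<in> sections M F" by (intro F.sec_mult Cinf_const s)
  have "iso x u (\<Sum>i\<in>I. w i *\<^sub>R v i) = iso x u ((\<lambda>y. \<Sum>i\<in>I. w i *\<^sub>R s i y) x)" using s by simp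
  also have "\<dots> = \<LL> x u (\<lambda>y. \<Sum>i\<in>I. w i *\<^sub>R s i y)" by (intro iso_eq u F.sec_sum sc)
  also have "\<dots> = (\<Sum>i\<in>I. w i *\<^sub>R \<LL> x u (s i))"
    using L_sum[OF u', of I "\<lambda>i y. w i *\<^sub>R s i y"] sc s by (simp add: L_scale[OF u'])
  also have "\<dots> = (\<Sum>i\<in>I. w i *\<^sub>R iso x u (v i))" using s iso_eq[OF u s(1)] by auto
  finally show ?thesis .
qed

lemma coord_independent:
  assumes c: "(U, \<phi>) \<in> M" "x \<in> U" and 0: "(\<Sum>b\<in>bas. k b *\<^sub>R coord_field M (U, \<phi>) b x)
    = (\<Sum>b\<in>bas. k' b *\<^sub>R coord_field M (U, \<phi>) b x)" "a \<in> bas"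
  shows "k a = k' a"
proof -
  obtain f where f: "f \<in> Cinf M" "\<And>b. b \<in> bas \<Longrightarrow> coord_field M (U, \<phi>) b x f = (if b = a then 1 else 0)"
    using coord_dual[OF c 0(2)] by blast
  have "(\<Sum>b\<in>bas. k b *\<^sub>R coord_field M (U, \<phi>) b x) f = k a" for k
  proof -
    have "(\<Sum>b\<in>bas. k b *\<^sub>R coord_field M (U, \<phi>) b x) f = (\<Sum>b\<in>bas. (k b *\<^sub>R coord_field M (U, \<phi>) b x) f)"
      by (rule sum_fun_apply)
    also have "\<dots> = (\<Sum>b\<in>bas. if b = a then k b else 0)"
      by (intro sum.cong) (auto simp: scaleR_fun_def f)
    finally show ?thesis using 0(2) finite_bas by simp
  qed
  from this[of k] this[of k'] show ?thesis unfolding 0(1) by simp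
qed

lemma coord_list: obtains bs where "set bs = bas" "distinct bs"
  using finite_bas finite_distinct_list by blast

lemma smooth_in_coord_frame:
  assumes c: "(U, \<phi>) \<in> M" and s: "smooth_section_on M (tangent_bundle M) W X"
  obtains k where "\<And>b. b \<in> bas \<Longrightarrow> smooth_fun_on M (U \<inter> W) (k b)"
    "\<And>x. x \<in> U \<inter> W \<Longrightarrow> X x = (\<Sum>b\<in>bas. k b x *\<^sub>R coord_field M (U, \<phi>) b x)"
proof -
  obtain bs where bs: "set bs = bas" "distinct bs" by (rule coord_list)
  have "(U, map (coord_field M (U, \<phi>)) bs) \<in> frames (tangent_bundle M)"
    using c bs onb_bas onb_independent[OF onb_bas] unfolding tangent_bundle_def onb_def
    by (simp, intro exI[of _ \<phi>] exI[of _ bs] conjI refl) simp_all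
  then have "smooth_in_frame M (map (coord_field M (U, \<phi>)) bs) (U \<inter> W) X"
    using s unfolding smooth_section_on_def by blast
  then obtain k where k: "\<And>i. i < length bs \<Longrightarrow> smooth_fun_on M (U \<inter> W) (k i)"
    "\<And>x. x \<in> U \<inter> W \<Longrightarrow> X x = (\<Sum>i<length bs. k i x *\<^sub>R coord_field M (U, \<phi>) (bs ! i) x)"
    unfolding smooth_in_frame_def by auto
  have bij: "bij_betw ((!) bs) {..<length bs} bas" using bij_betw_nth[OF bs(2)] bs(1) by blast
  define ix where "ix = inv_into {..<length bs} ((!) bs)"
  have ix: "ix (bs ! i) = i" if "i < length bs" for i
    using bij that unfolding ix_def bij_betw_def by (intro inv_into_f_f) auto
  have "ix b < length bs" if "b \<in> bas" for b
    using that bs(1) ix by (metis in_set_conv_nth)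
  moreover have "X x = (\<Sum>b\<in>bas. k (ix b) x *\<^sub>R coord_field M (U, \<phi>) b x)" if "x \<in> U \<inter> W" for x
    unfolding k(2)[OF that] sum.reindex_bij_betw[OF bij, symmetric] by (intro sum.cong) (auto simp: ix)
  ultimately show thesis using that[of "\<lambda>b. k (ix b)"] k(1) by blast
qed

end

section \<open>Local frames of a transitive Lie algebroid\<close>

text \<open>Near a point of the chart \<open>(U, \<phi>)\<close>: frames \<open>es\<close> of the algebroid and \<open>fs\<close> of \<open>F\<close>, lifts \<open>Bs b\<close>
  of the coordinate fields, and generators \<open>us j\<close> of the adjoint bundle.\<close>

locale local_data = trans_rep M \<A> F \<LL>
  for M :: "('m::{t2_space,second_countable_topology}, 'h::real_inner) atlas"
    and \<A> :: "('m, 'a::real_vector) algebroid" and F :: "('m, 'v::real_vector) vbundle" and \<LL> +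
  fixes U :: "'m set" and \<phi> :: "'m \<Rightarrow> 'h" and W :: "'m set" and es :: "('m \<Rightarrow> 'a) list" and fs :: "('m \<Rightarrow> 'v) list"
    and Bs :: "'h \<Rightarrow> 'm \<Rightarrow> 'a" and us :: "nat \<Rightarrow> 'm \<Rightarrow> 'a" and G :: "nat \<Rightarrow> 'h \<Rightarrow> 'm \<Rightarrow> real"
  assumes c: "(U, \<phi>) \<in> M" and WU: "W \<subseteq> U" and es: "A.framed W es" and fs: "F.framed W fs"
    and Bs: "\<And>b. b \<in> bas \<Longrightarrow> Bs b \<in> sections M \<A>"
      "\<And>b x. b \<in> bas \<Longrightarrow> x \<in> W \<Longrightarrow> rho x (Bs b x) = coord_field M (U, \<phi>) b x"
    and us: "\<And>j. j < length es \<Longrightarrow> us j \<in> sections M \<A>" "\<And>j x. j < length es \<Longrightarrow> x \<in> W \<Longrightarrow> rho x (us j x) = 0"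
    and G: "\<And>j b. j < length es \<Longrightarrow> b \<in> bas \<Longrightarrow> smooth_fun_on M W (G j b)"
    and es_eq: "\<And>j x. j < length es \<Longrightarrow> x \<in> W \<Longrightarrow> (es ! j) x = us j x + (\<Sum>b\<in>bas. G j b x *\<^sub>R Bs b x)"

context trans_rep
begin

text \<open>Lift the coordinate vectors at \<open>y\<close> and continue the lifts with constant
  coefficients. Their anchors form a matrix that is the identity at \<open>y\<close>; its inverse
  nearby corrects them to lifts of the coordinate fields. Subtracting such lifts from a frame leaves
  generators of the adjoint bundle.\<close>

lemma local_data_exists:
  assumes c: "(U, \<phi>) \<in> M" "y \<in> U" and N: "open N" "y \<in> N"
  obtains W es fs Bs us G where "local_data M \<A> F \<LL> U \<phi> W es fs Bs us G" "y \<in> W" "W \<subseteq> N"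
proof -
  have UN: "open (U \<inter> N)" "y \<in> U \<inter> N" using chart(1)[OF c(1)] c N by auto
  obtain V as where a: "(V, as) \<in> frames \<A>" "y \<in> V" by (rule A.frame_exists)
  have V: "open (V \<inter> (U \<inter> N))" "y \<in> V \<inter> (U \<inter> N)" using A.frame(1)[OF a(1)] a UN by auto
  obtain W1 es where es: "A.framed W1 es" "y \<in> W1" "W1 \<subseteq> V \<inter> (U \<inter> N)" by (rule A.framed_exists[OF V])
  have W1: "open W1" using es(1) by (simp add: A.framed_def)
  obtain W2 fs where fs: "F.framed W2 fs" "y \<in> W2" "W2 \<subseteq> W1" by (rule F.framed_exists[OF W1 es(2)])
  have W2: "open W2" using fs(1) by (simp add: F.framed_def)
  let ?cf = "\<lambda>b x. coord_field M (U, \<phi>) b x"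
  \<comment> \<open>\<open>bundle_map\<close> asserts smoothness for the frames of the bundle atlas.
    The anchor is therefore expanded on such a frame \<open>as\<close> and carried over to the
    global frame \<open>es\<close> afterwards.\<close>
  have "\<forall>k. \<exists>R. k < length as \<longrightarrow> (\<forall>b\<in>bas. smooth_fun_on M W2 (R b)) \<and>
      (\<forall>x\<in>W2. rho x ((as ! k) x) = (\<Sum>b\<in>bas. R b x *\<^sub>R ?cf b x))"
  proof (intro allI)
    fix k
    show "\<exists>R. k < length as \<longrightarrow> (\<forall>b\<in>bas. smooth_fun_on M W2 (R b)) \<and>
      (\<forall>x\<in>W2. rho x ((as ! k) x) = (\<Sum>b\<in>bas. R b x *\<^sub>R ?cf b x))"
    proof (cases "k < length as")
      case True
      have "bundle_map M \<A> (tangent_bundle M) rho" using lie unfolding lie_algebroid_def by (elim conjE)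
      then have "\<forall>(U, es)\<in>frames \<A>. \<forall>e\<in>set es. smooth_section_on M (tangent_bundle M) U (\<lambda>x. rho x (e x))"
        unfolding bundle_map_def by (elim conjE)
      then have "smooth_section_on M (tangent_bundle M) V (\<lambda>x. rho x ((as ! k) x))"
        using a(1) nth_mem[OF True] by fastforce
      from smooth_in_coord_frame[OF c(1) this] obtain R where
        "\<And>b. b \<in> bas \<Longrightarrow> smooth_fun_on M (U \<inter> V) (R b)"
        "\<And>x. x \<in> U \<inter> V \<Longrightarrow> rho x ((as ! k) x) = (\<Sum>b\<in>bas. R b x *\<^sub>R ?cf b x)" by blast
      moreover have "W2 \<subseteq> U \<inter> V" using fs(3) es(3) by blast
      ultimately show ?thesis by (intro exI[of _ R]) (use smooth_fun_on_subset in blast)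
    qed simp
  qed
  from choice[OF this] obtain R where R: "\<And>k b. k < length as \<Longrightarrow> b \<in> bas \<Longrightarrow> smooth_fun_on M W2 (R k b)"
      "\<And>k x. k < length as \<Longrightarrow> x \<in> W2 \<Longrightarrow> rho x ((as ! k) x) = (\<Sum>b\<in>bas. R k b x *\<^sub>R ?cf b x)" by blast
  have as_fibre: "(as ! k) x \<in> fibre \<A> x" if "x \<in> V" "k < length as" for k x
    using basis_at_comb[OF A.frame(2)[OF a(1) that(1)], of "\<lambda>i. if i = k then 1 else 0"] comb_unit[OF
      that(2)] by metis
  have es_fibre: "(es ! j) x \<in> fibre \<A> x" if "j < length es" for j x
    using A.sec_fibre[OF A.framed_sec[OF es(1) that]] .
  have "\<forall>j. \<exists>P. j < length es \<longrightarrow> (\<forall>b\<in>bas. smooth_fun_on M W2 (P b)) \<and>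
      (\<forall>x\<in>W2. rho x ((es ! j) x) = (\<Sum>b\<in>bas. P b x *\<^sub>R ?cf b x))"
  proof (intro allI)
    fix j
    show "\<exists>P. j < length es \<longrightarrow> (\<forall>b\<in>bas. smooth_fun_on M W2 (P b)) \<and>
      (\<forall>x\<in>W2. rho x ((es ! j) x) = (\<Sum>b\<in>bas. P b x *\<^sub>R ?cf b x))"
    proof (cases "j < length es")
      case True
      have "smooth_in_frame M as (V \<inter> UNIV) (es ! j)"
        by (rule A.smooth_section_onD(2)[OF A.sec_on[OF A.framed_sec[OF es(1) True]] a(1)])
      then obtain s where s: "\<And>k. k < length as \<Longrightarrow> smooth_fun_on M V (s k)" "\<And>x. x \<in> V \<Longrightarrow>
        (es ! j) x = comb as (\<lambda>k. s k x) x"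
        unfolding smooth_in_frame_iff by auto
      have VW: "W2 \<subseteq> V" using fs(3) es(3) by blast
      show ?thesis
      proof (intro exI[of _ "\<lambda>b x. \<Sum>k<length as. s k x * R k b x"] impI conjI ballI)
        fix b assume b: "b \<in> bas"
        show "smooth_fun_on M W2 (\<lambda>x. \<Sum>k<length as. s k x * R k b x)"
          by (intro smooth_fun_on_sum smooth_fun_on_mult W2 smooth_fun_on_subset[OF s(1) VW] R(1) b) auto
      next
        fix x assume x: "x \<in> W2"
        then have xV: "x \<in> V" using VW by blast
        have "rho x ((es ! j) x) = (\<Sum>k<length as. s k x *\<^sub>R rho x ((as ! k) x))"
          unfolding s(2)[OF xV] comb_def
          by (subst rho_sum) (auto intro!: A.fibre_ops as_fibre xV rho_linear(2) sum.cong)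
        also have "\<dots> = (\<Sum>k<length as. \<Sum>b\<in>bas. (s k x * R k b x) *\<^sub>R ?cf b x)"
          by (intro sum.cong refl) (simp add: R(2) x scaleR_sum_right)
        also have "\<dots> = (\<Sum>b\<in>bas. (\<Sum>k<length as. s k x * R k b x) *\<^sub>R ?cf b x)"
          by (subst sum.swap) (simp add: scaleR_sum_left)
        finally show "rho x ((es ! j) x) = (\<Sum>b\<in>bas. (\<Sum>k<length as. s k x * R k b x) *\<^sub>R ?cf b x)" .
      qed
    qed simp
  qed
  from choice[OF this] obtain P where P: "\<And>j b. j < length es \<Longrightarrow> b \<in> bas \<Longrightarrow> smooth_fun_on M W2 (P j b)"
      "\<And>j x. j < length es \<Longrightarrow> x \<in> W2 \<Longrightarrow> rho x ((es ! j) x) = (\<Sum>b\<in>bas. P j b x *\<^sub>R ?cf b x)" by blast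
  have rho_comb: "rho x (\<Sum>j<length es. k j *\<^sub>R (es ! j) x)
    = (\<Sum>b\<in>bas. (\<Sum>j<length es. k j * P j b x) *\<^sub>R ?cf b x)"
    if x: "x \<in> W2" for k x
  proof -
    have "rho x (\<Sum>j<length es. k j *\<^sub>R (es ! j) x) = (\<Sum>j<length es. k j *\<^sub>R rho x ((es ! j) x))"
      by (subst rho_sum) (auto intro!: A.fibre_ops es_fibre rho_linear(2) sum.cong)
    also have "\<dots> = (\<Sum>j<length es. \<Sum>b\<in>bas. (k j * P j b x) *\<^sub>R ?cf b x)"
      by (intro sum.cong refl) (simp add: P(2) x scaleR_sum_right)
    also have "\<dots> = (\<Sum>b\<in>bas. (\<Sum>j<length es. k j * P j b x) *\<^sub>R ?cf b x)"
      by (subst sum.swap) (simp add: scaleR_sum_left)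
    finally show ?thesis .
  qed
  \<comment> \<open>Transitivity enters here, at the single point \<open>y\<close>.\<close>
  have "\<forall>b\<in>bas. \<exists>d. ?cf b y = rho y (\<Sum>j<length es. d j *\<^sub>R (es ! j) y)"
  proof
    fix b assume "b \<in> bas"
    obtain a where a: "a \<in> fibre \<A> y" "rho y a = ?cf b y"
      by (rule rho_surj[OF coord_field_tangent[OF c]])
    obtain d where "a = comb es d y" by (rule basis_at_expand[OF A.framed_basis[OF es(1,2)] a(1)])
    then show "\<exists>d. ?cf b y = rho y (\<Sum>j<length es. d j *\<^sub>R (es ! j) y)" using a(2) unfolding comb_def by metis
  qed
  from bchoice[OF this] obtain d where d: "\<And>b. b \<in> bas \<Longrightarrow>
    ?cf b y = rho y (\<Sum>j<length es. d b j *\<^sub>R (es ! j) y)" by blast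
  define g where "g b b' x = (\<Sum>j<length es. d b j * P j b' x)" for b b' x
  have gy: "g b b' y = (if b = b' then 1 else 0)" if b: "b \<in> bas" "b' \<in> bas" for b b'
  proof -
    have "(\<Sum>b'\<in>bas. g b b' y *\<^sub>R ?cf b' y) = ?cf b y"
      unfolding d[OF b(1)] rho_comb[OF fs(2)] g_def ..
    also have "?cf b y = (\<Sum>b'\<in>bas. (if b' = b then 1 else 0) *\<^sub>R ?cf b' y)"
      using b finite_bas by (simp add: if_distrib[of "\<lambda>t. t *\<^sub>R _"] cong: if_cong)
    finally show ?thesis using coord_independent[OF c _ b(2), of "\<lambda>b'. g b b' y"
      "\<lambda>b'. if b' = b then 1 else 0"] by auto
  qed
  have gs: "smooth_fun_on M W2 (g b b')" if "b' \<in> bas" for b b'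
    unfolding g_def[abs_def]
    by (intro smooth_fun_on_sum smooth_fun_on_mult smooth_fun_on_const W2 P(1)) (use that in auto)
  have "\<exists>N' h. open N' \<and> y \<in> N' \<and> N' \<subseteq> W2 \<and> (\<forall>i\<in>bas. \<forall>j\<in>bas. smooth_fun_on M N' (h i j)) \<and>
      (\<forall>x\<in>N'. \<forall>i\<in>bas. \<forall>j\<in>bas. (\<Sum>k\<in>bas. h i k x * g k j x) = (if i = j then 1 else 0))"
    by (rule smooth_matrix_inverse[OF finite_bas W2 fs(2) gs gy])
  then obtain N' h where N': "open N'" "y \<in> N'" "N' \<subseteq> W2"
    and h: "\<And>i j. i \<in> bas \<Longrightarrow> j \<in> bas \<Longrightarrow> smooth_fun_on M N' (h i j)"
    "\<And>x i j. x \<in> N' \<Longrightarrow> i \<in> bas \<Longrightarrow> j \<in> bas \<Longrightarrow> (\<Sum>k\<in>bas. h i k x * g k j x) = (if i = j then 1 else 0)"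
    by blast
  define B0 where "B0 b x = (\<Sum>j<length es. (\<Sum>k\<in>bas. h b k x * d k j) *\<^sub>R (es ! j) x)" for b x
  have rB0: "rho x (B0 b x) = ?cf b x" if b: "b \<in> bas" and x: "x \<in> N'" for b x
  proof -
    have "rho x (B0 b x) = (\<Sum>b'\<in>bas. (\<Sum>j<length es. (\<Sum>k\<in>bas. h b k x * d k j) * P j b' x) *\<^sub>R ?cf b' x)"
      unfolding B0_def using x N' by (intro rho_comb) auto
    also have "\<dots> = (\<Sum>b'\<in>bas. (\<Sum>k\<in>bas. h b k x * g k b' x) *\<^sub>R ?cf b' x)"
      unfolding g_def sum_distrib_left sum_distrib_right by (subst sum.swap) (simp add: mult.assoc)
    also have "\<dots> = (\<Sum>b'\<in>bas. (if b' = b then 1 else 0) *\<^sub>R ?cf b' x)"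
      by (intro sum.cong refl) (use h(2)[OF x b] in auto)
    also have "\<dots> = ?cf b x" using b finite_bas by (simp add: if_distrib[of "\<lambda>t. t *\<^sub>R _"] cong: if_cong)
    finally show ?thesis .
  qed
  have sB0: "smooth_section_on M \<A> N' (B0 b)" if "b \<in> bas" for b
    unfolding B0_def[abs_def]
    by (intro A.smooth_section_on_sum A.smooth_section_on_mult smooth_fun_on_sum smooth_fun_on_mult
      smooth_fun_on_const
        N'(1) h(1) A.sec_on A.framed_sec[OF es(1)]) (use that in auto)
  \<comment> \<open>There are as many of these sections as the rank of the algebroid, so in general
    they generate the adjoint bundle redundantly.\<close>
  define u0 where "u0 j x = (es ! j) x - (\<Sum>b\<in>bas. P j b x *\<^sub>R B0 b x)" for j x
  have B0_fibre: "B0 b x \<in> fibre \<A> x" if "b \<in> bas" "x \<in> N'" for b x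
    using A.smooth_section_onD(1)[OF sB0] that by blast
  have ru0: "rho x (u0 j x) = 0" if j: "j < length es" and x: "x \<in> N'" for j x
  proof -
    have xW: "x \<in> W2" using x N' by blast
    have "rho x (u0 j x) = rho x ((es ! j) x) - rho x (\<Sum>b\<in>bas. P j b x *\<^sub>R B0 b x)"
      unfolding u0_def by (intro rho_diff es_fibre A.fibre_ops B0_fibre j x)
    also have "rho x (\<Sum>b\<in>bas. P j b x *\<^sub>R B0 b x) = (\<Sum>b\<in>bas. P j b x *\<^sub>R rho x (B0 b x))"
      by (subst rho_sum) (auto intro!: A.fibre_ops B0_fibre rho_linear(2) sum.cong x)
    also have "\<dots> = rho x ((es ! j) x)" unfolding P(2)[OF j xW] by (intro sum.cong refl) (simp add: rB0 x)
    finally show ?thesis by (simp add: zero_fun_def)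
  qed
  have su0: "smooth_section_on M \<A> N' (u0 j)" if "j < length es" for j
  proof -
    have "smooth_section_on M \<A> N' (\<lambda>x. (es ! j) x + (\<Sum>b\<in>bas. ((-1) * P j b x) *\<^sub>R B0 b x))"
      by (intro A.smooth_section_on_add A.smooth_section_on_sum A.smooth_section_on_mult smooth_fun_on_mult
        smooth_fun_on_const
          N'(1) A.sec_on A.framed_sec[OF es(1)] smooth_fun_on_subset[OF P(1) N'(3)] sB0) (use that in auto)
    then show ?thesis by (simp add: u0_def[abs_def] sum_negf)
  qed
  show thesis
  proof (rule bump[OF N'(1,2)])
    fix \<beta> N0 C assume *: "\<beta> \<in> Cinf M" "open N0" "y \<in> N0" "N0 \<subseteq> N'" "\<And>x. x \<in> N0 \<Longrightarrow> \<beta> x = 1"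
      "closed C" "C \<subseteq> N'" "\<And>x. x \<notin> C \<Longrightarrow> \<beta> x = 0"
    define Bs where "Bs b x = \<beta> x *\<^sub>R B0 b x" for b x
    define us where "us j x = \<beta> x *\<^sub>R u0 j x" for j x
    have N0: "N0 \<subseteq> W2" "N0 \<subseteq> W1" "N0 \<subseteq> U" "N0 \<subseteq> N" using *(4) N' fs(3) es(3) by blast+
    have "local_data M \<A> F \<LL> U \<phi> N0 es fs Bs us P"
    proof (intro local_data.intro local_data_axioms.intro)
      show "trans_rep M \<A> F \<LL>" by unfold_locales
      show "A.framed N0 es" by (rule A.framed_subset[OF es(1) *(2) N0(2)])
      show "F.framed N0 fs" by (rule F.framed_subset[OF fs(1) *(2) N0(1)])
      show "Bs b \<in> sections M \<A>" if "b \<in> bas" for b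
        unfolding Bs_def[abs_def] by (rule A.sec_cutoff[OF N'(1) *(1,6,7,8) sB0[OF that]])
      show "us j \<in> sections M \<A>" if "j < length es" for j
        unfolding us_def[abs_def] by (rule A.sec_cutoff[OF N'(1) *(1,6,7,8) su0[OF that]])
      show "rho x (Bs b x) = ?cf b x" if "b \<in> bas" "x \<in> N0" for b x
        using rB0[OF that(1)] that(2) *(4,5) by (auto simp: Bs_def)
      show "rho x (us j x) = 0" if "j < length es" "x \<in> N0" for j x
        using ru0[OF that(1)] that(2) *(4,5) by (auto simp: us_def)
      show "(es ! j) x = us j x + (\<Sum>b\<in>bas. P j b x *\<^sub>R Bs b x)" if "j < length es" "x \<in> N0" for j x
        using that *(5) by (simp add: us_def u0_def Bs_def)
      show "smooth_fun_on M N0 (P j b)" if "j < length es" "b \<in> bas" for j b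
        by (rule smooth_fun_on_subset[OF P(1)[OF that] N0(1)])
    qed (use c(1) N0(3) in auto)
    then show thesis using that *(3) N0(4) by blast
  qed
qed

end

context local_data
begin

lemma W_open: "open W" using es by (simp add: A.framed_def)

abbreviation cf :: "'h \<Rightarrow> 'm \<Rightarrow> 'm tangent" where "cf \<equiv> coord_field M (U, \<phi>)"

lemma rho_es:
  assumes x: "x \<in> W" and j: "j < length es"
  shows "rho x ((es ! j) x) = (\<Sum>b\<in>bas. G j b x *\<^sub>R cf b x)"
proof -
  have "rho x ((es ! j) x) = rho x (us j x) + rho x (\<Sum>b\<in>bas. G j b x *\<^sub>R Bs b x)"
    unfolding es_eq[OF j x] by (intro rho_linear(1) A.fibre_ops A.sec_fibre us Bs j)
  also have "\<dots> = (\<Sum>b\<in>bas. rho x (G j b x *\<^sub>R Bs b x))"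
    using us(2)[OF j x] by (subst rho_sum) (auto intro!: A.fibre_ops A.sec_fibre[OF Bs(1)])
  also have "\<dots> = (\<Sum>b\<in>bas. G j b x *\<^sub>R cf b x)"
    by (intro sum.cong refl) (simp add: rho_linear(2) A.sec_fibre[OF Bs(1)] Bs(2) x)
  finally show ?thesis .
qed

lemma rho_comb:
  assumes x: "x \<in> W"
  shows "rho x (comb es k x) = (\<Sum>b\<in>bas. (\<Sum>j<length es. k j * G j b x) *\<^sub>R cf b x)"
proof -
  have "rho x (comb es k x) = (\<Sum>j<length es. k j *\<^sub>R rho x ((es ! j) x))"
    unfolding comb_def
    using A.sec_fibre[OF A.framed_sec[OF es]]
    by (subst rho_sum) (auto intro!: A.fibre_ops rho_linear(2) sum.cong)
  also have "\<dots> = (\<Sum>j<length es. \<Sum>b\<in>bas. (k j * G j b x) *\<^sub>R cf b x)"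
    by (intro sum.cong refl) (simp add: rho_es[OF x] scaleR_sum_right)
  also have "\<dots> = (\<Sum>b\<in>bas. (\<Sum>j<length es. k j * G j b x) *\<^sub>R cf b x)"
    by (subst sum.swap) (simp add: scaleR_sum_left)
  finally show ?thesis .
qed

lemma G_zero_of_kernel:
  assumes x: "x \<in> W" and k: "rho x (comb es k x) = 0" "b \<in> bas"
  shows "(\<Sum>j<length es. k j * G j b x) = 0"
proof -
  have "(\<Sum>b\<in>bas. (\<Sum>j<length es. k j * G j b x) *\<^sub>R cf b x) = (\<Sum>b\<in>bas. 0 *\<^sub>R cf b x)"
    using k(1) rho_comb[OF x] by simp
  from coord_independent[OF c _ this k(2)] show ?thesis using x WU by auto
qed

lemma fibre_decompose:
  assumes x: "x \<in> W" and a: "a \<in> fibre \<A> x"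
  obtains k l where "a = (\<Sum>j<length es. k j *\<^sub>R us j x) + (\<Sum>b\<in>bas. l b *\<^sub>R Bs b x)"
proof -
  obtain k where k: "a = comb es k x" by (rule basis_at_expand[OF A.framed_basis[OF es x] a])
  have "a = (\<Sum>j<length es. k j *\<^sub>R us j x) + (\<Sum>j<length es. \<Sum>b\<in>bas. (k j * G j b x) *\<^sub>R Bs b x)"
    unfolding k comb_def sum.distrib[symmetric]
    by (intro sum.cong refl) (simp add: es_eq x scaleR_add_right scaleR_sum_right)
  also have "(\<Sum>j<length es. \<Sum>b\<in>bas. (k j * G j b x) *\<^sub>R Bs b x)
    = (\<Sum>b\<in>bas. (\<Sum>j<length es. k j * G j b x) *\<^sub>R Bs b x)"
    by (subst sum.swap) (simp add: scaleR_sum_left)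
  finally show thesis by (rule that)
qed

text \<open>On the kernel of the anchor the coefficients of the lifts vanish, since the coordinate
  fields are independent. Coefficients in the generators \<open>us\<close> can thus be read off from
  the frame \<open>es\<close>, which keeps them smooth although \<open>us\<close> need not be a
  frame.\<close>

lemma kernel_comb:
  assumes x: "x \<in> W" and k: "rho x (comb es k x) = 0"
  shows "comb es k x = (\<Sum>j<length es. k j *\<^sub>R us j x)"
proof -
  have "comb es k x = (\<Sum>j<length es. k j *\<^sub>R us j x) + (\<Sum>j<length es. \<Sum>b\<in>bas. (k j * G j b x) *\<^sub>R Bs b x)"
    unfolding comb_def sum.distrib[symmetric]
    by (intro sum.cong refl) (simp add: es_eq x scaleR_add_right scaleR_sum_right)
  also have "(\<Sum>j<length es. \<Sum>b\<in>bas. (k j * G j b x) *\<^sub>R Bs b x)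
    = (\<Sum>b\<in>bas. (\<Sum>j<length es. k j * G j b x) *\<^sub>R Bs b x)"
    by (subst sum.swap) (simp add: scaleR_sum_left)
  also have "\<dots> = 0"
    by (rule sum.neutral) (use G_zero_of_kernel[OF x k] in auto)
  finally show ?thesis by simp
qed

lemma adjoint_decompose:
  assumes x: "x \<in> W" and u: "u \<in> adjoint_fibre \<A> x"
  obtains k where "u = (\<Sum>j<length es. k j *\<^sub>R us j x)"
proof -
  have u': "u \<in> fibre \<A> x" "rho x u = 0" using u by (auto simp: adjoint_iff)
  obtain k where k: "u = comb es k x" by (rule basis_at_expand[OF A.framed_basis[OF es x] u'(1)])
  show thesis using that kernel_comb[OF x, of k] u'(2) unfolding k by blast
qed

lemma kernel_section:
  assumes s: "s \<in> sections M \<A>" "\<And>x. x \<in> W \<Longrightarrow> rho x (s x) = 0"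
  obtains k where "\<And>j. j < length es \<Longrightarrow> smooth_fun_on M W (k j)" "\<And>x. x \<in> W \<Longrightarrow>
    s x = (\<Sum>j<length es. k j x *\<^sub>R us j x)"
proof -
  obtain k where k: "\<And>i. i < length es \<Longrightarrow> smooth_fun_on M W (k i)" "\<And>x. x \<in> W \<Longrightarrow> s x = comb es (\<lambda>i. k i x) x"
    using A.frame_expand[OF es W_open order_refl A.sec_on[OF s(1)]] by blast
  show thesis
  proof (rule that[OF k(1)])
    fix x assume x: "x \<in> W"
    show "s x = (\<Sum>j<length es. k j x *\<^sub>R us j x)"
      using kernel_comb[OF x, of "\<lambda>i. k i x"] k(2)[OF x] s(2)[OF x] by simp
  qed
qed

lemma rho_section_smooth:
  assumes A: "A \<in> sections M \<A>" and f: "f \<in> Cinf M"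
  shows "smooth_fun_on M W (\<lambda>x. rho x (A x) f)"
proof -
  obtain k where k: "\<And>i. i < length es \<Longrightarrow> smooth_fun_on M W (k i)" "\<And>x. x \<in> W \<Longrightarrow> A x = comb es (\<lambda>i. k i x) x"
    using A.frame_expand[OF es W_open order_refl A.sec_on[OF A]] by blast
  have "smooth_fun_on M W (\<lambda>x. \<Sum>b\<in>bas. (\<Sum>j<length es. k j x * G j b x) * cf b x f)"
    by (intro smooth_fun_on_sum smooth_fun_on_mult W_open k(1) G smooth_fun_on_subset[OF
      coord_field_smooth[OF c f] WU]) auto
  then show ?thesis
    by (rule smooth_fun_on_cong[OF W_open, rotated])
      (simp add: k(2) rho_comb sum_fun_apply scaleR_fun_def)
qed

end

section \<open>Brackets of the local fields\<close>

context trans_rep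
begin

lemma rho_apply_Cinf:
  assumes A: "A \<in> sections M \<A>" and f: "f \<in> Cinf M" shows "(\<lambda>x. rho x (A x) f) \<in> Cinf M"
proof (rule CinfI, rule smooth_fun_on_local)
  fix x
  obtain U \<phi> where c: "(U, \<phi>) \<in> M" "x \<in> U" by (rule chart_exists)
  show "\<exists>T. open T \<and> x \<in> T \<and> smooth_fun_on M T (\<lambda>x. rho x (A x) f)"
  proof (rule local_data_exists[OF c open_UNIV UNIV_I])
    fix W es fs Bs us G
    assume l: "local_data M \<A> F \<LL> U \<phi> W es fs Bs us G" "x \<in> W"
    then show ?thesis
      using local_data.rho_section_smooth[OF l(1) A f] local_data.W_open[OF l(1)] by blast
  qed
qed

lemma rho_apply_notCinf: "a \<in> fibre \<A> x \<Longrightarrow> f \<notin> Cinf M \<Longrightarrow> rho x a f = 0"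
  using rho_tangent[of a x] unfolding tangent_space_def by blast

end

context local_data
begin

text \<open>The anchor of a bracket is the commutator of the anchors, and the anchor of
  \<open>us j\<close> vanishes on all of \<open>W\<close>, so that its derivatives at
  \<open>x\<close> vanish too.\<close>

lemma bracket_us_kernel:
  assumes A: "A \<in> sections M \<A>" and j: "j < length es" and x: "x \<in> W"
  shows "rho x (bracket \<A> A (us j) x) = 0"
proof
  fix f
  have "lie_bracket (\<lambda>x. rho x (A x)) (\<lambda>x. rho x (us j x)) x f = 0"
  proof (cases "f \<in> Cinf M")
    case True
    have rc: "rho x (A x) \<in> tangent_space M x" using rho_tangent A.sec_fibre[OF A] by blast
    have "(\<lambda>y. rho y (us j y) f) \<in> Cinf M" using rho_apply_Cinf[OF us(1)[OF j] True] .
    from tangent_local[OF rc this Cinf_const W_open x, of 0] us(2)[OF j]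
    have "rho x (A x) (\<lambda>y. rho y (us j y) f) = rho x (A x) (\<lambda>y. 0)" by simp
    then show ?thesis using us(2)[OF j x] by (simp add: lie_bracket_def tangent_const[OF rc])
  next
    \<comment> \<open>Tangent vectors are extended by 0 to functions that are not smooth, so an
      equality of tangent vectors includes this case.\<close>
    case False
    have "(\<lambda>y. rho y (us j y) f) = (\<lambda>y. 0)" "(\<lambda>y. rho y (A y) f) = (\<lambda>y. 0)"
      using rho_apply_notCinf[OF A.sec_fibre[OF us(1)[OF j]] False] rho_apply_notCinf[OF A.sec_fibre[OF A]
        False] by auto
    then show ?thesis
      by (simp add: lie_bracket_def tangent_const[OF rho_tangent[OF A.sec_fibre[OF A]]]
          tangent_const[OF rho_tangent[OF A.sec_fibre[OF us(1)[OF j]]]])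
  qed
  then show "rho x (bracket \<A> A (us j) x) f = 0 f"
    using rho_bracket[OF A us(1)[OF j]] by simp
qed

text \<open>On \<open>W\<close> the anchors of the lifts are coordinate fields, whose commutator
  vanishes by the symmetry of second derivatives.\<close>

lemma bracket_Bs_kernel:
  assumes b: "b \<in> bas" "b' \<in> bas" and x: "x \<in> W"
  shows "rho x (bracket \<A> (Bs b) (Bs b') x) = 0"
proof
  fix f
  have "lie_bracket (\<lambda>x. rho x (Bs b x)) (\<lambda>x. rho x (Bs b' x)) x f = 0"
  proof (cases "f \<in> Cinf M")
    case True
    have *: "rho x (Bs b x) (\<lambda>y. rho y (Bs b' y) f) =
       frechet_derivative (\<lambda>u. frechet_derivative (f \<circ> inv_into U \<phi>) (at u) b') (at (\<phi> x)) b" if b: "b \<in>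
         bas" "b' \<in> bas" for b b'
    proof -
      have C: "(\<lambda>y. rho y (Bs b' y) f) \<in> Cinf M" using rho_apply_Cinf[OF Bs(1)[OF b(2)] True] .
      have xU: "x \<in> U" using x WU by blast
      have W': "open (\<phi> ` W)" using chart_open_image[OF c W_open] WU by (simp add: Int_absorb1)
      have "rho x (Bs b x) (\<lambda>y. rho y (Bs b' y) f) =
        frechet_derivative ((\<lambda>y. rho y (Bs b' y) f) \<circ> inv_into U \<phi>) (at (\<phi> x)) b"
        unfolding Bs(2)[OF b(1) x] by (rule coord_field_eq[OF c xU C])
      also have "frechet_derivative ((\<lambda>y. rho y (Bs b' y) f) \<circ> inv_into U \<phi>) (at (\<phi> x)) =
        frechet_derivative (\<lambda>u. frechet_derivative (f \<circ> inv_into U \<phi>) (at u) b') (at (\<phi> x))"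
      proof (rule frechet_derivative_transform_within_open[OF _ W'])
        show "(\<lambda>y. rho y (Bs b' y) f) \<circ> inv_into U \<phi> differentiable at (\<phi> x)"
          using chart_differentiable[OF c xU UNIV_I Cinf_on[OF C]] by (auto simp: differentiable_def)
        fix u assume "u \<in> \<phi> ` W"
        then obtain y where y: "y \<in> W" "u = \<phi> y" by blast
        then have "y \<in> U" using WU by blast
        then show "((\<lambda>y. rho y (Bs b' y) f) \<circ> inv_into U \<phi>) u = frechet_derivative (f \<circ> inv_into U \<phi>) (at u) b'"
          using y Bs(2)[OF b(2) y(1)] coord_field_eq[OF c _ True] chart_inv[OF c] by simp
      qed (use x in auto)
      finally show ?thesis .
    qed
    have "smooth_on (\<phi> ` U) (f \<circ> inv_into U \<phi>)" using smooth_fun_on_smooth[OF Cinf_on[OF True] c, of UNIV]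
      by simp
    from smooth_on_symmetric[OF this chart(2)[OF c], of "\<phi> x"] show ?thesis
      using x WU by (auto simp: lie_bracket_def *[OF b] *[OF b(2,1)])
  next
    case False
    have "(\<lambda>y. rho y (Bs b y) f) = (\<lambda>y. 0)" "(\<lambda>y. rho y (Bs b' y) f) = (\<lambda>y. 0)"
      using rho_apply_notCinf[OF A.sec_fibre[OF Bs(1)] False] b by auto
    then show ?thesis
      by (simp add: lie_bracket_def tangent_const[OF rho_tangent[OF A.sec_fibre[OF Bs(1)[OF b(1)]]]]
          tangent_const[OF rho_tangent[OF A.sec_fibre[OF Bs(1)[OF b(2)]]]])
  qed
  then show "rho x (bracket \<A> (Bs b) (Bs b') x) f = 0 f"
    using rho_bracket[OF Bs(1) Bs(1)] b by simp
qed

end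

section \<open>The equation of primitives of a cocycle\<close>

context trans_rep
begin

lemma bundle_map_sec:
  assumes \<Phi>: "bundle_map M \<A> F \<Phi>" and A: "A \<in> sections M \<A>"
  shows "(\<lambda>x. \<Phi> x (A x)) \<in> sections M F"
proof (rule F.secI, rule F.smooth_section_on_local)
  fix x
  obtain V as where a: "(V, as) \<in> frames \<A>" "x \<in> V" by (rule A.frame_exists)
  have V: "open V" by (rule A.frame(1)[OF a(1)])
  have lin: "linear_between (fibre \<A> x) (fibre F x) (\<Phi> x)" for x using \<Phi> unfolding bundle_map_def by blast
  have "\<forall>(U, es)\<in>frames \<A>. \<forall>e\<in>set es. smooth_section_on M F U (\<lambda>x. \<Phi> x (e x))"
    using \<Phi> unfolding bundle_map_def by (elim conjE)
  then have sm: "smooth_section_on M F V (\<lambda>x. \<Phi> x ((as ! k) x))" if "k < length as" for k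
    using a(1) nth_mem[OF that] by fastforce
  have "smooth_in_frame M as (V \<inter> UNIV) A" by (rule A.smooth_section_onD(2)[OF A.sec_on[OF A] a(1)])
  then obtain s where s: "\<And>k. k < length as \<Longrightarrow> smooth_fun_on M V (s k)" "\<And>x. x \<in> V \<Longrightarrow> A x = comb as (\<lambda>k. s k x) x"
    unfolding smooth_in_frame_iff by auto
  have as_fibre: "(as ! k) y \<in> fibre \<A> y" if "y \<in> V" "k < length as" for k y
    using basis_at_comb[OF A.frame(2)[OF a(1) that(1)], of "\<lambda>i. if i = k then 1 else 0"] comb_unit[OF
      that(2)] by metis
  have lin': "\<Phi> y (\<Sum>k\<in>I. c k *\<^sub>R v k) = (\<Sum>k\<in>I. c k *\<^sub>R \<Phi> y (v k))" if "\<And>k. k \<in> I \<Longrightarrow> v k \<in> fibre \<A> y"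
    for y I c and v :: "nat \<Rightarrow> 'a"
    using that
  proof (induction I rule: infinite_finite_induct)
    case (insert i I)
    have "(\<Sum>k\<in>I. c k *\<^sub>R v k) \<in> fibre \<A> y" by (intro A.fibre_ops insert) auto
    then show ?case using insert lin[of y] unfolding linear_between_def by (simp add: A.fibre_ops)
  qed (use lin[of y] A.fibre_ops(1)[of y] in \<open>auto simp: linear_between_def dest!: bspec spec[of _ "0::real"]\<close>)
  have "smooth_section_on M F V (\<lambda>x. \<Sum>k<length as. s k x *\<^sub>R \<Phi> x ((as ! k) x))"
    by (intro F.smooth_section_on_sum F.smooth_section_on_mult V s(1) sm) auto
  then have "smooth_section_on M F V (\<lambda>x. \<Phi> x (A x))"
    by (rule F.smooth_section_on_cong) (subst s(2), simp, simp add: comb_def, subst lin', auto intro: as_fibre)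
  then show "\<exists>T. open T \<and> x \<in> T \<and> smooth_section_on M F T (\<lambda>x. \<Phi> x (A x))" using V a(2) by blast
qed auto

end

locale cocycle = trans_rep M \<A> F \<LL>
  for M :: "('m::{t2_space,second_countable_topology}, 'h::real_inner) atlas"
    and \<A> :: "('m, 'a::real_vector) algebroid" and F :: "('m, 'v::real_vector) vbundle" and \<LL> +
  fixes \<Omega> :: "'m \<Rightarrow> 'a \<Rightarrow> 'v"
  assumes \<Omega>: "\<Omega> \<in> cocycles1 M \<A> F \<LL>"
begin

lemma \<Omega>_bundle_map: "bundle_map M \<A> F \<Omega>"
  using \<Omega> by (simp add: cocycles1_def)

lemma \<Omega>_bracket: "A \<in> sections M \<A> \<Longrightarrow> B \<in> sections M \<A> \<Longrightarrow>
    \<Omega> x (bracket \<A> A B x) = \<LL> x (A x) (\<lambda>y. \<Omega> y (B y)) - \<LL> x (B x) (\<lambda>y. \<Omega> y (A y))"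
  using \<Omega> unfolding cocycles1_def by blast

lemma \<Omega>_sec: "A \<in> sections M \<A> \<Longrightarrow> (\<lambda>x. \<Omega> x (A x)) \<in> sections M F"
  by (rule bundle_map_sec[OF \<Omega>_bundle_map])

lemma \<Omega>_linear_between: "linear_between (fibre \<A> x) (fibre F x) (\<Omega> x)"
  using \<Omega>_bundle_map unfolding bundle_map_def by blast

lemma \<Omega>_add: "a \<in> fibre \<A> x \<Longrightarrow> b \<in> fibre \<A> x \<Longrightarrow> \<Omega> x (a + b) = \<Omega> x a + \<Omega> x b"
  and \<Omega>_scale: "a \<in> fibre \<A> x \<Longrightarrow> \<Omega> x (c *\<^sub>R a) = c *\<^sub>R \<Omega> x a"
  using \<Omega>_linear_between[of x] unfolding linear_between_def by auto

lemma \<Omega>_zero: "\<Omega> x 0 = 0"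
  using \<Omega>_scale[OF A.fibre_ops(1), of x 0] by simp

lemma \<Omega>_sum: "(\<And>i. i \<in> I \<Longrightarrow> s i \<in> fibre \<A> x) \<Longrightarrow> \<Omega> x (sum s I) = (\<Sum>i\<in>I. \<Omega> x (s i))"
  by (induction I rule: infinite_finite_induct) (auto simp: \<Omega>_zero \<Omega>_add A.fibre_ops(5))

text \<open>\<open>sol N m\<close>: \<open>m\<close> is a smooth section over \<open>N\<close> with \<open>\<LL>\<^sub>A m = \<Omega>(A)\<close>.\<close>

definition sol :: "'m set \<Rightarrow> ('m \<Rightarrow> 'v) \<Rightarrow> bool" where
  "sol N m \<longleftrightarrow> (\<forall>y\<in>N. \<exists>\<mu>\<in>sections M F. \<exists>N'. open N' \<and> y \<in> N' \<and> N' \<subseteq> N \<and>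
     (\<forall>x\<in>N'. \<mu> x = m x \<and> (\<forall>a\<in>fibre \<A> x. \<LL> x a \<mu> = \<Omega> x a)))"

definition primitives :: "'m \<Rightarrow> 'v set" where
  "primitives y = {\<tau> \<in> fibre F y. \<forall>u\<in>adjoint_fibre \<A> y. \<Omega> y u = iso y u \<tau>}"

lemma isotropy_coboundary_iff: "isotropy_coboundary M \<A> F \<LL> y (\<Omega> y) \<longleftrightarrow> primitives y \<noteq> {}"
  unfolding isotropy_coboundary_def primitives_def by blast

lemma solE:
  assumes "sol N m" "y \<in> N"
  obtains \<mu> N' where "\<mu> \<in> sections M F" "open N'" "y \<in> N'" "N' \<subseteq> N"
    "\<And>x. x \<in> N' \<Longrightarrow> \<mu> x = m x" "\<And>x a. x \<in> N' \<Longrightarrow> a \<in> fibre \<A> x \<Longrightarrow> \<LL> x a \<mu> = \<Omega> x a"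
proof -
  from bspec[OF assms(1)[unfolded sol_def] assms(2)] obtain \<mu> N' where *: "\<mu> \<in> sections M F" "open N'"
    "y \<in> N'" "N' \<subseteq> N"
    "\<forall>x\<in>N'. \<mu> x = m x \<and> (\<forall>a\<in>fibre \<A> x. \<LL> x a \<mu> = \<Omega> x a)" by (elim bexE exE conjE)
  show thesis by (rule that[OF *(1-4)]) (use *(5) in simp_all)
qed

lemma sol_val:
  assumes "sol N m" "y \<in> N" shows "m y \<in> primitives y"
proof (rule solE[OF assms])
  fix \<mu> N' assume *: "\<mu> \<in> sections M F" "open N'" "y \<in> N'" "N' \<subseteq> N"
    "\<And>x. x \<in> N' \<Longrightarrow> \<mu> x = m x" "\<And>x a. x \<in> N' \<Longrightarrow> a \<in> fibre \<A> x \<Longrightarrow> \<LL> x a \<mu> = \<Omega> x a"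
  have e: "m y = \<mu> y" using *(3,5) by simp
  show ?thesis
    unfolding primitives_def e
    using F.sec_fibre[OF *(1)] *(6)[OF *(3)] iso_eq[OF _ *(1)] by (auto simp: adjoint_iff)
qed

end

lemma pd_Ck_on:
  assumes "onb B" "open W" "pd B W g gd" "\<And>b. b \<in> B \<Longrightarrow> Ck_on k W (gd b)"
  shows "Ck_on (Suc k) W g"
proof (rule Ck_on_Suc_I[OF assms(2) pd_deriv[OF assms(3)]])
  show "Ck_on k W (\<lambda>x. \<Sum>b\<in>B. (v \<bullet> b) * gd b x)" for v
    by (intro Ck_on_sum Ck_on_bilinear[OF _ bounded_bilinear_mult] Ck_on_const assms(2,4))
qed

text \<open>Bootstrapping: the equation expresses the derivatives of \<open>\<sigma>\<close> through
  \<open>\<sigma>\<close> with smooth coefficients, so each pass gains one order.\<close>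

lemma (in flat_system) parallel_smooth:
  assumes a: "\<And>b i j. b \<in> B \<Longrightarrow> i \<in> J \<Longrightarrow> j \<in> J \<Longrightarrow> smooth_on W (a b i j)" and p: "parallel \<sigma>" "i \<in> J"
  shows "smooth_on W (\<sigma> i)"
proof -
  have "\<forall>i\<in>J. Ck_on k W (\<sigma> i)" for k
  proof (induction k)
    case 0
    then show ?case using p(1) pd_cont unfolding parallel_def by fastforce
  next
    case (Suc k)
    show ?case
    proof
      fix i assume i: "i \<in> J"
      have "pd B W (\<sigma> i) (\<lambda>b x. \<Sum>j\<in>J. a b i j x * \<sigma> j x)" using p(1) i by (simp add: parallel_def)
      then show "Ck_on (Suc k) W (\<sigma> i)"
        by (rule pd_Ck_on[OF onb W(1)])
          (use Suc a i in \<open>auto simp: smooth_on_def intro!: Ck_on_sum Ck_on_bilinear[OF _ bounded_bilinear_mult] W\<close>)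
    qed
  qed
  then show ?thesis using p(2) by (simp add: smooth_on_def)
qed

section \<open>The equation in coordinates\<close>

locale cocycle_local = cocycle M \<A> F \<LL> \<Omega> + local_data M \<A> F \<LL> U \<phi> W es fs Bs us G
  for M :: "('m::{t2_space,second_countable_topology}, 'h::real_inner) atlas"
    and \<A> :: "('m, 'a::real_vector) algebroid" and F :: "('m, 'v::real_vector) vbundle"
      and \<LL> \<Omega> U \<phi> W es fs Bs us G
begin

abbreviation r :: nat where "r \<equiv> length fs"

text \<open>On \<open>W\<close> the coefficients of a section are unique, so the choice affects only
  values off \<open>W\<close>.\<close>

definition co :: "('m \<Rightarrow> 'v) \<Rightarrow> nat \<Rightarrow> 'm \<Rightarrow> real" where
  "co \<nu> = (SOME c. (\<forall>i<r. smooth_fun_on M W (c i)) \<and> (\<forall>x\<in>W. \<nu> x = comb fs (\<lambda>i. c i x) x))"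

lemma co:
  assumes "\<nu> \<in> sections M F"
  shows "i < r \<Longrightarrow> smooth_fun_on M W (co \<nu> i)" "x \<in> W \<Longrightarrow> \<nu> x = comb fs (\<lambda>i. co \<nu> i x) x"
proof -
  have "\<exists>c. (\<forall>i<r. smooth_fun_on M W (c i)) \<and> (\<forall>x\<in>W. \<nu> x = comb fs (\<lambda>i. c i x) x)"
    using F.frame_expand[OF fs W_open order_refl F.sec_on[OF assms]] by metis
  from someI_ex[OF this] show "i < r \<Longrightarrow> smooth_fun_on M W (co \<nu> i)" "x \<in> W \<Longrightarrow> \<nu> x = comb fs (\<lambda>i. co \<nu> i x) x"
    unfolding co_def[symmetric] by blast+
qed

lemma co_unique:
  assumes "\<nu> \<in> sections M F" "x \<in> W" "\<nu> x = comb fs c x" "i < r"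
  shows "co \<nu> i x = c i"
  by (rule basis_at_unique[OF F.framed_basis[OF fs assms(2)] HOL.trans[OF co(2)[OF assms(1,2), symmetric]
    assms(3)] assms(4)])

text \<open>Unlike \<open>coord_field\<close>, which is 0 on functions that are not globally smooth,
  this also differentiates coefficients that are smooth only on \<open>W\<close>.\<close>

definition Dc :: "'h \<Rightarrow> ('m \<Rightarrow> real) \<Rightarrow> 'm \<Rightarrow> real" where
  "Dc b g x = frechet_derivative (g \<circ> inv_into U \<phi>) (at (\<phi> x)) b"

lemma Dc_local:
  assumes "x \<in> N" "open N" "N \<subseteq> W" "smooth_fun_on M N g" "\<And>y. y \<in> N \<Longrightarrow> g y = g' y"
  shows "Dc b g x = Dc b g' x"
proof -
  have xU: "x \<in> U" using assms WU by blast
  have N': "open (\<phi> ` N)" using chart_open_image[OF c assms(2)] WU assms(3) by (simp add: Int_absorb1)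
  have "frechet_derivative (g \<circ> inv_into U \<phi>) (at (\<phi> x)) = frechet_derivative (g' \<circ> inv_into U \<phi>) (at (\<phi> x))"
  proof (rule frechet_derivative_transform_within_open[OF _ N'])
    show "g \<circ> inv_into U \<phi> differentiable at (\<phi> x)"
      using chart_differentiable[OF c xU assms(1,4)] by (auto simp: differentiable_def)
    fix u assume "u \<in> \<phi> ` N"
    then obtain y where y: "y \<in> N" "u = \<phi> y" by blast
    then have "y \<in> U" using assms(3) WU by blast
    then show "(g \<circ> inv_into U \<phi>) u = (g' \<circ> inv_into U \<phi>) u" using y assms(5) chart_inv[OF c] by simp
  qed (use assms in auto)
  then show ?thesis by (simp add: Dc_def)
qed

text \<open>The Leibniz rule speaks of globally smooth functions, so the coefficients are replaced
  by global functions \<open>k i\<close> that agree with them near \<open>x\<close>.\<close>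

lemma L_expand:
  assumes \<nu>: "\<nu> \<in> sections M F" and x: "x \<in> W" and a: "a \<in> fibre \<A> x"
  obtains k where "\<And>i. i < r \<Longrightarrow> k i \<in> Cinf M" "\<And>i. i < r \<Longrightarrow> k i x = co \<nu> i x"
    "\<And>i b. i < r \<Longrightarrow> Dc b (k i) x = Dc b (co \<nu> i) x"
    "\<LL> x a \<nu> = comb fs (\<lambda>i. rho x a (k i)) x + (\<Sum>j<r. co \<nu> j x *\<^sub>R \<LL> x a (fs ! j))"
proof -
  obtain k T where k: "\<And>i. i < r \<Longrightarrow> k i \<in> Cinf M" "open T" "x \<in> T" "T \<subseteq> W"
    "\<And>y. y \<in> T \<Longrightarrow> \<nu> y = comb fs (\<lambda>i. k i y) y"
    using F.frame_expand_Cinf[OF fs W_open order_refl F.sec_on[OF \<nu>] x] by blast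
  have kc: "k i y = co \<nu> i y" if "i < r" "y \<in> T" for i y
    using co_unique[OF \<nu> _ k(5)[OF that(2)] that(1)] k(4) that(2) by auto
  have "(\<lambda>y. comb fs (\<lambda>i. k i y) y) \<in> sections M F"
    unfolding comb_def by (intro F.sec_sum F.sec_mult k(1) F.framed_sec[OF fs]) auto
  then have "\<LL> x a \<nu> = \<LL> x a (\<lambda>y. comb fs (\<lambda>i. k i y) y)" by (rule L_local[OF a \<nu> _ k(2,3,5)])
  also have "\<dots> = comb fs (\<lambda>i. rho x a (k i)) x + (\<Sum>j<r. k j x *\<^sub>R \<LL> x a (fs ! j))"
    by (rule L_comb[OF a F.framed_sec[OF fs] k(1)])
  also have "(\<Sum>j<r. k j x *\<^sub>R \<LL> x a (fs ! j)) = (\<Sum>j<r. co \<nu> j x *\<^sub>R \<LL> x a (fs ! j))"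
    by (intro sum.cong) (use kc k(3) in auto)
  finally have e: "\<LL> x a \<nu> = comb fs (\<lambda>i. rho x a (k i)) x + (\<Sum>j<r. co \<nu> j x *\<^sub>R \<LL> x a (fs ! j))" .
  have "Dc b (k i) x = Dc b (co \<nu> i) x" if "i < r" for i b
    by (rule Dc_local[OF k(3,2,4) Cinf_on[OF k(1)[OF that]]]) (use kc that in auto)
  then show thesis using that[OF k(1) _ _ e] kc k(3) by blast
qed

text \<open>The index \<open>r\<close> stands for the inhomogeneous term \<open>- \<Omega>\<close>: the equation \<open>\<LL>\<^sub>A m = \<Omega>(A)\<close> becomes
  linear in the coefficients of \<open>m\<close> extended by the constant \<open>1\<close> at \<open>r\<close>.\<close>

definition SS :: "('m \<Rightarrow> 'a) \<Rightarrow> nat \<Rightarrow> 'm \<Rightarrow> 'v" where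
  "SS s j x = (if j < r then \<LL> x (s x) (fs ! j) else - \<Omega> x (s x))"

lemma SS_sec: "s \<in> sections M \<A> \<Longrightarrow> SS s j \<in> sections M F"
  using L_sec[OF _ F.framed_sec[OF fs]] F.sec_mult[OF Cinf_const \<Omega>_sec, of s "-1"]
  by (cases "j < r") (auto simp: SS_def[abs_def])

lemma SS_bracket:
  assumes "A \<in> sections M \<A>" "B \<in> sections M \<A>"
  shows "SS (bracket \<A> A B) j x = \<LL> x (A x) (SS B j) - \<LL> x (B x) (SS A j)"
proof (cases "j < r")
  case True
  then show ?thesis using L_bracket[OF assms F.framed_sec[OF fs True], of x] by (simp add: SS_def[abs_def])
next
  case False
  have "\<LL> x (A x) (\<lambda>y. - \<Omega> y (B y)) = - \<LL> x (A x) (\<lambda>y. \<Omega> y (B y))" if "A \<in> sections M \<A>" "B \<in> sections M \<A>"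
    for A B
    using L_scale[OF A.sec_fibre[OF that(1)] \<Omega>_sec[OF that(2)], of x "-1"] by simp
  then show ?thesis using False \<Omega>_bracket[OF assms] assms by (simp add: SS_def[abs_def])
qed

lemma SS_kernel:
  assumes "s x = (\<Sum>a<length es. q a *\<^sub>R us a x)"
  shows "SS s j x = (\<Sum>a<length es. q a *\<^sub>R SS (us a) j x)"
proof -
  have f: "q a *\<^sub>R us a x \<in> fibre \<A> x" "us a x \<in> fibre \<A> x" if "a < length es" for a
    using A.sec_fibre[OF us(1)[OF that]] A.fibre_ops(3) by blast+
  show ?thesis
  proof (cases "j < r")
    case True
    then show ?thesis unfolding SS_def assms by (subst L_a_sum) (auto simp: f L_a_scale)
  next
    case False
    then show ?thesis unfolding SS_def assms by (subst \<Omega>_sum) (auto simp: f \<Omega>_scale sum_negf)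
  qed
qed

text \<open>\<open>\<Gamma> b\<close> is the connection matrix along the lift \<open>Bs b\<close>. A
  constraint index \<open>q\<close> of \<open>K\<close> pairs a generator of the adjoint bundle with
  a component, so each \<open>K q\<close> is one scalar equation for primitives. In both, column
  \<open>r\<close> carries the inhomogeneous term.\<close>

definition \<Gamma> :: "'h \<Rightarrow> nat \<Rightarrow> nat \<Rightarrow> 'm \<Rightarrow> real" where "\<Gamma> b i j = co (SS (Bs b) j) i"
definition K :: "nat \<times> nat \<Rightarrow> nat \<Rightarrow> 'm \<Rightarrow> real" where "K q j = co (SS (us (fst q)) j) (snd q)"

lemma co_L_Bs:
  assumes \<nu>: "\<nu> \<in> sections M F" and x: "x \<in> W" and b: "b \<in> bas" and i: "i < r"
  shows "co (\<lambda>x. \<LL> x (Bs b x) \<nu>) i x = Dc b (co \<nu> i) x + (\<Sum>k<r. \<Gamma> b i k x * co \<nu> k x)"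
proof (rule L_expand[OF \<nu> x A.sec_fibre[OF Bs(1)[OF b]]])
  have xU: "x \<in> U" using x WU by blast
  fix k assume k: "\<And>i. i < r \<Longrightarrow> k i \<in> Cinf M" "\<And>i b. i < r \<Longrightarrow> Dc b (k i) x = Dc b (co \<nu> i) x"
    "\<LL> x (Bs b x) \<nu> = comb fs (\<lambda>i. rho x (Bs b x) (k i)) x + (\<Sum>j<r. co \<nu> j x *\<^sub>R \<LL> x (Bs b x) (fs ! j))"
  have 1: "comb fs (\<lambda>i. rho x (Bs b x) (k i)) x = comb fs (\<lambda>i. Dc b (co \<nu> i) x) x"
    by (rule comb_cong) (use k(2) coord_field_eq[OF c xU k(1)] in \<open>simp add: Bs(2)[OF b x] Dc_def\<close>)
  have 2: "(\<Sum>j<r. co \<nu> j x *\<^sub>R \<LL> x (Bs b x) (fs ! j)) = comb fs (\<lambda>i. \<Sum>j<r. co \<nu> j x * \<Gamma> b i j x) x"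
  proof -
    have "\<LL> x (Bs b x) (fs ! j) = comb fs (\<lambda>i. \<Gamma> b i j x) x" if "j < r" for j
      using co(2)[OF SS_sec[OF Bs(1)[OF b]] x, of j] that by (simp add: SS_def \<Gamma>_def)
    then show ?thesis by (simp add: comb_sum comb_scale)
  qed
  have "\<LL> x (Bs b x) \<nu> = comb fs (\<lambda>i. Dc b (co \<nu> i) x + (\<Sum>k<r. \<Gamma> b i k x * co \<nu> k x)) x"
    unfolding k(3) 1 2 comb_add by (simp add: mult.commute)
  from co_unique[OF L_sec[OF Bs(1)[OF b] \<nu>] x this i] show ?thesis .
qed

lemma co_L_us:
  assumes \<nu>: "\<nu> \<in> sections M F" and x: "x \<in> W" and a: "a < length es" and i: "i < r"
  shows "co (\<lambda>x. \<LL> x (us a x) \<nu>) i x = (\<Sum>k<r. K (a, i) k x * co \<nu> k x)"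
proof (rule L_expand[OF \<nu> x A.sec_fibre[OF us(1)[OF a]]])
  fix k assume k: "\<LL> x (us a x) \<nu> = comb fs (\<lambda>i. rho x (us a x) (k i)) x + (\<Sum>j<r. co \<nu> j x *\<^sub>R \<LL> x (us a x) (fs ! j))"
  have 1: "comb fs (\<lambda>i. rho x (us a x) (k i)) x = 0" by (simp add: us(2)[OF a x] comb_def)
  have 2: "(\<Sum>j<r. co \<nu> j x *\<^sub>R \<LL> x (us a x) (fs ! j)) = comb fs (\<lambda>i. \<Sum>j<r. co \<nu> j x * K (a, i) j x) x"
  proof -
    have "\<LL> x (us a x) (fs ! j) = comb fs (\<lambda>i. K (a, i) j x) x" if "j < r" for j
      using co(2)[OF SS_sec[OF us(1)[OF a]] x, of j] that by (simp add: SS_def K_def)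
    then show ?thesis by (simp add: comb_sum comb_scale)
  qed
  have "\<LL> x (us a x) \<nu> = comb fs (\<lambda>i. \<Sum>k<r. K (a, i) k x * co \<nu> k x) x"
    unfolding k 1 2 by (simp add: mult.commute)
  from co_unique[OF L_sec[OF us(1)[OF a] \<nu>] x this i] show ?thesis .
qed

lemma \<Gamma>_smooth: "b \<in> bas \<Longrightarrow> i < r \<Longrightarrow> smooth_fun_on M W (\<Gamma> b i j)"
  unfolding \<Gamma>_def by (rule co(1)[OF SS_sec[OF Bs(1)]])

lemma K_smooth: "a < length es \<Longrightarrow> i < r \<Longrightarrow> smooth_fun_on M W (K (a, i) j)"
  unfolding K_def by (rule co(1)[OF SS_sec[OF us(1)]]) auto

lemma co_diff:
  assumes "\<mu> \<in> sections M F" "\<nu> \<in> sections M F" "\<nu>' \<in> sections M F" "x \<in> W" "\<nu>' x = \<mu> x - \<nu> x" "i < r"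
  shows "co \<nu>' i x = co \<mu> i x - co \<nu> i x"
  by (rule co_unique[OF assms(3,4) _ assms(6)]) (simp add: assms(5) comb_diff co(2)[OF assms(1,4)] co(2)[OF
    assms(2,4)])

lemma co_kernel:
  assumes s: "s \<in> sections M \<A>" "s x = (\<Sum>a<length es. q a *\<^sub>R us a x)" and x: "x \<in> W" and i: "i < r"
  shows "co (SS s j) i x = (\<Sum>a<length es. q a * K (a, i) j x)"
proof (rule co_unique[OF SS_sec[OF s(1)] x _ i])
  show "SS s j x = comb fs (\<lambda>i. \<Sum>a<length es. q a * K (a, i) j x) x"
  proof -
    have "SS (us a) j x = comb fs (\<lambda>i. K (a, i) j x) x" if "a < length es" for a
      using co(2)[OF SS_sec[OF us(1)[OF that]] x, of j] by (simp add: K_def)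
    then show ?thesis
      unfolding SS_kernel[where s = s and q = q and x = x, OF s(2)] by (simp add: comb_sum comb_scale)
  qed
qed

text \<open>The bracket of two lifts is a combination of the generators \<open>us\<close>. Comparing
  coefficients in \<open>SS_bracket\<close> gives the usual curvature formula on one side and rows
  of \<open>K\<close> on the other. The column \<open>r\<close> expresses the cocycle identity of
  \<open>\<Omega>\<close>.\<close>

lemma curvature:
  assumes b: "b \<in> bas" "b' \<in> bas"
  obtains q where "\<And>a. a < length es \<Longrightarrow> smooth_fun_on M W (q a)"
    "\<And>i j x. i < r \<Longrightarrow> x \<in> W \<Longrightarrow> Dc b (\<Gamma> b' i j) x - Dc b' (\<Gamma> b i j) x + (\<Sum>k<r. \<Gamma> b i k x * \<Gamma> b' k j x - \<Gamma> b' i k x * \<Gamma> b k j x)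
       = (\<Sum>a<length es. q a x * K (a, i) j x)"
proof -
  have B: "Bs b \<in> sections M \<A>" "Bs b' \<in> sections M \<A>" using Bs(1) b by blast+
  obtain q where q: "\<And>j. j < length es \<Longrightarrow> smooth_fun_on M W (q j)"
    "\<And>x. x \<in> W \<Longrightarrow> bracket \<A> (Bs b) (Bs b') x = (\<Sum>j<length es. q j x *\<^sub>R us j x)"
    using kernel_section[OF sec_bracket[OF B] bracket_Bs_kernel[OF b]] by blast
  show thesis
  proof (rule that[OF q(1)])
    fix i j x assume i: "i < r" and x: "x \<in> W"
    have "(\<Sum>a<length es. q a x * K (a, i) j x) = co (SS (bracket \<A> (Bs b) (Bs b')) j) i x"
      by (rule co_kernel[OF sec_bracket[OF B] q(2)[OF x] x i, symmetric])
    also have "\<dots> = co (\<lambda>x. \<LL> x (Bs b x) (SS (Bs b') j)) i x - co (\<lambda>x. \<LL> x (Bs b' x) (SS (Bs b) j)) i x"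
      by (rule co_diff[OF L_sec[OF B(1) SS_sec[OF B(2)]] L_sec[OF B(2) SS_sec[OF B(1)]] SS_sec[OF
        sec_bracket[OF B]] x SS_bracket[OF B] i])
    finally show "Dc b (\<Gamma> b' i j) x - Dc b' (\<Gamma> b i j) x + (\<Sum>k<r. \<Gamma> b i k x * \<Gamma> b' k j x - \<Gamma> b' i k x * \<Gamma> b k j x)
       = (\<Sum>a<length es. q a x * K (a, i) j x)"
      using co_L_Bs[OF SS_sec[OF B(2)] x b(1) i, of j] co_L_Bs[OF SS_sec[OF B(1)] x b(2) i, of j]
      by (simp add: \<Gamma>_def sum_subtractf)
  qed
qed

text \<open>The same comparison for the bracket of a lift with a generator; it yields the covariant
  derivative of the matrix of that generator.\<close>

lemma K_derivative:
  assumes b: "b \<in> bas" and a: "a < length es"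
  obtains q where "\<And>a'. a' < length es \<Longrightarrow> smooth_fun_on M W (q a')"
    "\<And>i j x. i < r \<Longrightarrow> x \<in> W \<Longrightarrow> Dc b (K (a, i) j) x + (\<Sum>k<r. \<Gamma> b i k x * K (a, k) j x) - (\<Sum>k<r. K (a, i) k x * \<Gamma> b k j x)
       = (\<Sum>a'<length es. q a' x * K (a', i) j x)"
proof -
  have B: "Bs b \<in> sections M \<A>" "us a \<in> sections M \<A>" using Bs(1) b us(1) a by blast+
  obtain q where q: "\<And>j. j < length es \<Longrightarrow> smooth_fun_on M W (q j)"
    "\<And>x. x \<in> W \<Longrightarrow> bracket \<A> (Bs b) (us a) x = (\<Sum>j<length es. q j x *\<^sub>R us j x)"
    using kernel_section[OF sec_bracket[OF B] bracket_us_kernel[OF B(1) a]] by blast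
  show thesis
  proof (rule that[OF q(1)])
    fix i j x assume i: "i < r" and x: "x \<in> W"
    have "(\<Sum>a<length es. q a x * K (a, i) j x) = co (SS (bracket \<A> (Bs b) (us a)) j) i x"
      by (rule co_kernel[OF sec_bracket[OF B] q(2)[OF x] x i, symmetric])
    also have "\<dots> = co (\<lambda>x. \<LL> x (Bs b x) (SS (us a) j)) i x - co (\<lambda>x. \<LL> x (us a x) (SS (Bs b) j)) i x"
      by (rule co_diff[OF L_sec[OF B(1) SS_sec[OF B(2)]] L_sec[OF B(2) SS_sec[OF B(1)]] SS_sec[OF
        sec_bracket[OF B]] x SS_bracket[OF B] i])
    finally show "Dc b (K (a, i) j) x + (\<Sum>k<r. \<Gamma> b i k x * K (a, k) j x) - (\<Sum>k<r. K (a, i) k x * \<Gamma> b k j x)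
       = (\<Sum>a'<length es. q a' x * K (a', i) j x)"
      using co_L_Bs[OF SS_sec[OF B(2)] x b i, of j] co_L_us[OF SS_sec[OF B(1)] x a i, of j]
      by (simp add: \<Gamma>_def K_def)
  qed
qed

end

lemma bounded_near:
  fixes f :: "'i \<Rightarrow> 'a::topological_space \<Rightarrow> real"
  assumes "finite I" "open O'" "p \<in> O'" "\<And>i. i \<in> I \<Longrightarrow> continuous_on O' (f i)"
  shows "\<exists>C T. C \<ge> 0 \<and> open T \<and> p \<in> T \<and> T \<subseteq> O' \<and> (\<forall>i\<in>I. \<forall>x\<in>T. \<bar>f i x\<bar> \<le> C)"
  using assms(1,4)
proof (induction I rule: finite_induct)
  case empty
  then show ?case using assms by (intro exI[of _ 0] exI[of _ O']) auto
next
  case (insert i I)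
  then obtain C T where CT: "C \<ge> 0" "open T" "p \<in> T" "T \<subseteq> O'" "\<forall>i\<in>I. \<forall>x\<in>T. \<bar>f i x\<bar> \<le> C" by auto
  have cont: "continuous_on O' (\<lambda>x. \<bar>f i x\<bar>)" using insert.prems by (auto intro: continuous_intros)
  define T' where "T' = O' \<inter> (\<lambda>x. \<bar>f i x\<bar>) -` {..< \<bar>f i p\<bar> + 1}"
  have "open T'" unfolding T'_def by (rule continuous_open_preimage[OF cont assms(2)]) auto
  moreover have "p \<in> T'" using assms by (auto simp: T'_def)
  ultimately show ?case
    using CT by (intro exI[of _ "max C (\<bar>f i p\<bar> + 1)"] exI[of _ "T \<inter> T'"]) (auto simp: T'_def
      le_max_iff_disj open_Int)
qed

section \<open>Reduction to a flat system on a ball\<close>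

context cocycle_local
begin

abbreviation \<psi> :: "'h \<Rightarrow> 'm" where "\<psi> \<equiv> inv_into U \<phi>"

lemma phi_W: "open (\<phi> ` W)" "x \<in> W \<Longrightarrow> \<psi> (\<phi> x) = x" "u \<in> \<phi> ` W \<Longrightarrow> \<psi> u \<in> W" "u \<in> \<phi> ` W \<Longrightarrow> \<phi> (\<psi> u) = u"
proof -
  show "open (\<phi> ` W)" using chart_open_image[OF c W_open] WU by (simp add: Int_absorb1)
  show *: "x \<in> W \<Longrightarrow> \<psi> (\<phi> x) = x" for x using chart_inv[OF c] WU by blast
  show "u \<in> \<phi> ` W \<Longrightarrow> \<psi> u \<in> W" "u \<in> \<phi> ` W \<Longrightarrow> \<phi> (\<psi> u) = u" using * by auto
qed

lemma smooth_on_phi_W: "smooth_fun_on M W g \<Longrightarrow> smooth_on (\<phi> ` W) (\<lambda>u. g (\<psi> u))"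
  using smooth_fun_on_smooth[OF _ c, of W g] WU by (simp add: Int_absorb1 comp_def)

text \<open>The minus sign comes from solving \<open>\<LL>\<^sub>B m = \<Omega>(B)\<close> for the
  derivative of the coefficients. Row \<open>r\<close> is 0, which keeps the auxiliary coefficient
  constant.\<close>

definition ca :: "'h \<Rightarrow> nat \<Rightarrow> nat \<Rightarrow> 'h \<Rightarrow> real" where
  "ca b i j u = (if i < r then - \<Gamma> b i j (\<psi> u) else 0)"

definition cK :: "nat \<times> nat \<Rightarrow> nat \<Rightarrow> 'h \<Rightarrow> real" where "cK q j u = K q j (\<psi> u)"

abbreviation QQ where "QQ \<equiv> {..<length es} \<times> {..<r}"

lemma ca_smooth: "b \<in> bas \<Longrightarrow> smooth_on (\<phi> ` W) (ca b i j)"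
proof (cases "i < r")
  case True
  assume b: "b \<in> bas"
  have "smooth_on (\<phi> ` W) (\<lambda>u. (-1) * \<Gamma> b i j (\<psi> u))"
    by (intro smooth_on_bilinear[OF phi_W(1) bounded_bilinear_mult] smooth_on_const smooth_on_phi_W \<Gamma>_smooth
      b True)
  then show ?thesis using True by (simp add: ca_def[abs_def])
qed (simp add: ca_def[abs_def] smooth_on_const)

lemma cK_smooth: "q \<in> QQ \<Longrightarrow> smooth_on (\<phi> ` W) (cK q j)"
  unfolding cK_def[abs_def] by (cases q) (auto intro!: smooth_on_phi_W K_smooth)

lemma Dc_psi: "u \<in> \<phi> ` W \<Longrightarrow> Dc b g (\<psi> u) = frechet_derivative (\<lambda>u. g (\<psi> u)) (at u) b"
  by (simp add: Dc_def phi_W comp_def)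

lemma ca_deriv:
  assumes "u \<in> \<phi> ` W" "b \<in> bas" "i < r"
  shows "frechet_derivative (ca b i j) (at u) c' = - Dc c' (\<Gamma> b i j) (\<psi> u)"
proof -
  have "((\<lambda>u. \<Gamma> b i j (\<psi> u)) has_derivative frechet_derivative (\<lambda>u. \<Gamma> b i j (\<psi> u)) (at u)) (at u)"
    by (rule smooth_on_differentiable[OF smooth_on_phi_W[OF \<Gamma>_smooth] assms(1)]) (use assms in auto)
  from frechet_derivative_at[OF has_derivative_minus[OF this], THEN fun_cong, of c']
  show ?thesis using assms(3) by (simp add: Dc_psi[OF assms(1)] ca_def[abs_def])
qed

text \<open>All coefficients are continuous, hence bounded by a common \<open>C\<close> near
  \<open>p\<close>; after that the radius is taken small against \<open>C\<close>.\<close>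

lemma flat_ball:
  assumes p: "p \<in> \<phi> ` W" and T: "open T" "p \<in> T"
  obtains d ad Kd m S C where "d > 0" "ball p d \<subseteq> \<phi> ` W \<inter> T"
    "flat_system bas (ball p d) {..r} QQ ca ad cK Kd m (S :: 'h \<Rightarrow> 'h \<Rightarrow> nat \<Rightarrow> nat \<times> nat \<Rightarrow> 'h \<Rightarrow> real) C (2 * d)"
proof -
  let ?O = "\<phi> ` W"
  define P where "P b b' q \<longleftrightarrow> (\<forall>a<length es. smooth_fun_on M W (q a)) \<and> (\<forall>i j x. i < r \<longrightarrow> x \<in> W \<longrightarrow>
     Dc b (\<Gamma> b' i j) x - Dc b' (\<Gamma> b i j) x + (\<Sum>k<r. \<Gamma> b i k x * \<Gamma> b' k j x - \<Gamma> b' i k x * \<Gamma> b k j x)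
       = (\<Sum>a<length es. q a x * K (a, i) j x))" for b b' q
  have "\<forall>b\<in>bas. \<forall>b'\<in>bas. \<exists>q. P b b' q"
  proof (intro ballI)
    fix b b' assume b: "b \<in> bas" "b' \<in> bas"
    show "\<exists>q. P b b' q"
    proof (rule curvature[OF b], goal_cases)
      case (1 q)
      show ?case unfolding P_def by (rule exI[of _ q], intro conjI allI impI 1)
    qed
  qed
  then have "\<forall>b\<in>bas. \<exists>q. \<forall>b'\<in>bas. P b b' (q b')" by (intro ballI bchoice) simp
  from bchoice[OF this] obtain qc where qc0: "\<And>b b'. b \<in> bas \<Longrightarrow> b' \<in> bas \<Longrightarrow> P b b' (qc b b')" by blast
  have qc: "b \<in> bas \<Longrightarrow> b' \<in> bas \<Longrightarrow> a < length es \<Longrightarrow> smooth_fun_on M W (qc b b' a)"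
    "b \<in> bas \<Longrightarrow> b' \<in> bas \<Longrightarrow> i < r \<Longrightarrow> x \<in> W \<Longrightarrow>
       Dc b (\<Gamma> b' i j) x - Dc b' (\<Gamma> b i j) x + (\<Sum>k<r. \<Gamma> b i k x * \<Gamma> b' k j x - \<Gamma> b' i k x * \<Gamma> b k j x)
       = (\<Sum>a<length es. qc b b' a x * K (a, i) j x)" for b b' a i j x
    using qc0[of b b'] unfolding P_def by simp_all
  define P' where "P' b a q \<longleftrightarrow> (\<forall>a<length es. smooth_fun_on M W (q a)) \<and> (\<forall>i j x. i < r \<longrightarrow> x \<in> W \<longrightarrow>
     Dc b (K (a, i) j) x + (\<Sum>k<r. \<Gamma> b i k x * K (a, k) j x) - (\<Sum>k<r. K (a, i) k x * \<Gamma> b k j x)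
       = (\<Sum>a'<length es. q a' x * K (a', i) j x))" for b a q
  have "\<forall>b\<in>bas. \<forall>a\<in>{..<length es}. \<exists>q. P' b a q"
  proof (intro ballI)
    fix b a assume b: "b \<in> bas" and "a \<in> {..<length es}"
    then have a: "a < length es" by simp
    show "\<exists>q. P' b a q"
    proof (rule K_derivative[OF b a], goal_cases)
      case (1 q)
      show ?case unfolding P'_def by (rule exI[of _ q], intro conjI allI impI 1)
    qed
  qed
  then have "\<forall>b\<in>bas. \<exists>q. \<forall>a\<in>{..<length es}. P' b a (q a)" by (intro ballI bchoice) simp
  from bchoice[OF this] obtain qk where qk0: "\<And>b a. b \<in> bas \<Longrightarrow> a < length es \<Longrightarrow> P' b a (qk b a)" by blast
  have qk: "b \<in> bas \<Longrightarrow> a < length es \<Longrightarrow> a' < length es \<Longrightarrow> smooth_fun_on M W (qk b a a')"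
    "b \<in> bas \<Longrightarrow> a < length es \<Longrightarrow> i < r \<Longrightarrow> x \<in> W \<Longrightarrow>
       Dc b (K (a, i) j) x + (\<Sum>k<r. \<Gamma> b i k x * K (a, k) j x) - (\<Sum>k<r. K (a, i) k x * \<Gamma> b k j x)
       = (\<Sum>a'<length es. qk b a a' x * K (a', i) j x)" for b a a' i j x
    using qk0[of b a] unfolding P'_def by simp_all
  \<comment> \<open>The curvature in component \<open>i\<close> involves constraints with the same
    component only. In \<open>m\<close>, the derivative of a constraint mixes generators through
    \<open>qk\<close> and components through \<open>\<Gamma>\<close>.\<close>
  define S where "S c' b i q u = (if snd q = i then qc b c' (fst q) (\<psi> u) else 0)" for c' b :: 'h
    and i :: nat and q :: "nat \<times> nat" and u :: 'h
  define m where "m b q q' u = (if snd q' = snd q then qk b (fst q) (fst q') (\<psi> u) else 0) -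
    (if fst q' = fst q then \<Gamma> b (snd q) (snd q') (\<psi> u) else 0)" for b :: 'h and q q' :: "nat \<times> nat" and u :: 'h
  have S_cont: "continuous_on ?O (S c' b i q)" if "b \<in> bas" "c' \<in> bas" "q \<in> QQ" for c' b i q
    using smooth_on_continuous[OF smooth_on_phi_W[OF qc(1)[OF that(1,2)]]] that(3) unfolding S_def[abs_def]
    by (cases "snd q = i") auto
  have m_cont: "continuous_on ?O (m b q q')" if "b \<in> bas" "q \<in> QQ" "q' \<in> QQ" for b q q'
    using smooth_on_continuous[OF smooth_on_phi_W[OF qk(1)[OF that(1)]]]
      smooth_on_continuous[OF smooth_on_phi_W[OF \<Gamma>_smooth[OF that(1)]]] that(2,3)
    unfolding m_def[abs_def]
    by (cases "snd q' = snd q"; cases "fst q' = fst q") (auto intro!: continuous_on_diff continuous_on_minus)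
  have finQ: "finite QQ" by simp
  have "\<exists>C T. C \<ge> 0 \<and> open T \<and> p \<in> T \<and> T \<subseteq> ?O \<and>
    (\<forall>x\<in>bas \<times> {..r} \<times> {..r}. \<forall>u\<in>T. \<bar>(case x of (b, i, j) \<Rightarrow> ca b i j) u\<bar> \<le> C)"
    by (rule bounded_near[OF _ phi_W(1) p]) (auto simp: finite_bas intro: smooth_on_continuous ca_smooth)
  then obtain C1 T1 where 1: "C1 \<ge> 0" "open T1" "p \<in> T1" "T1 \<subseteq> ?O"
    "\<And>b i j u. b \<in> bas \<Longrightarrow> i \<le> r \<Longrightarrow> j \<le> r \<Longrightarrow> u \<in> T1 \<Longrightarrow> \<bar>ca b i j u\<bar> \<le> C1" by force
  have "\<exists>C T. C \<ge> 0 \<and> open T \<and> p \<in> T \<and> T \<subseteq> ?O \<and> (\<forall>x\<in>QQ \<times> {..r}. \<forall>u\<in>T. \<bar>(case x of (q, j) \<Rightarrow> cK q j) u\<bar> \<le> C)"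
    by (rule bounded_near[OF _ phi_W(1) p]) (auto intro!: smooth_on_continuous cK_smooth)
  then obtain C2 T2 where 2: "C2 \<ge> 0" "open T2" "p \<in> T2" "T2 \<subseteq> ?O"
    "\<And>q j u. q \<in> QQ \<Longrightarrow> j \<le> r \<Longrightarrow> u \<in> T2 \<Longrightarrow> \<bar>cK q j u\<bar> \<le> C2" by force
  have "\<exists>C T. C \<ge> 0 \<and> open T \<and> p \<in> T \<and> T \<subseteq> ?O \<and>
    (\<forall>x\<in>bas \<times> QQ \<times> QQ. \<forall>u\<in>T. \<bar>(case x of (b, q, q') \<Rightarrow> m b q q') u\<bar> \<le> C)"
    by (rule bounded_near[OF _ phi_W(1) p]) (use m_cont finite_bas in \<open>auto intro!: finite_cartesian_product\<close>)
  then obtain C3 T3 where 3: "C3 \<ge> 0" "open T3" "p \<in> T3" "T3 \<subseteq> ?O"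
    "\<And>b q q' u. b \<in> bas \<Longrightarrow> q \<in> QQ \<Longrightarrow> q' \<in> QQ \<Longrightarrow> u \<in> T3 \<Longrightarrow> \<bar>m b q q' u\<bar> \<le> C3" by force
  have "\<exists>C T. C \<ge> 0 \<and> open T \<and> p \<in> T \<and> T \<subseteq> ?O \<and>
    (\<forall>x\<in>bas \<times> bas \<times> {..r} \<times> QQ. \<forall>u\<in>T. \<bar>(case x of (b, c', i, q) \<Rightarrow> S b c' i q) u\<bar> \<le> C)"
    by (rule bounded_near[OF _ phi_W(1) p]) (use S_cont finite_bas in \<open>auto intro!: finite_cartesian_product\<close>)
  then obtain C4 T4 where 4: "C4 \<ge> 0" "open T4" "p \<in> T4" "T4 \<subseteq> ?O"
    "\<And>b c' i q u. b \<in> bas \<Longrightarrow> c' \<in> bas \<Longrightarrow> i \<le> r \<Longrightarrow> q \<in> QQ \<Longrightarrow> u \<in> T4 \<Longrightarrow> \<bar>S b c' i q u\<bar> \<le> C4" by force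
  define C where "C = C1 + C2 + C3 + C4"
  have C: "C \<ge> 0" "C1 \<le> C" "C2 \<le> C" "C3 \<le> C" "C4 \<le> C" using 1(1) 2(1) 3(1) 4(1) by (auto simp: C_def)
  have "open (T \<inter> T1 \<inter> T2 \<inter> T3 \<inter> T4)" "p \<in> T \<inter> T1 \<inter> T2 \<inter> T3 \<inter> T4" using T 1 2 3 4 by auto
  then obtain d0 where d0: "d0 > 0" "ball p d0 \<subseteq> T \<inter> T1 \<inter> T2 \<inter> T3 \<inter> T4" by (meson openE)
  \<comment> \<open>For diameter \<open>2 * d\<close> the smallness condition reads
    \<open>L * (2 * d) \<le> 1 / 8\<close>, whence the 16 in \<open>d\<close>; there
    \<open>L + 1\<close> also covers \<open>L = 0\<close>.\<close>
  define L where "L = (real (card {..r}) + 1) * ((real (card QQ) + 1) * (real (card bas) * C))"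
  have L: "L \<ge> 0" using C(1) by (simp add: L_def)
  define d where "d = min d0 (1 / (16 * (L + 1)))"
  have d: "d > 0" using d0 L by (simp add: d_def)
  have Ld: "L * (2 * d) \<le> 1 / 8"
  proof -
    have "L * (2 * d) \<le> (L + 1) * (2 * (1 / (16 * (L + 1))))" using L d by (intro mult_mono) (auto simp: d_def)
    also have "\<dots> = 1 / 8" using L by (simp add: field_simps)
    finally show ?thesis .
  qed
  have sub: "ball p d \<subseteq> T \<inter> T1 \<inter> T2 \<inter> T3 \<inter> T4" using d0(2) by (auto simp: d_def subset_iff)
  then have subO: "ball p d \<subseteq> ?O" using 1(4) by blast
  define ad where "ad c' b i j u = frechet_derivative (ca b i j) (at u) c'" for c' b i j u
  define Kd where "Kd c' q j u = frechet_derivative (cK q j) (at u) c'" for c' q j u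
  have "flat_system bas (ball p d) {..r} QQ ca ad cK Kd m S C (2 * d)"
  proof
    show "onb bas" by (rule onb_bas)
    show "norm (x - y) \<le> 2 * d" if "x \<in> ball p d" "y \<in> ball p d" for x y
      using dist_triangle2[of x y p] that by (simp add: dist_norm norm_minus_commute)
    show "pd bas (ball p d) (ca b i j) (\<lambda>c'. ad c' b i j)" if "b \<in> bas" for b i j
      unfolding ad_def[abs_def] by (rule pd_smooth[OF onb_bas smooth_on_subset[OF ca_smooth[OF that] subO]])
    show "pd bas (ball p d) (cK q j) (\<lambda>c'. Kd c' q j)" if "q \<in> QQ" for q j
      unfolding Kd_def[abs_def] by (rule pd_smooth[OF onb_bas smooth_on_subset[OF cK_smooth[OF that] subO]])
    show "\<bar>ca b i j x\<bar> \<le> C" if "b \<in> bas" "i \<in> {..r}" "j \<in> {..r}" "x \<in> ball p d" for b i j x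
      using 1(5)[of b i j x] that sub C by force
    show "\<bar>cK q j x\<bar> \<le> C" if "q \<in> QQ" "j \<in> {..r}" "x \<in> ball p d" for q j x
      using 2(5)[of q j x] that sub C by force
    show "\<bar>m b q q' x\<bar> \<le> C" if "b \<in> bas" "q \<in> QQ" "q' \<in> QQ" "x \<in> ball p d" for b q q' x
      using 3(5)[of b q q' x] that sub C by force
    show "\<bar>S b c' i q x\<bar> \<le> C" if "b \<in> bas" "c' \<in> bas" "i \<in> {..r}" "q \<in> QQ" "x \<in> ball p d" for b c' i q x
      using 4(5)[of b c' i q x] that sub C by force
    show "(real (card {..r}) + 1) * ((real (card QQ) + 1) * (real (card bas) * (2 * d * C))) \<le> 1 / 8"
      using Ld unfolding L_def by (simp only: mult_ac)
    show "Kd b q j u = (\<Sum>q'\<in>QQ. m b q q' u * cK q' j u) - (\<Sum>k\<in>{..r}. cK q k u * ca b k j u)"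
      if b: "b \<in> bas" and q: "q \<in> QQ" and u: "u \<in> ball p d" for b q j u
    proof -
      obtain a i where ai: "q = (a, i)" "a < length es" "i < r" using q by auto
      have uO: "u \<in> ?O" using u subO by blast
      have x: "\<psi> u \<in> W" using phi_W(3) uO by blast
      have 1: "Kd b q j u = Dc b (K q j) (\<psi> u)" unfolding Kd_def cK_def[abs_def] Dc_psi[OF uO] ..
      have 2: "(\<Sum>k\<in>{..r}. cK q k u * ca b k j u) = - (\<Sum>k<r. K q k (\<psi> u) * \<Gamma> b k j (\<psi> u))"
        by (simp add: lessThan_Suc_atMost[symmetric] ca_def cK_def sum_negf)
      have "(\<Sum>q'\<in>QQ. m b q q' u * cK q' j u) = (\<Sum>a'<length es. \<Sum>i'<r. m b q (a', i') u * K (a', i') j (\<psi> u))"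
        unfolding sum.cartesian_product by (intro sum.cong) (auto simp: cK_def)
      also have "\<dots> = (\<Sum>a'<length es. (\<Sum>i'<r. (if i' = i then qk b a a' (\<psi> u) * K (a', i') j (\<psi> u) else 0)) -
            (\<Sum>i'<r. (if a' = a then \<Gamma> b i i' (\<psi> u) * K (a', i') j (\<psi> u) else 0)))"
        unfolding sum_subtractf[symmetric] by (intro sum.cong refl) (auto simp: m_def ai algebra_simps)
      also have "\<dots> = (\<Sum>a'<length es. qk b a a' (\<psi> u) * K (a', i) j (\<psi> u)) -
           (\<Sum>a'<length es. if a' = a then \<Sum>i'<r. \<Gamma> b i i' (\<psi> u) * K (a', i') j (\<psi> u) else 0)"
        unfolding sum_subtractf using ai(3) by (intro arg_cong2[where f = minus] sum.cong refl) auto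
      also have "(\<Sum>a'<length es. if a' = a then \<Sum>i'<r. \<Gamma> b i i' (\<psi> u) * K (a', i') j (\<psi> u) else 0) =
           (\<Sum>i'<r. \<Gamma> b i i' (\<psi> u) * K (a, i') j (\<psi> u))" using ai(2) by simp
      finally show ?thesis unfolding 1 2 using qk(2)[OF b ai(2,3) x, of j] ai(1) by simp
    qed
    show "ad c' b i j u - ad b c' i j u + (\<Sum>k\<in>{..r}. ca b i k u * ca c' k j u - ca c' i k u * ca b k j u)
      = (\<Sum>q\<in>QQ. S c' b i q u * cK q j u)"
      if b: "b \<in> bas" "c' \<in> bas" and u: "u \<in> ball p d" for b c' i j u
    proof -
      have uO: "u \<in> ?O" using u subO by blast
      have x: "\<psi> u \<in> W" using phi_W(3) uO by blast
      have R: "(\<Sum>q\<in>QQ. S c' b i q u * cK q j u) = (\<Sum>a<length es. \<Sum>i'<r. if i'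
        = i then qc b c' a (\<psi> u) * K (a, i') j (\<psi> u) else 0)"
        unfolding sum.cartesian_product by (intro sum.cong) (auto simp: cK_def S_def)
      show ?thesis
      proof (cases "i < r")
        case True
        have "(\<Sum>q\<in>QQ. S c' b i q u * cK q j u) = (\<Sum>a<length es. qc b c' a (\<psi> u) * K (a, i) j (\<psi> u))"
          unfolding R using True by simp
        moreover have "(\<Sum>k\<in>{..r}. ca b i k u * ca c' k j u - ca c' i k u * ca b k j u) =
          (\<Sum>k<r. \<Gamma> b i k (\<psi> u) * \<Gamma> c' k j (\<psi> u) - \<Gamma> c' i k (\<psi> u) * \<Gamma> b k j (\<psi> u))"
          unfolding lessThan_Suc_atMost[symmetric] using True by (simp add: ca_def)
        ultimately show ?thesis
          unfolding ad_def using qc(2)[OF b True x, of j] by (simp add: ca_deriv[OF uO _ True] b)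
      next
        \<comment> \<open>In row \<open>r\<close> all entries of \<open>ca\<close> vanish, and no
          constraint has component \<open>r\<close>, so both sides are 0.\<close>
        case False
        have "ca b i j = (\<lambda>u. 0)" for b j using False by (simp add: ca_def[abs_def])
        then show ?thesis unfolding R using False by (simp add: ad_def)
      qed
    qed
  qed (use finQ C(1) in auto)
  then show thesis using that d sub subO by blast
qed

lemma comb_co: "\<nu> \<in> sections M F \<Longrightarrow> x \<in> W \<Longrightarrow> comb fs (\<lambda>i. co \<nu> i x) x = \<nu> x"
  using co(2) by simp

lemma eq_iff_co:
  assumes "\<mu> \<in> sections M F" "\<nu> \<in> sections M F" "x \<in> W"
  shows "\<mu> x = \<nu> x \<longleftrightarrow> (\<forall>i<r. co \<mu> i x = co \<nu> i x)"
proof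
  assume "\<mu> x = \<nu> x"
  then show "\<forall>i<r. co \<mu> i x = co \<nu> i x"
    using co_unique[OF assms(1,3), of "\<lambda>i. co \<nu> i x"] comb_co[OF assms(2,3)] by simp
next
  assume "\<forall>i<r. co \<mu> i x = co \<nu> i x"
  then show "\<mu> x = \<nu> x" using comb_cong[of fs "\<lambda>i. co \<mu> i x" "\<lambda>i. co \<nu> i x" x] comb_co assms by metis
qed

lemma co_\<Omega>:
  assumes s: "s \<in> sections M \<A>" "x \<in> W" "i < r"
  shows "co (\<lambda>x. \<Omega> x (s x)) i x = - co (SS s r) i x"
proof (rule co_unique[OF \<Omega>_sec[OF s(1)] s(2) _ s(3)])
  have "\<Omega> x (s x) = (-1) *\<^sub>R SS s r x" by (simp add: SS_def)
  also have "\<dots> = comb fs (\<lambda>i. (-1) * co (SS s r) i x) x"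
    unfolding comb_scale comb_co[OF SS_sec[OF s(1)] s(2)] ..
  finally show "\<Omega> x (s x) = comb fs (\<lambda>i. - co (SS s r) i x) x" by simp
qed

lemma L_Bs_iff:
  assumes "\<mu> \<in> sections M F" "x \<in> W" "b \<in> bas"
  shows "\<LL> x (Bs b x) \<mu> = \<Omega> x (Bs b x) \<longleftrightarrow>
    (\<forall>i<r. Dc b (co \<mu> i) x + (\<Sum>k<r. \<Gamma> b i k x * co \<mu> k x) = - \<Gamma> b i r x)"
  using eq_iff_co[OF L_sec[OF Bs(1)[OF assms(3)] assms(1)] \<Omega>_sec[OF Bs(1)[OF assms(3)]] assms(2)]
    co_L_Bs[OF assms] co_\<Omega>[OF Bs(1)[OF assms(3)] assms(2)]
  by (simp add: \<Gamma>_def)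

lemma L_us_iff:
  assumes "\<mu> \<in> sections M F" "x \<in> W" "a < length es"
  shows "\<LL> x (us a x) \<mu> = \<Omega> x (us a x) \<longleftrightarrow> (\<forall>i<r. (\<Sum>k<r. K (a, i) k x * co \<mu> k x) = - K (a, i) r x)"
  using eq_iff_co[OF L_sec[OF us(1)[OF assms(3)] assms(1)] \<Omega>_sec[OF us(1)[OF assms(3)]] assms(2)]
    co_L_us[OF assms] co_\<Omega>[OF us(1)[OF assms(3)] assms(2)]
  by (simp add: K_def)

lemma L_all:
  assumes \<mu>: "\<mu> \<in> sections M F" and x: "x \<in> W" and a: "a \<in> fibre \<A> x"
    and B: "\<And>b. b \<in> bas \<Longrightarrow> \<LL> x (Bs b x) \<mu> = \<Omega> x (Bs b x)"
    and u: "\<And>j. j < length es \<Longrightarrow> \<LL> x (us j x) \<mu> = \<Omega> x (us j x)"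
  shows "\<LL> x a \<mu> = \<Omega> x a"
proof -
  obtain k l where a': "a = (\<Sum>j<length es. k j *\<^sub>R us j x) + (\<Sum>b\<in>bas. l b *\<^sub>R Bs b x)"
    by (rule fibre_decompose[OF x a])
  have f: "us j x \<in> fibre \<A> x" if "j < length es" for j using A.sec_fibre[OF us(1)[OF that]] .
  have g: "Bs b x \<in> fibre \<A> x" if "b \<in> bas" for b using A.sec_fibre[OF Bs(1)[OF that]] .
  have h: "(\<Sum>j<length es. k j *\<^sub>R us j x) \<in> fibre \<A> x" "(\<Sum>b\<in>bas. l b *\<^sub>R Bs b x) \<in> fibre \<A> x"
    by (auto intro!: A.fibre_ops f g)
  have "\<LL> x (\<Sum>j<length es. k j *\<^sub>R us j x) \<mu> = \<Omega> x (\<Sum>j<length es. k j *\<^sub>R us j x)"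
    by (subst L_a_sum, (auto intro!: A.fibre_ops f)[1], subst \<Omega>_sum) (auto intro!: A.fibre_ops f simp:
      L_a_scale \<Omega>_scale f u)
  moreover have "\<LL> x (\<Sum>b\<in>bas. l b *\<^sub>R Bs b x) \<mu> = \<Omega> x (\<Sum>b\<in>bas. l b *\<^sub>R Bs b x)"
    by (subst L_a_sum, (auto intro!: A.fibre_ops g)[1], subst \<Omega>_sum) (auto intro!: A.fibre_ops g simp:
      L_a_scale \<Omega>_scale g B)
  ultimately show ?thesis unfolding a' by (simp add: L_a_add[OF h] \<Omega>_add[OF h])
qed

text \<open>Completed by the coefficient 1 at \<open>r\<close>, the coefficients of a solution
  satisfy the homogeneous system. This reduces uniqueness of solutions to
  \<open>parallel_unique\<close>.\<close>

lemma sol_pd: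
  assumes d: "open D" "D \<subseteq> \<phi> ` W" and s: "sol (\<psi> ` D) m"
  obtains \<sigma> where "\<And>u. u \<in> D \<Longrightarrow> m (\<psi> u) = comb fs (\<lambda>i. \<sigma> i u) (\<psi> u)" "\<And>u. \<sigma> r u = 1"
    "\<And>i. i \<le> r \<Longrightarrow> pd bas D (\<sigma> i) (\<lambda>b u. \<Sum>j\<in>{..r}. ca b i j u * \<sigma> j u)"
proof -
  have "\<forall>u\<in>D. \<exists>k. m (\<psi> u) = comb fs k (\<psi> u)"
  proof
    fix u assume u: "u \<in> D"
    then have x: "\<psi> u \<in> W" using phi_W(3) d by blast
    have "m (\<psi> u) \<in> primitives (\<psi> u)" by (rule sol_val[OF s]) (use u in blast)
    then have "m (\<psi> u) \<in> fibre F (\<psi> u)" by (simp add: primitives_def)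
    then show "\<exists>k. m (\<psi> u) = comb fs k (\<psi> u)"
      using basis_at_expand[OF F.framed_basis[OF fs x]] by metis
  qed
  from bchoice[OF this] obtain k where k: "\<And>u. u \<in> D \<Longrightarrow> m (\<psi> u) = comb fs (k u) (\<psi> u)" by blast
  define \<sigma> where "\<sigma> i u = (if i < r then k u i else 1)" for i u
  have m: "m (\<psi> u) = comb fs (\<lambda>i. \<sigma> i u) (\<psi> u)" if "u \<in> D" for u
    unfolding k[OF that] by (rule comb_cong) (simp add: \<sigma>_def)
  have deriv: "(\<sigma> i has_derivative (\<lambda>v. \<Sum>b\<in>bas. (v \<bullet> b) * (\<Sum>j\<in>{..r}. ca b i j u * \<sigma> j u))) (at u)"
    if u: "u \<in> D" for i u
  proof (cases "i < r")
    case False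
    then have "\<sigma> i = (\<lambda>u. 1)" "\<And>b j. ca b i j u = 0" by (auto simp: \<sigma>_def ca_def)
    then show ?thesis by simp
  next
    case True
    have x: "\<psi> u \<in> W" and uW: "u \<in> \<phi> ` W" using phi_W(3) d u by blast+
    show ?thesis
    proof (rule solE[OF s imageI[OF u]])
      fix \<mu> N' assume *: "\<mu> \<in> sections M F" "open N'" "\<psi> u \<in> N'" "N' \<subseteq> \<psi> ` D"
        "\<And>x. x \<in> N' \<Longrightarrow> \<mu> x = m x" "\<And>x a. x \<in> N' \<Longrightarrow> a \<in> fibre \<A> x \<Longrightarrow> \<LL> x a \<mu> = \<Omega> x a"
      have N'W: "N' \<subseteq> W" using *(4) phi_W(3) d(2) by blast
      have eq: "co \<mu> j (\<psi> w) = \<sigma> j w" if w: "w \<in> \<phi> ` N'" "j < r" for w j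
      proof -
        have w': "\<psi> w \<in> N'" "w \<in> D"
        proof -
          obtain x where x: "x \<in> N'" "w = \<phi> x" using w(1) by blast
          then obtain u where "u \<in> D" "x = \<psi> u" using *(4) by blast
          then show "w \<in> D" using x(2) phi_W(4) d(2) by auto
          show "\<psi> w \<in> N'" using x N'W phi_W(2) by auto
        qed
        have e: "\<mu> (\<psi> w) = comb fs (\<lambda>i. \<sigma> i w) (\<psi> w)" using *(5)[OF w'(1)] m[OF w'(2)] by simp
        show ?thesis using co_unique[OF *(1) _ e w(2)] w'(1) N'W by blast
      qed
      have uN: "u \<in> \<phi> ` N'" using *(3) phi_W(4)[OF uW] by (metis imageI)
      have oN: "open (\<phi> ` N')" using chart_open_image[OF c *(2)] N'W WU by (simp add: Int_absorb1)
      let ?g = "\<lambda>w. co \<mu> i (\<psi> w)"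
      have "pd bas (\<phi> ` W) ?g (\<lambda>b w. frechet_derivative ?g (at w) b)"
        by (rule pd_smooth[OF onb_bas smooth_on_phi_W[OF co(1)[OF *(1) True]]])
      from pd_deriv[OF this uW]
      have "(?g has_derivative (\<lambda>v. \<Sum>b\<in>bas. (v \<bullet> b) * frechet_derivative ?g (at u) b)) (at u)" .
      then have "(\<sigma> i has_derivative (\<lambda>v. \<Sum>b\<in>bas. (v \<bullet> b) * frechet_derivative ?g (at u) b)) (at u)"
        by (rule has_derivative_transform_within_open[OF _ oN uN]) (rule eq[OF _ True])
      moreover have "frechet_derivative ?g (at u) b = (\<Sum>j\<in>{..r}. ca b i j u * \<sigma> j u)" if b: "b \<in> bas" for b
      proof -
        have "\<LL> (\<psi> u) (Bs b (\<psi> u)) \<mu> = \<Omega> (\<psi> u) (Bs b (\<psi> u))" by (rule *(6)[OF *(3) A.sec_fibre[OF Bs(1)[OF b]]])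
        then have "Dc b (co \<mu> i) (\<psi> u) = - (\<Sum>k<r. \<Gamma> b i k (\<psi> u) * co \<mu> k (\<psi> u)) - \<Gamma> b i r (\<psi> u)"
          using L_Bs_iff[OF *(1) x b] True by fastforce
        then show ?thesis
          unfolding Dc_psi[OF uW] lessThan_Suc_atMost[symmetric]
          using True eq[OF uN] by (simp add: ca_def \<sigma>_def sum_negf)
      qed
      ultimately show ?thesis by simp
    qed
  qed
  have "continuous_on D (\<sigma> i)" for i
    by (meson continuous_at_imp_continuous_on has_derivative_continuous deriv)
  then have "pd bas D (\<sigma> i) (\<lambda>b u. \<Sum>j\<in>{..r}. ca b i j u * \<sigma> j u)" for i
    unfolding pd_def using deriv smooth_on_continuous[OF smooth_on_subset[OF ca_smooth d(2)]]
    by (auto intro!: continuous_intros)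
  then show thesis using that[of \<sigma>] m by (simp add: \<sigma>_def)
qed

text \<open>The isotropy action can be computed with any extension of the vector. The one with
  constant coefficients turns the condition on a primitive into the constraints at
  \<open>y\<close>.\<close>

lemma kernel_initial:
  assumes y: "y \<in> W" and \<tau>: "comb fs t y \<in> primitives y" and q: "q \<in> QQ"
  shows "(\<Sum>j\<in>{..r}. cK q j (\<phi> y) * (if j < r then t j else 1)) = 0"
proof -
  obtain a i where ai: "q = (a, i)" "a < length es" "i < r" using q by auto
  define \<nu> where "\<nu> = (\<lambda>x. comb fs t x)"
  have \<nu>: "\<nu> \<in> sections M F" unfolding \<nu>_def comb_def
    by (intro F.sec_sum F.sec_mult Cinf_const F.framed_sec[OF fs]) auto
  have ad: "us a y \<in> adjoint_fibre \<A> y" using A.sec_fibre[OF us(1)[OF ai(2)]] us(2)[OF ai(2) y]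
    by (simp add: adjoint_iff)
  have "\<Omega> y (us a y) = iso y (us a y) (\<nu> y)" using \<tau> ad by (simp add: primitives_def \<nu>_def)
  then have "\<LL> y (us a y) \<nu> = \<Omega> y (us a y)" using iso_eq[OF ad \<nu>] by simp
  then have "(\<Sum>k<r. K (a, i) k y * co \<nu> k y) = - K (a, i) r y" using L_us_iff[OF \<nu> y ai(2)] ai(3) by blast
  moreover have "co \<nu> k y = t k" if "k < r" for k by (rule co_unique[OF \<nu> y _ that]) (simp add: \<nu>_def)
  ultimately show ?thesis
    unfolding lessThan_Suc_atMost[symmetric] by (simp add: cK_def phi_W(2)[OF y] ai(1))
qed

text \<open>The converse of \<open>sol_pd\<close>: the differential system gives the equation for
  the lifts, the constraints give it for the generators, and together these span the fibre.\<close>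

lemma sol_of_parallel:
  assumes D: "open D" "D \<subseteq> \<phi> ` W" and \<sigma>: "\<And>i. i \<le> r \<Longrightarrow> pd bas D (\<sigma> i) (\<lambda>b u. \<Sum>j\<in>{..r}. ca b i j u * \<sigma> j u)"
    and sm: "\<And>i. i \<le> r \<Longrightarrow> smooth_on D (\<sigma> i)" and one: "\<And>u. u \<in> D \<Longrightarrow> \<sigma> r u = 1"
    and ker: "\<And>q u. q \<in> QQ \<Longrightarrow> u \<in> D \<Longrightarrow> (\<Sum>j\<in>{..r}. cK q j u * \<sigma> j u) = 0"
  shows "sol (\<psi> ` D) (\<lambda>x. comb fs (\<lambda>i. \<sigma> i (\<phi> x)) x)"
proof -
  let ?N = "\<psi> ` D"
  let ?m = "\<lambda>x. comb fs (\<lambda>i. \<sigma> i (\<phi> x)) x"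
  have NW: "?N \<subseteq> W" using D(2) phi_W(3) by blast
  have \<phi>N: "\<phi> ` ?N = D" using D(2) phi_W(4) by (force simp: image_image)
  have N_eq: "?N = U \<inter> \<phi> -` D"
    using NW WU \<phi>N D(2) chart_inv[OF c] by (auto simp: rev_image_eqI)
  have oN: "open ?N" unfolding N_eq by (rule chart_open_vimage[OF c D(1)])
  have sN: "smooth_fun_on M ?N (\<lambda>x. \<sigma> i (\<phi> x))" if "i < r" for i
  proof (rule smooth_fun_on_chart[OF c oN])
    show "?N \<subseteq> U" using NW WU by blast
    show "smooth_on (\<phi> ` ?N) ((\<lambda>x. \<sigma> i (\<phi> x)) \<circ> \<psi>)"
      unfolding \<phi>N by (subst smooth_on_cong[OF D(1), of _ "\<sigma> i"]) (use sm[of i] that phi_W(4) D(2) in auto)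
  qed
  have sm_m: "smooth_section_on M F ?N ?m"
    unfolding comb_def by (intro F.smooth_section_on_sum F.smooth_section_on_mult oN sN F.sec_on
      F.framed_sec[OF fs]) auto
  show ?thesis
    unfolding sol_def
  proof
    fix y assume y: "y \<in> ?N"
    obtain \<mu> N' where *: "\<mu> \<in> sections M F" "open N'" "y \<in> N'" "N' \<subseteq> ?N" "\<And>x. x \<in> N' \<Longrightarrow> \<mu> x = ?m x"
      using F.sec_extend[OF oN y sm_m] by blast
    have "\<LL> x a \<mu> = \<Omega> x a" if x: "x \<in> N'" and a: "a \<in> fibre \<A> x" for x a
    proof -
      have xW: "x \<in> W" using x *(4) NW by blast
      have uD: "\<phi> x \<in> D" using x *(4) \<phi>N by blast
      have N'W: "N' \<subseteq> W" using *(4) NW by blast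
      have co_eq: "co \<mu> k w = \<sigma> k (\<phi> w)" if "w \<in> N'" "k < r" for k w
        by (rule co_unique[OF *(1) _ *(5)[OF that(1)] that(2)]) (use that N'W in blast)
      show ?thesis
      proof (rule L_all[OF *(1) xW a])
        fix b assume b: "b \<in> bas"
        have "Dc b (co \<mu> i) x + (\<Sum>k<r. \<Gamma> b i k x * co \<mu> k x) = - \<Gamma> b i r x" if i: "i < r" for i
        proof -
          have "Dc b (co \<mu> i) x = Dc b (\<lambda>x. \<sigma> i (\<phi> x)) x"
            by (rule Dc_local[OF x *(2) N'W smooth_fun_on_subset[OF co(1)[OF *(1) i] N'W]]) (rule co_eq[OF _ i])
          also have "\<dots> = frechet_derivative (\<sigma> i) (at (\<phi> x)) b"
          proof -
            have "frechet_derivative (\<sigma> i) (at (\<phi> x)) = frechet_derivative (\<lambda>u. \<sigma> i (\<phi> (\<psi> u))) (at (\<phi> x))"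
            proof (rule frechet_derivative_transform_within_open[OF _ D(1) uD])
              show "\<sigma> i differentiable at (\<phi> x)"
                using smooth_on_differentiable[OF sm uD, of i] i by (auto simp: differentiable_def)
            qed (use phi_W(4) D(2) in auto)
            then show ?thesis using Dc_psi[of "\<phi> x" b "\<lambda>x. \<sigma> i (\<phi> x)"] xW phi_W(2)[OF xW] by simp
          qed
          also have "\<dots> = (\<Sum>j\<in>{..r}. ca b i j (\<phi> x) * \<sigma> j (\<phi> x))"
            using pd_unique[OF onb_bas \<sigma> uD b, of i] i by simp
          also have "\<dots> = - (\<Sum>k<r. \<Gamma> b i k x * co \<mu> k x) - \<Gamma> b i r x"
            unfolding lessThan_Suc_atMost[symmetric]
            using i by (simp add: ca_def phi_W(2)[OF xW] one[OF uD] co_eq[OF x] sum_negf)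
          finally show ?thesis by simp
        qed
        then show "\<LL> x (Bs b x) \<mu> = \<Omega> x (Bs b x)" using L_Bs_iff[OF *(1) xW b] by blast
      next
        fix j assume j: "j < length es"
        have "(\<Sum>k<r. K (j, i) k x * co \<mu> k x) = - K (j, i) r x" if i: "i < r" for i
          using ker[of "(j, i)" "\<phi> x"] j i uD unfolding lessThan_Suc_atMost[symmetric]
          by (simp add: cK_def phi_W(2)[OF xW] one[OF uD] co_eq[OF x])
        then show "\<LL> x (us j x) \<mu> = \<Omega> x (us j x)" using L_us_iff[OF *(1) xW j] by blast
      qed
    qed
    then show "\<exists>\<mu>\<in>sections M F. \<exists>N'. open N' \<and> y \<in> N' \<and> N' \<subseteq> ?N \<and>
       (\<forall>x\<in>N'. \<mu> x = ?m x \<and> (\<forall>a\<in>fibre \<A> x. \<LL> x a \<mu> = \<Omega> x a))"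
      using * by (intro bexI[OF _ *(1)] exI[of _ N'] conjI ballI) auto
  qed
qed

end

section \<open>Neighbourhoods on which primitives extend uniquely\<close>

context cocycle
begin

definition nice_nbhd :: "'m set \<Rightarrow> bool" where
  "nice_nbhd N \<longleftrightarrow> open N \<and> path_connected N \<and>
     (\<forall>y\<in>N. \<forall>v\<in>primitives y. \<exists>s. sol N s \<and> s y = v) \<and>
     (\<forall>s s' y y'. sol N s \<longrightarrow> sol N s' \<longrightarrow> y \<in> N \<longrightarrow> y' \<in> N \<longrightarrow> s y = s' y \<longrightarrow> s y' = s' y')"

text \<open>The neighbourhood corresponds in a chart to a ball from \<open>flat_ball\<close>. The
  same ball serves all initial points in it, because the system is solved from an arbitrary
  \<open>y\<close>, not only from the centre.\<close>

lemma nice_nbhd_exists: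
  assumes T: "open T" "y0 \<in> T"
  obtains N where "nice_nbhd N" "y0 \<in> N" "N \<subseteq> T"
proof -
  obtain U \<phi> where c: "(U, \<phi>) \<in> M" "y0 \<in> U" by (rule chart_exists)
  show thesis
  proof (rule local_data_exists[OF c T])
    fix W es fs Bs us G
    assume ld: "local_data M \<A> F \<LL> U \<phi> W es fs Bs us G" and y0: "y0 \<in> W" and WT: "W \<subseteq> T"
    interpret cocycle_local M \<A> F \<LL> \<Omega> U \<phi> W es fs Bs us G
      using ld cocycle_axioms by (simp add: cocycle_local_def)
    have p: "\<phi> y0 \<in> \<phi> ` W" using y0 by blast
    show thesis
    proof (rule flat_ball[OF p open_UNIV UNIV_I])
      fix d ad Kd m S C assume 1: "d > 0" "ball (\<phi> y0) d \<subseteq> \<phi> ` W \<inter> UNIV"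
        "flat_system bas (ball (\<phi> y0) d) {..r} QQ ca ad cK Kd m (S :: 'h \<Rightarrow> 'h \<Rightarrow> nat \<Rightarrow> nat \<times> nat \<Rightarrow> 'h \<Rightarrow> real) C (2 * d)"
      interpret fl: flat_system bas "ball (\<phi> y0) d" "{..r}" QQ ca ad cK Kd m S C "2 * d" by (rule 1(3))
      define D where "D = ball (\<phi> y0) d"
      have D: "open D" "D \<subseteq> \<phi> ` W" "convex D" "\<phi> y0 \<in> D" using 1(1,2) by (auto simp: D_def)
      define N where "N = \<psi> ` D"
      have NW: "N \<subseteq> W" using D(2) phi_W(3) by (auto simp: N_def)
      have \<phi>N: "\<phi> y \<in> D \<and> \<psi> (\<phi> y) = y" if "y \<in> N" for y
        using that D(2) phi_W(3,4) by (force simp: N_def)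
      have N_eq: "N = U \<inter> \<phi> -` D"
        using NW WU \<phi>N chart_inv[OF c(1)] by (auto simp: N_def rev_image_eqI)
      have oN: "open N" unfolding N_eq by (rule chart_open_vimage[OF c(1) D(1)])
      have "continuous_on D \<psi>"
        using homeomorphism_cont2[OF chart(3)[OF c(1)]] by (rule continuous_on_subset) (use D(2) WU in blast)
      then have pN: "path_connected N"
        unfolding N_def by (intro path_connected_continuous_image convex_imp_path_connected D)
      have ex: "\<exists>s. sol N s \<and> s y = v" if y: "y \<in> N" and v: "v \<in> primitives y" for y v
      proof -
        have yW: "y \<in> W" using y NW by blast
        have "v \<in> fibre F y" using v by (simp add: primitives_def)
        then obtain t where t: "v = comb fs t y" by (rule basis_at_expand[OF F.framed_basis[OF fs yW]])
        define \<tau> where "\<tau> j = (if j < r then t j else 1)" for j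
        have yD: "\<phi> y \<in> ball (\<phi> y0) d" using \<phi>N[OF y] by (simp add: D_def)
        have "(\<Sum>j\<in>{..r}. cK q j (\<phi> y) * \<tau> j) = 0" if "q \<in> QQ" for q
          unfolding \<tau>_def by (rule kernel_initial[OF yW _ that]) (use v t in simp)
        then show ?thesis
        proof (rule fl.parallel_exists[OF yD])
        fix \<sigma> assume \<sigma>: "fl.parallel \<sigma>" "\<And>j. j \<in> {..r} \<Longrightarrow> \<sigma> j (\<phi> y) = \<tau> j"
          "\<And>q x. q \<in> QQ \<Longrightarrow> x \<in> ball (\<phi> y0) d \<Longrightarrow> (\<Sum>j\<in>{..r}. cK q j x * \<sigma> j x) = 0"
        have pdD: "pd bas D (\<sigma> i) (\<lambda>b u. \<Sum>j\<in>{..r}. ca b i j u * \<sigma> j u)" if "i \<le> r" for i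
          using \<sigma>(1) that unfolding fl.parallel_def D_def by auto
        have sm: "smooth_on D (\<sigma> i)" if "i \<le> r" for i
          unfolding D_def
          by (rule fl.parallel_smooth[OF _ \<sigma>(1)]) (use that smooth_on_subset[OF ca_smooth D(2)] in
            \<open>auto simp: D_def\<close>)
        \<comment> \<open>Row \<open>r\<close> of \<open>ca\<close> is 0, so this coefficient has
          zero derivative on the convex ball and keeps its initial value.\<close>
        have one: "\<sigma> r u = 1" if u: "u \<in> D" for u
        proof -
          have "\<exists>k. \<forall>u\<in>D. \<sigma> r u = k"
          proof (rule has_derivative_zero_constant[OF D(3)])
            fix u assume "u \<in> D"
            from pd_deriv[OF pdD this, of r] have "(\<sigma> r has_derivative (\<lambda>v. 0)) (at u)" by (simp add: ca_def)
            then show "(\<sigma> r has_derivative (\<lambda>h. 0)) (at u within D)" by (rule has_derivative_at_withinI)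
          qed
          moreover have "\<sigma> r (\<phi> y) = 1" using \<sigma>(2)[of r] by (simp add: \<tau>_def)
          ultimately show ?thesis using u yD unfolding D_def by metis
        qed
        have "sol N (\<lambda>x. comb fs (\<lambda>i. \<sigma> i (\<phi> x)) x)"
          unfolding N_def by (rule sol_of_parallel[OF D(1,2) pdD sm one]) (use \<sigma>(3) in \<open>auto simp: D_def\<close>)
        moreover have "comb fs (\<lambda>i. \<sigma> i (\<phi> y)) y = v"
          unfolding t by (rule comb_cong) (simp add: \<sigma>(2) \<tau>_def)
        ultimately show ?thesis by blast
        qed
      qed
      have un: "s y' = s' y'" if s: "sol N s" "sol N s'" and y: "y \<in> N" "y' \<in> N" "s y = s' y" for s s' y y'
      proof -
        obtain \<sigma> where \<sigma>: "\<And>u. u \<in> D \<Longrightarrow> s (\<psi> u) = comb fs (\<lambda>i. \<sigma> i u) (\<psi> u)" "\<And>u. \<sigma> r u = 1"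
          "\<And>i. i \<le> r \<Longrightarrow> pd bas D (\<sigma> i) (\<lambda>b u. \<Sum>j\<in>{..r}. ca b i j u * \<sigma> j u)"
          by (rule sol_pd[OF D(1,2) s(1)[unfolded N_def]]) blast
        obtain \<sigma>' where \<sigma>': "\<And>u. u \<in> D \<Longrightarrow> s' (\<psi> u) = comb fs (\<lambda>i. \<sigma>' i u) (\<psi> u)" "\<And>u. \<sigma>' r u = 1"
          "\<And>i. i \<le> r \<Longrightarrow> pd bas D (\<sigma>' i) (\<lambda>b u. \<Sum>j\<in>{..r}. ca b i j u * \<sigma>' j u)"
          by (rule sol_pd[OF D(1,2) s(2)[unfolded N_def]]) blast
        have par: "fl.parallel \<sigma>" "fl.parallel \<sigma>'" using \<sigma>(3) \<sigma>'(3) unfolding fl.parallel_def D_def by auto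
        have u: "\<phi> y \<in> D" "\<psi> (\<phi> y) = y" "\<phi> y' \<in> D" "\<psi> (\<phi> y') = y'" using \<phi>N y by blast+
        have eqy: "\<sigma> j (\<phi> y) = \<sigma>' j (\<phi> y)" if "j \<in> {..r}" for j
        proof (cases "j < r")
          case True
          have yW: "y \<in> W" using y(1) NW by blast
          show ?thesis
            using basis_at_unique[OF F.framed_basis[OF fs yW], of "\<lambda>i. \<sigma> i (\<phi> y)" "\<lambda>i. \<sigma>' i (\<phi> y)"]
              \<sigma>(1)[OF u(1)] \<sigma>'(1)[OF u(1)] u(2) y(3) True by simp
        next
          case False
          then have "j = r" using that by simp
          then show ?thesis using \<sigma>(2) \<sigma>'(2) by simp
        qed
        have "\<sigma> j (\<phi> y') = \<sigma>' j (\<phi> y')" if "j \<in> {..r}" for j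
          by (rule fl.parallel_unique[OF par, of "\<phi> y"]) (use u that eqy in \<open>auto simp: D_def\<close>)
        then have "comb fs (\<lambda>i. \<sigma> i (\<phi> y')) y' = comb fs (\<lambda>i. \<sigma>' i (\<phi> y')) y'" by (intro comb_cong) auto
        then show ?thesis using \<sigma>(1)[OF u(3)] \<sigma>'(1)[OF u(3)] u(4) by simp
      qed
      have "nice_nbhd N" unfolding nice_nbhd_def using oN pN ex un by blast
      moreover have "y0 \<in> N" using D(4) phi_W(2)[OF y0] unfolding N_def by (metis imageI)
      ultimately show thesis using that NW WT by blast
    qed
  qed
qed

end

section \<open>Cocycles that vanish on the adjoint bundle\<close>

context trans_rep
begin

text \<open>The cutoff scales the section without leaving the kernel, so the anchor of the extension
  vanishes everywhere.\<close>

lemma kernel_section_extend: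
  assumes u: "u \<in> adjoint_fibre \<A> y"
  obtains s where "s \<in> sections M \<A>" "s y = u" "\<And>x. rho x (s x) = 0"
proof -
  obtain U \<phi> where c: "(U, \<phi>) \<in> M" "y \<in> U" by (rule chart_exists)
  show thesis
  proof (rule local_data_exists[OF c open_UNIV UNIV_I])
    fix W es fs Bs us G
    assume "local_data M \<A> F \<LL> U \<phi> W es fs Bs us G" and y: "y \<in> W"
    then interpret local_data M \<A> F \<LL> U \<phi> W es fs Bs us G by simp
    obtain k where k: "u = (\<Sum>j<length es. k j *\<^sub>R us j y)" by (rule adjoint_decompose[OF y u])
    define s0 where "s0 x = (\<Sum>j<length es. k j *\<^sub>R us j x)" for x
    have s0: "s0 \<in> sections M \<A>"
      unfolding s0_def[abs_def] by (intro A.sec_sum A.sec_mult Cinf_const us) auto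
    have rs0: "rho x (s0 x) = 0" if "x \<in> W" for x
    proof -
      have "rho x (s0 x) = (\<Sum>j<length es. k j *\<^sub>R rho x (us j x))"
        unfolding s0_def
        by (subst rho_sum) (auto intro!: A.fibre_ops A.sec_fibre[OF us(1)] rho_linear(2) sum.cong)
      then show ?thesis using us(2) that by simp
    qed
    show thesis
    proof (rule bump[OF W_open y])
      fix \<beta> N' C assume *: "\<beta> \<in> Cinf M" "open N'" "y \<in> N'" "N' \<subseteq> W" "\<And>x. x \<in> N' \<Longrightarrow> \<beta> x = 1"
        "closed C" "C \<subseteq> W" "\<And>x. x \<notin> C \<Longrightarrow> \<beta> x = 0"
      show thesis
      proof (rule that[of "\<lambda>x. \<beta> x *\<^sub>R s0 x"])
        show "(\<lambda>x. \<beta> x *\<^sub>R s0 x) \<in> sections M \<A>" by (rule A.sec_mult[OF *(1) s0])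
        show "\<beta> y *\<^sub>R s0 y = u" using *(3,5) by (simp add: s0_def k)
        show "rho x (\<beta> x *\<^sub>R s0 x) = 0" for x
          using *(7,8) rs0 by (cases "x \<in> C") (auto simp: rho_linear(2) A.sec_fibre[OF s0] rho_zero)
      qed
    qed
  qed
qed

text \<open>Local lifts are combinations of the \<open>Bs b\<close>. Being a lift is an affine
  condition at each point, so they can be glued.\<close>

lemma vector_field_lift:
  assumes X: "X \<in> sections M (tangent_bundle M)"
  obtains A where "A \<in> sections M \<A>" "\<And>x. rho x (A x) = X x"
proof -
  have sX: "smooth_section_on M (tangent_bundle M) UNIV X" using X by (simp add: sections_def)
  have "\<forall>y. \<exists>Ns. open (fst Ns) \<and> y \<in> fst Ns \<and> snd Ns \<in> sections M \<A> \<and> (\<forall>x\<in>fst Ns. rho x (snd Ns x) = X x)"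
  proof
    fix y
    obtain U \<phi> where c: "(U, \<phi>) \<in> M" "y \<in> U" by (rule chart_exists)
    show "\<exists>Ns. open (fst Ns) \<and> y \<in> fst Ns \<and> snd Ns \<in> sections M \<A> \<and> (\<forall>x\<in>fst Ns. rho x (snd Ns x) = X x)"
    proof (rule local_data_exists[OF c open_UNIV UNIV_I])
      fix W es fs Bs us G
      assume "local_data M \<A> F \<LL> U \<phi> W es fs Bs us G" and y: "y \<in> W"
      then interpret local_data M \<A> F \<LL> U \<phi> W es fs Bs us G by simp
      obtain k where k: "\<And>b. b \<in> bas \<Longrightarrow> smooth_fun_on M U (k b)" "\<And>x. x \<in> U \<Longrightarrow> X x = (\<Sum>b\<in>bas. k b x *\<^sub>R cf b x)"
        using smooth_in_coord_frame[OF c(1) sX] by auto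
      have "smooth_section_on M \<A> W (\<lambda>x. \<Sum>b\<in>bas. k b x *\<^sub>R Bs b x)"
        by (intro A.smooth_section_on_sum A.smooth_section_on_mult W_open A.sec_on Bs
          smooth_fun_on_subset[OF k(1) WU])
      then obtain s N where s: "s \<in> sections M \<A>" "open N" "y \<in> N" "N \<subseteq> W" "\<And>x. x \<in> N \<Longrightarrow>
        s x = (\<Sum>b\<in>bas. k b x *\<^sub>R Bs b x)"
        using A.sec_extend[OF W_open y] by blast
      have "rho x (s x) = X x" if x: "x \<in> N" for x
      proof -
        have xW: "x \<in> W" and xU: "x \<in> U" using x s(4) WU by auto
        have "rho x (s x) = (\<Sum>b\<in>bas. k b x *\<^sub>R rho x (Bs b x))"
          unfolding s(5)[OF x]
          by (subst rho_sum) (auto intro!: A.fibre_ops A.sec_fibre[OF Bs(1)] rho_linear(2) sum.cong)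
        then show ?thesis unfolding k(2)[OF xU] by (simp add: Bs(2) xW)
      qed
      then show ?thesis using s by (intro exI[of _ "(N, s)"]) auto
    qed
  qed
  from choice[OF this] obtain Ns where Ns: "\<And>y. open (fst (Ns y))" "\<And>y. y \<in> fst (Ns y)"
    "\<And>y. snd (Ns y) \<in> sections M \<A>"
    "\<And>y x. x \<in> fst (Ns y) \<Longrightarrow> rho x (snd (Ns y) x) = X x" by blast
  show thesis
  proof (rule A.sections_glue[of "\<lambda>y. fst (Ns y)" "\<lambda>y. snd (Ns y)", OF Ns(1-3)])
    fix A assume A: "A \<in> sections M \<A>"
      "\<And>x. \<exists>(m::nat) ys w. (\<forall>i<m. w i \<noteq> 0 \<longrightarrow> x \<in> fst (Ns (ys i))) \<and> (\<Sum>i<m. w i) = 1 \<and>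
        A x = (\<Sum>i<m. w i *\<^sub>R snd (Ns (ys i)) x)"
    have "rho x (A x) = X x" for x
    proof -
      obtain m :: nat and ys w where *: "\<forall>i<m. w i \<noteq> 0 \<longrightarrow> x \<in> fst (Ns (ys i))" "(\<Sum>i<m. w i) = 1"
        "A x = (\<Sum>i<m. w i *\<^sub>R snd (Ns (ys i)) x)" using A(2)[of x] by blast
      have "rho x (A x) = (\<Sum>i<m. w i *\<^sub>R rho x (snd (Ns (ys i)) x))"
        unfolding *(3) by (subst rho_sum) (auto intro!: A.fibre_ops A.sec_fibre[OF Ns(3)] rho_linear(2)
          sum.cong)
      also have "\<dots> = (\<Sum>i<m. w i *\<^sub>R X x)"
        by (intro sum.cong refl) (use *(1) Ns(4) in auto)
      also have "\<dots> = X x" using *(2) by (simp flip: scaleR_sum_left)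
      finally show ?thesis .
    qed
    then show thesis using that A(1) by blast
  qed
qed

section \<open>Sections of the invariant subbundle\<close>

abbreviation F0 :: "('m, 'v) vbundle" where "F0 \<equiv> invariant_bundle M \<A> F \<LL>"

lemma F0_fibre: "fibre F0 x = {\<nu> \<in> fibre F x. \<forall>u\<in>adjoint_fibre \<A> x. iso x u \<nu> = 0}"
  by (simp add: invariant_bundle_def subbundle_def)

lemma F0_frames: "(V, es) \<in> frames F0 \<longleftrightarrow> open V \<and> (\<forall>e\<in>set es. smooth_section_on M F V e) \<and>
  (\<forall>x\<in>V. basis_at es x (fibre F0 x))"
  by (simp add: invariant_bundle_def subbundle_def)

text \<open>Smoothness in \<open>F0\<close> is tested in frames made of invariant sections;
  \<open>smooth_in_subframe\<close> derives it from smoothness in \<open>F\<close>.\<close>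

lemma F0_smooth_section:
  assumes U: "open U" and \<nu>: "smooth_section_on M F U \<nu>" "\<And>x. x \<in> U \<Longrightarrow> \<nu> x \<in> fibre F0 x"
  shows "smooth_section_on M F0 U \<nu>"
  unfolding smooth_section_on_def
proof (intro conjI ballI)
  fix Ves assume "Ves \<in> frames F0"
  then obtain V es where V: "Ves = (V, es)" "open V" "\<And>e. e \<in> set es \<Longrightarrow> smooth_section_on M F V e"
    "\<And>x. x \<in> V \<Longrightarrow> basis_at es x (fibre F0 x)" by (cases Ves) (auto simp: F0_frames)
  have "smooth_in_frame M es (V \<inter> U) \<nu>"
  proof (rule F.smooth_in_subframe)
    show "basis_at es x (fibre F0 x)" if "x \<in> V \<inter> U" for x using V(4) that by blast
    show "\<nu> x \<in> fibre F0 x" if "x \<in> V \<inter> U" for x using \<nu>(2) that by blast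
    show "smooth_section_on M F (V \<inter> U) \<nu>" by (rule F.smooth_section_on_subset[OF \<nu>(1)]) blast
    show "smooth_section_on M F (V \<inter> U) e" if "e \<in> set es" for e
      by (rule F.smooth_section_on_subset[OF V(3)[OF that]]) blast
  qed (use V U in auto)
  then show "case Ves of (V, es) \<Rightarrow> smooth_in_frame M es (V \<inter> U) \<nu>" by (simp add: V(1))
qed (use \<nu>(2) in blast)

lemma F0_sec: "\<nu> \<in> sections M F \<Longrightarrow> (\<And>x. \<nu> x \<in> fibre F0 x) \<Longrightarrow> \<nu> \<in> sections M F0"
  using F0_smooth_section[OF open_UNIV F.sec_on] by (simp add: sections_def)

end

section \<open>Primitives at all points\<close>

context cocycle
begin

text \<open>On a nice neighbourhood a primitive at one point extends to all others, so the existence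
  of primitives is a locally constant property.\<close>

lemma primitives_all:
  assumes "connected (UNIV :: 'm set)" "primitives x \<noteq> {}" shows "primitives y \<noteq> {}"
proof -
  have "(primitives x \<noteq> {}) = (primitives y \<noteq> {})"
  proof (rule connected_local_const[OF assms(1)], simp_all)
    show "\<forall>a. \<forall>\<^sub>F b in at a. (primitives a = {}) = (primitives b = {})"
    proof
      fix a
      obtain N where N: "nice_nbhd N" "a \<in> N" by (rule nice_nbhd_exists[OF open_UNIV UNIV_I])
      have *: "primitives b \<noteq> {}" if a': "a' \<in> N" and b: "b \<in> N" and "primitives a' \<noteq> {}" for a' b
      proof -
        obtain v where "v \<in> primitives a'" using \<open>primitives a' \<noteq> {}\<close> by blast
        then obtain s where "sol N s" using N(1) a' unfolding nice_nbhd_def by blast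
        then show ?thesis using sol_val b by blast
      qed
      have "open N" using N(1) by (simp add: nice_nbhd_def)
      then show "\<forall>\<^sub>F b in at a. (primitives a = {}) = (primitives b = {})"
        unfolding eventually_at_topological using * N(2) by blast
    qed
  qed
  then show ?thesis using assms(2) by simp
qed

text \<open>On the adjoint bundle the representation acts pointwise, so weights with sum 1 preserve
  the equation. For other vectors the derivatives of the weights would enter, which is why only the
  equation on the adjoint bundle is claimed.\<close>

lemma primitives_global:
  assumes "\<And>y. primitives y \<noteq> {}"
  obtains \<mu> where "\<mu> \<in> sections M F" "\<And>x u. u \<in> adjoint_fibre \<A> x \<Longrightarrow> \<Omega> x u = \<LL> x u \<mu>"
proof -
  have "\<forall>y. \<exists>Ns. open (fst Ns) \<and> y \<in> fst Ns \<and> snd Ns \<in> sections M F \<and>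
    (\<forall>x\<in>fst Ns. \<forall>u\<in>adjoint_fibre \<A> x. \<LL> x u (snd Ns) = \<Omega> x u)"
  proof
    fix y
    obtain N where N: "nice_nbhd N" "y \<in> N" by (rule nice_nbhd_exists[OF open_UNIV UNIV_I])
    obtain v where "v \<in> primitives y" using assms by blast
    then obtain m where m: "sol N m" using N unfolding nice_nbhd_def by blast
    show "\<exists>Ns. open (fst Ns) \<and> y \<in> fst Ns \<and> snd Ns \<in> sections M F \<and>
      (\<forall>x\<in>fst Ns. \<forall>u\<in>adjoint_fibre \<A> x. \<LL> x u (snd Ns) = \<Omega> x u)"
    proof (rule solE[OF m N(2)])
      fix \<mu> N' assume *: "\<mu> \<in> sections M F" "open N'" "y \<in> N'" "\<And>x a. x \<in> N' \<Longrightarrow> a \<in> fibre \<A> x \<Longrightarrow> \<LL> x a \<mu> = \<Omega> x a"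
      then show ?thesis by (intro exI[of _ "(N', \<mu>)"]) (auto simp: adjoint_iff)
    qed
  qed
  from choice[OF this] obtain Ns where Ns: "\<And>y. open (fst (Ns y))" "\<And>y. y \<in> fst (Ns y)"
    "\<And>y. snd (Ns y) \<in> sections M F"
    "\<And>y x u. x \<in> fst (Ns y) \<Longrightarrow> u \<in> adjoint_fibre \<A> x \<Longrightarrow> \<LL> x u (snd (Ns y)) = \<Omega> x u" by blast
  show thesis
  proof (rule F.sections_glue[of "\<lambda>y. fst (Ns y)" "\<lambda>y. snd (Ns y)", OF Ns(1-3)])
    fix \<mu> assume \<mu>: "\<mu> \<in> sections M F"
      "\<And>x. \<exists>(m::nat) ys w. (\<forall>i<m. w i \<noteq> 0 \<longrightarrow> x \<in> fst (Ns (ys i))) \<and> (\<Sum>i<m. w i) = 1 \<and>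
        \<mu> x = (\<Sum>i<m. w i *\<^sub>R snd (Ns (ys i)) x)"
    have "\<Omega> x u = \<LL> x u \<mu>" if u: "u \<in> adjoint_fibre \<A> x" for x u
    proof -
      obtain m :: nat and ys w where *: "\<forall>i<m. w i \<noteq> 0 \<longrightarrow> x \<in> fst (Ns (ys i))" "(\<Sum>i<m. w i) = 1"
        "\<mu> x = (\<Sum>i<m. w i *\<^sub>R snd (Ns (ys i)) x)" using \<mu>(2)[of x] by blast
      have "\<LL> x u \<mu> = iso x u (\<mu> x)" by (rule iso_eq[OF u \<mu>(1), symmetric])
      also have "\<dots> = (\<Sum>i<m. w i *\<^sub>R iso x u (snd (Ns (ys i)) x))"
        unfolding *(3) by (rule iso_sum[OF u]) (rule F.sec_fibre[OF Ns(3)])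
      also have "\<dots> = (\<Sum>i<m. w i *\<^sub>R \<Omega> x u)"
        by (intro sum.cong refl) (use *(1) Ns(4)[OF _ u] iso_eq[OF u Ns(3)] in auto)
      also have "\<dots> = \<Omega> x u" using *(2) by (simp flip: scaleR_sum_left)
      finally show ?thesis by simp
    qed
    then show thesis using that \<mu>(1) by blast
  qed
qed

end

text \<open>Subtracting the coboundary of a section that solves the equation on the adjoint bundle gives a
  cocycle that vanishes there; by the cocycle identity it has invariant values.\<close>

locale reduced_cocycle = cocycle M \<A> F \<LL> \<Omega>
  for M :: "('m::{t2_space,second_countable_topology}, 'h::real_inner) atlas"
    and \<A> :: "('m, 'a::real_vector) algebroid" and F :: "('m, 'v::real_vector) vbundle" and \<LL> \<Omega> +
  fixes \<mu> :: "'m \<Rightarrow> 'v"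
  assumes \<mu>: "\<mu> \<in> sections M F" "\<And>x u. u \<in> adjoint_fibre \<A> x \<Longrightarrow> \<Omega> x u = \<LL> x u \<mu>"
begin

definition \<Omega>0 :: "'m \<Rightarrow> 'a \<Rightarrow> 'v" where "\<Omega>0 x a = \<Omega> x a - \<LL> x a \<mu>"

lemma \<Omega>0_add: "a \<in> fibre \<A> x \<Longrightarrow> b \<in> fibre \<A> x \<Longrightarrow> \<Omega>0 x (a + b) = \<Omega>0 x a + \<Omega>0 x b"
  and \<Omega>0_scale: "a \<in> fibre \<A> x \<Longrightarrow> \<Omega>0 x (k *\<^sub>R a) = k *\<^sub>R \<Omega>0 x a"
  and \<Omega>0_adjoint: "u \<in> adjoint_fibre \<A> x \<Longrightarrow> \<Omega>0 x u = 0"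
  by (auto simp: \<Omega>0_def \<Omega>_add \<Omega>_scale L_a_add L_a_scale \<mu>(2) algebra_simps)

lemma \<Omega>0_sec: "A \<in> sections M \<A> \<Longrightarrow> (\<lambda>x. \<Omega>0 x (A x)) \<in> sections M F"
  unfolding \<Omega>0_def by (intro F.sec_diff \<Omega>_sec L_sec \<mu>)

lemma \<Omega>0_bracket:
  assumes "A \<in> sections M \<A>" "B \<in> sections M \<A>"
  shows "\<Omega>0 x (bracket \<A> A B x) = \<LL> x (A x) (\<lambda>y. \<Omega>0 y (B y)) - \<LL> x (B x) (\<lambda>y. \<Omega>0 y (A y))"
  unfolding \<Omega>0_def
  using assms by (simp add: \<Omega>_bracket L_bracket[OF _ _ \<mu>(1)] L_diff A.sec_fibre \<Omega>_sec L_sec \<mu>(1))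

text \<open>Extend \<open>u\<close> to a section \<open>s\<close> of the adjoint bundle. The bracket
  of \<open>A\<close> with \<open>s\<close> lies there again, so in the cocycle identity for
  \<open>A\<close> and \<open>s\<close> everything vanishes except the derivative of
  \<open>\<Omega>0\<close> on \<open>A\<close> along \<open>s\<close>, which must vanish
  too.\<close>

lemma \<Omega>0_invariant:
  assumes a: "a \<in> fibre \<A> x" shows "\<Omega>0 x a \<in> fibre F0 x"
proof -
  obtain A where A: "A \<in> sections M \<A>" "A x = a" using A.fibre_extend[OF a] .
  have "iso x u (\<Omega>0 x a) = 0" if u: "u \<in> adjoint_fibre \<A> x" for u
  proof -
    obtain s where s: "s \<in> sections M \<A>" "s x = u" "\<And>x. rho x (s x) = 0"
      by (rule kernel_section_extend[OF u]) blast
    have z: "\<Omega>0 y (s y) = 0" for y by (rule \<Omega>0_adjoint) (simp add: adjoint_iff A.sec_fibre[OF s(1)] s(3))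
    have "lie_bracket (\<lambda>x. rho x (A x)) (\<lambda>x. rho x (s x)) x = 0"
    proof
      fix f
      have t: "rho x (A x) \<in> tangent_space M x" by (rule rho_tangent[OF A.sec_fibre[OF A(1)]])
      show "lie_bracket (\<lambda>x. rho x (A x)) (\<lambda>x. rho x (s x)) x f = 0 f"
        using tangent_const[OF t, of 0] by (simp add: lie_bracket_def s(3))
    qed
    then have "rho x (bracket \<A> A s x) = 0" using rho_bracket[OF A(1) s(1)] by simp
    then have "\<Omega>0 x (bracket \<A> A s x) = 0"
      by (intro \<Omega>0_adjoint) (simp add: adjoint_iff A.sec_fibre[OF sec_bracket[OF A(1) s(1)]])
    then have "\<LL> x (s x) (\<lambda>y. \<Omega>0 y (A y)) = 0"
      using \<Omega>0_bracket[OF A(1) s(1), of x] L_zero[OF A.sec_fibre[OF A(1)]] by (simp add: z)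
    then show ?thesis using iso_eq[OF u \<Omega>0_sec[OF A(1)]] s(2) A(2) by simp
  qed
  moreover have "\<Omega>0 x a \<in> fibre F x" using F.sec_fibre[OF \<Omega>0_sec[OF A(1)], of x] A(2) by simp
  ultimately show ?thesis by (simp add: F0_fibre)
qed

lemma \<Omega>0_F0_sec: "A \<in> sections M \<A> \<Longrightarrow> (\<lambda>x. \<Omega>0 x (A x)) \<in> sections M F0"
  by (intro F0_sec \<Omega>0_sec \<Omega>0_invariant A.sec_fibre)

lemma \<Omega>0_smooth:
  assumes "open U" "smooth_section_on M \<A> U s"
  shows "smooth_section_on M F0 U (\<lambda>x. \<Omega>0 x (s x))"
proof (rule F0_smooth_section[OF assms(1)])
  show "\<Omega>0 x (s x) \<in> fibre F0 x" if "x \<in> U" for x by (rule \<Omega>0_invariant[OF A.smooth_section_onD(1)[OF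
    assms(2) that]])
  show "smooth_section_on M F U (\<lambda>x. \<Omega>0 x (s x))"
  proof (rule F.smooth_section_on_local[OF assms(1)])
    fix x assume "x \<in> U"
    then obtain s' N where s': "s' \<in> sections M \<A>" "open N" "x \<in> N" "N \<subseteq> U" "\<And>y. y \<in> N \<Longrightarrow> s' y = s y"
      using A.sec_extend[OF assms(1) _ assms(2)] by blast
    have "smooth_section_on M F N (\<lambda>x. \<Omega>0 x (s x))"
      by (rule F.smooth_section_on_cong[OF F.sec_on[OF \<Omega>0_sec[OF s'(1)]]]) (simp add: s'(5))
    then show "\<exists>T. open T \<and> x \<in> T \<and> smooth_section_on M F T (\<lambda>x. \<Omega>0 x (s x))" using s' by blast
  qed
qed

lemma frame_section: "(U, es) \<in> frames \<A> \<Longrightarrow> e \<in> set es \<Longrightarrow> smooth_section_on M \<A> U e"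
proof -
  assume f: "(U, es) \<in> frames \<A>" and e: "e \<in> set es"
  obtain i where i: "i < length es" "e = es ! i" using e by (metis in_set_conv_nth)
  have "smooth_section_on M \<A> U (\<lambda>x. comb es (\<lambda>k. if k = i then 1 else 0) x)"
    by (rule A.smooth_section_on_frame[OF f A.frame(1)[OF f]]) (auto intro: smooth_fun_on_const)
  then show ?thesis using i by (simp add: comb_unit)
qed

lemma \<Omega>0_cocycle: "\<Omega>0 \<in> cocycles1 M \<A> F0 (restrict_rep M F0 \<LL>)"
proof -
  have "bundle_map M \<A> F0 \<Omega>0"
    unfolding bundle_map_def linear_between_def
  proof (intro conjI allI ballI)
    show "\<Omega>0 x ` fibre \<A> x \<subseteq> fibre F0 x" for x using \<Omega>0_invariant by blast
    fix Ues assume "Ues \<in> frames \<A>"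
    then show "case Ues of (U, es) \<Rightarrow> \<forall>e\<in>set es. smooth_section_on M F0 U (\<lambda>x. \<Omega>0 x (e x))"
      using \<Omega>0_smooth A.frame(1) frame_section by (cases Ues) blast
  qed (use \<Omega>0_add \<Omega>0_scale in auto)
  then show ?thesis
    unfolding cocycles1_def restrict_rep_def by (simp add: \<Omega>0_F0_sec \<Omega>0_bracket)
qed

lemma \<Omega>0_homologic: "homologic M \<A> F \<LL> \<Omega> \<Omega>0"
  unfolding homologic_def is_coboundary_def coboundary_op_def
  by (rule bexI[OF _ \<mu>(1)]) (simp add: \<Omega>0_def)

text \<open>The choice of the lift is harmless because \<open>\<Omega>0\<close> vanishes on
  differences of lifts.\<close>

definition \<theta> :: "'m \<Rightarrow> 'm tangent \<Rightarrow> 'v" where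
  "\<theta> x X = \<Omega>0 x (SOME a. a \<in> fibre \<A> x \<and> rho x a = X)"

lemma \<Omega>0_eq:
  assumes "a \<in> fibre \<A> x" "b \<in> fibre \<A> x" "rho x a = rho x b" shows "\<Omega>0 x a = \<Omega>0 x b"
proof -
  have "a - b \<in> adjoint_fibre \<A> x" using assms by (simp add: adjoint_iff A.fibre_ops rho_diff)
  then have "\<Omega>0 x (b + (a - b)) = \<Omega>0 x b" using assms(2) by (subst \<Omega>0_add) (auto simp: \<Omega>0_adjoint adjoint_iff)
  then show ?thesis by simp
qed

lemma \<theta>_rho: assumes "a \<in> fibre \<A> x" shows "\<theta> x (rho x a) = \<Omega>0 x a"
proof -
  have "(SOME b. b \<in> fibre \<A> x \<and> rho x b = rho x a) \<in> fibre \<A> x \<and> rho x (SOME b. b \<in> fibre \<A> x \<and>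
    rho x b = rho x a) = rho x a"
    by (rule someI_ex) (use assms in blast)
  then show ?thesis unfolding \<theta>_def using \<Omega>0_eq assms by blast
qed

text \<open>Frames of the tangent bundle come from arbitrary bases of the model space, whereas lifts
  are provided for \<open>bas\<close>.\<close>

lemma coord_field_linear:
  assumes c: "(U, \<phi>) \<in> M" "x \<in> U"
  shows "coord_field M (U, \<phi>) b x = (\<Sum>b'\<in>bas. (b \<bullet> b') *\<^sub>R coord_field M (U, \<phi>) b' x)"
proof
  fix f
  show "coord_field M (U, \<phi>) b x f = (\<Sum>b'\<in>bas. (b \<bullet> b') *\<^sub>R coord_field M (U, \<phi>) b' x) f"
  proof (cases "f \<in> Cinf M")
    case True
    have "linear (frechet_derivative (f \<circ> inv_into U \<phi>) (at (\<phi> x)))"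
      using has_derivative_linear[OF chart_differentiable[OF c UNIV_I Cinf_on[OF True]]] .
    from onb_linear[OF onb_bas this, of b] show ?thesis
      by (simp add: sum_fun_apply scaleR_fun_def coord_field_eq[OF c True])
  qed (simp add: sum_fun_apply scaleR_fun_def coord_field_def)
qed

text \<open>Near each point \<open>\<theta>\<close> of a coordinate field is
  \<open>\<Omega>0\<close> of a smooth lift of that field.\<close>

lemma \<theta>_coord_smooth:
  assumes c: "(U, \<phi>) \<in> M" shows "smooth_section_on M F0 U (\<lambda>x. \<theta> x (coord_field M (U, \<phi>) b x))"
proof (rule F0_smooth_section[OF chart(1)[OF c]])
  show "\<theta> x (coord_field M (U, \<phi>) b x) \<in> fibre F0 x" if x: "x \<in> U" for x
  proof -
    obtain a where "a \<in> fibre \<A> x" "rho x a = coord_field M (U, \<phi>) b x"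
      by (rule rho_surj[OF coord_field_tangent[OF c x]])
    then show ?thesis using \<theta>_rho \<Omega>0_invariant by metis
  qed
  show "smooth_section_on M F U (\<lambda>x. \<theta> x (coord_field M (U, \<phi>) b x))"
  proof (rule F.smooth_section_on_local[OF chart(1)[OF c]])
    fix y assume y: "y \<in> U"
    show "\<exists>T. open T \<and> y \<in> T \<and> smooth_section_on M F T (\<lambda>x. \<theta> x (coord_field M (U, \<phi>) b x))"
    proof (rule local_data_exists[OF c y open_UNIV UNIV_I])
      fix W es fs Bs us G
      assume "local_data M \<A> F \<LL> U \<phi> W es fs Bs us G" and y: "y \<in> W"
      then interpret local_data M \<A> F \<LL> U \<phi> W es fs Bs us G by simp
      define s where "s x = (\<Sum>b'\<in>bas. (b \<bullet> b') *\<^sub>R Bs b' x)" for x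
      have s: "s \<in> sections M \<A>" unfolding s_def[abs_def] by (intro A.sec_sum A.sec_mult Cinf_const Bs)
      have "\<theta> x (coord_field M (U, \<phi>) b x) = \<Omega>0 x (s x)" if x: "x \<in> W" for x
      proof -
        have "rho x (s x) = (\<Sum>b'\<in>bas. (b \<bullet> b') *\<^sub>R rho x (Bs b' x))"
          unfolding s_def by (subst rho_sum) (auto intro!: A.fibre_ops A.sec_fibre[OF Bs(1)] rho_linear(2)
            sum.cong)
        also have "\<dots> = coord_field M (U, \<phi>) b x"
          using coord_field_linear[OF c, of x b] x WU by (auto simp: Bs(2))
        finally show ?thesis using \<theta>_rho[OF A.sec_fibre[OF s]] by metis
      qed
      then have "smooth_section_on M F W (\<lambda>x. \<theta> x (coord_field M (U, \<phi>) b x))"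
        by (intro F.smooth_section_on_cong[OF F.sec_on[OF \<Omega>0_sec[OF s]]]) simp
      then show ?thesis using W_open y by blast
    qed
  qed
qed

text \<open>Two lifts differ by an element of the adjoint bundle, which annihilates
  \<open>\<nu>\<close> because the value of \<open>\<nu>\<close> is invariant.\<close>

lemma reduced_connection_eq:
  assumes a: "a \<in> fibre \<A> x" and \<nu>: "\<nu> \<in> sections M F" "\<nu> \<in> sections M F0" "\<nu> x \<in> fibre F0 x"
  shows "reduced_connection M \<A> F0 \<LL> x (rho x a) \<nu> = \<LL> x a \<nu>"
proof -
  have "\<LL> x b \<nu> = \<LL> x a \<nu>" if b: "b \<in> fibre \<A> x" "rho x b = rho x a" for b
  proof -
    have ba: "b - a \<in> adjoint_fibre \<A> x" using a b by (simp add: adjoint_iff A.fibre_ops rho_diff)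
    have "\<LL> x (b - a) \<nu> = 0" using iso_eq[OF ba \<nu>(1)] \<nu>(3) ba by (simp add: F0_fibre)
    then have "\<LL> x (a + (b - a)) \<nu> = \<LL> x a \<nu>" using a ba by (subst L_a_add) (auto simp: adjoint_iff)
    then show ?thesis by simp
  qed
  note eq = this
  have "(THE w. \<forall>b\<in>fibre \<A> x. rho x b = rho x a \<longrightarrow> \<LL> x b \<nu> = w) = \<LL> x a \<nu>"
  proof (rule the_equality)
    show "\<forall>b\<in>fibre \<A> x. rho x b = rho x a \<longrightarrow> \<LL> x b \<nu> = \<LL> x a \<nu>" using eq by blast
    fix w assume "\<forall>b\<in>fibre \<A> x. rho x b = rho x a \<longrightarrow> \<LL> x b \<nu> = w"
    from bspec[OF this a] show "w = \<LL> x a \<nu>" by simp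
  qed
  then show ?thesis using \<nu>(2) by (simp add: reduced_connection_def)
qed

lemma \<theta>_cocycle: "\<theta> \<in> cocycles1 M (tangent_algebroid M) F0 (reduced_connection M \<A> F0 \<LL>)"
proof -
  have fib: "fibre (tangent_algebroid M) = tangent_space M" "frames (tangent_algebroid M)
    = frames (tangent_bundle M)"
    by (auto simp: tangent_algebroid_def tangent_bundle_def)
  have "bundle_map M (tangent_algebroid M) F0 \<theta>"
    unfolding bundle_map_def linear_between_def fib
  proof (intro conjI allI ballI)
    fix x
    have lift: "\<exists>a\<in>fibre \<A> x. rho x a = X" if "X \<in> tangent_space M x" for X using rho_surj[OF that] by blast
    show "\<theta> x ` tangent_space M x \<subseteq> fibre F0 x"
      using lift \<theta>_rho \<Omega>0_invariant by fastforce
    fix X assume "X \<in> tangent_space M x"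
    then obtain a where a: "a \<in> fibre \<A> x" "rho x a = X" using lift by blast
    show "\<theta> x (k *\<^sub>R X) = k *\<^sub>R \<theta> x X" for k
      using \<theta>_rho[OF A.fibre_ops(3)[OF a(1)], of k] \<theta>_rho[OF a(1)] a by (simp add: rho_linear \<Omega>0_scale)
    fix Y assume "Y \<in> tangent_space M x"
    then obtain b where b: "b \<in> fibre \<A> x" "rho x b = Y" using lift by blast
    show "\<theta> x (X + Y) = \<theta> x X + \<theta> x Y"
      using \<theta>_rho[OF A.fibre_ops(2)[OF a(1) b(1)]] \<theta>_rho[OF a(1)] \<theta>_rho[OF b(1)] a b
      by (simp add: rho_linear \<Omega>0_add)
  next
    fix Ues assume "Ues \<in> frames (tangent_bundle M)"
    then show "case Ues of (U, es) \<Rightarrow> \<forall>e\<in>set es. smooth_section_on M F0 U (\<lambda>x. \<theta> x (e x))"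
      using \<theta>_coord_smooth by (auto simp: tangent_bundle_def)
  qed
  moreover have "\<theta> x (bracket (tangent_algebroid M) X Y x) =
      reduced_connection M \<A> F0 \<LL> x (X x) (\<lambda>y. \<theta> y (Y y)) - reduced_connection M \<A> F0 \<LL> x (Y x) (\<lambda>y. \<theta> y (X y))"
    if "X \<in> sections M (tangent_algebroid M)" "Y \<in> sections M (tangent_algebroid M)" for X Y x
  proof -
    have "X \<in> sections M (tangent_bundle M)" "Y \<in> sections M (tangent_bundle M)"
      using that by (auto simp: sections_def smooth_section_on_def tangent_algebroid_def)
    \<comment> \<open>Vector fields have global lifts, so the identity for \<open>\<theta>\<close>
      becomes the one for \<open>\<Omega>0\<close>.\<close>
    then have "\<exists>A\<in>sections M \<A>. X = (\<lambda>x. rho x (A x))" "\<exists>B\<in>sections M \<A>. Y = (\<lambda>x. rho x (B x))"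
      by (metis vector_field_lift)+
    then obtain A B where A: "A \<in> sections M \<A>" "X = (\<lambda>x. rho x (A x))" and B: "B \<in> sections M \<A>"
      "Y = (\<lambda>x. rho x (B x))"
      by blast
    note XY = A(2) B(2)
    have br: "bracket (tangent_algebroid M) X Y x = rho x (bracket \<A> A B x)"
      by (simp add: tangent_algebroid_def rho_bracket[OF A(1) B(1)] XY)
    have \<theta>: "(\<lambda>y. \<theta> y (rho y (A y))) = (\<lambda>y. \<Omega>0 y (A y))" "(\<lambda>y. \<theta> y (rho y (B y))) = (\<lambda>y. \<Omega>0 y (B y))"
      by (auto simp: \<theta>_rho A.sec_fibre[OF A(1)] A.sec_fibre[OF B(1)])
    show ?thesis
      unfolding br unfolding XY \<theta>
      by (simp add: \<theta>_rho A.sec_fibre[OF sec_bracket[OF A(1) B(1)]] reduced_connection_eq A.sec_fibre[OF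
        A(1)] A.sec_fibre[OF B(1)]
          \<Omega>0_sec \<Omega>0_F0_sec \<Omega>0_invariant A(1) B(1) \<Omega>0_bracket)
  qed
  ultimately show ?thesis unfolding cocycles1_def by blast
qed

end

section \<open>Pull-back to the universal covering\<close>

lemma smooth_fun_on_compose:
  fixes M1 :: "('m::{t2_space,second_countable_topology}, 'h::real_inner) atlas"
    and M2 :: "('n::{t2_space,second_countable_topology}, 'h) atlas"
  assumes M1: "smooth_manifold M1" and M2: "smooth_manifold M2"
    and g: "smooth_map_on M1 M2 W g" "open W" and f: "smooth_fun_on M2 T f" "open T"
  shows "smooth_fun_on M1 (W \<inter> g -` T) (f \<circ> g)"
proof -
  interpret A: mfd M1 by unfold_locales (rule M1)
  interpret B: mfd M2 by unfold_locales (rule M2)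
  have cont: "continuous_on W g" using g(1) by (simp add: smooth_map_on_def)
  show ?thesis
  proof (rule A.smooth_fun_on_local)
    fix x assume x: "x \<in> W \<inter> g -` T"
    obtain U \<phi> where c: "(U, \<phi>) \<in> M1" "x \<in> U" by (rule A.chart_exists)
    obtain V \<psi> where d: "(V, \<psi>) \<in> M2" "g x \<in> V" by (rule B.chart_exists)
    define N where "N = U \<inter> (W \<inter> g -` (V \<inter> T))"
    have "open (W \<inter> g -` (V \<inter> T))"
      by (rule continuous_open_preimage[OF cont g(2)]) (use B.chart(1)[OF d(1)] f(2) in auto)
    then have N: "open N" "N \<subseteq> U" "x \<in> N" using A.chart(1)[OF c(1)] x c d by (auto simp: N_def)
    have NU: "U \<inter> N = N" using N by blast
    have "smooth_on (\<phi> ` N) (\<lambda>u. (f \<circ> inv_into V \<psi>) ((\<psi> \<circ> g \<circ> inv_into U \<phi>) u))"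
    proof (rule smooth_on_compose[OF A.onb_bas])
      show "open (\<phi> ` N)" using A.chart_open_image[OF c(1) N(1)] NU by simp
      show "open (\<psi> ` (V \<inter> T))" by (rule B.chart_open_image[OF d(1) f(2)])
      show "(\<psi> \<circ> g \<circ> inv_into U \<phi>) ` \<phi> ` N \<subseteq> \<psi> ` (V \<inter> T)"
        using A.chart_inv[OF c(1)] by (auto simp: N_def)
      show "smooth_on (\<psi> ` (V \<inter> T)) (f \<circ> inv_into V \<psi>)" by (rule B.smooth_fun_on_smooth[OF f(1) d(1)])
      have "smooth_on (\<phi> ` (U \<inter> W \<inter> g -` V)) (\<psi> \<circ> g \<circ> inv_into U \<phi>)"
        using g(1) c(1) d(1) unfolding smooth_map_on_def by blast
      then show "smooth_on (\<phi> ` N) (\<psi> \<circ> g \<circ> inv_into U \<phi>)" by (rule smooth_on_subset) (auto simp: N_def)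
    qed
    then have "smooth_on (\<phi> ` N) ((f \<circ> g) \<circ> inv_into U \<phi>)"
    proof (subst smooth_on_cong[of _ _ "\<lambda>u. (f \<circ> inv_into V \<psi>) ((\<psi> \<circ> g \<circ> inv_into U \<phi>) u)"])
      show "open (\<phi> ` N)" using A.chart_open_image[OF c(1) N(1)] NU by simp
      show "((f \<circ> g) \<circ> inv_into U \<phi>) u = (f \<circ> inv_into V \<psi>) ((\<psi> \<circ> g \<circ> inv_into U \<phi>) u)" if "u \<in> \<phi> ` N" for u
        using that A.chart_inv[OF c(1)] B.chart_inv[OF d(1)] by (auto simp: N_def)
    qed
    then have "smooth_fun_on M1 N (f \<circ> g)" by (rule A.smooth_fun_on_chart[OF c(1) N(1,2)])
    then show "\<exists>T. open T \<and> x \<in> T \<and> smooth_fun_on M1 T (f \<circ> g)" using N by blast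
  qed
qed

locale covering = trans_rep M \<A> F \<LL> + M': mfd M'
  for M :: "('m::{t2_space,second_countable_topology}, 'h::real_inner) atlas"
    and \<A> :: "('m, 'a::real_vector) algebroid" and F :: "('m, 'v::real_vector) vbundle" and \<LL>
    and M' :: "('z::{t2_space,second_countable_topology}, 'h) atlas" +
  fixes p :: "'z \<Rightarrow> 'm"
  assumes p: "universal_covering M' M p"
begin

lemma p_cont: "continuous_on UNIV p" and p_surj: "range p = UNIV"
  using p unfolding universal_covering_def covering_space_def by auto

lemma p_vimage: "open T \<Longrightarrow> open (p -` T)"
  using continuous_open_preimage[OF p_cont open_UNIV] by simp

lemma sheet:
  obtains W q where "open W" "z \<in> W" "open (p ` W)" "smooth_map_on M' M W p" "smooth_map_on M M' (p ` W) q"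
    "\<And>y. y \<in> W \<Longrightarrow> q (p y) = y" "\<And>T. open T \<Longrightarrow> open (p ` (T \<inter> W))" "continuous_on (p ` W) q"
proof -
  obtain W where W: "open W" "z \<in> W" "open (p ` W)" "inj_on p W" "smooth_map_on M' M W p"
    "smooth_map_on M M' (p ` W) (inv_into W p)"
    using p unfolding universal_covering_def local_diffeo_def by blast
  have q: "inv_into W p (p y) = y" if "y \<in> W" for y using W(4) that by (rule inv_into_f_f)
  have c: "continuous_on (p ` W) (inv_into W p)" using W(6) by (simp add: smooth_map_on_def)
  have "open (p ` (T \<inter> W))" if "open T" for T
  proof -
    have "p ` (T \<inter> W) = p ` W \<inter> inv_into W p -` T" using q by auto
    then show ?thesis using continuous_open_preimage[OF c W(3) that] by simp
  qed
  then show thesis using that[OF W(1,2,3,5,6) q _ c] by blast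
qed

lemma p_open: assumes "open T" shows "open (p ` T)"
  unfolding open_subopen[of "p ` T"]
proof
  fix x assume "x \<in> p ` T"
  then obtain z where z: "z \<in> T" "x = p z" by blast
  show "\<exists>S. open S \<and> x \<in> S \<and> S \<subseteq> p ` T"
    by (rule sheet[of z]) (use z assms in blast)
qed

lemma smooth_fun_pullback:
  assumes "smooth_fun_on M T f" "open T" shows "smooth_fun_on M' (p -` T) (\<lambda>z. f (p z))"
proof (rule M'.smooth_fun_on_local)
  fix z assume z: "z \<in> p -` T"
  show "\<exists>T. open T \<and> z \<in> T \<and> smooth_fun_on M' T (\<lambda>z. f (p z))"
  proof (rule sheet[of z])
    fix W assume W: "open W" "z \<in> W" "smooth_map_on M' M W p"
    have "smooth_fun_on M' (W \<inter> p -` T) (f \<circ> p)"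
      by (rule smooth_fun_on_compose[OF M'.mfd mfd W(3,1) assms])
    then show ?thesis using W(1,2) z p_vimage[OF assms(2)]
      by (intro exI[of _ "W \<inter> p -` T"]) (auto simp: comp_def)
  qed
qed

lemma Cinf_pullback: "f \<in> Cinf M \<Longrightarrow> (\<lambda>z. f (p z)) \<in> Cinf M'"
  using smooth_fun_pullback[of UNIV f] by (simp add: Cinf_def)

section \<open>The pull-back bundle\<close>

abbreviation pF :: "('z, 'v) vbundle" where "pF \<equiv> pullback_bundle p F"

lemma pF_fibre: "fibre pF z = fibre F (p z)"
  by (simp add: pullback_bundle_def)

lemma pF_frames: "frames pF = (\<lambda>(U, es). (p -` U, map (\<lambda>e. e \<circ> p) es)) ` frames F"
  by (simp add: pullback_bundle_def)

lemma comb_pullback: "comb (map (\<lambda>e. e \<circ> p) es) a z = comb es a (p z)"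
  by (simp add: comb_def)

lemma smooth_in_frame_pullback:
  assumes "smooth_in_frame M es T \<mu>" "open T"
  shows "smooth_in_frame M' (map (\<lambda>e. e \<circ> p) es) (p -` T) (\<lambda>z. \<mu> (p z))"
proof -
  obtain c where c: "\<And>i. i < length es \<Longrightarrow> smooth_fun_on M T (c i)" "\<And>x. x \<in> T \<Longrightarrow> \<mu> x = comb es (\<lambda>i. c i x) x"
    using assms(1) unfolding smooth_in_frame_iff by blast
  show ?thesis
    unfolding smooth_in_frame_iff
    by (rule exI[of _ "\<lambda>i z. c i (p z)"]) (use c smooth_fun_pullback[OF _ assms(2)] in
      \<open>auto simp: comb_pullback\<close>)
qed

lemma pF_vb: "vector_bundle M' pF"
  unfolding vector_bundle_def
proof (intro conjI ballI)
  fix Ues assume "Ues \<in> frames pF"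
  then obtain U es where f: "Ues = (p -` U, map (\<lambda>e. e \<circ> p) es)" "(U, es) \<in> frames F" by (auto simp: pF_frames)
  have "basis_at (map (\<lambda>e. e \<circ> p) es) z (fibre pF z)" if "z \<in> p -` U" for z
    using F.frame(2)[OF f(2), of "p z"] that by (simp add: basis_at_iff comb_pullback pF_fibre)
  then show "case Ues of (U, es) \<Rightarrow> open U \<and> (\<forall>x\<in>U. basis_at es x (fibre pF x))"
    using p_vimage[OF F.frame(1)[OF f(2)]] by (simp add: f(1))
next
  fix Ues assume "Ues \<in> frames pF"
  then obtain U es where f: "Ues = (p -` U, map (\<lambda>e. e \<circ> p) es)" "(U, es) \<in> frames F" by (auto simp: pF_frames)
  have "smooth_in_frame M' (map (\<lambda>e. e \<circ> p) es) (p -` U \<inter> p -` V) (\<lambda>z. e (p z))"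
    if g: "(V, es') \<in> frames F" and e: "e \<in> set es'" for V es' e
    using smooth_in_frame_pullback[OF F.frame_smooth[OF f(2) g e]] F.frame(1)[OF f(2)] F.frame(1)[OF g]
    by (simp add: open_Int vimage_Int)
  then show "case Ues of (U, es) \<Rightarrow> \<forall>(V, es')\<in>frames pF. \<forall>e\<in>set es'. smooth_in_frame M' es (U \<inter> V) e"
    by (auto simp: f(1) pF_frames comp_def)
next
  show "(\<Union>(U, es)\<in>frames pF. U) = UNIV"
  proof (intro equalityI subsetI UNIV_I)
    fix z :: 'z
    obtain U es where "(U, es) \<in> frames F" "p z \<in> U" by (rule F.frame_exists)
    then show "z \<in> (\<Union>(U, es)\<in>frames pF. U)" unfolding pF_frames by force
  qed
qed

sublocale pF: vb M' pF by unfold_locales (rule pF_vb)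

lemma pF_sec: assumes "\<mu> \<in> sections M F" shows "(\<lambda>z. \<mu> (p z)) \<in> sections M' pF"
proof (rule pF.secI, rule pF.smooth_section_onI)
  show "\<mu> (p z) \<in> fibre pF z" for z using F.sec_fibre[OF assms] by (simp add: pF_fibre)
  fix V es' assume "(V, es') \<in> frames pF"
  then obtain U es where f: "V = p -` U" "es' = map (\<lambda>e. e \<circ> p) es" "(U, es) \<in> frames F"
    by (auto simp: pF_frames)
  have "smooth_in_frame M es U \<mu>" using F.smooth_section_onD(2)[OF F.sec_on[OF assms, of UNIV] f(3)] by simp
  from smooth_in_frame_pullback[OF this F.frame(1)[OF f(3)]]
    show "smooth_in_frame M' es' (V \<inter> UNIV) (\<lambda>z. \<mu> (p z))"
    by (simp add: f)
qed

text \<open>The function is moved down by the local inverse of \<open>p\<close> and extended with a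
  bump function. Since every germ on the covering is a pull-back, local operators there are
  determined by their values on pull-backs.\<close>

lemma Cinf_germ:
  assumes T: "open T" "z \<in> T" and g: "smooth_fun_on M' T g"
  shows "\<exists>f N. f \<in> Cinf M \<and> open N \<and> z \<in> N \<and> N \<subseteq> T \<and> (\<forall>y\<in>N. g y = f (p y))"
proof (rule sheet[of z])
  fix W q assume W: "open W" "z \<in> W" "open (p ` W)" "smooth_map_on M' M W p" "smooth_map_on M M' (p ` W) q"
    "\<And>y. y \<in> W \<Longrightarrow> q (p y) = y" "\<And>T. open T \<Longrightarrow> open (p ` (T \<inter> W))" "continuous_on (p ` W) q"
  have "smooth_fun_on M (p ` W \<inter> q -` T) (g \<circ> q)"
    by (rule smooth_fun_on_compose[OF mfd M'.mfd W(5,3) g T(1)])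
  moreover have "p ` W \<inter> q -` T = p ` (T \<inter> W)" using W(6) by auto
  ultimately have "smooth_fun_on M (p ` (T \<inter> W)) (g \<circ> q)" by simp
  from Cinf_extend[OF W(7)[OF T(1)] _ this, of "p z"] T(2) W(2)
  obtain f N where f: "f \<in> Cinf M" "open N" "p z \<in> N" "N \<subseteq> p ` (T \<inter> W)" "\<And>x. x \<in> N \<Longrightarrow> f x = (g \<circ> q) x" by blast
  show ?thesis
  proof (intro exI[of _ f] exI[of _ "T \<inter> W \<inter> p -` N"] conjI ballI)
    show "open (T \<inter> W \<inter> p -` N)" using T W p_vimage[OF f(2)] by auto
    show "g y = f (p y)" if "y \<in> T \<inter> W \<inter> p -` N" for y using f(5) W(6) that by simp
  qed (use T W f in auto)
qed

text \<open>The coefficients in a pulled-back frame are functions on the covering, whose germs come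
  from below.\<close>

lemma sec_germ:
  assumes s: "s \<in> sections M' pF"
  shows "\<exists>\<mu> N. \<mu> \<in> sections M F \<and> open N \<and> z \<in> N \<and> (\<forall>y\<in>N. s y = \<mu> (p y))"
proof -
  obtain U es where f: "(U, es) \<in> frames F" "p z \<in> U" by (rule F.frame_exists)
  have U: "open U" by (rule F.frame(1)[OF f(1)])
  have pU: "open (p -` U)" "z \<in> p -` U" using p_vimage[OF U] f(2) by auto
  have "(p -` U, map (\<lambda>e. e \<circ> p) es) \<in> frames pF" using f(1) by (force simp: pF_frames)
  from pF.smooth_section_onD(2)[OF pF.sec_on[OF s, of UNIV] this]
  obtain c where c: "\<And>i. i < length es \<Longrightarrow> smooth_fun_on M' (p -` U) (c i)" "\<And>y. y \<in> p -` U \<Longrightarrow>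
    s y = comb es (\<lambda>i. c i y) (p y)"
    unfolding smooth_in_frame_iff by (auto simp: comb_pullback)
  have "\<forall>i\<in>{..<length es}. \<exists>fN. fst fN \<in> Cinf M \<and> open (snd fN) \<and> z \<in> snd fN \<and>
    (\<forall>y\<in>snd fN. c i y = fst fN (p y))"
  proof
    fix i assume "i \<in> {..<length es}"
    then have "smooth_fun_on M' (p -` U) (c i)" using c(1) by simp
    from Cinf_germ[OF pU this] obtain f N where "f \<in> Cinf M" "open N" "z \<in> N" "\<And>y. y \<in> N \<Longrightarrow> c i y = f (p y)"
      by blast
    then show "\<exists>fN. fst fN \<in> Cinf M \<and> open (snd fN) \<and> z \<in> snd fN \<and> (\<forall>y\<in>snd fN. c i y = fst fN (p y))"
      by (intro exI[of _ "(f, N)"]) auto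
  qed
  from bchoice[OF this] obtain k where k: "\<And>i. i < length es \<Longrightarrow> fst (k i) \<in> Cinf M" "\<And>i. i < length es \<Longrightarrow>
    open (snd (k i))"
    "\<And>i. i < length es \<Longrightarrow> z \<in> snd (k i)" "\<And>i y. i < length es \<Longrightarrow> y \<in> snd (k i) \<Longrightarrow> c i y = fst (k i) (p y)" by auto
  have "smooth_section_on M F U (\<lambda>x. comb es (\<lambda>i. fst (k i) x) x)"
    by (rule F.smooth_section_on_frame[OF f(1) U order_refl]) (rule Cinf_on[OF k(1)])
  then obtain \<mu> N where \<mu>: "\<mu> \<in> sections M F" "open N" "p z \<in> N" "N \<subseteq> U" "\<And>x. x \<in> N \<Longrightarrow>
    \<mu> x = comb es (\<lambda>i. fst (k i) x) x"
    using F.sec_extend[OF U f(2)] by blast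
  define N' where "N' = p -` N \<inter> (\<Inter>i\<in>{..<length es}. snd (k i))"
  show ?thesis
  proof (intro exI[of _ \<mu>] exI[of _ N'] conjI ballI)
    show "\<mu> \<in> sections M F" by (rule \<mu>(1))
    show "open N'" unfolding N'_def by (intro open_Int p_vimage[OF \<mu>(2)] open_INT) (use k(2) in auto)
    show "z \<in> N'" using \<mu>(3) k(3) by (auto simp: N'_def)
    fix y assume y: "y \<in> N'"
    then have "p y \<in> N" "p y \<in> U" using \<mu>(4) by (auto simp: N'_def)
    then have "s y = comb es (\<lambda>i. c i y) (p y)" "\<mu> (p y) = comb es (\<lambda>i. fst (k i) (p y)) (p y)"
      using c(2) \<mu>(5) by auto
    moreover have "comb es (\<lambda>i. c i y) (p y) = comb es (\<lambda>i. fst (k i) (p y)) (p y)"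
      by (rule comb_cong) (use k(4) y in \<open>auto simp: N'_def\<close>)
    ultimately show "s y = \<mu> (p y)" by simp
  qed
qed

text \<open>\<open>Z f\<close> is \<open>X g\<close> for any \<open>g\<close> whose pull-back has
  the germ of \<open>f\<close>. This is well defined because \<open>p\<close> is open and
  \<open>X\<close> is local.\<close>

lemma tangent_lift:
  assumes X: "X \<in> tangent_space M (p z)"
  obtains Z where "Z \<in> tangent_space M' z"
    "\<And>f g N. f \<in> Cinf M' \<Longrightarrow> g \<in> Cinf M \<Longrightarrow> open N \<Longrightarrow> z \<in> N \<Longrightarrow> (\<And>y. y \<in> N \<Longrightarrow> f y = g (p y)) \<Longrightarrow> Z f = X g"
proof -
  define G where "G f g \<longleftrightarrow> g \<in> Cinf M \<and> (\<exists>N. open N \<and> z \<in> N \<and> (\<forall>y\<in>N. f y = g (p y)))" for f g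
  define Z where "Z f = (if f \<in> Cinf M' then X (SOME g. G f g) else 0)" for f
  have G_ex: "\<exists>g. G f g" if f: "f \<in> Cinf M'" for f
    using Cinf_germ[OF open_UNIV UNIV_I M'.Cinf_on[OF f], of z] unfolding G_def by blast
  have Z: "Z f = X g" if f: "f \<in> Cinf M'" and g: "G f g" for f g
  proof -
    have "G f (SOME g. G f g)" by (rule someI[of "G f"]) (rule g)
    then obtain N where N: "(SOME g. G f g) \<in> Cinf M" "open N" "z \<in> N" "\<And>y. y \<in> N \<Longrightarrow> f y = (SOME g. G f g) (p y)"
      unfolding G_def by blast
    obtain N' where N': "g \<in> Cinf M" "open N'" "z \<in> N'" "\<And>y. y \<in> N' \<Longrightarrow> f y = g (p y)"
      using g unfolding G_def by blast
    have eq: "(SOME g. G f g) (p y) = g (p y)" if "y \<in> N \<inter> N'" for y using N(4)[of y] N'(4)[of y] that by simp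
    have "X (SOME g. G f g) = X g"
      by (rule tangent_local[OF X N(1) N'(1), of "p ` (N \<inter> N')"])
        (use p_open[of "N \<inter> N'"] N(2,3) N'(2,3) eq in auto)
    then show ?thesis using f by (simp add: Z_def)
  qed
  have Gz: "f z = g (p z)" if "G f g" for f g using that unfolding G_def by blast
  have G_op: "G (\<lambda>y. H (f y) (f' y)) (\<lambda>x. H (g x) (g' x))"
    if G: "G f g" "G f' g'" "(\<lambda>x. H (g x) (g' x)) \<in> Cinf M" for f g f' g' and H :: "real \<Rightarrow> real \<Rightarrow> real"
  proof -
    obtain N N' where "open N" "z \<in> N" "\<forall>y\<in>N. f y = g (p y)" "open N'" "z \<in> N'" "\<forall>y\<in>N'. f' y = g' (p y)"
      using G(1,2) unfolding G_def by blast
    then show ?thesis using G(3) unfolding G_def by (intro conjI exI[of _ "N \<inter> N'"]) (auto simp: open_Int)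
  qed
  have GC: "G f g \<Longrightarrow> g \<in> Cinf M" for f g by (simp add: G_def)
  have "Z \<in> tangent_space M' z"
    unfolding tangent_space_def linear_between_def
  proof (intro CollectI conjI ballI allI impI)
    fix f assume f: "f \<in> Cinf M'"
    obtain g where g: "G f g" using G_ex[OF f] by blast
    show "Z (k *\<^sub>R f) = k *\<^sub>R Z f" for k
    proof -
      have "G (\<lambda>y. k * f y) (\<lambda>x. k * g x)"
        using G_op[OF g g, of "\<lambda>a b. k * a"] Cinf_mult[OF Cinf_const GC[OF g]] by simp
      then show ?thesis
        using Z[OF f g] Z[OF M'.Cinf_mult[OF M'.Cinf_const f, of k]] tangent_linear(2)[OF X GC[OF g] GC[OF g]]
        by (simp add: scaleR_fun_def)
    qed
    fix f' assume f': "f' \<in> Cinf M'"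
    obtain g' where g': "G f' g'" using G_ex[OF f'] by blast
    note t = tangent_linear[OF X GC[OF g] GC[OF g']]
    show "Z (f + f') = Z f + Z f'"
      using Z[OF f g] Z[OF f' g'] Z[OF M'.Cinf_add[OF f f'] G_op[OF g g' Cinf_add[OF GC[OF g] GC[OF g']]]] t
      by (simp add: plus_fun_def)
    show "Z (\<lambda>y. f y * f' y) = Z f * f' z + f z * Z f'"
      using Z[OF f g] Z[OF f' g'] Z[OF M'.Cinf_mult[OF f f'] G_op[OF g g' Cinf_mult[OF GC[OF g] GC[OF g']]]] t
        Gz[OF g] Gz[OF g'] by simp
  qed (auto simp: Z_def)
  moreover have "Z f = X g" if "f \<in> Cinf M'" "g \<in> Cinf M" "open N" "z \<in> N" "\<And>y. y \<in> N \<Longrightarrow> f y = g (p y)" for f g N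
    by (rule Z[OF that(1)]) (use that in \<open>auto simp: G_def\<close>)
  ultimately show thesis using that by blast
qed

abbreviation pa :: "'z \<Rightarrow> 'a \<Rightarrow> 'z tangent" where "pa \<equiv> pullback_anchor M' M p \<A>"

text \<open>The anchor is given by a unique description. The vector from \<open>tangent_lift\<close>
  satisfies it, and it is the only one because a tangent vector on the covering is determined by its
  values on pull-backs.\<close>

lemma pullback_anchor:
  assumes a: "a \<in> fibre \<A> (p z)"
  shows "pa z a \<in> tangent_space M' z"
    and "f \<in> Cinf M' \<Longrightarrow> g \<in> Cinf M \<Longrightarrow> open N \<Longrightarrow> z \<in> N \<Longrightarrow> (\<And>y. y \<in> N \<Longrightarrow> f y = g (p y)) \<Longrightarrow>
      pa z a f = rho (p z) a g"
proof -
  let ?X = "rho (p z) a"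
  have X: "?X \<in> tangent_space M (p z)" by (rule rho_tangent[OF a])
  obtain Z where Z: "Z \<in> tangent_space M' z"
    "\<And>f g N. f \<in> Cinf M' \<Longrightarrow> g \<in> Cinf M \<Longrightarrow> open N \<Longrightarrow> z \<in> N \<Longrightarrow> (\<And>y. y \<in> N \<Longrightarrow> f y = g (p y)) \<Longrightarrow> Z f = ?X g"
    using tangent_lift[OF X] by blast
  have push: "push_tangent M p Z = ?X"
  proof
    fix f show "push_tangent M p Z f = ?X f"
      using Z(2)[OF Cinf_pullback _ open_UNIV UNIV_I] rho_apply_notCinf[OF a]
        by (auto simp: push_tangent_def comp_def)
  qed
  have "pa z a = Z"
    unfolding pullback_anchor_def
  proof (rule the_equality)
    fix Z' assume Z': "Z' \<in> tangent_space M' z \<and> push_tangent M p Z' = ?X"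
    show "Z' = Z"
    proof
      fix f
      show "Z' f = Z f"
      proof (cases "f \<in> Cinf M'")
        case True
        obtain g N where g: "g \<in> Cinf M" "open N" "z \<in> N" "\<And>y. y \<in> N \<Longrightarrow> f y = g (p y)"
          using Cinf_germ[OF open_UNIV UNIV_I M'.Cinf_on[OF True], of z] by blast
        have "Z' f = Z' (\<lambda>y. g (p y))"
          by (rule M'.tangent_local[OF _ True Cinf_pullback[OF g(1)] g(2-4)]) (use Z' in blast)
        also have "\<dots> = push_tangent M p Z' g" using g(1) by (simp add: push_tangent_def comp_def)
        also have "\<dots> = ?X g" using Z' by simp
        finally show ?thesis using Z(2)[OF True g] by simp
      next
        case False
        then show ?thesis using Z' Z(1) by (simp add: tangent_space_def)
      qed
    qed
  qed (use Z(1) push in blast)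
  then show "pa z a \<in> tangent_space M' z"
    "f \<in> Cinf M' \<Longrightarrow> g \<in> Cinf M \<Longrightarrow> open N \<Longrightarrow> z \<in> N \<Longrightarrow> (\<And>y. y \<in> N \<Longrightarrow> f y = g (p y)) \<Longrightarrow> pa z a f = ?X g"
    using Z by auto
qed

text \<open>The same descent for operators: the candidate \<open>D\<close> applies
  \<open>\<LL>\<close> to a section below with the given germ. Any competitor is local by its
  Leibniz rule and so agrees with \<open>D\<close>.\<close>

lemma pullback_rep:
  assumes a: "a \<in> fibre \<A> (p z)" and s: "s \<in> sections M' pF"
    and \<mu>: "\<mu> \<in> sections M F" and N: "open N" "z \<in> N" "\<And>y. y \<in> N \<Longrightarrow> s y = \<mu> (p y)"
  shows "pullback_rep M' M p \<A> F \<LL> z a s = \<LL> (p z) a \<mu>"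
proof -
  define G where "G s \<mu> \<longleftrightarrow> \<mu> \<in> sections M F \<and> (\<exists>N. open N \<and> z \<in> N \<and> (\<forall>y\<in>N. s y = \<mu> (p y)))" for s \<mu>
  define D where "D s = (if s \<in> sections M' pF then \<LL> (p z) a (SOME \<mu>. G s \<mu>) else 0)" for s
  have G_ex: "\<exists>\<mu>. G s \<mu>" if "s \<in> sections M' pF" for s
    using sec_germ[OF that, of z] unfolding G_def by blast
  have D: "D s = \<LL> (p z) a \<mu>" if s: "s \<in> sections M' pF" and g: "G s \<mu>" for s \<mu>
  proof -
    have "G s (SOME g. G s g)" by (rule someI[of "G s"]) (rule g)
    then obtain N where N: "(SOME g. G s g) \<in> sections M F" "open N" "z \<in> N" "\<And>y. y \<in> N \<Longrightarrow>
      s y = (SOME g. G s g) (p y)"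
      unfolding G_def by blast
    obtain N' where N': "\<mu> \<in> sections M F" "open N'" "z \<in> N'" "\<And>y. y \<in> N' \<Longrightarrow> s y = \<mu> (p y)"
      using g unfolding G_def by blast
    have eq: "(SOME g. G s g) (p y) = \<mu> (p y)" if "y \<in> N \<inter> N'" for y using N(4)[of y] N'(4)[of y] that by simp
    have "\<LL> (p z) a (SOME g. G s g) = \<LL> (p z) a \<mu>"
      by (rule L_local[OF a N(1) N'(1), of "p ` (N \<inter> N')"])
        (use p_open[of "N \<inter> N'"] N(2,3) N'(2,3) eq in auto)
    then show ?thesis using s by (simp add: D_def)
  qed
  have Gz: "s z = \<mu> (p z)" if "G s \<mu>" for s \<mu> using that unfolding G_def by blast
  have GC: "G s \<mu> \<Longrightarrow> \<mu> \<in> sections M F" for s \<mu> by (simp add: G_def)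
  have symb: "is_symbol M' pF z D (pa z a)"
    unfolding is_symbol_def
  proof (intro conjI ballI)
    show "pa z a \<in> tangent_space M' z" by (rule pullback_anchor(1)[OF a])
    fix f s assume f: "f \<in> Cinf M'" and s: "s \<in> sections M' pF"
    obtain g N where g: "g \<in> Cinf M" "open N" "z \<in> N" "\<And>y. y \<in> N \<Longrightarrow> f y = g (p y)"
      using Cinf_germ[OF open_UNIV UNIV_I M'.Cinf_on[OF f], of z] by blast
    obtain \<mu> where \<mu>: "G s \<mu>" using G_ex[OF s] by blast
    then obtain N' where N': "open N'" "z \<in> N'" "\<And>y. y \<in> N' \<Longrightarrow> s y = \<mu> (p y)" unfolding G_def by blast
    have "G (\<lambda>y. f y *\<^sub>R s y) (\<lambda>x. g x *\<^sub>R \<mu> x)"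
      unfolding G_def using F.sec_mult[OF g(1) GC[OF \<mu>]] g N'
        by (intro conjI exI[of _ "N \<inter> N'"]) (auto simp: open_Int)
    from D[OF pF.sec_mult[OF f s] this] have "D (\<lambda>y. f y *\<^sub>R s y)
      = rho (p z) a g *\<^sub>R \<mu> (p z) + g (p z) *\<^sub>R \<LL> (p z) a \<mu>"
      by (simp add: L_leibniz[OF a g(1) GC[OF \<mu>]])
    then show "D (\<lambda>y. f y *\<^sub>R s y) = pa z a f *\<^sub>R s z + f z *\<^sub>R D s"
      using pullback_anchor(2)[OF a f g] D[OF s \<mu>] Gz[OF \<mu>] g(3,4) by simp
  qed
  have cdo: "D \<in> CDO M' pF z"
    unfolding CDO_def linear_between_def
  proof (intro CollectI conjI ballI allI impI)
    show "D ` sections M' pF \<subseteq> fibre pF z"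
    proof clarify
      fix s assume s: "s \<in> sections M' pF"
      then obtain \<mu> where "G s \<mu>" using G_ex by blast
      then show "D s \<in> fibre pF z" using D[OF s] L_fibre[OF a GC] by (simp add: pF_fibre)
    qed
    fix s assume s: "s \<in> sections M' pF"
    obtain \<mu> where \<mu>: "G s \<mu>" using G_ex[OF s] by blast
    then obtain N where N: "open N" "z \<in> N" "\<And>y. y \<in> N \<Longrightarrow> s y = \<mu> (p y)" unfolding G_def by blast
    show "D (k *\<^sub>R s) = k *\<^sub>R D s" for k
    proof -
      have "G (\<lambda>y. k *\<^sub>R s y) (\<lambda>x. k *\<^sub>R \<mu> x)"
        unfolding G_def using F.sec_mult[OF Cinf_const GC[OF \<mu>]] N by auto
      from D[OF pF.sec_mult[OF M'.Cinf_const s] this] show ?thesis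
        using D[OF s \<mu>] by (simp add: scaleR_fun_def L_scale[OF a GC[OF \<mu>]])
    qed
    fix s' assume s': "s' \<in> sections M' pF"
    obtain \<mu>' where \<mu>': "G s' \<mu>'" using G_ex[OF s'] by blast
    then obtain N' where N': "open N'" "z \<in> N'" "\<And>y. y \<in> N' \<Longrightarrow> s' y = \<mu>' (p y)" unfolding G_def by blast
    have "G (\<lambda>y. s y + s' y) (\<lambda>x. \<mu> x + \<mu>' x)"
      unfolding G_def using F.sec_add[OF GC[OF \<mu>] GC[OF \<mu>']] N N'
        by (intro conjI exI[of _ "N \<inter> N'"]) (auto simp: open_Int)
    from D[OF pF.sec_add[OF s s'] this] show "D (s + s') = D s + D s'"
      using D[OF s \<mu>] D[OF s' \<mu>'] by (simp add: plus_fun_def L_add[OF a GC[OF \<mu>] GC[OF \<mu>']])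
  qed (use symb in \<open>auto simp: D_def\<close>)
  have Dp: "D (\<nu> \<circ> p) = \<LL> (p z) a \<nu>" if \<nu>: "\<nu> \<in> sections M F" for \<nu>
  proof -
    have "G (\<lambda>y. \<nu> (p y)) \<nu>" unfolding G_def using \<nu> by (intro conjI exI[of _ UNIV]) auto
    from D[OF pF_sec[OF \<nu>] this] show ?thesis by (simp add: comp_def)
  qed
  have "pullback_rep M' M p \<A> F \<LL> z a = D"
    unfolding pullback_rep_def
  proof (rule the_equality)
    fix D' assume D': "D' \<in> CDO M' pF z \<and> is_symbol M' pF z D' (pa z a) \<and> (\<forall>\<nu>\<in>sections M F. D' (\<nu> \<circ> p)
      = \<LL> (p z) a \<nu>)"
    show "D' = D"
    proof
      fix s
      show "D' s = D s"
      proof (cases "s \<in> sections M' pF")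
        case True
        obtain \<mu> where \<mu>: "G s \<mu>" using G_ex[OF True] by blast
        then obtain N where N: "open N" "z \<in> N" "\<And>y. y \<in> N \<Longrightarrow> s y = \<mu> (p y)" unfolding G_def by blast
        have "D' s = D' (\<lambda>y. \<mu> (p y))"
        proof (rule M'.bump[OF N(1,2)])
          fix \<beta> N' C assume *: "\<beta> \<in> Cinf M'" "open N'" "z \<in> N'" "N' \<subseteq> N" "\<And>x. x \<in> N' \<Longrightarrow> \<beta> x = 1"
            "closed C" "C \<subseteq> N" "\<And>x. x \<notin> C \<Longrightarrow> \<beta> x = 0"
          have leib: "D' (\<lambda>y. \<beta> y *\<^sub>R t y) = pa z a \<beta> *\<^sub>R t z + \<beta> z *\<^sub>R D' t" if "t \<in> sections M' pF" for t
            using D' *(1) that unfolding is_symbol_def by blast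
          have "(\<lambda>y. \<beta> y *\<^sub>R s y) = (\<lambda>y. \<beta> y *\<^sub>R \<mu> (p y))" using * N(3) by (metis scale_eq_0_iff subsetD)
          then show ?thesis
            using leib[OF True] leib[OF pF_sec[OF GC[OF \<mu>]]] *(3,5) N(2,3) by simp
        qed
        also have "\<dots> = \<LL> (p z) a \<mu>" using D' GC[OF \<mu>] by (auto simp: comp_def)
        finally show ?thesis using D[OF True \<mu>] by simp
      next
        case False
        have "D' s = 0" using D' False unfolding CDO_def by blast
        then show ?thesis using False by (simp add: D_def)
      qed
    qed
  qed (use cdo symb Dp in blast)
  moreover have "G s \<mu>" using \<mu> N unfolding G_def by blast
  ultimately show ?thesis using D[OF s] by simp
qed

end

section \<open>The local system of primitives on the covering\<close>

locale covering_cocycle = cocycle M \<A> F \<LL> \<Omega> + covering M \<A> F \<LL> M' p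
  for M :: "('m::{t2_space,second_countable_topology}, 'h::real_inner) atlas"
    and \<A> :: "('m, 'a::real_vector) algebroid" and F :: "('m, 'v::real_vector) vbundle" and \<LL> \<Omega>
    and M' :: "('z::{t2_space,second_countable_topology}, 'h) atlas" and p
begin

lemma pullback_coboundary_iff:
  "is_coboundary M' (pullback_algebroid M' M p \<A>) pF (pullback_rep M' M p \<A> F \<LL>) (pullback_cochain p \<Omega>) \<longleftrightarrow>
    (\<exists>s\<in>sections M' pF. \<forall>z. \<forall>a\<in>fibre \<A> (p z). \<Omega> (p z) a = pullback_rep M' M p \<A> F \<LL> z a s)"
  by (simp add: is_coboundary_def coboundary_op_def pullback_cochain_def pullback_algebroid_def algebroid_of_def
      pullback_bundle_def[of p \<A>])

lemma pullback_coboundary_imp: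
  assumes "is_coboundary M' (pullback_algebroid M' M p \<A>) pF (pullback_rep M' M p \<A> F \<LL>) (pullback_cochain p \<Omega>)"
  shows "primitives x \<noteq> {}"
proof -
  obtain s where s: "s \<in> sections M' pF" "\<And>z a. a \<in> fibre \<A> (p z) \<Longrightarrow> \<Omega> (p z) a = pullback_rep M' M p \<A> F \<LL> z a s"
    using assms unfolding pullback_coboundary_iff by blast
  obtain z where z: "x = p z" using p_surj by (metis UNIV_I imageE)
  obtain \<mu> N where \<mu>: "\<mu> \<in> sections M F" "open N" "z \<in> N" "\<And>y. y \<in> N \<Longrightarrow> s y = \<mu> (p y)"
    using sec_germ[OF s(1)] by blast
  have "\<mu> x \<in> primitives x"
    unfolding primitives_def
  proof (intro CollectI conjI ballI)
    show "\<mu> x \<in> fibre F x" by (rule F.sec_fibre[OF \<mu>(1)])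
    fix u assume u: "u \<in> adjoint_fibre \<A> x"
    then have u': "u \<in> fibre \<A> (p z)" by (simp add: adjoint_iff z)
    show "\<Omega> x u = iso x u (\<mu> x)"
      using s(2)[OF u'] pullback_rep[OF u' s(1) \<mu>] iso_eq[OF u \<mu>(1)] by (simp add: z)
  qed
  then show ?thesis by blast
qed

text \<open>Solutions on the covering are described by germs of solutions below;
  \<open>pullback_rep\<close> relates this to the equation for the induced representation.\<close>

definition Sol :: "'z set \<Rightarrow> ('z \<Rightarrow> 'v) \<Rightarrow> bool" where
  "Sol N s \<longleftrightarrow> (\<forall>z\<in>N. \<exists>\<mu> N'. \<mu> \<in> sections M F \<and> open N' \<and> z \<in> N' \<and> N' \<subseteq> N \<and>
     (\<forall>y\<in>N'. s y = \<mu> (p y) \<and> (\<forall>a\<in>fibre \<A> (p y). \<LL> (p y) a \<mu> = \<Omega> (p y) a)))"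

lemma SolE:
  assumes "Sol N s" "z \<in> N"
  obtains \<mu> N' where "\<mu> \<in> sections M F" "open N'" "z \<in> N'" "N' \<subseteq> N" "\<And>y. y \<in> N' \<Longrightarrow> s y = \<mu> (p y)"
    "\<And>y a. y \<in> N' \<Longrightarrow> a \<in> fibre \<A> (p y) \<Longrightarrow> \<LL> (p y) a \<mu> = \<Omega> (p y) a"
proof -
  from bspec[OF assms(1)[unfolded Sol_def] assms(2)] obtain \<mu> N' where *: "\<mu> \<in> sections M F" "open N'"
    "z \<in> N'" "N' \<subseteq> N"
    "\<forall>y\<in>N'. s y = \<mu> (p y) \<and> (\<forall>a\<in>fibre \<A> (p y). \<LL> (p y) a \<mu> = \<Omega> (p y) a)" by (elim exE conjE)
  show thesis by (rule that[OF *(1-4)]) (use *(5) in simp_all)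
qed

text \<open>On a sheet \<open>q\<close> inverts \<open>p\<close>, so a solution descends;
  \<open>sol_pullback\<close> goes the other way.\<close>

lemma Sol_sheet:
  assumes W: "\<And>y. y \<in> W \<Longrightarrow> q (p y) = y" and N: "N \<subseteq> W" and s: "Sol N s"
  shows "sol (p ` N) (\<lambda>x. s (q x))"
  unfolding sol_def
proof
  fix x assume "x \<in> p ` N"
  then obtain z where z: "z \<in> N" "x = p z" by blast
  show "\<exists>\<mu>\<in>sections M F. \<exists>N'. open N' \<and> x \<in> N' \<and> N' \<subseteq> p ` N \<and>
     (\<forall>x\<in>N'. \<mu> x = s (q x) \<and> (\<forall>a\<in>fibre \<A> x. \<LL> x a \<mu> = \<Omega> x a))"
  proof (rule SolE[OF s z(1)])
    fix \<mu> N' assume *: "\<mu> \<in> sections M F" "open N'" "z \<in> N'" "N' \<subseteq> N" "\<And>y. y \<in> N' \<Longrightarrow> s y = \<mu> (p y)"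
      "\<And>y a. y \<in> N' \<Longrightarrow> a \<in> fibre \<A> (p y) \<Longrightarrow> \<LL> (p y) a \<mu> = \<Omega> (p y) a"
    have "\<mu> (p y) = s (q (p y))" if "y \<in> N'" for y using W *(4,5) N that by auto
    then show ?thesis
      using * p_open[OF *(2)] z(2) by (intro bexI[OF _ *(1)] exI[of _ "p ` N'"]) auto
  qed
qed

lemma sol_pullback:
  assumes "sol N m" "open N'" "p ` N' \<subseteq> N" shows "Sol N' (\<lambda>z. m (p z))"
  unfolding Sol_def
proof
  fix z assume z: "z \<in> N'"
  then have "p z \<in> N" using assms(3) by blast
  with assms(1) show "\<exists>\<mu> N''. \<mu> \<in> sections M F \<and> open N'' \<and> z \<in> N'' \<and> N'' \<subseteq> N' \<and>
     (\<forall>y\<in>N''. m (p y) = \<mu> (p y) \<and> (\<forall>a\<in>fibre \<A> (p y). \<LL> (p y) a \<mu> = \<Omega> (p y) a))"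
  proof (rule solE)
    fix \<mu> N1 assume *: "\<mu> \<in> sections M F" "open N1" "p z \<in> N1" "N1 \<subseteq> N"
      "\<And>x. x \<in> N1 \<Longrightarrow> \<mu> x = m x" "\<And>x a. x \<in> N1 \<Longrightarrow> a \<in> fibre \<A> x \<Longrightarrow> \<LL> x a \<mu> = \<Omega> x a"
    show ?thesis
      by (rule exI[of _ \<mu>], rule exI[of _ "N' \<inter> p -` N1"])
        (use * assms(2) z p_vimage[OF *(2)] in \<open>auto simp: open_Int\<close>)
  qed
qed

sublocale ls: local_system "\<lambda>z. primitives (p z)" Sol
proof
  fix N N' s assume s: "Sol N s" "N' \<subseteq> N" "open N'"
  show "Sol N' s"
    unfolding Sol_def
  proof
    fix z assume z: "z \<in> N'"
    then have "z \<in> N" using s(2) by blast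
    with s(1) show "\<exists>\<mu> N''. \<mu> \<in> sections M F \<and> open N'' \<and> z \<in> N'' \<and> N'' \<subseteq> N' \<and>
     (\<forall>y\<in>N''. s y = \<mu> (p y) \<and> (\<forall>a\<in>fibre \<A> (p y). \<LL> (p y) a \<mu> = \<Omega> (p y) a))"
    proof (rule SolE)
      fix \<mu> N1 assume *: "\<mu> \<in> sections M F" "open N1" "z \<in> N1" "N1 \<subseteq> N" "\<And>y. y \<in> N1 \<Longrightarrow> s y = \<mu> (p y)"
        "\<And>y a. y \<in> N1 \<Longrightarrow> a \<in> fibre \<A> (p y) \<Longrightarrow> \<LL> (p y) a \<mu> = \<Omega> (p y) a"
      show ?thesis
        by (rule exI[of _ \<mu>], rule exI[of _ "N1 \<inter> N'"]) (use * s(3) z in \<open>auto simp: open_Int\<close>)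
    qed
  qed
next
  fix N s z assume s: "Sol N s" and z: "z \<in> N"
  show "s z \<in> primitives (p z)"
  proof (rule SolE[OF s z])
    fix \<mu> N1 assume *: "\<mu> \<in> sections M F" "z \<in> N1" "\<And>y. y \<in> N1 \<Longrightarrow> s y = \<mu> (p y)"
      "\<And>y a. y \<in> N1 \<Longrightarrow> a \<in> fibre \<A> (p y) \<Longrightarrow> \<LL> (p y) a \<mu> = \<Omega> (p y) a"
    show ?thesis
      unfolding primitives_def *(3)[OF *(2)]
      using F.sec_fibre[OF *(1)] *(4)[OF *(2)] iso_eq[OF _ *(1)] by (auto simp: adjoint_iff)
  qed
next
  fix T :: "'z set" and z assume T: "open T" "z \<in> T"
  show "\<exists>N. open N \<and> z \<in> N \<and> N \<subseteq> T \<and> path_connected N \<and>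
        (\<forall>y\<in>N. \<forall>v\<in>primitives (p y). \<exists>s. Sol N s \<and> s y = v) \<and>
        (\<forall>s s' y y'. Sol N s \<longrightarrow> Sol N s' \<longrightarrow> y \<in> N \<longrightarrow> y' \<in> N \<longrightarrow> s y = s' y \<longrightarrow> s y' = s' y')"
  proof (rule sheet[of z])
    fix W q assume W: "open W" "z \<in> W" "\<And>y. y \<in> W \<Longrightarrow> q (p y) = y" "\<And>T. open T \<Longrightarrow> open (p ` (T \<inter> W))"
      "continuous_on (p ` W) q"
    obtain N0 where N0: "nice_nbhd N0" "p z \<in> N0" "N0 \<subseteq> p ` (T \<inter> W)"
      by (rule nice_nbhd_exists[OF W(4)[OF T(1)], of "p z"]) (use T W in auto)
    \<comment> \<open>The part of the sheet above a nice neighbourhood \<open>N0\<close>. It is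
      homeomorphic to \<open>N0\<close> through \<open>p\<close> and \<open>q\<close>, which carry
      solutions back and forth.\<close>
    define N where "N = T \<inter> W \<inter> p -` N0"
    have N: "N = q ` N0" "p ` N = N0" "N \<subseteq> W" "N \<subseteq> T" using N0(3) W(3) by (force simp: N_def)+
    have "open N0" using N0(1) by (simp add: nice_nbhd_def)
    then have oN: "open N" unfolding N_def using T W(1) p_vimage by auto
    have "path_connected N"
      unfolding N(1)
      by (rule path_connected_continuous_image) (use N0 W(5) in
        \<open>auto simp: nice_nbhd_def intro: continuous_on_subset\<close>)
    moreover have "\<exists>s. Sol N s \<and> s y = v" if y: "y \<in> N" and v: "v \<in> primitives (p y)" for y v
    proof -
      have "p y \<in> N0" using y N(2) by blast
      then obtain m where "sol N0 m" "m (p y) = v" using N0(1) v unfolding nice_nbhd_def by blast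
      then show ?thesis using sol_pullback[OF _ oN] N(2) by blast
    qed
    moreover have "s y' = s' y'" if s: "Sol N s" "Sol N s'" and y: "y \<in> N" "y' \<in> N" "s y = s' y" for s s' y y'
    proof -
      have sol: "sol N0 (\<lambda>x. s (q x))" "sol N0 (\<lambda>x. s' (q x))"
        using Sol_sheet[of W q N, OF W(3) N(3)] s N(2) by auto
      have q: "q (p y) = y" "q (p y') = y'" using W(3) y N(3) by auto
      have un: "\<And>s s' y y'. sol N0 s \<Longrightarrow> sol N0 s' \<Longrightarrow> y \<in> N0 \<Longrightarrow> y' \<in> N0 \<Longrightarrow> s y = s' y \<Longrightarrow> s y' = s' y'"
        using N0(1) unfolding nice_nbhd_def by blast
      have "p y \<in> N0" "p y' \<in> N0" using y N(2) by blast+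
      from un[OF sol this] show ?thesis using q y(3) by simp
    qed
    moreover have "z \<in> N" using N0(2) T(2) W(2) by (simp add: N_def)
    ultimately show ?thesis using oN N(4) by blast
  qed
qed

lemma pullback_coboundary:
  assumes "primitives x \<noteq> {}"
  shows "is_coboundary M' (pullback_algebroid M' M p \<A>) pF (pullback_rep M' M p \<A> F \<LL>) (pullback_cochain p \<Omega>)"
proof -
  obtain z where z: "x = p z" using p_surj by (metis UNIV_I imageE)
  obtain v where v: "v \<in> primitives (p z)" using assms z by blast
  have sc: "simply_connected (UNIV :: 'z set)" using p by (simp add: universal_covering_def)
  show ?thesis
  proof (rule ls.global_section[OF sc v])
    fix s assume s: "\<And>z. \<exists>N s'. open N \<and> z \<in> N \<and> Sol N s' \<and> (\<forall>y\<in>N. s y = s' y)"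
    have germ: "\<exists>\<mu> N. \<mu> \<in> sections M F \<and> open N \<and> z \<in> N \<and> (\<forall>y\<in>N. s y = \<mu> (p y)) \<and>
        (\<forall>a\<in>fibre \<A> (p z). \<LL> (p z) a \<mu> = \<Omega> (p z) a)" for z
    proof -
      obtain N s' where N: "open N" "z \<in> N" "Sol N s'" "\<forall>y\<in>N. s y = s' y" using s[of z] by blast
      show ?thesis
      proof (rule SolE[OF N(3,2)])
        fix \<mu> N1 assume *: "\<mu> \<in> sections M F" "open N1" "z \<in> N1" "N1 \<subseteq> N" "\<And>y. y \<in> N1 \<Longrightarrow> s' y = \<mu> (p y)"
          "\<And>y a. y \<in> N1 \<Longrightarrow> a \<in> fibre \<A> (p y) \<Longrightarrow> \<LL> (p y) a \<mu> = \<Omega> (p y) a"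
        show ?thesis
          by (rule exI[of _ \<mu>], rule exI[of _ N1]) (use * N(4) in auto)
      qed
    qed
    have sec: "s \<in> sections M' pF"
    proof (rule pF.sec_local)
      fix z
      obtain \<mu> N where "\<mu> \<in> sections M F" "open N" "z \<in> N" "\<forall>y\<in>N. s y = \<mu> (p y)" using germ[of z] by blast
      then show "\<exists>T \<nu>. open T \<and> z \<in> T \<and> \<nu> \<in> sections M' pF \<and> (\<forall>y\<in>T. s y = \<nu> y)"
        by (intro exI[of _ N] exI[of _ "\<lambda>z. \<mu> (p z)"]) (use pF_sec in auto)
    qed
    have "\<Omega> (p z) a = pullback_rep M' M p \<A> F \<LL> z a s" if a: "a \<in> fibre \<A> (p z)" for z a
    proof -
      obtain \<mu> N where \<mu>: "\<mu> \<in> sections M F" "open N" "z \<in> N" "\<forall>y\<in>N. s y = \<mu> (p y)"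
        "\<forall>a\<in>fibre \<A> (p z). \<LL> (p z) a \<mu> = \<Omega> (p z) a" using germ[of z] by blast
      then show ?thesis using pullback_rep[OF a sec \<mu>(1-3)] a by simp
    qed
    then show ?thesis unfolding pullback_coboundary_iff using sec by blast
  qed
qed

end

theorem theorem3p10:
  fixes M :: "('m::{t2_space,second_countable_topology}, 'h::real_inner) atlas"
    and M' :: "('z::{t2_space,second_countable_topology}, 'h) atlas"
    and p :: "'z \<Rightarrow> 'm"
    and \<A> :: "('m, 'a::real_vector) algebroid"
    and F F0 :: "('m, 'v::real_vector) vbundle"
    and \<LL> \<LL>0 :: "'m \<Rightarrow> 'a \<Rightarrow> ('m \<Rightarrow> 'v) \<Rightarrow> 'v"
    and \<LL>bar :: "'m \<Rightarrow> 'm tangent \<Rightarrow> ('m \<Rightarrow> 'v) \<Rightarrow> 'v"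
    and \<Omega> :: "'m \<Rightarrow> 'a \<Rightarrow> 'v"
    and x :: 'm
  assumes "smooth_manifold M" and "connected (UNIV :: 'm set)"
    and "transitive_algebroid M \<A>"
    and "vector_bundle M F"
    and "algebroid_rep M \<A> F \<LL>"
    and "smooth_manifold M'" and "universal_covering M' M p"
  defines "F0 \<equiv> invariant_bundle M \<A> F \<LL>"
    and "\<LL>0 \<equiv> restrict_rep M F0 \<LL>"
    and "\<LL>bar \<equiv> reduced_connection M \<A> F0 \<LL>"
  assumes "\<Omega> \<in> cocycles1 M \<A> F \<LL>"
  shows
    "let s1 = isotropy_coboundary M \<A> F \<LL> x (\<Omega> x);
         s2 = (\<forall>y. isotropy_coboundary M \<A> F \<LL> y (\<Omega> y));
         s3 = is_coboundary M' (pullback_algebroid M' M p \<A>) (pullback_bundle p F)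
                (pullback_rep M' M p \<A> F \<LL>) (pullback_cochain p \<Omega>);
         s4 = (\<exists>\<Omega>0 \<in> cocycles1 M \<A> F0 \<LL>0.
                (\<forall>u\<in>adjoint_fibre \<A> x. \<Omega>0 x u = 0) \<and> homologic M \<A> F \<LL> \<Omega> \<Omega>0);
         s5 = (\<exists>\<Omega>0 \<in> cocycles1 M \<A> F0 \<LL>0.
                (\<forall>y. \<forall>u\<in>adjoint_fibre \<A> y. \<Omega>0 y u = 0) \<and> homologic M \<A> F \<LL> \<Omega> \<Omega>0);
         s6 = (\<exists>\<theta> \<in> cocycles1 M (tangent_algebroid M) F0 \<LL>bar. \<exists>\<mu> \<in> sections M F.
                \<forall>y. \<forall>a\<in>fibre \<A> y. \<Omega> y a = \<theta> y (anchor \<A> y a) + coboundary_op \<LL> \<mu> y a)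
     in (s1 \<longleftrightarrow> s2) \<and> (s2 \<longleftrightarrow> s3) \<and> (s3 \<longleftrightarrow> s4) \<and> (s4 \<longleftrightarrow> s5) \<and> (s5 \<longleftrightarrow> s6)"
proof -
  interpret covering_cocycle M \<A> F \<LL> \<Omega> M' p
    by unfold_locales (use assms in simp_all)
  let ?F0 = "invariant_bundle M \<A> F \<LL>"
  let ?C0 = "cocycles1 M \<A> ?F0 (restrict_rep M ?F0 \<LL>)"
  let ?s2 = "\<forall>y. primitives y \<noteq> {}"
  let ?s3 = "is_coboundary M' (pullback_algebroid M' M p \<A>) (pullback_bundle p F)
     (pullback_rep M' M p \<A> F \<LL>) (pullback_cochain p \<Omega>)"
  let ?s4 = "\<exists>\<Omega>0\<in>?C0. (\<forall>u\<in>adjoint_fibre \<A> x. \<Omega>0 x u = 0) \<and> homologic M \<A> F \<LL> \<Omega> \<Omega>0"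
  let ?s5 = "\<exists>\<Omega>0\<in>?C0. (\<forall>y. \<forall>u\<in>adjoint_fibre \<A> y. \<Omega>0 y u = 0) \<and> homologic M \<A> F \<LL> \<Omega> \<Omega>0"
  let ?s6 = "\<exists>\<theta>\<in>cocycles1 M (tangent_algebroid M) ?F0 (reduced_connection M \<A> ?F0 \<LL>). \<exists>\<mu>\<in>sections M F.
     \<forall>y. \<forall>a\<in>fibre \<A> y. \<Omega> y a = \<theta> y (anchor \<A> y a) + coboundary_op \<LL> \<mu> y a"
  have primitiveI: "primitives y \<noteq> {}"
    if "\<mu> \<in> sections M F" "\<And>u. u \<in> adjoint_fibre \<A> y \<Longrightarrow> \<Omega> y u = \<LL> y u \<mu>" for y \<mu>
    using that F.sec_fibre[OF that(1), of y] by (auto simp: primitives_def iso_eq)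
  \<comment> \<open>The equivalences close as follows: 1 with 2 and 1 with 3 directly, 2 to both 5
    and 6, 5 to 4 to 1, and 6 to 2.\<close>
  have 12: "primitives x \<noteq> {} \<longleftrightarrow> ?s2" using primitives_all[OF assms(2)] by blast
  have 13: "primitives x \<noteq> {} \<longleftrightarrow> ?s3" using pullback_coboundary pullback_coboundary_imp by blast
  have 256: "?s5 \<and> ?s6" if s2: ?s2
  proof (rule primitives_global)
    fix \<mu> assume "\<mu> \<in> sections M F" "\<And>x u. u \<in> adjoint_fibre \<A> x \<Longrightarrow> \<Omega> x u = \<LL> x u \<mu>"
    then interpret reduced_cocycle M \<A> F \<LL> \<Omega> \<mu> by unfold_locales
    have ?s5 using \<Omega>0_cocycle \<Omega>0_adjoint \<Omega>0_homologic by blast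
    moreover have ?s6
      by (intro bexI[OF _ \<theta>_cocycle] bexI[OF _ \<mu>(1)]) (simp add: \<theta>_rho coboundary_op_def \<Omega>0_def)
    ultimately show ?thesis by blast
  qed (use s2 in blast)
  have 41: "primitives x \<noteq> {}" if s4: ?s4
  proof -
    obtain \<Omega>0 where \<Omega>0: "\<And>u. u \<in> adjoint_fibre \<A> x \<Longrightarrow> \<Omega>0 x u = 0" "homologic M \<A> F \<LL> \<Omega> \<Omega>0"
      using s4 by blast
    then obtain \<mu> where \<mu>: "\<mu> \<in> sections M F" "\<And>a. a \<in> fibre \<A> x \<Longrightarrow> \<Omega> x a - \<Omega>0 x a = \<LL> x a \<mu>"
      by (auto simp: homologic_def is_coboundary_def coboundary_op_def)
    show ?thesis
    proof (rule primitiveI[OF \<mu>(1)])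
      fix u assume u: "u \<in> adjoint_fibre \<A> x"
      show "\<Omega> x u = \<LL> x u \<mu>" using \<mu>(2)[of u] \<Omega>0(1)[OF u] u by (simp add: adjoint_iff)
    qed
  qed
  have 62: ?s2 if s6: ?s6
  proof
    fix y
    obtain \<theta> \<mu> where \<theta>: "\<theta> \<in> cocycles1 M (tangent_algebroid M) ?F0 (reduced_connection M \<A> ?F0 \<LL>)"
      and \<mu>: "\<mu> \<in> sections M F" "\<And>a. a \<in> fibre \<A> y \<Longrightarrow> \<Omega> y a = \<theta> y (anchor \<A> y a) + \<LL> y a \<mu>"
      using s6 unfolding coboundary_op_def by blast
    have lin: "linear_between (tangent_space M y) (fibre ?F0 y) (\<theta> y)"
      using \<theta> by (simp add: cocycles1_def bundle_map_def tangent_algebroid_def tangent_bundle_def)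
    have "0 \<in> tangent_space M y" by (simp add: tangent_space_def linear_between_def)
    \<comment> \<open>On the adjoint bundle the anchor is 0 and \<open>\<theta>\<close> is linear,
      so the equation in 6 leaves \<open>\<Omega> = \<DD>\<mu>\<close> there.\<close>
    with lin have "\<theta> y (0 *\<^sub>R 0) = 0 *\<^sub>R \<theta> y 0" unfolding linear_between_def by blast
    then have "\<theta> y 0 = 0" by simp
    then show "primitives y \<noteq> {}" by (intro primitiveI[OF \<mu>(1)]) (simp add: \<mu>(2) adjoint_iff)
  qed
  have "?s5 \<Longrightarrow> ?s4" by blast
  then show ?thesis
    unfolding Let_def isotropy_coboundary_iff F0_def \<LL>0_def \<LL>bar_def
    using 12 13 256 41 62 by argo
qed

end
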